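(* Let $f>1$ be an integer, $q^2=2^{2f+1}$, and let $S={}^2B_2(q^2)$ be the Suzuki group. Let $S<G\leqslant\mathrm{Aut}(S)$ (so $G\neq S$) with $|G:S|=d$. Then $|\mathrm{cd}(G)|\geqslant 7$, and if $d$ is not a prime, then $|\mathrm{cd}(G)|\geqslant 9$.
   Context: For a finite group $G$, $\mathrm{cd}(G)=\{\chi(1)\mid\chi\in\mathrm{Irr}(G)\}$ is the set of degrees of the ordinary complex irreducible characters of $G$. The Suzuki group ${}^2B_2(q^2)$ with $q^2=2^{2f+1}$ (also denoted $\mathrm{Sz}(2^{2f+1})$) is the simple group of order $(q^4+1)q^4(q^2-1)$; here the symbol $q^2$ denotes the integer $2^{2f+1}$ and $q^4=(q^2)^2$. $S$ is identified with the group of inner automorphisms inside $\mathrm{Aut}(S)$. *)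

theory Defs
  imports
    "HOL-Algebra.Bij"
    "HOL-Algebra.Coset"
    "HOL-Algebra.Generated_Groups"
    "HOL-Computational_Algebra.Primes"
    "Jordan_Normal_Form.VS_Connect"
begin

definition GL :: "nat \<Rightarrow> 'a::field mat monoid" where
  "GL n = units_of (ring_mat TYPE('a) n ())"

text \<open>
  Suzuki's matrix group, i.e. Sz(q) for q = 2^(2f+1). It is meant for a field with exactly
  2^(2f+1) elements; there \<open>\<lambda>x. x ^ 2 ^ (f + 1)\<close> is the automorphism whose square is the
  Frobenius map \<open>\<lambda>x. x\<^sup>2\<close>.
  The matrices \<open>suzuki_S\<close> form a Sylow 2-subgroup of order q^2, the \<open>suzuki_M\<close> a cyclic torus of
  order q - 1 normalising it, and \<open>suzuki_T\<close> is an involution inverting this torus.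
\<close>

definition suzuki_twist :: "nat \<Rightarrow> 'a::field \<Rightarrow> 'a" where
  "suzuki_twist f x = x ^ (2 ^ (f + 1))"

definition suzuki_S :: "nat \<Rightarrow> 'a::field \<Rightarrow> 'a \<Rightarrow> 'a mat" where
  "suzuki_S f a b = (let \<theta> = suzuki_twist f in mat_of_rows_list 4
     [[1, 0, 0, 0],
      [a, 1, 0, 0],
      [b, \<theta> a, 1, 0],
      [a\<^sup>2 * \<theta> a + a * b + \<theta> b, a * \<theta> a + b, a, 1]])"

definition suzuki_M :: "nat \<Rightarrow> 'a::field \<Rightarrow> 'a mat" where
  "suzuki_M f l = mat_of_rows_list 4
     [[l ^ (1 + 2 ^ f), 0, 0, 0],
      [0, l ^ (2 ^ f), 0, 0],
      [0, 0, inverse (l ^ (2 ^ f)), 0],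
      [0, 0, 0, inverse (l ^ (1 + 2 ^ f))]]"

definition suzuki_T :: "'a::field mat" where
  "suzuki_T = mat_of_rows_list 4
     [[0, 0, 0, 1],
      [0, 0, 1, 0],
      [0, 1, 0, 0],
      [1, 0, 0, 0]]"

definition suzuki_group :: "nat \<Rightarrow> 'a::field mat monoid" where
  "suzuki_group f = GL 4 \<lparr>carrier := generate (GL 4)
     ({suzuki_S f a b | a b. True} \<union> {suzuki_M f l | l. l \<noteq> 0} \<union> {suzuki_T})\<rparr>"

text \<open>Elements of \<^const>\<open>AutoGroup\<close> are extensional functions, hence the restriction.\<close>

definition Inn :: "('g, 'b) monoid_scheme \<Rightarrow> ('g \<Rightarrow> 'g) set" where
  "Inn G = {\<lambda>x\<in>carrier G. g \<otimes>\<^bsub>G\<^esub> x \<otimes>\<^bsub>G\<^esub> inv\<^bsub>G\<^esub> g | g. g \<in> carrier G}"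

definition irreducible_rep ::
    "('g, 'b) monoid_scheme \<Rightarrow> nat \<Rightarrow> ('g \<Rightarrow> complex mat) \<Rightarrow> bool" where
  "irreducible_rep G n \<rho> \<longleftrightarrow> n > 0 \<and> \<rho> \<in> hom G (GL n) \<and>
     (\<forall>W. VectorSpace.subspace class_ring W (module_vec TYPE(complex) n) \<and>
          (\<forall>g\<in>carrier G. \<forall>w\<in>W. \<rho> g *\<^sub>v w \<in> W) \<longrightarrow>
          W = {0\<^sub>v n} \<or> W = carrier_vec n)"

definition rep_character ::
    "('g, 'b) monoid_scheme \<Rightarrow> ('g \<Rightarrow> complex mat) \<Rightarrow> 'g \<Rightarrow> complex" where
  "rep_character G \<rho> = (\<lambda>g\<in>carrier G. sum_list (diag_mat (\<rho> g)))"

definition Irr :: "('g, 'b) monoid_scheme \<Rightarrow> ('g \<Rightarrow> complex) set" where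
  "Irr G = {rep_character G \<rho> | n \<rho>. irreducible_rep G n \<rho>}"

definition cd :: "('g, 'b) monoid_scheme \<Rightarrow> complex set" where
  "cd G = {\<chi> \<one>\<^bsub>G\<^esub> | \<chi>. \<chi> \<in> Irr G}"

end

theory Submission
  imports Defs "Jordan_Normal_Form.Spectral_Radius" "HOL-Algebra.Multiplicative_Group"
begin

text \<open>
  Put q = 2^n with n = 2f + 1 and r = 2^(f + 1), and let P be a Sylow 2-subgroup of the Suzuki
  group and B its normaliser. Consider the set Om of constituents of the character induced from a
  non-trivial linear character of P. Functions that are bi-equivariant for that linear character
  are invariant under inversion, so by Gelfand's trick the Hecke algebra is commutative and the
  constituents have multiplicity one; moreover they are real, there are q of them, and a field
  automorphism fixes as many of them as it fixes field elements.
  Column orthogonality, with the integrality of the multiplicities in restrictions to P and B,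
  yields the degrees q^2 and q^2 + 1 of the characters that occur in representations induced from
  B, the degrees (q - 1)(q + 1 + r) and (q - 1)(q + 1 - r) of the cuspidal members of Om (the
  degree q^2 - 1 is excluded because central characters are algebraic integers), and the existence
  of a non-real character of even degree divisible by q - 1.

  Every automorphism is the product of an inner and a field automorphism. Hence G is a split
  extension of the simple group by a cyclic group of odd order d dividing n, and Clifford theory
  turns an orbit of length t of characters of degree c into the degree t c of G. Counting fixed
  points gives orbits of length d for both cuspidal degrees and for the degree q^2 + 1, invariant
  cuspidal characters, and orbits of intermediate length if d is not prime. The degrees so
  obtained are separated by their residues modulo 2, r and q - 1.
\<close>

text \<open>The character table is never computed. A character of the simple group enters only
  through its values at the identity, at one involution, at two elements of order four and on the
  torus; its multiplicities along P and B are linear forms in these values. Column orthogonality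
  turns each sum of products of two such multiplicities over all irreducible characters into an
  explicit number, the inner product of two induced characters, so no induced module is built. Small
  totals force multiplicities 0, 1 or 2. For the cuspidal members of Om the totals leave an integer
  x of mean square at most 1, with degree (q - 1)(q + 1 + r x); x = 0 is compatible with the totals
  and has to be excluded by integrality. The simple group is axiomatised by its coordinates inside a
  possibly larger group, so that the same results serve for the matrix group and for its copy inside
  the automorphism group. The condition f > 1 enters the counting: members of Om with an orbit
  shorter than d number fewer than 2^f, while either sign of x occurs at least 2^f times.\<close>

definition vsub :: "nat \<Rightarrow> complex vec set \<Rightarrow> bool" where
  "vsub n W \<longleftrightarrow> W \<subseteq> carrier_vec n \<and> 0\<^sub>v n \<in> W \<and> (\<forall>v\<in>W. \<forall>w\<in>W. v + w \<in> W) \<and> (\<forall>c. \<forall>v\<in>W. c \<cdot>\<^sub>v v \<in> W)"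

lemma subspace_iff_vsub:
  "VectorSpace.subspace class_ring W (module_vec TYPE(complex) n) \<longleftrightarrow> vsub n W"
proof -
  interpret vec_space "TYPE(complex)" n .
  have "a + b \<in> W \<and> a \<in> carrier_vec n" if "vsub n W" "a \<in> W" "b \<in> W" for a b
    using that unfolding vsub_def by auto
  then show ?thesis
    using vectorspace_axioms module_axioms
    unfolding VectorSpace.subspace_def submodule_def submodule_axioms_def vsub_def
    by (auto simp: module_vec_simps)
qed

section \<open>Matrix representations, traces and finite sums of matrices\<close>

definition mrep :: "('g, 'b) monoid_scheme \<Rightarrow> nat \<Rightarrow> ('g \<Rightarrow> complex mat) \<Rightarrow> bool" where
  "mrep G n \<rho> \<longleftrightarrow> (\<forall>g\<in>carrier G. \<rho> g \<in> carrier_mat n n) \<and> \<rho> \<one>\<^bsub>G\<^esub> = 1\<^sub>m n \<and>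
     (\<forall>g\<in>carrier G. \<forall>h\<in>carrier G. \<rho> (g \<otimes>\<^bsub>G\<^esub> h) = \<rho> g * \<rho> h)"

lemma GL_group: "group (GL n :: 'a::field mat monoid)"
  unfolding GL_def by (rule monoid.units_group) (rule ring.is_monoid[OF ring_mat])

lemma GL_simps:
  "carrier (GL n) = Units (ring_mat TYPE('a::field) n ())"
  "x \<otimes>\<^bsub>GL n\<^esub> y = x * (y :: 'a mat)"
  "\<one>\<^bsub>GL n\<^esub> = (1\<^sub>m n :: 'a mat)"
  by (auto simp: GL_def units_of_def ring_mat_simps)

lemma GL_carrier_iff:
  "A \<in> carrier (GL n) \<longleftrightarrow>
     (A :: 'a::field mat) \<in> carrier_mat n n \<and> (\<exists>B\<in>carrier_mat n n. B * A = 1\<^sub>m n \<and> A * B = 1\<^sub>m n)"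
  unfolding GL_simps Units_def by (auto simp: ring_mat_simps)

text \<open>In a group multiplicativity supplies the inverse matrix, so blocks, transposes and
  twists of representations can be recognised by matrix identities alone.\<close>

lemma mrep_iff_hom:
  assumes "group G"
  shows "mrep G n \<rho> \<longleftrightarrow> \<rho> \<in> hom G (GL n)"
proof
  interpret group G by fact
  assume m: "mrep G n \<rho>"
  have "\<rho> g \<in> carrier (GL n)" if g: "g \<in> carrier G" for g
  proof -
    have "\<rho> (inv\<^bsub>G\<^esub> g) * \<rho> g = 1\<^sub>m n" "\<rho> g * \<rho> (inv\<^bsub>G\<^esub> g) = 1\<^sub>m n"
      using m g unfolding mrep_def by (metis inv_closed l_inv, metis inv_closed r_inv)
    then show ?thesis using m g unfolding GL_carrier_iff mrep_def by auto
  qed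
  then show "\<rho> \<in> hom G (GL n)" using m by (auto simp: hom_def mrep_def GL_simps(2,3))
next
  assume h: "\<rho> \<in> hom G (GL n)"
  then have "\<rho> \<one>\<^bsub>G\<^esub> = 1\<^sub>m n" using hom_one[OF h assms GL_group] by (simp add: GL_simps)
  then show "mrep G n \<rho>" using h unfolding mrep_def hom_def by (auto simp: GL_simps(2,3) GL_carrier_iff)
qed

definition mtr :: "complex mat \<Rightarrow> complex" where
  "mtr A = (\<Sum>i<dim_row A. A $$ (i,i))"

lemma sum_list_diag_mat: "sum_list (diag_mat A) = mtr A"
  unfolding mtr_def diag_mat_def by (simp add: interv_sum_list_conv_sum_set_nat atLeast0LessThan)

lemma index_mult_mat_sum:
  assumes "A \<in> carrier_mat n m" "B \<in> carrier_mat m k" "i < n" "j < k"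
  shows "(A * B) $$ (i,j) = (\<Sum>l<m. A $$ (i,l) * B $$ (l,j))"
  using assms by (simp add: scalar_prod_def atLeast0LessThan)

lemma mtr_comm:
  assumes "A \<in> carrier_mat n m" "B \<in> carrier_mat m n"
  shows "mtr (A * B) = mtr (B * A)"
proof -
  have "mtr (A * B) = (\<Sum>i<n. \<Sum>l<m. A $$ (i,l) * B $$ (l,i))"
    unfolding mtr_def using assms by (intro sum.cong) (auto simp: index_mult_mat_sum[OF assms] simp del: index_mult_mat(1))
  also have "\<dots> = (\<Sum>l<m. \<Sum>i<n. B $$ (l,i) * A $$ (i,l))"
    by (subst sum.swap) (simp add: mult.commute)
  also have "\<dots> = mtr (B * A)"
    unfolding mtr_def using assms by (intro sum.cong) (auto simp: index_mult_mat_sum[OF assms(2,1)] simp del: index_mult_mat(1))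
  finally show ?thesis .
qed

lemma mtr_one [simp]: "mtr (1\<^sub>m n) = of_nat n"
  by (simp add: mtr_def)

lemma mtr_smult: "mtr (c \<cdot>\<^sub>m A) = c * mtr A" if "A \<in> carrier_mat n n"
  using that by (simp add: mtr_def sum_distrib_left)

text \<open>Matrices carry their dimensions as data, so the dimensions are arguments: the empty sum
  has to know which zero matrix it is.\<close>

definition msum :: "nat \<Rightarrow> nat \<Rightarrow> 'x set \<Rightarrow> ('x \<Rightarrow> complex mat) \<Rightarrow> complex mat" where
  "msum n m X F = mat n m (\<lambda>ij. \<Sum>x\<in>X. F x $$ ij)"

lemma msum_carrier [simp]: "msum n m X F \<in> carrier_mat n m"
  by (simp add: msum_def)

lemma msum_dim [simp]: "dim_row (msum n m X F) = n" "dim_col (msum n m X F) = m"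
  by (simp_all add: msum_def)

lemma msum_index: "i < n \<Longrightarrow> j < m \<Longrightarrow> msum n m X F $$ (i,j) = (\<Sum>x\<in>X. F x $$ (i,j))"
  by (simp add: msum_def)

lemma msum_cong: "(\<And>x. x \<in> X \<Longrightarrow> F x = H x) \<Longrightarrow> msum n m X F = msum n m X H"
  unfolding msum_def by (intro eq_matI) auto

lemma msum_reindex: "bij_betw f X Y \<Longrightarrow> msum n m X (\<lambda>x. F (f x)) = msum n m Y F"
  unfolding msum_def by (intro eq_matI) (auto simp: sum.reindex_bij_betw[where g="\<lambda>x. F x $$ _"])

lemma mult_msum:
  assumes A: "A \<in> carrier_mat k n" and F: "\<And>x. x \<in> X \<Longrightarrow> F x \<in> carrier_mat n m"
  shows "A * msum n m X F = msum k m X (\<lambda>x. A * F x)"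
proof (rule eq_matI)
  fix i j assume "i < dim_row (msum k m X (\<lambda>x. A * F x))" "j < dim_col (msum k m X (\<lambda>x. A * F x))"
  then have ij: "i < k" "j < m" by auto
  have "(A * msum n m X F) $$ (i,j) = (\<Sum>l<n. \<Sum>x\<in>X. A $$ (i,l) * F x $$ (l,j))"
    using ij by (subst index_mult_mat_sum[OF A msum_carrier]) (auto simp: msum_index sum_distrib_left)
  also have "\<dots> = (\<Sum>x\<in>X. (A * F x) $$ (i,j))"
    by (subst sum.swap) (intro sum.cong refl, subst index_mult_mat_sum[OF A F], auto simp: ij)
  finally show "(A * msum n m X F) $$ (i,j) = msum k m X (\<lambda>x. A * F x) $$ (i,j)"
    using ij by (simp add: msum_index)
qed (use A in auto)

lemma msum_mult:
  assumes A: "A \<in> carrier_mat m k" and F: "\<And>x. x \<in> X \<Longrightarrow> F x \<in> carrier_mat n m"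
  shows "msum n m X F * A = msum n k X (\<lambda>x. F x * A)"
proof (rule eq_matI)
  fix i j assume "i < dim_row (msum n k X (\<lambda>x. F x * A))" "j < dim_col (msum n k X (\<lambda>x. F x * A))"
  then have ij: "i < n" "j < k" by auto
  have "(msum n m X F * A) $$ (i,j) = (\<Sum>l<m. \<Sum>x\<in>X. F x $$ (i,l) * A $$ (l,j))"
    using ij by (subst index_mult_mat_sum[OF msum_carrier A]) (auto simp: msum_index sum_distrib_right)
  also have "\<dots> = (\<Sum>x\<in>X. (F x * A) $$ (i,j))"
    by (subst sum.swap) (intro sum.cong refl, subst index_mult_mat_sum[OF F A], auto simp: ij)
  finally show "(msum n m X F * A) $$ (i,j) = msum n k X (\<lambda>x. F x * A) $$ (i,j)"
    using ij by (simp add: msum_index)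
qed (use A in auto)

lemma mtr_msum:
  assumes F: "\<And>x. x \<in> X \<Longrightarrow> F x \<in> carrier_mat n n"
  shows "mtr (msum n n X F) = (\<Sum>x\<in>X. mtr (F x))"
proof -
  have "mtr (msum n n X F) = (\<Sum>i<n. \<Sum>x\<in>X. F x $$ (i,i))"
    by (simp add: mtr_def msum_def)
  also have "\<dots> = (\<Sum>x\<in>X. mtr (F x))"
    by (subst sum.swap) (intro sum.cong refl, use F in \<open>auto simp: mtr_def\<close>)
  finally show ?thesis .
qed

lemma msum_smult:
  assumes F: "\<And>x. x \<in> X \<Longrightarrow> F x \<in> carrier_mat n m"
  shows "msum n m X (\<lambda>x. c \<cdot>\<^sub>m F x) = c \<cdot>\<^sub>m msum n m X F"
proof (rule eq_matI)
  fix i j assume ij: "i < dim_row (c \<cdot>\<^sub>m msum n m X F)" "j < dim_col (c \<cdot>\<^sub>m msum n m X F)"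
  then have ij': "i < n" "j < m" by auto
  have "(c \<cdot>\<^sub>m F x) $$ (i,j) = c * F x $$ (i,j)" if "x \<in> X" for x
    using F[OF that] ij' by (subst index_smult_mat) auto
  then show "msum n m X (\<lambda>x. c \<cdot>\<^sub>m F x) $$ (i,j) = (c \<cdot>\<^sub>m msum n m X F) $$ (i,j)"
    using ij' ij by (simp add: msum_index sum_distrib_left)
qed auto

subsection \<open>Schur's lemma\<close>

lemma irreducible_rep_iff:
  assumes "group G"
  shows "irreducible_rep G n \<rho> \<longleftrightarrow> n > 0 \<and> mrep G n \<rho> \<and>
    (\<forall>W. vsub n W \<longrightarrow> (\<forall>g\<in>carrier G. \<forall>w\<in>W. \<rho> g *\<^sub>v w \<in> W) \<longrightarrow> W = {0\<^sub>v n} \<or> W = carrier_vec n)"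
  unfolding irreducible_rep_def subspace_iff_vsub mrep_iff_hom[OF assms] by blast

lemma vsub_kernel:
  assumes A: "A \<in> carrier_mat m n"
  shows "vsub n {v \<in> carrier_vec n. A *\<^sub>v v = 0\<^sub>v m}"
  unfolding vsub_def using A by (auto simp: mult_add_distrib_mat_vec mult_mat_vec)

lemma vsub_image:
  assumes A: "A \<in> carrier_mat m n"
  shows "vsub m ((*\<^sub>v) A ` carrier_vec n)"
  unfolding vsub_def
proof (intro conjI ballI allI)
  show "0\<^sub>v m \<in> (*\<^sub>v) A ` carrier_vec n" by (rule image_eqI[of _ _ "0\<^sub>v n"]) (use A in auto)
  show "v + w \<in> (*\<^sub>v) A ` carrier_vec n" if "v \<in> (*\<^sub>v) A ` carrier_vec n" "w \<in> (*\<^sub>v) A ` carrier_vec n" for v w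
  proof -
    from that obtain x y where "v = A *\<^sub>v x" "w = A *\<^sub>v y" "x \<in> carrier_vec n" "y \<in> carrier_vec n" by auto
    then show ?thesis by (intro image_eqI[of _ _ "x + y"]) (use A in \<open>auto simp: mult_add_distrib_mat_vec\<close>)
  qed
  show "c \<cdot>\<^sub>v v \<in> (*\<^sub>v) A ` carrier_vec n" if "v \<in> (*\<^sub>v) A ` carrier_vec n" for c v
  proof -
    from that obtain x where "v = A *\<^sub>v x" "x \<in> carrier_vec n" by auto
    then show ?thesis by (intro image_eqI[of _ _ "c \<cdot>\<^sub>v x"]) (use A in \<open>auto simp: mult_mat_vec\<close>)
  qed
qed (use A in auto)

lemma zero_mat_of_kernel:
  assumes A: "(A :: complex mat) \<in> carrier_mat m n" and "\<And>v. v \<in> carrier_vec n \<Longrightarrow> A *\<^sub>v v = 0\<^sub>v m"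
  shows "A = 0\<^sub>m m n"
proof (rule eq_matI)
  fix i j assume ij: "i < dim_row (0\<^sub>m m n)" "j < dim_col (0\<^sub>m m n)"
  then have "A $$ (i,j) = (A *\<^sub>v unit_vec n j) $ i"
    using A by (simp add: scalar_prod_right_unit row_carrier_vec[of i])
  also have "\<dots> = 0" using ij assms(2)[of "unit_vec n j"] by auto
  finally show "A $$ (i,j) = (0\<^sub>m m n) $$ (i,j)" using ij by simp
qed (use A in auto)

lemma Schur_bijective:
  assumes G: "group G" and r: "irreducible_rep G n \<rho>" and s: "irreducible_rep G m \<sigma>"
    and A: "A \<in> carrier_mat m n" and int: "\<And>g. g \<in> carrier G \<Longrightarrow> A * \<rho> g = \<sigma> g * A"
    and nz: "A \<noteq> 0\<^sub>m m n"
  shows "{v \<in> carrier_vec n. A *\<^sub>v v = 0\<^sub>v m} = {0\<^sub>v n}" "(*\<^sub>v) A ` carrier_vec n = carrier_vec m"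
proof -
  note R = r[unfolded irreducible_rep_iff[OF G]] and S = s[unfolded irreducible_rep_iff[OF G]]
  have rc: "\<rho> g \<in> carrier_mat n n" and sc: "\<sigma> g \<in> carrier_mat m m" if "g \<in> carrier G" for g
    using R S that unfolding mrep_def by auto
  have comm: "A *\<^sub>v (\<rho> g *\<^sub>v v) = \<sigma> g *\<^sub>v (A *\<^sub>v v)" if "g \<in> carrier G" "v \<in> carrier_vec n" for g v
    using int[OF that(1)] rc[OF that(1)] sc[OF that(1)] that(2) A
    by (metis assoc_mult_mat_vec)
  let ?K = "{v \<in> carrier_vec n. A *\<^sub>v v = 0\<^sub>v m}"
  have "\<sigma> g *\<^sub>v 0\<^sub>v m = 0\<^sub>v m" if "g \<in> carrier G" for g
    using sc[OF that] by (intro eq_vecI) auto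
  then have "\<forall>g\<in>carrier G. \<forall>w\<in>?K. \<rho> g *\<^sub>v w \<in> ?K" using comm mult_mat_vec_carrier[OF rc] by auto
  then have "?K = {0\<^sub>v n} \<or> ?K = carrier_vec n" using R vsub_kernel[OF A] by blast
  moreover have "?K \<noteq> carrier_vec n" using zero_mat_of_kernel[OF A] nz by blast
  ultimately show K: "?K = {0\<^sub>v n}" by blast
  let ?I = "(*\<^sub>v) A ` carrier_vec n"
  have "\<forall>g\<in>carrier G. \<forall>w\<in>?I. \<sigma> g *\<^sub>v w \<in> ?I"
  proof (intro ballI)
    fix g w assume g: "g \<in> carrier G" and "w \<in> ?I"
    then obtain v where v: "v \<in> carrier_vec n" "w = A *\<^sub>v v" by auto
    show "\<sigma> g *\<^sub>v w \<in> ?I"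
      using comm[OF g v(1)] v mult_mat_vec_carrier[OF rc[OF g] v(1)] by (metis image_eqI)
  qed
  then have "?I = {0\<^sub>v m} \<or> ?I = carrier_vec m" using S vsub_image[OF A] by blast
  moreover have "?I \<noteq> {0\<^sub>v m}" using zero_mat_of_kernel[OF A] nz by blast
  ultimately show "?I = carrier_vec m" by blast
qed

text \<open>Over the complex numbers A has an eigenvalue c; then A - c is an intertwiner with
  non-trivial kernel, hence zero by irreducibility.\<close>

lemma Schur_scalar:
  assumes G: "group G" and r: "irreducible_rep G n \<rho>"
    and A: "A \<in> carrier_mat n n" and int: "\<And>g. g \<in> carrier G \<Longrightarrow> A * \<rho> g = \<rho> g * A"
  shows "\<exists>c. A = c \<cdot>\<^sub>m 1\<^sub>m n"
proof -
  note R = r[unfolded irreducible_rep_iff[OF G]]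
  from spectrum_non_empty[OF A] R obtain c where "eigenvalue A c" unfolding spectrum_def by auto
  then obtain v where v: "v \<in> carrier_vec n" "v \<noteq> 0\<^sub>v n" "A *\<^sub>v v = c \<cdot>\<^sub>v v"
    using A unfolding eigenvalue_def eigenvector_def by auto
  let ?B = "A + (-c) \<cdot>\<^sub>m 1\<^sub>m n"
  have B: "?B \<in> carrier_mat n n" using A by simp
  have "?B *\<^sub>v v = c \<cdot>\<^sub>v v + (-c) \<cdot>\<^sub>v v"
    using v A by (subst add_mult_distrib_mat_vec[OF A]) (auto intro!: eq_vecI)
  also have "\<dots> = 0\<^sub>v n" using v by (intro eq_vecI) auto
  finally have k: "v \<in> {v \<in> carrier_vec n. ?B *\<^sub>v v = 0\<^sub>v n}" using v by simp
  have "?B * \<rho> g = \<rho> g * ?B" if g: "g \<in> carrier G" for g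
  proof -
    have rg: "\<rho> g \<in> carrier_mat n n" using R g unfolding mrep_def by auto
    show ?thesis using A rg int[OF g]
      by (simp add: add_mult_distrib_mat[OF A _ rg] mult_add_distrib_mat[OF rg A]
          mult_smult_assoc_mat[of "1\<^sub>m n" n n "\<rho> g" n] mult_smult_distrib[OF rg, of "1\<^sub>m n" n])
  qed
  then have "?B = 0\<^sub>m n n"
    using Schur_bijective(1)[OF G r r B] k v(2) by blast
  then have "A = c \<cdot>\<^sub>m 1\<^sub>m n"
  proof -
    assume z: "?B = 0\<^sub>m n n"
    show ?thesis
    proof (rule eq_matI)
      fix i j assume ij: "i < dim_row (c \<cdot>\<^sub>m 1\<^sub>m n)" "j < dim_col (c \<cdot>\<^sub>m 1\<^sub>m n)"
      then have "?B $$ (i,j) = 0" using z by simp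
      then show "A $$ (i,j) = (c \<cdot>\<^sub>m 1\<^sub>m n) $$ (i,j)" using ij A by simp
    qed (use A in auto)
  qed
  then show ?thesis by blast
qed

text \<open>Preimages of the unit vectors are the columns of a right inverse, injectivity makes it a
  left inverse, and comparing the traces of the two products gives equality of the
  dimensions.\<close>

lemma Schur_inverse:
  assumes G: "group G" and r: "irreducible_rep G n \<rho>" and s: "irreducible_rep G m \<sigma>"
    and A: "A \<in> carrier_mat m n" and int: "\<And>g. g \<in> carrier G \<Longrightarrow> A * \<rho> g = \<sigma> g * A"
    and nz: "A \<noteq> 0\<^sub>m m n"
  shows "n = m \<and> (\<exists>B\<in>carrier_mat n m. A * B = 1\<^sub>m m \<and> B * A = 1\<^sub>m n)"
proof -
  note bij = Schur_bijective[OF G r s A int nz]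
  have "\<exists>x. x \<in> carrier_vec n \<and> A *\<^sub>v x = unit_vec m i" for i
    using bij(2) unit_vec_carrier[of m i] by (metis imageE)
  then obtain x where x: "\<And>i. x i \<in> carrier_vec n" "\<And>i. A *\<^sub>v x i = unit_vec m i" by metis
  define B where "B = mat_of_cols n (map x [0..<m])"
  have B: "B \<in> carrier_mat n m" unfolding B_def by auto
  have colB: "col B j = x j" if "j < m" for j
    using that x unfolding B_def by (subst col_mat_of_cols) auto
  have AB: "A * B = 1\<^sub>m m"
  proof (rule mat_col_eqI)
    fix j assume "j < dim_col (1\<^sub>m m)"
    then have j: "j < m" by simp
    then show "col (A * B) j = col (1\<^sub>m m) j"
      using col_mult2[OF A B j] colB[OF j] x(2) by simp
  qed (use A B in auto)
  have BA: "B * A = 1\<^sub>m n"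
  proof -
    let ?C = "B * A + (-1) \<cdot>\<^sub>m 1\<^sub>m n"
    have C: "?C \<in> carrier_mat n n" using A B by auto
    have "A * (B * A) = A" using AB A B by (metis assoc_mult_mat left_mult_one_mat)
    then have "A * ?C = A + (-1) \<cdot>\<^sub>m A"
      using A B by (subst mult_add_distrib_mat[OF A]) (auto simp: mult_smult_distrib[OF A, of "1\<^sub>m n" n])
    also have "\<dots> = 0\<^sub>m m n" using A by (intro eq_matI) auto
    finally have z: "A * ?C = 0\<^sub>m m n" .
    have "?C *\<^sub>v v = 0\<^sub>v n" if v: "v \<in> carrier_vec n" for v
    proof -
      have "A *\<^sub>v (?C *\<^sub>v v) = 0\<^sub>v m"
      proof -
        have "A *\<^sub>v (?C *\<^sub>v v) = 0\<^sub>m m n *\<^sub>v v" using z v A C by (metis assoc_mult_mat_vec)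
        then show ?thesis using v by (auto intro!: eq_vecI)
      qed
      moreover have "?C *\<^sub>v v \<in> carrier_vec n" using C v by (rule mult_mat_vec_carrier)
      ultimately have "?C *\<^sub>v v \<in> {v \<in> carrier_vec n. A *\<^sub>v v = 0\<^sub>v m}" by blast
      then show ?thesis using bij(1) by simp
    qed
    then have "?C = 0\<^sub>m n n" by (rule zero_mat_of_kernel[OF C])
    then have "?C $$ (i,j) = 0" if "i < n" "j < n" for i j using that by simp
    then have e: "(B * A) $$ (i,j) = 1\<^sub>m n $$ (i,j)" if "i < n" "j < n" for i j
      using that A B by (auto simp del: index_mult_mat(1) split: if_splits)
    show ?thesis by (rule eq_matI) (use e A B in \<open>auto simp del: index_mult_mat(1)\<close>)
  qed
  have "of_nat m = mtr (A * B)" unfolding AB by simp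
  also have "\<dots> = mtr (B * A)" by (rule mtr_comm[OF A B])
  also have "\<dots> = of_nat n" unfolding BA by simp
  finally have "n = m" by simp
  with AB BA B show ?thesis by blast
qed

section \<open>Schur orthogonality for matrix coefficients and characters\<close>

locale fin_group = group G for G (structure) +
  assumes fin [simp]: "finite (carrier G)"
begin

lemma mrepD:
  assumes "mrep G n \<rho>"
  shows "g \<in> carrier G \<Longrightarrow> \<rho> g \<in> carrier_mat n n" "\<rho> \<one> = 1\<^sub>m n"
    "g \<in> carrier G \<Longrightarrow> h \<in> carrier G \<Longrightarrow> \<rho> (g \<otimes> h) = \<rho> g * \<rho> h"
    "g \<in> carrier G \<Longrightarrow> \<rho> g * \<rho> (inv g) = 1\<^sub>m n" "g \<in> carrier G \<Longrightarrow> \<rho> (inv g) * \<rho> g = 1\<^sub>m n"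
proof -
  note m = assms[unfolded mrep_def]
  show "g \<in> carrier G \<Longrightarrow> \<rho> g \<in> carrier_mat n n" "\<rho> \<one> = 1\<^sub>m n"
    "g \<in> carrier G \<Longrightarrow> h \<in> carrier G \<Longrightarrow> \<rho> (g \<otimes> h) = \<rho> g * \<rho> h" using m by blast+
  show "\<rho> g * \<rho> (inv g) = 1\<^sub>m n" "\<rho> (inv g) * \<rho> g = 1\<^sub>m n" if "g \<in> carrier G"
    using m that by (metis inv_closed r_inv, metis inv_closed l_inv)
qed

lemma irrD: "irreducible_rep G n \<rho> \<Longrightarrow> mrep G n \<rho>" "irreducible_rep G n \<rho> \<Longrightarrow> n > 0"
  using irreducible_rep_iff[OF is_group] by auto

lemma bij_mult_left: "h \<in> carrier G \<Longrightarrow> bij_betw (\<lambda>g. h \<otimes> g) (carrier G) (carrier G)"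
  by (rule bij_betw_byWitness[of _ "\<lambda>g. inv h \<otimes> g"]) (auto simp: m_assoc[symmetric])

lemma bij_inv: "bij_betw (\<lambda>g. inv g) (carrier G) (carrier G)"
  by (rule bij_betw_byWitness[of _ "\<lambda>g. inv g"]) auto

lemma avg_intertwines:
  assumes r: "mrep G n \<rho>" and s: "mrep G m \<sigma>" and X: "X \<in> carrier_mat n m" and h: "h \<in> carrier G"
  shows "msum n m (carrier G) (\<lambda>g. \<rho> g * X * \<sigma> (inv g)) * \<sigma> h =
         \<rho> h * msum n m (carrier G) (\<lambda>g. \<rho> g * X * \<sigma> (inv g))"
proof -
  note R = mrepD[OF r] and S = mrepD[OF s]
  have car: "\<rho> g * X * \<sigma> (inv g) \<in> carrier_mat n m" if "g \<in> carrier G" for g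
    by (rule mult_carrier_mat[OF mult_carrier_mat[OF R(1)[OF that] X] S(1)[OF inv_closed[OF that]]])
  have "\<rho> h * msum n m (carrier G) (\<lambda>g. \<rho> g * X * \<sigma> (inv g)) =
        msum n m (carrier G) (\<lambda>g. \<rho> h * (\<rho> g * X * \<sigma> (inv g)))"
    by (rule mult_msum[OF R(1)[OF h] car])
  also have "\<dots> = msum n m (carrier G) (\<lambda>g. \<rho> (h \<otimes> g) * X * \<sigma> (inv (h \<otimes> g)) * \<sigma> h)"
  proof (rule msum_cong)
    fix g assume g: "g \<in> carrier G"
    have c: "\<rho> h \<in> carrier_mat n n" "\<rho> g \<in> carrier_mat n n" "\<sigma> (inv g) \<in> carrier_mat m m" "\<sigma> h \<in> carrier_mat m m"
      "\<sigma> (inv h) \<in> carrier_mat m m"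
      using R(1) S(1) g h by auto
    have "\<sigma> (inv (h \<otimes> g)) * \<sigma> h = \<sigma> (inv g) * (\<sigma> (inv h) * \<sigma> h)"
      using g h c by (simp add: inv_mult_group S(3) assoc_mult_mat[of _ m m _ m _ m])
    then have e: "\<sigma> (inv (h \<otimes> g)) * \<sigma> h = \<sigma> (inv g)" using S(5)[OF h] c by simp
    have "\<rho> (h \<otimes> g) * X * \<sigma> (inv (h \<otimes> g)) * \<sigma> h = \<rho> (h \<otimes> g) * X * (\<sigma> (inv (h \<otimes> g)) * \<sigma> h)"
      using g h X R(1)[of "h \<otimes> g"] S(1)[of "inv (h \<otimes> g)"] c by (intro assoc_mult_mat[of _ n m _ m _ m]) auto
    also have "\<dots> = \<rho> h * \<rho> g * X * \<sigma> (inv g)" using e R(3)[OF h g] by simp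
    also have "\<dots> = \<rho> h * (\<rho> g * X * \<sigma> (inv g))"
      using c X by (simp add: assoc_mult_mat[of _ n n _ n _ m] assoc_mult_mat[of _ n n _ m _ m] assoc_mult_mat[of "\<rho> h * \<rho> g" n n X m "\<sigma> (inv g)" m])
    finally show "\<rho> h * (\<rho> g * X * \<sigma> (inv g)) = \<rho> (h \<otimes> g) * X * \<sigma> (inv (h \<otimes> g)) * \<sigma> h" ..
  qed
  also have "\<dots> = msum n m (carrier G) (\<lambda>g. \<rho> g * X * \<sigma> (inv g) * \<sigma> h)"
    by (rule msum_reindex[OF bij_mult_left[OF h], of n m "\<lambda>g. \<rho> g * X * \<sigma> (inv g) * \<sigma> h"])
  also have "\<dots> = msum n m (carrier G) (\<lambda>g. \<rho> g * X * \<sigma> (inv g)) * \<sigma> h"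
    by (rule msum_mult[symmetric, OF S(1)[OF h] car])
  finally show ?thesis ..
qed

lemma mtr_conj:
  assumes "mrep G n \<rho>" "X \<in> carrier_mat n n" "g \<in> carrier G"
  shows "mtr (\<rho> g * X * \<rho> (inv g)) = mtr X"
proof -
  note R = mrepD[OF assms(1)]
  have c: "\<rho> g \<in> carrier_mat n n" "\<rho> (inv g) \<in> carrier_mat n n" using R(1) assms(3) by auto
  have "mtr (\<rho> g * X * \<rho> (inv g)) = mtr (\<rho> (inv g) * (\<rho> g * X))"
    by (rule mtr_comm[of _ n n]) (use c assms in auto)
  also have "\<rho> (inv g) * (\<rho> g * X) = X"
    using assoc_mult_mat[OF c(2,1) assms(2)] R(5)[OF assms(3)] assms(2) by simp
  finally show ?thesis .
qed

text \<open>The average is scalar by Schur's lemma and conjugation preserves traces, so comparing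
  traces determines the scalar.\<close>

lemma avg_same:
  assumes r: "irreducible_rep G n \<rho>" and X: "X \<in> carrier_mat n n"
  shows "msum n n (carrier G) (\<lambda>g. \<rho> g * X * \<rho> (inv g)) = (of_nat (card (carrier G)) * mtr X / of_nat n) \<cdot>\<^sub>m 1\<^sub>m n"
proof -
  let ?A = "msum n n (carrier G) (\<lambda>g. \<rho> g * X * \<rho> (inv g))"
  note m = irrD(1)[OF r] and n = irrD(2)[OF r]
  note R = mrepD[OF m]
  have car: "\<rho> g * X * \<rho> (inv g) \<in> carrier_mat n n" if "g \<in> carrier G" for g
    by (rule mult_carrier_mat[OF mult_carrier_mat[OF R(1)[OF that] X] R(1)[OF inv_closed[OF that]]])
  obtain c where c: "?A = c \<cdot>\<^sub>m 1\<^sub>m n"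
    using Schur_scalar[OF is_group r msum_carrier avg_intertwines[OF m m X]] by blast
  have "c * of_nat n = mtr ?A" unfolding c by (simp add: mtr_smult[of _ n])
  also have "\<dots> = of_nat (card (carrier G)) * mtr X"
    by (subst mtr_msum[OF car]) (simp_all add: mtr_conj[OF m X])
  finally have "c = of_nat (card (carrier G)) * mtr X / of_nat n" using n by (simp add: field_simps)
  with c show ?thesis by simp
qed

lemma avg_diff:
  assumes r: "irreducible_rep G n \<rho>" and s: "irreducible_rep G m \<sigma>" and X: "X \<in> carrier_mat n m"
    and ne: "rep_character G \<rho> \<noteq> rep_character G \<sigma>"
  shows "msum n m (carrier G) (\<lambda>g. \<rho> g * X * \<sigma> (inv g)) = 0\<^sub>m n m"
proof (rule ccontr)
  let ?A = "msum n m (carrier G) (\<lambda>g. \<rho> g * X * \<sigma> (inv g))"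
  assume nz: "?A \<noteq> 0\<^sub>m n m"
  note R = mrepD[OF irrD(1)[OF r]] and S = mrepD[OF irrD(1)[OF s]]
  note int = avg_intertwines[OF irrD(1)[OF r] irrD(1)[OF s] X]
  from Schur_inverse[OF is_group s r msum_carrier int nz]
  obtain B where B: "B \<in> carrier_mat m n" "?A * B = 1\<^sub>m n" "B * ?A = 1\<^sub>m m" by auto
  have A: "?A \<in> carrier_mat n m" by simp
  have "mtr (\<rho> h) = mtr (\<sigma> h)" if h: "h \<in> carrier G" for h
  proof -
    note c = R(1)[OF h] S(1)[OF h]
    have "\<rho> h = \<rho> h * (?A * B)" using B(2) c by simp
    also have "\<dots> = ?A * \<sigma> h * B" by (simp only: int[OF h] assoc_mult_mat[OF c(1) A B(1)])
    finally have "mtr (\<rho> h) = mtr (?A * \<sigma> h * B)" by simp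
    also have "\<dots> = mtr (B * (?A * \<sigma> h))" by (rule mtr_comm[of _ n m]) (use A B c in auto)
    also have "B * (?A * \<sigma> h) = \<sigma> h"
      using assoc_mult_mat[OF B(1) A c(2)] B(3) c(2) by simp
    finally show ?thesis .
  qed
  then have "rep_character G \<rho> = rep_character G \<sigma>"
    unfolding rep_character_def sum_list_diag_mat by (intro restrict_ext)
  with ne show False ..
qed

text \<open>The elementary matrix with its only 1 at position (k,l) isolates a single product of
  matrix entries. Applying Schur's lemma to all such averages yields the orthogonality of matrix
  coefficients.\<close>

lemma coeff_sum_average:
  assumes r: "mrep G n \<rho>" and s: "mrep G m \<sigma>" and ij: "i < n" "k < n" "l < m" "j < m"
  defines "X \<equiv> mat n m (\<lambda>(a,b). if a = k \<and> b = l then 1 else 0 :: complex)"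
  shows "(\<Sum>g\<in>carrier G. \<rho> g $$ (i,k) * \<sigma> (inv g) $$ (l,j)) = msum n m (carrier G) (\<lambda>g. \<rho> g * X * \<sigma> (inv g)) $$ (i,j)"
proof -
  note R = mrepD[OF r] and S = mrepD[OF s]
  have X: "X \<in> carrier_mat n m" unfolding X_def by simp
  have e: "(\<rho> g * X * \<sigma> (inv g)) $$ (i,j) = \<rho> g $$ (i,k) * \<sigma> (inv g) $$ (l,j)" if g: "g \<in> carrier G" for g
  proof -
    note c = R(1)[OF g] S(1)[OF inv_closed[OF g]]
    have "(\<rho> g * X) $$ (i,b) = (if b = l then \<rho> g $$ (i,k) else 0)" if "b < m" for b
    proof -
      have "(\<rho> g * X) $$ (i,b) = (\<Sum>a<n. \<rho> g $$ (i,a) * X $$ (a,b))"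
        by (rule index_mult_mat_sum[OF c(1) X ij(1) that])
      also have "\<dots> = (\<Sum>a<n. if a = k then (if b = l then \<rho> g $$ (i,k) else 0) else 0)"
        by (rule sum.cong) (use that in \<open>auto simp: X_def\<close>)
      finally have "(\<rho> g * X) $$ (i,b) = (\<Sum>a<n. if a = k then (if b = l then \<rho> g $$ (i,k) else 0) else 0)" .
      then show ?thesis using ij by simp
    qed
    then have "(\<rho> g * X * \<sigma> (inv g)) $$ (i,j) = (\<Sum>b<m. if b = l then \<rho> g $$ (i,k) * \<sigma> (inv g) $$ (l,j) else 0)"
      using index_mult_mat_sum[OF mult_carrier_mat[OF c(1) X] c(2) ij(1,4)]
      by (simp add: if_distrib[of "\<lambda>x. x * _"] cong: if_cong del: sum.delta)
    then show ?thesis using ij by simp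
  qed
  show ?thesis using ij e by (simp add: msum_index)
qed

lemma coeff_orth:
  assumes r: "irreducible_rep G n \<rho>" and s: "irreducible_rep G m \<sigma>"
    and ij: "i < n" "k < n" "l < m" "j < m"
  shows "rep_character G \<rho> \<noteq> rep_character G \<sigma> \<Longrightarrow> (\<Sum>g\<in>carrier G. \<rho> g $$ (i,k) * \<sigma> (inv g) $$ (l,j)) = 0"
    "\<rho> = \<sigma> \<Longrightarrow> m = n \<Longrightarrow> (\<Sum>g\<in>carrier G. \<rho> g $$ (i,k) * \<sigma> (inv g) $$ (l,j)) =
       (if i = j \<and> k = l then of_nat (card (carrier G)) / of_nat n else 0)"
proof -
  let ?T = "\<Sum>g\<in>carrier G. \<rho> g $$ (i,k) * \<sigma> (inv g) $$ (l,j)"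
  note R = mrepD[OF irrD(1)[OF r]] and S = mrepD[OF irrD(1)[OF s]]
  define X where "X = mat n m (\<lambda>(a,b). if a = k \<and> b = l then 1 else 0 :: complex)"
  have X: "X \<in> carrier_mat n m" unfolding X_def by simp
  have eq: "?T = msum n m (carrier G) (\<lambda>g. \<rho> g * X * \<sigma> (inv g)) $$ (i,j)"
    unfolding X_def by (rule coeff_sum_average[OF irrD(1)[OF r] irrD(1)[OF s] ij])
  show "?T = 0" if "rep_character G \<rho> \<noteq> rep_character G \<sigma>"
    unfolding eq using avg_diff[OF r s X that] ij by simp
  show "?T =
       (if i = j \<and> k = l then of_nat (card (carrier G)) / of_nat n else 0)" if "\<rho> = \<sigma>" "m = n"
  proof -
    have X': "X \<in> carrier_mat n n" using X that by simp
    have "mtr X = (if k = l then 1 else 0)"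
    proof -
      have "mtr X = (\<Sum>a<n. if a = k then (if k = l then 1 else 0) else 0)"
        unfolding mtr_def using that by (intro sum.cong) (auto simp: X_def)
      then show ?thesis using ij by simp
    qed
    moreover have "msum n m (carrier G) (\<lambda>g. \<rho> g * X * \<sigma> (inv g)) = (of_nat (card (carrier G)) * mtr X / of_nat n) \<cdot>\<^sub>m 1\<^sub>m n"
      using avg_same[OF r X'] that by simp
    ultimately show ?thesis unfolding eq using ij that by auto
  qed
qed

text \<open>The free matrices A and B make this usable beyond characters: they become representing
  matrices of group elements in the convolution formula and the idempotent of the Hecke algebra in
  the multiplicity one argument.\<close>

lemma trace_orth:
  assumes r: "irreducible_rep G n \<rho>" and s: "irreducible_rep G m \<sigma>"
    and A: "A \<in> carrier_mat n n" and B: "B \<in> carrier_mat m m"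
  shows "rep_character G \<rho> \<noteq> rep_character G \<sigma> \<Longrightarrow> (\<Sum>g\<in>carrier G. mtr (A * \<rho> g) * mtr (\<sigma> (inv g) * B)) = 0"
    "\<rho> = \<sigma> \<Longrightarrow> m = n \<Longrightarrow> (\<Sum>g\<in>carrier G. mtr (A * \<rho> g) * mtr (\<sigma> (inv g) * B)) =
       of_nat (card (carrier G)) / of_nat n * mtr (A * B)"
proof -
  let ?T = "\<Sum>g\<in>carrier G. mtr (A * \<rho> g) * mtr (\<sigma> (inv g) * B)"
  note R = mrepD[OF irrD(1)[OF r]] and S = mrepD[OF irrD(1)[OF s]]
  have tr: "mtr (C * D) = (\<Sum>(a,b)\<in>{..<p}\<times>{..<p}. C $$ (a,b) * D $$ (b,a))"
    if "C \<in> carrier_mat p p" "D \<in> carrier_mat p p" for C D p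
    unfolding mtr_def sum.cartesian_product[symmetric] using that
    by (intro sum.cong) (auto simp: index_mult_mat_sum[OF that] simp del: index_mult_mat(1))
  let ?N = "{..<n}\<times>{..<n}" and ?M = "{..<m}\<times>{..<m}"
  have eq: "?T =
    (\<Sum>(k,i)\<in>?N. \<Sum>(l,j)\<in>?M. A $$ (k,i) * B $$ (j,l) * (\<Sum>g\<in>carrier G. \<rho> g $$ (i,k) * \<sigma> (inv g) $$ (l,j)))"
  proof -
    have "?T =
      (\<Sum>g\<in>carrier G. \<Sum>ki\<in>?N. \<Sum>lj\<in>?M. (A $$ ki * \<rho> g $$ (snd ki, fst ki)) * (\<sigma> (inv g) $$ lj * B $$ (snd lj, fst lj)))"
      by (intro sum.cong refl) (simp add: tr[OF A R(1)] tr[OF S(1) B] sum_product case_prod_unfold)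
    also have "\<dots> = (\<Sum>ki\<in>?N. \<Sum>g\<in>carrier G. \<Sum>lj\<in>?M. (A $$ ki * \<rho> g $$ (snd ki, fst ki)) * (\<sigma> (inv g) $$ lj * B $$ (snd lj, fst lj)))"
      by (rule sum.swap)
    also have "\<dots> = (\<Sum>ki\<in>?N. \<Sum>lj\<in>?M. \<Sum>g\<in>carrier G. (A $$ ki * \<rho> g $$ (snd ki, fst ki)) * (\<sigma> (inv g) $$ lj * B $$ (snd lj, fst lj)))"
      by (intro sum.cong refl, rule sum.swap)
    finally show ?thesis
      by (simp add: case_prod_unfold sum_distrib_left mult_ac)
  qed
  show "?T = 0" if ne: "rep_character G \<rho> \<noteq> rep_character G \<sigma>"
    unfolding eq by (intro sum.neutral ballI, clarify, intro sum.neutral ballI, clarify)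
      (use coeff_orth(1)[OF r s _ _ _ _ ne] in auto)
  show "?T =
       of_nat (card (carrier G)) / of_nat n * mtr (A * B)" if same: "\<rho> = \<sigma>" "m = n"
  proof -
    let ?c = "of_nat (card (carrier G)) / of_nat n :: complex"
    have "(\<Sum>(l,j)\<in>?M. A $$ (k,i) * B $$ (j,l) * (\<Sum>g\<in>carrier G. \<rho> g $$ (i,k) * \<sigma> (inv g) $$ (l,j))) =
       ?c * (A $$ (k,i) * B $$ (i,k))" if ki: "k < n" "i < n" for k i
    proof -
      have "(\<Sum>(l,j)\<in>?M. A $$ (k,i) * B $$ (j,l) * (\<Sum>g\<in>carrier G. \<rho> g $$ (i,k) * \<sigma> (inv g) $$ (l,j))) =
        (\<Sum>lj\<in>?M. if lj = (k,i) then ?c * (A $$ (k,i) * B $$ (i,k)) else 0)"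
        by (intro sum.cong refl) (use ki same coeff_orth(2)[OF r s] in \<open>auto simp: same split: if_splits\<close>)
      then show ?thesis using ki same by simp
    qed
    then have "?T = (\<Sum>(k,i)\<in>?N. ?c * (A $$ (k,i) * B $$ (i,k)))"
      unfolding eq by (intro sum.cong refl) auto
    also have "\<dots> = ?c * mtr (A * B)"
      using tr[OF A] B same by (simp add: sum_distrib_left case_prod_unfold)
    finally show ?thesis .
  qed
qed

text \<open>Were all the coefficient sums zero, the sum of the products of the common character at g
  and at its inverse would vanish, whereas it equals the group order. A nonzero coefficient sum is
  an entry of an averaged elementary matrix, which is therefore a nonzero intertwiner and invertible
  by Schur's lemma.\<close>

lemma intertwiner_exists:
  assumes r: "irreducible_rep G n \<rho>" and s: "irreducible_rep G m \<sigma>"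
    and e: "\<And>g. g \<in> carrier G \<Longrightarrow> mtr (\<rho> g) = mtr (\<sigma> g)"
  obtains A B where "A \<in> carrier_mat n n" "B \<in> carrier_mat n n" "A * B = 1\<^sub>m n" "B * A = 1\<^sub>m n"
    "\<And>g. g \<in> carrier G \<Longrightarrow> A * \<rho> g = \<sigma> g * A"
proof -
  note mr = irrD(1)[OF r] and ms = irrD(1)[OF s]
  note R = mrepD[OF mr] and S = mrepD[OF ms]
  have nm: "n = m" using e[of \<one>] R(2) S(2) by simp
  obtain k l where kl: "k < m" "l < n" and nz: "(\<Sum>g\<in>carrier G. \<sigma> g $$ (k,k) * \<rho> (inv g) $$ (l,l)) \<noteq> 0"
  proof (rule ccontr)
    assume "\<not> thesis"
    then have z: "(\<Sum>g\<in>carrier G. \<sigma> g $$ (k,k) * \<rho> (inv g) $$ (l,l)) = 0" if "k < m" "l < n" for k l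
      using that \<open>\<And>k l. \<lbrakk>k < m; l < n; (\<Sum>g\<in>carrier G. \<sigma> g $$ (k,k) * \<rho> (inv g) $$ (l,l)) \<noteq> 0\<rbrakk> \<Longrightarrow> thesis\<close> by blast
    have "(\<Sum>g\<in>carrier G. mtr (\<rho> g) * mtr (\<rho> (inv g))) = (\<Sum>g\<in>carrier G. mtr (1\<^sub>m n * \<rho> g) * mtr (\<rho> (inv g) * 1\<^sub>m n))"
      by (intro sum.cong refl) (simp add: R(1) left_mult_one_mat[OF R(1)] right_mult_one_mat[OF R(1)])
    also have "\<dots> = of_nat (card (carrier G)) / of_nat n * mtr (1\<^sub>m n * 1\<^sub>m n)"
      by (rule trace_orth(2)[OF r r]) auto
    also have "\<dots> \<noteq> 0" using fin irrD(2)[OF r] one_closed by (auto simp: card_eq_0_iff)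
    finally have "(\<Sum>g\<in>carrier G. mtr (\<sigma> g) * mtr (\<rho> (inv g))) \<noteq> 0" by (simp add: e)
    moreover have "(\<Sum>g\<in>carrier G. mtr (\<sigma> g) * mtr (\<rho> (inv g))) = (\<Sum>g\<in>carrier G. \<Sum>k<m. \<Sum>l<n. \<sigma> g $$ (k,k) * \<rho> (inv g) $$ (l,l))"
    proof (intro sum.cong refl)
      fix g assume g: "g \<in> carrier G"
      show "mtr (\<sigma> g) * mtr (\<rho> (inv g)) = (\<Sum>k<m. \<Sum>l<n. \<sigma> g $$ (k,k) * \<rho> (inv g) $$ (l,l))"
        using S(1)[OF g] R(1)[OF inv_closed[OF g]] by (simp add: mtr_def sum_product)
    qed
    moreover have "(\<Sum>g\<in>carrier G. \<Sum>k<m. \<Sum>l<n. \<sigma> g $$ (k,k) * \<rho> (inv g) $$ (l,l)) =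
      (\<Sum>k<m. \<Sum>l<n. \<Sum>g\<in>carrier G. \<sigma> g $$ (k,k) * \<rho> (inv g) $$ (l,l))"
      by (subst sum.swap, rule sum.cong[OF refl], rule sum.swap)
    ultimately show False using z by simp
  qed
  define X where "X = mat m n (\<lambda>(a,b). if a = k \<and> b = l then 1 else 0 :: complex)"
  have X: "X \<in> carrier_mat m n" unfolding X_def by simp
  let ?A = "msum m n (carrier G) (\<lambda>g. \<sigma> g * X * \<rho> (inv g))"
  have "?A $$ (k,l) \<noteq> 0"
    using nz coeff_sum_average[OF ms mr kl(1) kl(1) kl(2) kl(2)] unfolding X_def by simp
  then have A0: "?A \<noteq> 0\<^sub>m m n" using kl by auto
  note int = avg_intertwines[OF ms mr X]
  from Schur_inverse[OF is_group r s msum_carrier int A0]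
  obtain B where "B \<in> carrier_mat n m" "?A * B = 1\<^sub>m m" "B * ?A = 1\<^sub>m n" by blast
  then show ?thesis using that[of ?A B] int nm by simp
qed

lemma chr_conj:
  assumes "mrep G n \<rho>" "x \<in> carrier G" "g \<in> carrier G"
  shows "mtr (\<rho> (g \<otimes> x \<otimes> inv g)) = mtr (\<rho> x)"
  using mtr_conj[OF assms(1) mrepD(1)[OF assms(1,2)] assms(3)] mrepD(3)[OF assms(1)] assms(2,3) by simp

lemma IrrE:
  assumes "\<chi> \<in> Irr G"
  obtains n \<rho> where "irreducible_rep G n \<rho>" "mrep G n \<rho>" "\<chi> = rep_character G \<rho>" "n > 0" "\<chi> \<one> = of_nat n"
    "\<And>g. g \<in> carrier G \<Longrightarrow> \<chi> g = mtr (\<rho> g)"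
proof -
  from assms obtain n \<rho> where r: "irreducible_rep G n \<rho>" "\<chi> = rep_character G \<rho>" unfolding Irr_def by blast
  have e: "\<chi> g = mtr (\<rho> g)" if "g \<in> carrier G" for g
    using r(2) that by (simp add: rep_character_def sum_list_diag_mat)
  have "\<chi> \<one> = of_nat n" using e[of \<one>] mrepD(2)[OF irrD(1)[OF r(1)]] by simp
  with r e irrD[OF r(1)] that show ?thesis by blast
qed

lemma IrrI: "irreducible_rep G n \<rho> \<Longrightarrow> rep_character G \<rho> \<in> Irr G"
  unfolding Irr_def by blast

lemma Irr_eqI:
  assumes "\<chi> \<in> Irr G" "\<xi> \<in> Irr G" "\<And>g. g \<in> carrier G \<Longrightarrow> \<chi> g = \<xi> g"
  shows "\<chi> = \<xi>"
proof -
  have "\<chi> \<in> extensional (carrier G)" "\<xi> \<in> extensional (carrier G)"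
    using assms(1,2) unfolding Irr_def rep_character_def by auto
  then show ?thesis using assms(3) by (metis extensionalityI)
qed

lemma Irr_conj: "\<chi> \<in> Irr G \<Longrightarrow> x \<in> carrier G \<Longrightarrow> g \<in> carrier G \<Longrightarrow> \<chi> (g \<otimes> x \<otimes> inv g) = \<chi> x"
  by (erule IrrE) (simp add: chr_conj)

lemma Irr_comm: assumes "\<chi> \<in> Irr G" "x \<in> carrier G" "y \<in> carrier G" shows "\<chi> (x \<otimes> y) = \<chi> (y \<otimes> x)"
proof -
  have "x \<otimes> (y \<otimes> x) \<otimes> inv x = x \<otimes> y" using assms by (simp add: m_assoc)
  then show ?thesis using Irr_conj[OF assms(1), of "y \<otimes> x" x] assms by simp
qed

lemma Irr_one: "\<chi> \<in> Irr G \<Longrightarrow> \<exists>n>0. \<chi> \<one> = of_nat n"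
  by (erule IrrE) auto

lemma Irr_one_nz: "\<chi> \<in> Irr G \<Longrightarrow> \<chi> \<one> \<noteq> 0"
  by (erule IrrE) auto

lemma Irr_convolution:
  assumes c: "\<chi> \<in> Irr G" and d: "\<xi> \<in> Irr G" and xy: "x \<in> carrier G" "y \<in> carrier G"
  shows "(\<Sum>g\<in>carrier G. \<chi> (x \<otimes> g) * \<xi> (inv g \<otimes> y)) =
     (if \<chi> = \<xi> then of_nat (card (carrier G)) / \<chi> \<one> * \<chi> (x \<otimes> y) else 0)"
proof -
  obtain n \<rho> where r: "irreducible_rep G n \<rho>" "mrep G n \<rho>" "\<chi> = rep_character G \<rho>" "n > 0" "\<chi> \<one> = of_nat n"
    "\<And>g. g \<in> carrier G \<Longrightarrow> \<chi> g = mtr (\<rho> g)" using IrrE[OF c] by metis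
  obtain m \<sigma> where s: "irreducible_rep G m \<sigma>" "mrep G m \<sigma>" "\<xi> = rep_character G \<sigma>" "m > 0" "\<xi> \<one> = of_nat m"
    "\<And>g. g \<in> carrier G \<Longrightarrow> \<xi> g = mtr (\<sigma> g)" using IrrE[OF d] by metis
  note R = mrepD[OF r(2)] and S = mrepD[OF s(2)]
  show ?thesis
  proof (cases "\<chi> = \<xi>")
    case False
    have "(\<Sum>g\<in>carrier G. \<chi> (x \<otimes> g) * \<xi> (inv g \<otimes> y)) = (\<Sum>g\<in>carrier G. mtr (\<rho> x * \<rho> g) * mtr (\<sigma> (inv g) * \<sigma> y))"
      by (intro sum.cong refl) (simp add: r(6) s(6) xy R(3) S(3))
    also have "\<dots> = 0" using trace_orth(1)[OF r(1) s(1) R(1)[OF xy(1)] S(1)[OF xy(2)]] False r(3) s(3) by blast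
    finally show ?thesis using False by simp
  next
    case True
    have "(\<Sum>g\<in>carrier G. \<chi> (x \<otimes> g) * \<xi> (inv g \<otimes> y)) = (\<Sum>g\<in>carrier G. mtr (\<rho> x * \<rho> g) * mtr (\<rho> (inv g) * \<rho> y))"
      by (intro sum.cong refl) (simp add: True[symmetric] r(6) xy R(3))
    also have "\<dots> = of_nat (card (carrier G)) / of_nat n * mtr (\<rho> x * \<rho> y)"
      using trace_orth(2)[OF r(1) r(1) R(1)[OF xy(1)] R(1)[OF xy(2)]] by simp
    finally show ?thesis using True r(5,6) xy R(3) by simp
  qed
qed

text \<open>The average of a representation over the conjugates of y is the scalar matrix of trace
  \<open>\<chi> y\<close>. This is the source of both column orthogonality and the integrality of
  central characters.\<close>

lemma Irr_average:
  assumes c: "\<chi> \<in> Irr G" and xy: "x \<in> carrier G" "y \<in> carrier G"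
  shows "(\<Sum>h\<in>carrier G. \<chi> (x \<otimes> (h \<otimes> y \<otimes> inv h))) = of_nat (card (carrier G)) / \<chi> \<one> * \<chi> x * \<chi> y"
proof -
  obtain n \<rho> where r: "irreducible_rep G n \<rho>" "mrep G n \<rho>" "\<chi> = rep_character G \<rho>" "n > 0" "\<chi> \<one> = of_nat n"
    "\<And>g. g \<in> carrier G \<Longrightarrow> \<chi> g = mtr (\<rho> g)" using IrrE[OF c] by metis
  note R = mrepD[OF r(2)]
  have car: "\<rho> g * \<rho> y * \<rho> (inv g) \<in> carrier_mat n n" if "g \<in> carrier G" for g
    by (rule mult_carrier_mat[OF mult_carrier_mat[OF R(1)[OF that] R(1)[OF xy(2)]] R(1)[OF inv_closed[OF that]]])
  let ?M = "msum n n (carrier G) (\<lambda>h. \<rho> h * \<rho> y * \<rho> (inv h))"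
  have "(\<Sum>h\<in>carrier G. \<chi> (x \<otimes> (h \<otimes> y \<otimes> inv h))) = (\<Sum>h\<in>carrier G. mtr (\<rho> x * (\<rho> h * \<rho> y * \<rho> (inv h))))"
    by (intro sum.cong refl) (simp add: r(6) xy R(3))
  also have "\<dots> = mtr (msum n n (carrier G) (\<lambda>h. \<rho> x * (\<rho> h * \<rho> y * \<rho> (inv h))))"
    by (rule mtr_msum[symmetric], rule mult_carrier_mat[OF R(1)[OF xy(1)] car])
  also have "\<dots> = mtr (\<rho> x * ?M)" by (subst mult_msum[OF R(1)[OF xy(1)] car]) simp_all
  also have "?M = (of_nat (card (carrier G)) * mtr (\<rho> y) / of_nat n) \<cdot>\<^sub>m 1\<^sub>m n"
    by (rule avg_same[OF r(1) R(1)[OF xy(2)]])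
  also have "mtr (\<rho> x * \<dots>) = of_nat (card (carrier G)) * mtr (\<rho> y) / of_nat n * mtr (\<rho> x)"
    using R(1)[OF xy(1)] by (simp add: mult_smult_distrib[of _ n n _ n] mtr_smult[of _ n])
  finally show ?thesis using r(5,6) xy by simp
qed

end

subsection \<open>Invariant subspaces\<close>

lemma vsub_mult_mat_vec:
  assumes W: "vsub n W" and N: "N \<in> carrier_mat n m" and cols: "\<And>j. j < m \<Longrightarrow> col N j \<in> W" and x: "x \<in> carrier_vec m"
  shows "N *\<^sub>v x \<in> W"
proof -
  define y where "y k = vec m (\<lambda>i. if i < k then x $ i else 0)" for k
  have yc: "y k \<in> carrier_vec m" for k unfolding y_def by simp
  have "N *\<^sub>v y k \<in> W" if "k \<le> m" for k
    using that
  proof (induction k)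
    case 0
    have "N *\<^sub>v y 0 = 0\<^sub>v n" using N by (intro eq_vecI) (auto simp: y_def scalar_prod_def)
    then show ?case using W unfolding vsub_def by simp
  next
    case (Suc k)
    then have k: "k < m" by simp
    have "N *\<^sub>v y (Suc k) = N *\<^sub>v y k + x $ k \<cdot>\<^sub>v col N k"
    proof (rule eq_vecI)
      fix i assume "i < dim_vec (N *\<^sub>v y k + x $ k \<cdot>\<^sub>v col N k)"
      then have i: "i < n" using N by simp
      have "(N *\<^sub>v y (Suc k)) $ i = (\<Sum>j<m. N $$ (i,j) * (if j < Suc k then x $ j else 0))"
        using N i by (auto simp: scalar_prod_def y_def atLeast0LessThan intro!: sum.cong)
      also have "\<dots> = (\<Sum>j<m. N $$ (i,j) * (if j < k then x $ j else 0) + (if j = k then N $$ (i,k) * x $ k else 0))"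
        by (rule sum.cong) auto
      also have "\<dots> = (\<Sum>j<m. N $$ (i,j) * (if j < k then x $ j else 0)) + N $$ (i,k) * x $ k"
        using k by (simp add: sum.distrib)
      also have "(\<Sum>j<m. N $$ (i,j) * (if j < k then x $ j else 0)) = (N *\<^sub>v y k) $ i"
        using N i by (auto simp: scalar_prod_def y_def atLeast0LessThan intro!: sum.cong)
      finally show "(N *\<^sub>v y (Suc k)) $ i = (N *\<^sub>v y k + x $ k \<cdot>\<^sub>v col N k) $ i"
        using N i k by simp
    qed (use N in simp)
    then show ?case using Suc k cols W unfolding vsub_def by simp
  qed
  from this[of m] have "N *\<^sub>v y m \<in> W" by simp
  also have "y m = x" using x unfolding y_def by (intro eq_vecI) auto
  finally show ?thesis .
qed

text \<open>Take k maximal such that some invertible matrix has its first k columns in W. If a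
  vector of W had a nonzero coordinate beyond these in this basis, exchanging it for a basis vector
  would contradict maximality.\<close>

lemma adapted_basis:
  assumes W: "vsub n W" and W0: "W \<noteq> {0\<^sub>v n}" and W1: "W \<noteq> carrier_vec n"
  obtains k N M where "0 < k" "k < n" "N \<in> carrier_mat n n" "M \<in> carrier_mat n n" "M * N = 1\<^sub>m n" "N * M = 1\<^sub>m n"
    "\<And>j. j < k \<Longrightarrow> col N j \<in> W" "\<And>w i. w \<in> W \<Longrightarrow> k \<le> i \<Longrightarrow> i < n \<Longrightarrow> (M *\<^sub>v w) $ i = 0"
proof -
  define Q where "Q k N M \<longleftrightarrow> k \<le> n \<and> N \<in> carrier_mat n n \<and> M \<in> carrier_mat n n \<and> M * N = 1\<^sub>m n \<and> N * M = 1\<^sub>m n \<and>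
     (\<forall>j<k. col N j \<in> W)" for k and N M :: "complex mat"
  have Wc: "w \<in> carrier_vec n" if "w \<in> W" for w using W that unfolding vsub_def by auto
  have ex: "\<exists>k N M. Q k N M" by (rule exI[of _ 0], rule exI[of _ "1\<^sub>m n"], rule exI[of _ "1\<^sub>m n"]) (simp add: Q_def)
  define K where "K = {k. \<exists>N M. Q k N M}"
  have K: "finite K" "K \<noteq> {}" using ex by (auto simp: K_def Q_def intro: finite_subset[of _ "{..n}"])
  define k where "k = Max K"
  from Max_in[OF K] obtain N M where Q: "Q k N M" unfolding k_def K_def by blast
  have max: "\<not> Q (Suc k) N' M'" for N' M'
  proof -
    have "Suc k \<notin> K" using Max_ge[OF K(1), of "Suc k"] k_def by auto
    then show ?thesis by (auto simp: K_def)
  qed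
  note q = Q[unfolded Q_def]
  have N: "N \<in> carrier_mat n n" and M: "M \<in> carrier_mat n n" and MN: "M * N = 1\<^sub>m n" and NM: "N * M = 1\<^sub>m n"
    using q by auto
  have NMw: "N *\<^sub>v (M *\<^sub>v w) = w" if "w \<in> carrier_vec n" for w
    using assoc_mult_mat_vec[OF N M that] NM that by simp
  have zero: "(M *\<^sub>v w) $ i = 0" if w: "w \<in> W" and i: "k \<le> i" "i < n" for w i
  proof (rule ccontr)
    assume nz: "(M *\<^sub>v w) $ i \<noteq> 0"
    define c where "c = M *\<^sub>v w"
    have c: "c \<in> carrier_vec n" "c $ i \<noteq> 0" using M Wc[OF w] nz unfolding c_def by auto
    \<comment> \<open>The exchange in coordinates: column k becomes c, the coordinate vector of w,
      and column i takes over the unit vector displaced from place k. Invertibility rests on c being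
      nonzero at i.\<close>
    define F where "F = mat n n (\<lambda>(a,j). if j = k then c $ a else if a = (if j = i then k else j) then 1 else 0)"
    have F: "F \<in> carrier_mat n n" unfolding F_def by simp
    have "det F \<noteq> 0"
    proof
      assume "det F = 0"
      then obtain x where x: "x \<in> carrier_vec n" "x \<noteq> 0\<^sub>v n" "F *\<^sub>v x = 0\<^sub>v n"
        using det_0_iff_vec_prod_zero_field[OF F] by auto
      have row: "(\<Sum>j<n. F $$ (a,j) * x $ j) = 0" if "a < n" for a
      proof -
        have "(F *\<^sub>v x) $ a = (\<Sum>j<n. F $$ (a,j) * x $ j)"
          using that F x(1) by (simp add: scalar_prod_def atLeast0LessThan)
        then show ?thesis using x(3) that by simp
      qed
      have "(\<Sum>j<n. F $$ (i,j) * x $ j) = (\<Sum>j<n. if j = k then c $ i * x $ k else 0)"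
        using i by (intro sum.cong) (auto simp: F_def)
      then have xk: "x $ k = 0" using row[OF i(2)] i c(2) by simp
      have "x $ j = 0" if j: "j < n" for j
      proof (cases "j = k")
        case False
        define a where "a = (if j = i then k else j)"
        have a: "a < n" using i j unfolding a_def by auto
        have "(\<Sum>l<n. F $$ (a,l) * x $ l) = (\<Sum>l<n. if l = j then x $ j else 0)"
          using i j False a xk by (intro sum.cong) (auto simp: F_def a_def)
        then show ?thesis using row[OF a] j by simp
      qed (use xk in simp)
      then have "x = 0\<^sub>v n" using x(1) by (intro eq_vecI) auto
      with x(2) show False ..
    qed
    from det_non_zero_imp_unit[OF F this, of "()"] obtain F' where F': "F' \<in> carrier_mat n n" "F' * F = 1\<^sub>m n" "F * F' = 1\<^sub>m n"
      unfolding Units_def by (auto simp: ring_mat_simps)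
    have "Q (Suc k) (N * F) (F' * M)"
      unfolding Q_def
    proof (intro conjI allI impI)
      show "F' * M * (N * F) = 1\<^sub>m n"
      proof -
        have "F' * M * (N * F) = F' * ((M * N) * F)" using F F' M N by (simp add: assoc_mult_mat[of _ n n _ n _ n])
        then show ?thesis using MN F F' by simp
      qed
      show "N * F * (F' * M) = 1\<^sub>m n"
      proof -
        have "N * F * (F' * M) = N * (F * (F' * M))" by (rule assoc_mult_mat[OF N F, of _ n]) (use F' M in simp)
        also have "F * (F' * M) = (F * F') * M" by (rule assoc_mult_mat[OF F F'(1) M, symmetric])
        finally show ?thesis using NM M F' by simp
      qed
      show "col (N * F) j \<in> W" if j: "j < Suc k" for j
      proof -
        have jn: "j < n" using j i by simp
        have "col (N * F) j = N *\<^sub>v col F j" by (rule col_mult2[OF N F jn])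
        moreover have "col F j = (if j = k then c else unit_vec n j)"
          using j i c(1) by (intro eq_vecI) (auto simp: F_def)
        moreover have "N *\<^sub>v unit_vec n j = col N j" using N jn by (intro eq_vecI) (auto simp: scalar_prod_right_unit)
        ultimately show ?thesis using q j w NMw[OF Wc[OF w]] unfolding c_def by (auto split: if_splits)
      qed
    qed (use F F' M N i in auto)
    with max show False by blast
  qed
  have "k < n"
  proof (rule ccontr)
    assume "\<not> k < n"
    then have cols: "\<And>j. j < n \<Longrightarrow> col N j \<in> W" using q by auto
    have "v \<in> W" if "v \<in> carrier_vec n" for v
      using vsub_mult_mat_vec[OF W N cols, of "M *\<^sub>v v"] NMw[OF that] M that by auto
    with W1 Wc show False by blast
  qed
  moreover have "0 < k"
  proof (rule ccontr)
    assume "\<not> 0 < k"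
    then have "M *\<^sub>v w = 0\<^sub>v n" if "w \<in> W" for w
      using zero[OF that] M by (intro eq_vecI) auto
    then have "w = 0\<^sub>v n" if "w \<in> W" for w
      using NMw[OF Wc[OF that]] that N by (auto intro!: eq_vecI)
    then show False using W W0 unfolding vsub_def by blast
  qed
  ultimately show ?thesis using that[of k N M] q zero by blast
qed

lemma mtr_split:
  assumes "k \<le> n" "A \<in> carrier_mat n n"
  shows "mtr A = (\<Sum>i<k. A $$ (i,i)) + (\<Sum>i<n-k. A $$ (i+k,i+k))"
proof -
  have "mtr A = (\<Sum>i\<in>{..<k} \<union> {k..<n}. A $$ (i,i))"
    unfolding mtr_def using assms by (intro sum.cong) auto
  also have "\<dots> = (\<Sum>i<k. A $$ (i,i)) + (\<Sum>i\<in>{k..<n}. A $$ (i,i))"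
    by (rule sum.union_disjoint) auto
  also have "(\<Sum>i\<in>{k..<n}. A $$ (i,i)) = (\<Sum>i<n-k. A $$ (i+k,i+k))"
    by (rule sum.reindex_bij_witness[of _ "\<lambda>i. i + k" "\<lambda>i. i - k"]) (use assms in auto)
  finally show ?thesis .
qed

section \<open>Decomposition of characters, column orthogonality and restriction\<close>

context fin_group
begin

lemma mrep_conjugate:
  assumes r: "mrep G n \<rho>" and N: "N \<in> carrier_mat n n" and M: "M \<in> carrier_mat n n"
    and MN: "M * N = 1\<^sub>m n" and NM: "N * M = 1\<^sub>m n"
  shows "mrep G n (\<lambda>g. M * \<rho> g * N)" "g \<in> carrier G \<Longrightarrow> mtr (M * \<rho> g * N) = mtr (\<rho> g)"
proof -
  note R = mrepD[OF r]
  show "mrep G n (\<lambda>g. M * \<rho> g * N)"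
    unfolding mrep_def
  proof (intro conjI ballI)
    show "M * \<rho> g * N \<in> carrier_mat n n" if "g \<in> carrier G" for g
      using R(1)[OF that] M N by simp
    show "M * \<rho> \<one> * N = 1\<^sub>m n" using R(2) M MN by simp
    show "M * \<rho> (g \<otimes> h) * N = M * \<rho> g * N * (M * \<rho> h * N)" if gh: "g \<in> carrier G" "h \<in> carrier G" for g h
    proof -
      note c = R(1)[OF gh(1)] R(1)[OF gh(2)]
      have "M * \<rho> g * N * (M * \<rho> h * N) = M * \<rho> g * ((N * M) * (\<rho> h * N))"
        using c M N by (simp add: assoc_mult_mat[of _ n n _ n _ n])
      also have "\<dots> = M * \<rho> (g \<otimes> h) * N"
        unfolding NM R(3)[OF gh] using c M N by (simp add: assoc_mult_mat[of _ n n _ n _ n])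
      finally show ?thesis ..
    qed
  qed
  show "mtr (M * \<rho> g * N) = mtr (\<rho> g)" if g: "g \<in> carrier G"
  proof -
    have "mtr (M * \<rho> g * N) = mtr (N * (M * \<rho> g))"
      by (rule mtr_comm[of _ n n]) (use R(1)[OF g] M N in auto)
    also have "N * (M * \<rho> g) = \<rho> g" using assoc_mult_mat[OF N M R(1)[OF g]] NM R(1)[OF g] by simp
    finally show ?thesis .
  qed
qed

text \<open>In an adapted basis the matrices are block triangular, and the two diagonal blocks are
  representations. Only traces matter, so a submodule and its quotient suffice and no complement is
  constructed.\<close>

lemma reducible_split:
  assumes r: "mrep G n \<rho>" and red: "\<not> irreducible_rep G n \<rho>" and n: "n > 0"
  obtains n1 n2 \<rho>1 \<rho>2 where "n1 < n" "n2 < n" "mrep G n1 \<rho>1" "mrep G n2 \<rho>2"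
    "\<And>g. g \<in> carrier G \<Longrightarrow> mtr (\<rho> g) = mtr (\<rho>1 g) + mtr (\<rho>2 g)"
proof -
  from red r n obtain W where W: "vsub n W" "\<And>g w. g \<in> carrier G \<Longrightarrow> w \<in> W \<Longrightarrow> \<rho> g *\<^sub>v w \<in> W" "W \<noteq> {0\<^sub>v n}" "W \<noteq> carrier_vec n"
    unfolding irreducible_rep_iff[OF is_group] by blast
  obtain k N M where k: "0 < k" "k < n" and N: "N \<in> carrier_mat n n" and M: "M \<in> carrier_mat n n" and MN: "M * N = 1\<^sub>m n" and NM: "N * M = 1\<^sub>m n"
    and col: "\<And>j. j < k \<Longrightarrow> col N j \<in> W" and z: "\<And>w i. w \<in> W \<Longrightarrow> k \<le> i \<Longrightarrow> i < n \<Longrightarrow> (M *\<^sub>v w) $ i = 0"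
    using adapted_basis[OF W(1,3,4)] by metis
  note R = mrepD[OF r]
  define S where "S g = M * \<rho> g * N" for g
  note c = mrep_conjugate[OF r N M MN NM, folded S_def]
  note S = mrepD[OF c(1)]
  have z': "S g $$ (i,j) = 0" if g: "g \<in> carrier G" and j: "j < k" and i: "k \<le> i" "i < n" for g i j
  proof -
    have jn: "j < n" using j k by simp
    have "S g $$ (i,j) = col (S g) j $ i" using S(1)[OF g] i jn by simp
    also have "col (S g) j = (M * \<rho> g) *\<^sub>v col N j"
      unfolding S_def by (rule col_mult2[of _ n n, OF _ N jn]) (use M R(1)[OF g] in simp)
    also have "\<dots> = M *\<^sub>v (\<rho> g *\<^sub>v col N j)"
      by (rule assoc_mult_mat_vec[OF M R(1)[OF g]]) (use N jn in simp)
    also have "\<dots> $ i = 0" by (rule z[OF W(2)[OF g col[OF j]] i])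
    finally show ?thesis .
  qed
  have prod: "S (g \<otimes> h) $$ (i,j) = (\<Sum>l<k. S g $$ (i,l) * S h $$ (l,j)) + (\<Sum>l<n-k. S g $$ (i,l+k) * S h $$ (l+k,j))"
    if "g \<in> carrier G" "h \<in> carrier G" "i < n" "j < n" for g h i j
  proof -
    have "S (g \<otimes> h) $$ (i,j) = (\<Sum>l\<in>{..<k} \<union> {k..<n}. S g $$ (i,l) * S h $$ (l,j))"
      unfolding S(3)[OF that(1,2)] using k
      by (subst index_mult_mat_sum[OF S(1)[OF that(1)] S(1)[OF that(2)] that(3,4)]) (auto intro!: sum.cong)
    also have "\<dots> = (\<Sum>l<k. S g $$ (i,l) * S h $$ (l,j)) + (\<Sum>l\<in>{k..<n}. S g $$ (i,l) * S h $$ (l,j))"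
      by (rule sum.union_disjoint) auto
    also have "(\<Sum>l\<in>{k..<n}. S g $$ (i,l) * S h $$ (l,j)) = (\<Sum>l<n-k. S g $$ (i,l+k) * S h $$ (l+k,j))"
      by (rule sum.reindex_bij_witness[of _ "\<lambda>i. i + k" "\<lambda>i. i - k"]) auto
    finally show ?thesis .
  qed
  define \<rho>1 where "\<rho>1 g = mat k k (\<lambda>ij. S g $$ ij)" for g
  define \<rho>2 where "\<rho>2 g = mat (n-k) (n-k) (\<lambda>(i,j). S g $$ (i+k,j+k))" for g
  have m1: "mrep G k \<rho>1"
    unfolding mrep_def
  proof (intro conjI ballI)
    show "\<rho>1 \<one> = 1\<^sub>m k" unfolding \<rho>1_def S(2) using k by (intro eq_matI) auto
    fix g h assume gh: "g \<in> carrier G" "h \<in> carrier G"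
    show "\<rho>1 (g \<otimes> h) = \<rho>1 g * \<rho>1 h"
    proof (rule eq_matI)
      fix i j assume "i < dim_row (\<rho>1 g * \<rho>1 h)" "j < dim_col (\<rho>1 g * \<rho>1 h)"
      then have ij: "i < k" "j < k" by (auto simp: \<rho>1_def)
      have "\<rho>1 (g \<otimes> h) $$ (i,j) = (\<Sum>l<k. S g $$ (i,l) * S h $$ (l,j))"
        using ij k prod[OF gh, of i j] z'[OF gh(2) ij(2)] by (simp add: \<rho>1_def)
      also have "\<dots> = (\<rho>1 g * \<rho>1 h) $$ (i,j)"
        using ij by (subst index_mult_mat_sum[of _ k k _ k]) (auto simp: \<rho>1_def)
      finally show "\<rho>1 (g \<otimes> h) $$ (i,j) = (\<rho>1 g * \<rho>1 h) $$ (i,j)" .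
    qed (auto simp: \<rho>1_def)
  qed (auto simp: \<rho>1_def)
  have m2: "mrep G (n-k) \<rho>2"
    unfolding mrep_def
  proof (intro conjI ballI)
    show "\<rho>2 \<one> = 1\<^sub>m (n-k)" unfolding \<rho>2_def S(2) using k by (intro eq_matI) auto
    fix g h assume gh: "g \<in> carrier G" "h \<in> carrier G"
    show "\<rho>2 (g \<otimes> h) = \<rho>2 g * \<rho>2 h"
    proof (rule eq_matI)
      fix i j assume "i < dim_row (\<rho>2 g * \<rho>2 h)" "j < dim_col (\<rho>2 g * \<rho>2 h)"
      then have ij: "i < n-k" "j < n-k" by (auto simp: \<rho>2_def)
      have "\<rho>2 (g \<otimes> h) $$ (i,j) = (\<Sum>l<n-k. S g $$ (i+k,l+k) * S h $$ (l+k,j+k))"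
        using ij k prod[OF gh, of "i+k" "j+k"] z'[OF gh(1), of _ "i+k"] by (simp add: \<rho>2_def)
      also have "\<dots> = (\<rho>2 g * \<rho>2 h) $$ (i,j)"
        using ij by (subst index_mult_mat_sum[of _ "n-k" "n-k" _ "n-k"]) (auto simp: \<rho>2_def)
      finally show "\<rho>2 (g \<otimes> h) $$ (i,j) = (\<rho>2 g * \<rho>2 h) $$ (i,j)" .
    qed (auto simp: \<rho>2_def)
  qed (auto simp: \<rho>2_def)
  have "mtr (\<rho> g) = mtr (\<rho>1 g) + mtr (\<rho>2 g)" if g: "g \<in> carrier G" for g
    unfolding c(2)[OF g, symmetric]
    by (subst mtr_split[OF _ S(1)[OF g], of k]) (use k in \<open>simp_all add: mtr_def \<rho>1_def \<rho>2_def\<close>)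
  with m1 m2 k that[of k "n-k" \<rho>1 \<rho>2] show ?thesis by simp
qed

theorem mrep_decomposition:
  assumes "mrep G n \<rho>"
  shows "\<exists>xs. set xs \<subseteq> Irr G \<and> (\<forall>g\<in>carrier G. mtr (\<rho> g) = (\<Sum>\<xi>\<leftarrow>xs. \<xi> g))"
  using assms
proof (induction n arbitrary: \<rho> rule: less_induct)
  case (less n)
  consider "n = 0" | "irreducible_rep G n \<rho>" | "n > 0" "\<not> irreducible_rep G n \<rho>" by blast
  then show ?case
  proof cases
    case 1
    then have "mtr (\<rho> g) = 0" if "g \<in> carrier G" for g
      using mrepD(1)[OF less.prems that] by (simp add: mtr_def)
    then show ?thesis by (intro exI[of _ "[]"]) simp
  next
    case 2
    then show ?thesis
      using IrrI[OF 2] by (intro exI[of _ "[rep_character G \<rho>]"]) (simp add: rep_character_def sum_list_diag_mat)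
  next
    case 3
    obtain n1 n2 \<rho>1 \<rho>2 where s: "n1 < n" "n2 < n" "mrep G n1 \<rho>1" "mrep G n2 \<rho>2"
      "\<And>g. g \<in> carrier G \<Longrightarrow> mtr (\<rho> g) = mtr (\<rho>1 g) + mtr (\<rho>2 g)"
      using reducible_split[OF less.prems 3(2,1)] by metis
    from less.IH[OF s(1,3)] obtain xs where xs: "set xs \<subseteq> Irr G" "\<forall>g\<in>carrier G. mtr (\<rho>1 g) = (\<Sum>\<xi>\<leftarrow>xs. \<xi> g)" by blast
    from less.IH[OF s(2,4)] obtain ys where ys: "set ys \<subseteq> Irr G" "\<forall>g\<in>carrier G. mtr (\<rho>2 g) = (\<Sum>\<xi>\<leftarrow>ys. \<xi> g)" by blast
    show ?thesis by (intro exI[of _ "xs @ ys"]) (use s(5) xs ys in auto)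
  qed
qed

lemma regular_rep:
  obtains \<rho> where "mrep G (card (carrier G)) \<rho>"
    "\<And>g. g \<in> carrier G \<Longrightarrow> mtr (\<rho> g) = (if g = \<one> then of_nat (card (carrier G)) else 0)"
proof -
  let ?N = "card (carrier G)"
  obtain e where e: "bij_betw e {..<?N} (carrier G)"
    using ex_bij_betw_nat_finite[OF fin] by (auto simp: atLeast0LessThan)
  have ec: "e i \<in> carrier G" if "i < ?N" for i using e that unfolding bij_betw_def by auto
  have ei: "e i = e j \<longleftrightarrow> i = j" if "i < ?N" "j < ?N" for i j using e that unfolding bij_betw_def inj_on_def by auto
  define \<rho> where "\<rho> g = mat ?N ?N (\<lambda>(i,j). if e i = g \<otimes> e j then 1 else 0 :: complex)" for g
  have c: "\<rho> g \<in> carrier_mat ?N ?N" for g unfolding \<rho>_def by simp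
  have "mrep G ?N \<rho>"
    unfolding mrep_def
  proof (intro conjI ballI)
    show "\<rho> \<one> = 1\<^sub>m ?N" by (rule eq_matI) (auto simp: \<rho>_def ec ei)
    fix g h assume gh: "g \<in> carrier G" "h \<in> carrier G"
    show "\<rho> (g \<otimes> h) = \<rho> g * \<rho> h"
    proof (rule eq_matI)
      fix i j assume "i < dim_row (\<rho> g * \<rho> h)" "j < dim_col (\<rho> g * \<rho> h)"
      then have ij: "i < ?N" "j < ?N" by (simp_all add: \<rho>_def)
      obtain k where k: "k < ?N" "e k = h \<otimes> e j" using e gh ec[OF ij(2)] unfolding bij_betw_def by (metis imageE lessThan_iff m_closed)
      have "(\<rho> g * \<rho> h) $$ (i,j) = (\<Sum>l<?N. \<rho> g $$ (i,l) * \<rho> h $$ (l,j))"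
        by (rule index_mult_mat_sum[OF c c ij])
      also have "\<dots> = (\<Sum>l<?N. if l = k then (if e i = g \<otimes> e k then 1 else 0) else 0)"
        using ij k by (intro sum.cong refl) (auto simp: \<rho>_def ei[OF _ k(1)] simp flip: k(2))
      also have "\<dots> = (if e i = g \<otimes> (h \<otimes> e j) then 1 else 0)" using k by simp
      finally show "\<rho> (g \<otimes> h) $$ (i,j) = (\<rho> g * \<rho> h) $$ (i,j)"
        using ij gh ec by (simp add: \<rho>_def m_assoc)
    qed (auto simp: \<rho>_def)
  qed (rule c)
  moreover have "mtr (\<rho> g) = (if g = \<one> then of_nat ?N else 0)" if g: "g \<in> carrier G" for g
  proof -
    have "e i = g \<otimes> e i \<longleftrightarrow> g = \<one>" if "i < ?N" for i using g ec[OF that] by (metis l_one one_closed right_cancel)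
    then have "mtr (\<rho> g) = (\<Sum>i<?N. if g = \<one> then 1 else 0)"
      unfolding mtr_def \<rho>_def by (intro sum.cong) auto
    then show ?thesis by simp
  qed
  ultimately show ?thesis using that by blast
qed

text \<open>The inverse takes the place of complex conjugation, which makes the pairing bilinear and
  symmetric. For characters it agrees with the usual inner product, and unitary representations do
  not enter.\<close>

definition ip :: "('a \<Rightarrow> complex) \<Rightarrow> ('a \<Rightarrow> complex) \<Rightarrow> complex" where
  "ip f h = (\<Sum>g\<in>carrier G. f g * h (inv g)) / of_nat (card (carrier G))"

lemma card_pos [simp]: "card (carrier G) > 0" "card (carrier G) \<noteq> 0" "carrier G \<noteq> {}"
  using fin card_gt_0_iff one_closed by fastforce+

lemma ip_cong: "(\<And>g. g \<in> carrier G \<Longrightarrow> f g = f' g) \<Longrightarrow> (\<And>g. g \<in> carrier G \<Longrightarrow> h g = h' g) \<Longrightarrow> ip f h = ip f' h'"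
  unfolding ip_def by simp

lemma ip_commute: "ip f h = ip h f"
  unfolding ip_def
  using sum.reindex_bij_betw[OF bij_inv, of "\<lambda>g. f g * h (inv g)"] by (simp add: mult.commute)

lemma ip_Irr: "\<chi> \<in> Irr G \<Longrightarrow> \<xi> \<in> Irr G \<Longrightarrow> ip \<chi> \<xi> = (if \<chi> = \<xi> then 1 else 0)"
  using Irr_convolution[of \<chi> \<xi> \<one> \<one>] Irr_one_nz[of \<chi>] unfolding ip_def by auto

lemma ip_sum_left: "ip (\<lambda>g. \<Sum>x\<in>X. c x * F x g) h = (\<Sum>x\<in>X. c x * ip (F x) h)"
proof -
  have "(\<Sum>g\<in>carrier G. (\<Sum>x\<in>X. c x * F x g) * h (inv g)) = (\<Sum>x\<in>X. c x * (\<Sum>g\<in>carrier G. F x g * h (inv g)))"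
    unfolding sum_distrib_left sum_distrib_right by (subst sum.swap) (simp add: mult.assoc)
  then show ?thesis unfolding ip_def by (simp flip: sum_divide_distrib)
qed

lemma ip_sum_right: "ip h (\<lambda>g. \<Sum>x\<in>X. c x * F x g) = (\<Sum>x\<in>X. c x * ip h (F x))"
  using ip_sum_left[where X=X and c=c and F=F and h=h] by (simp add: ip_commute)

lemma ip_sum_list: "(\<And>g. g \<in> carrier G \<Longrightarrow> f g = (\<Sum>\<xi>\<leftarrow>xs. \<xi> g)) \<Longrightarrow> set xs \<subseteq> Irr G \<Longrightarrow> \<xi> \<in> Irr G \<Longrightarrow>
   ip f \<xi> = of_nat (count_list xs \<xi>)"
proof (induction xs arbitrary: f)
  case (Cons x xs)
  have "ip f \<xi> = ip (\<lambda>g. x g + (\<Sum>\<xi>\<leftarrow>xs. \<xi> g)) \<xi>" by (rule ip_cong) (use Cons.prems in auto)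
  also have "\<dots> = ip x \<xi> + ip (\<lambda>g. \<Sum>\<xi>\<leftarrow>xs. \<xi> g) \<xi>"
    unfolding ip_def by (simp add: distrib_right sum.distrib add_divide_distrib)
  finally show ?case using Cons.IH[of "\<lambda>g. \<Sum>\<xi>\<leftarrow>xs. \<xi> g"] Cons.prems by (simp add: ip_Irr)
qed (simp add: ip_def)

lemma sum_list_count:
  assumes "finite A" "set xs \<subseteq> A"
  shows "(\<Sum>x\<leftarrow>xs. f x) = (\<Sum>x\<in>A. of_nat (count_list xs x) * f x :: complex)"
  using assms
proof (induction xs)
  case (Cons a xs)
  have "(\<Sum>x\<in>A. of_nat (count_list (a # xs) x) * f x) = (\<Sum>x\<in>A. of_nat (count_list xs x) * f x + (if x = a then f a else 0))"
    by (rule sum.cong) (auto simp: distrib_right)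
  then show ?case using Cons by (simp add: sum.distrib)
qed simp

text \<open>Pairing with the regular character, which is supported at the identity, shows that each
  irreducible character occurs in it with multiplicity equal to its degree. Hence all of them appear
  in one finite list, and the second claim is the resulting decomposition.\<close>

lemma finite_Irr [simp]: "finite (Irr G)"
  and sum_Irr_regular: "g \<in> carrier G \<Longrightarrow> (\<Sum>\<chi>\<in>Irr G. \<chi> \<one> * \<chi> g) = (if g = \<one> then of_nat (card (carrier G)) else 0)"
proof -
  obtain \<rho> where r: "mrep G (card (carrier G)) \<rho>"
    "\<And>g. g \<in> carrier G \<Longrightarrow> mtr (\<rho> g) = (if g = \<one> then of_nat (card (carrier G)) else 0)" using regular_rep by metis
  obtain xs where xs: "set xs \<subseteq> Irr G" "\<And>g. g \<in> carrier G \<Longrightarrow> mtr (\<rho> g) = (\<Sum>\<xi>\<leftarrow>xs. \<xi> g)"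
    using mrep_decomposition[OF r(1)] by blast
  have c: "of_nat (count_list xs \<xi>) = \<xi> \<one>" if "\<xi> \<in> Irr G" for \<xi>
  proof -
    have "of_nat (count_list xs \<xi>) = ip (\<lambda>g. mtr (\<rho> g)) \<xi>" using ip_sum_list[OF xs(2) xs(1) that] by simp
    also have "\<dots> = (\<Sum>g\<in>carrier G. if g = \<one> then of_nat (card (carrier G)) * \<xi> \<one> else 0) / of_nat (card (carrier G))"
      unfolding ip_def by (rule arg_cong[where f="\<lambda>x. x / _"], rule sum.cong) (auto simp: r(2))
    also have "\<dots> = \<xi> \<one>" by simp
    finally show ?thesis .
  qed
  have "\<xi> \<in> set xs" if "\<xi> \<in> Irr G" for \<xi>
    using c[OF that] Irr_one_nz[OF that] by (metis count_notin of_nat_0)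
  then show f: "finite (Irr G)" using finite_subset[of "Irr G" "set xs"] by blast
  show "(\<Sum>\<chi>\<in>Irr G. \<chi> \<one> * \<chi> g) = (if g = \<one> then of_nat (card (carrier G)) else 0)" if g: "g \<in> carrier G"
    using r(2)[OF g] xs(2)[OF g] sum_list_count[OF f xs(1), of "\<lambda>\<xi>. \<xi> g"] c by simp
qed

lemma mrep_multiplicities:
  assumes "mrep G n \<rho>"
  obtains m :: "('a \<Rightarrow> complex) \<Rightarrow> nat" where "\<And>\<xi>. \<xi> \<in> Irr G \<Longrightarrow> ip (\<lambda>g. mtr (\<rho> g)) \<xi> = of_nat (m \<xi>)"
    "\<And>g. g \<in> carrier G \<Longrightarrow> mtr (\<rho> g) = (\<Sum>\<xi>\<in>Irr G. of_nat (m \<xi>) * \<xi> g)"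
proof -
  obtain xs where xs: "set xs \<subseteq> Irr G" "\<And>g. g \<in> carrier G \<Longrightarrow> mtr (\<rho> g) = (\<Sum>\<xi>\<leftarrow>xs. \<xi> g)"
    using mrep_decomposition[OF assms] by blast
  show ?thesis
    by (rule that[of "count_list xs"]) (use ip_sum_list[OF xs(2) xs(1)] sum_list_count[OF finite_Irr xs(1)] xs(2) in auto)
qed

text \<open>Averaging over the conjugates of the inverse of y rewrites the products of values
  through the regular character, which detects when x times such a conjugate is trivial. This
  bypasses the equality of the numbers of classes and of irreducible characters.\<close>

theorem column_orthogonality:
  assumes x: "x \<in> carrier G" and y: "y \<in> carrier G"
  shows "(\<Sum>\<chi>\<in>Irr G. \<chi> x * \<chi> (inv y)) = of_nat (card {h \<in> carrier G. h \<otimes> y \<otimes> inv h = x})"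
proof -
  let ?N = "of_nat (card (carrier G)) :: complex"
  have eq: "x \<otimes> (h \<otimes> inv y \<otimes> inv h) = \<one> \<longleftrightarrow> h \<otimes> y \<otimes> inv h = x" if "h \<in> carrier G" for h
  proof -
    have "h \<otimes> inv y \<otimes> inv h = inv (h \<otimes> y \<otimes> inv h)" using that y by (simp add: inv_mult_group m_assoc)
    then show ?thesis using that x y by (metis inv_closed inv_equality inv_inv m_closed r_inv)
  qed
  have "?N * (\<Sum>\<chi>\<in>Irr G. \<chi> x * \<chi> (inv y)) = (\<Sum>\<chi>\<in>Irr G. \<chi> \<one> * (\<Sum>h\<in>carrier G. \<chi> (x \<otimes> (h \<otimes> inv y \<otimes> inv h))))"
    unfolding sum_distrib_left[of ?N]
    by (rule sum.cong[OF refl]) (simp add: Irr_average x y Irr_one_nz)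
  also have "\<dots> = (\<Sum>h\<in>carrier G. \<Sum>\<chi>\<in>Irr G. \<chi> \<one> * \<chi> (x \<otimes> (h \<otimes> inv y \<otimes> inv h)))"
    unfolding sum_distrib_left by (rule sum.swap)
  also have "\<dots> = (\<Sum>h\<in>carrier G. if h \<otimes> y \<otimes> inv h = x then ?N else 0)"
    by (rule sum.cong[OF refl]) (simp add: sum_Irr_regular x y eq)
  also have "\<dots> = ?N * of_nat (card {h \<in> carrier G. h \<otimes> y \<otimes> inv h = x})"
    by (simp add: sum.If_cases Int_def)
  finally show ?thesis by simp
qed

text \<open>The squares of the multiplicities add up to 1, so a single constituent occurs, once.
  Duals, twists by automorphisms and linear characters are recognised as irreducible by this
  criterion rather than by inspecting subspaces.\<close>

lemma norm_one_Irr: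
  assumes r: "mrep G n \<rho>" and one: "ip (\<lambda>g. mtr (\<rho> g)) (\<lambda>g. mtr (\<rho> g)) = 1"
  shows "(\<lambda>g\<in>carrier G. mtr (\<rho> g)) \<in> Irr G"
proof -
  obtain m :: "('a \<Rightarrow> complex) \<Rightarrow> nat" where m: "\<And>\<xi>. \<xi> \<in> Irr G \<Longrightarrow> ip (\<lambda>g. mtr (\<rho> g)) \<xi> = of_nat (m \<xi>)"
    "\<And>g. g \<in> carrier G \<Longrightarrow> mtr (\<rho> g) = (\<Sum>\<xi>\<in>Irr G. of_nat (m \<xi>) * \<xi> g)"
    using mrep_multiplicities[OF r] by metis
  have "1 = ip (\<lambda>g. mtr (\<rho> g)) (\<lambda>g. \<Sum>\<xi>\<in>Irr G. of_nat (m \<xi>) * \<xi> g)"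
    unfolding one[symmetric] by (rule ip_cong) (use m(2) in auto)
  also have "\<dots> = of_nat (\<Sum>\<xi>\<in>Irr G. m \<xi> * m \<xi>)" unfolding ip_sum_right by (simp add: m(1))
  finally have s: "(\<Sum>\<xi>\<in>Irr G. m \<xi> * m \<xi>) = 1" by (metis of_nat_1 of_nat_eq_iff)
  then obtain \<chi> where x: "\<chi> \<in> Irr G" "m \<chi> > 0" by (metis (no_types, lifting) gr0I mult_0 sum.neutral zero_neq_one)
  have split: "m \<chi> * m \<chi> + (\<Sum>\<xi>\<in>Irr G - {\<chi>}. m \<xi> * m \<xi>) = 1" using s x(1) by (simp add: sum.remove)
  moreover have "m \<chi> * m \<chi> \<ge> 1" using x(2) by simp
  ultimately have "m \<chi> * m \<chi> = 1" "(\<Sum>\<xi>\<in>Irr G - {\<chi>}. m \<xi> * m \<xi>) = 0" by linarith+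
  then have "m \<chi> = 1" "\<forall>\<xi>\<in>Irr G - {\<chi>}. m \<xi> = 0" by auto
  then have "mtr (\<rho> g) = \<chi> g" if "g \<in> carrier G" for g
    using m(2)[OF that] x(1) by (simp add: sum.remove)
  moreover have "\<chi> \<in> extensional (carrier G)" using x(1) unfolding Irr_def rep_character_def by auto
  ultimately have "(\<lambda>g\<in>carrier G. mtr (\<rho> g)) = \<chi>" by (intro extensionalityI[of _ "carrier G"]) auto
  with x show ?thesis by simp
qed

lemma Irr_dual:
  assumes c: "\<chi> \<in> Irr G"
  shows "(\<lambda>g\<in>carrier G. \<chi> (inv g)) \<in> Irr G"
proof -
  obtain n \<rho> where r: "mrep G n \<rho>" "\<And>g. g \<in> carrier G \<Longrightarrow> \<chi> g = mtr (\<rho> g)" using IrrE[OF c] by metis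
  note R = mrepD[OF r(1)]
  let ?d = "\<lambda>g. transpose_mat (\<rho> (inv g))"
  have d: "mrep G n ?d"
    unfolding mrep_def
  proof (intro conjI ballI)
    show "?d (g \<otimes> h) = ?d g * ?d h" if "g \<in> carrier G" "h \<in> carrier G" for g h
      using that R(1) by (simp add: inv_mult_group R(3) transpose_mult[of _ n n _ n])
  qed (use R in auto)
  have tr: "mtr (?d g) = \<chi> (inv g)" if "g \<in> carrier G" for g
    using R(1)[of "inv g"] that by (auto simp: r(2) mtr_def)
  have "mtr (?d g) * mtr (?d (inv g)) = \<chi> g * \<chi> (inv g)" if "g \<in> carrier G" for g
    using tr[OF that] tr[of "inv g"] that by simp
  then have "ip (\<lambda>g. mtr (?d g)) (\<lambda>g. mtr (?d g)) = ip \<chi> \<chi>"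
    unfolding ip_def by (intro arg_cong[where f="\<lambda>x. x / _"] sum.cong refl) blast
  then have "(\<lambda>g\<in>carrier G. mtr (?d g)) \<in> Irr G" by (intro norm_one_Irr[OF d]) (simp add: ip_Irr c)
  also have "(\<lambda>g\<in>carrier G. mtr (?d g)) = (\<lambda>g\<in>carrier G. \<chi> (inv g))" by (rule restrict_ext) (rule tr)
  finally show ?thesis .
qed

lemma Irr_automorphism:
  assumes c: "\<chi> \<in> Irr G" and f: "bij_betw \<phi> (carrier G) (carrier G)"
    and h: "\<And>g h. g \<in> carrier G \<Longrightarrow> h \<in> carrier G \<Longrightarrow> \<phi> (g \<otimes> h) = \<phi> g \<otimes> \<phi> h"
  shows "(\<lambda>g\<in>carrier G. \<chi> (\<phi> g)) \<in> Irr G"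
proof -
  obtain n \<rho> where r: "mrep G n \<rho>" "\<And>g. g \<in> carrier G \<Longrightarrow> \<chi> g = mtr (\<rho> g)" using IrrE[OF c] by metis
  note R = mrepD[OF r(1)]
  have fc: "\<phi> g \<in> carrier G" if "g \<in> carrier G" for g using f that unfolding bij_betw_def by auto
  have f1: "\<phi> \<one> = \<one>" using h[of \<one> \<one>] fc[of \<one>] by simp
  have finv: "\<phi> (inv g) = inv (\<phi> g)" if "g \<in> carrier G" for g
    using h[of "inv g" g] f1 fc that by (metis inv_closed inv_equality l_inv)
  have d: "mrep G n (\<lambda>g. \<rho> (\<phi> g))" unfolding mrep_def by (auto simp: R fc h f1)
  have "ip (\<lambda>g. mtr (\<rho> (\<phi> g))) (\<lambda>g. mtr (\<rho> (\<phi> g))) = ip \<chi> \<chi>"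
    unfolding ip_def sum.reindex_bij_betw[OF f, of "\<lambda>g. \<chi> g * \<chi> (inv g)", symmetric] by (simp add: r(2) fc finv)
  then have "(\<lambda>g\<in>carrier G. mtr (\<rho> (\<phi> g))) \<in> Irr G" by (intro norm_one_Irr[OF d]) (simp add: ip_Irr c)
  also have "(\<lambda>g\<in>carrier G. mtr (\<rho> (\<phi> g))) = (\<lambda>g\<in>carrier G. \<chi> (\<phi> g))" by (rule restrict_ext) (simp add: r(2) fc)
  finally show ?thesis .
qed

lemma linear_Irr:
  assumes h: "\<And>g h. g \<in> carrier G \<Longrightarrow> h \<in> carrier G \<Longrightarrow> f (g \<otimes> h) = f g * (f h :: complex)" and one: "f \<one> = 1"
  shows "(\<lambda>g\<in>carrier G. f g) \<in> Irr G"
proof -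
  let ?r = "\<lambda>g. mat 1 1 (\<lambda>ij. f g)"
  have tr: "mtr (?r g) = f g" for g by (simp add: mtr_def)
  have m: "mrep G 1 ?r"
    unfolding mrep_def by (auto intro!: eq_matI simp: one h scalar_prod_def)
  have "f g * f (inv g) = 1" if "g \<in> carrier G" for g using h[of g "inv g"] that one by simp
  then have "ip (\<lambda>g. mtr (?r g)) (\<lambda>g. mtr (?r g)) = 1" unfolding tr ip_def by simp
  from norm_one_Irr[OF m this] show ?thesis unfolding tr .
qed

lemma ex_multiplicities:
  assumes "mrep G n \<rho>"
  shows "\<exists>m :: ('a \<Rightarrow> complex) \<Rightarrow> nat. (\<forall>\<xi>\<in>Irr G. ip (\<lambda>g. mtr (\<rho> g)) \<xi> = of_nat (m \<xi>)) \<and>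
    (\<forall>g\<in>carrier G. mtr (\<rho> g) = (\<Sum>\<xi>\<in>Irr G. of_nat (m \<xi>) * \<xi> g))"
proof (rule mrep_multiplicities[OF assms])
  fix m :: "('a \<Rightarrow> complex) \<Rightarrow> nat"
  assume "\<And>\<xi>. \<xi> \<in> Irr G \<Longrightarrow> ip (\<lambda>g. mtr (\<rho> g)) \<xi> = of_nat (m \<xi>)"
    "\<And>g. g \<in> carrier G \<Longrightarrow> mtr (\<rho> g) = (\<Sum>\<xi>\<in>Irr G. of_nat (m \<xi>) * \<xi> g)"
  then show ?thesis by (intro exI[of _ m]) simp
qed

lemma fin_group_subgroup:
  assumes "subgroup H G"
  shows "fin_group (G\<lparr>carrier := H\<rparr>)"
proof -
  interpret H: group "G\<lparr>carrier := H\<rparr>" by (rule subgroup.subgroup_is_group[OF assms is_group])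
  show ?thesis by unfold_locales (use subgroup.subset[OF assms] in \<open>auto intro: finite_subset[OF _ fin]\<close>)
qed

lemma mrep_subgroup:
  assumes "subgroup H G" "mrep G n \<rho>"
  shows "mrep (G\<lparr>carrier := H\<rparr>) n \<rho>"
  using assms subgroup.subset[OF assms(1)] unfolding mrep_def by auto

lemma inv_subgroup: "subgroup H G \<Longrightarrow> h \<in> H \<Longrightarrow> inv\<^bsub>G\<lparr>carrier := H\<rparr>\<^esub> h = inv h"
  by (rule m_inv_consistent)

lemma ip_subgroup:
  assumes "subgroup H G"
  shows "fin_group.ip (G\<lparr>carrier := H\<rparr>) f h = (\<Sum>g\<in>H. f g * h (inv g)) / of_nat (card H)"
proof -
  interpret H: fin_group "G\<lparr>carrier := H\<rparr>" by (rule fin_group_subgroup[OF assms])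
  show ?thesis unfolding H.ip_def using inv_subgroup[OF assms] by simp
qed

lemma restrict_multiplicity:
  assumes H: "subgroup H G" and c: "\<chi> \<in> Irr G"
  shows "\<exists>m :: ('a \<Rightarrow> complex) \<Rightarrow> nat.
    (\<forall>\<xi>\<in>Irr (G\<lparr>carrier := H\<rparr>). (\<Sum>g\<in>H. \<chi> g * \<xi> (inv g)) / of_nat (card H) = of_nat (m \<xi>)) \<and>
    (\<forall>g\<in>H. \<chi> g = (\<Sum>\<xi>\<in>Irr (G\<lparr>carrier := H\<rparr>). of_nat (m \<xi>) * \<xi> g))"
proof -
  interpret H: fin_group "G\<lparr>carrier := H\<rparr>" by (rule fin_group_subgroup[OF H])
  obtain n \<rho> where r: "mrep G n \<rho>" "\<And>g. g \<in> carrier G \<Longrightarrow> \<chi> g = mtr (\<rho> g)" using IrrE[OF c] by metis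
  obtain m :: "('a \<Rightarrow> complex) \<Rightarrow> nat" where m: "\<And>\<xi>. \<xi> \<in> Irr (G\<lparr>carrier := H\<rparr>) \<Longrightarrow> H.ip (\<lambda>g. mtr (\<rho> g)) \<xi> = of_nat (m \<xi>)"
    "\<And>g. g \<in> carrier (G\<lparr>carrier := H\<rparr>) \<Longrightarrow> mtr (\<rho> g) = (\<Sum>\<xi>\<in>Irr (G\<lparr>carrier := H\<rparr>). of_nat (m \<xi>) * \<xi> g)"
    using H.ex_multiplicities[OF mrep_subgroup[OF H r(1)]] by blast
  have e: "mtr (\<rho> g) = \<chi> g" if "g \<in> H" for g using r(2) that subgroup.subset[OF H] by auto
  have "(\<Sum>g\<in>H. \<chi> g * \<xi> (inv g)) / of_nat (card H) = of_nat (m \<xi>)" if "\<xi> \<in> Irr (G\<lparr>carrier := H\<rparr>)" for \<xi>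
    using m(1)[OF that] e unfolding ip_subgroup[OF H] by simp
  then show ?thesis using m(2) e by (intro exI[of _ m]) simp
qed

text \<open>For f an irreducible character of H this is the degree of the induced character, written
  by Frobenius reciprocity as a sum over its constituents; it is derived from the regular character
  of G.\<close>

lemma sum_Irr_restriction:
  assumes H: "subgroup H G"
  shows "(\<Sum>\<chi>\<in>Irr G. (\<Sum>g\<in>H. \<chi> g * f (inv g)) / of_nat (card H) * \<chi> \<one>) =
    of_nat (card (carrier G)) / of_nat (card H) * f \<one>"
proof -
  have Hc: "g \<in> carrier G" if "g \<in> H" for g using subgroup.subset[OF H] that by auto
  have fH: "finite H" by (rule finite_subset[OF subgroup.subset[OF H] fin])
  have "(\<Sum>\<chi>\<in>Irr G. (\<Sum>g\<in>H. \<chi> g * f (inv g)) / of_nat (card H) * \<chi> \<one>) =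
    (\<Sum>\<chi>\<in>Irr G. \<Sum>g\<in>H. f (inv g) / of_nat (card H) * (\<chi> \<one> * \<chi> g))"
    by (simp add: sum_divide_distrib sum_distrib_right sum_distrib_left mult_ac)
  also have "\<dots> = (\<Sum>g\<in>H. f (inv g) / of_nat (card H) * (\<Sum>\<chi>\<in>Irr G. \<chi> \<one> * \<chi> g))"
    by (subst sum.swap) (simp add: sum_distrib_left)
  also have "\<dots> = (\<Sum>g\<in>H. if g = \<one> then f \<one> / of_nat (card H) * of_nat (card (carrier G)) else 0)"
    by (rule sum.cong[OF refl]) (simp add: sum_Irr_regular Hc)
  also have "\<dots> = of_nat (card (carrier G)) / of_nat (card H) * f \<one>"
    using subgroup.one_closed[OF H] fH by simp
  finally show ?thesis .
qed

end

section \<open>Clifford theory for split cyclic extensions\<close>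

lemma smult_smult_mat': "a \<cdot>\<^sub>m (b \<cdot>\<^sub>m A) = (a * b) \<cdot>\<^sub>m (A :: complex mat)"
  by (rule eq_matI) auto

lemma complex_root_exists:
  assumes "c \<noteq> 0" "e > 0"
  obtains z :: complex where "z \<noteq> 0" "z ^ e = c"
proof -
  let ?z = "rcis (root e (cmod c)) (Arg c / of_nat e)"
  have "?z ^ e = rcis (root e (cmod c) ^ e) (of_nat e * (Arg c / of_nat e))" by (rule DeMoivre2)
  also have "\<dots> = rcis (cmod c) (Arg c)" using assms by simp
  also have "\<dots> = c" by (rule rcis_cmod_Arg)
  finally show ?thesis using that[of ?z] assms by (metis power_0_left zero_less_iff_neq_zero)
qed

locale cyclic_extension = fin_group G for G (structure) +
  fixes S and s and d :: nat
  assumes S: "subgroup S G" and s_closed: "s \<in> carrier G" and s_norm: "\<And>x. x \<in> S \<Longrightarrow> s \<otimes> x \<otimes> inv s \<in> S"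
    and d_pos: "d > 0" and s_pow: "s [^] d = \<one>"
    and decompose: "\<And>g. g \<in> carrier G \<Longrightarrow> \<exists>x\<in>S. \<exists>i<d. g = x \<otimes> s [^] i"
    and unique: "\<And>x y i j. x \<in> S \<Longrightarrow> y \<in> S \<Longrightarrow> i < d \<Longrightarrow> j < d \<Longrightarrow> x \<otimes> s [^] i = y \<otimes> s [^] j \<Longrightarrow> x = y \<and> i = j"
begin

abbreviation "SG \<equiv> G\<lparr>carrier := S\<rparr>"

sublocale SG: fin_group SG by (rule fin_group_subgroup[OF S])

lemma S_carrier: "x \<in> S \<Longrightarrow> x \<in> carrier G"
  using subgroup.subset[OF S] by auto

lemmas S_mult = subgroup.m_closed[OF S]
lemmas S_inv = subgroup.m_inv_closed[OF S]
lemmas S_one = subgroup.one_closed[OF S]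

definition sc :: "nat \<Rightarrow> 'a \<Rightarrow> 'a" where
  "sc i x = s [^] i \<otimes> x \<otimes> inv (s [^] i)"

lemma sp_closed [simp]: "s [^] (i::nat) \<in> carrier G" using s_closed by simp

lemma sc_0: "x \<in> S \<Longrightarrow> sc 0 x = x" by (simp add: sc_def S_carrier)

lemma sc_add: "x \<in> S \<Longrightarrow> sc (i + j) x = sc i (sc j x)"
  by (simp add: sc_def S_carrier s_closed nat_pow_mult[symmetric] inv_mult_group m_assoc)

lemma sc_closed: "x \<in> S \<Longrightarrow> sc i x \<in> S"
proof (induction i)
  case (Suc i)
  have "sc (Suc i) x = s \<otimes> sc i x \<otimes> inv s"
    using sc_add[OF Suc.prems, of 1 i] s_closed sc_def[of 1 "sc i x"] by simp
  then show ?case using s_norm[OF Suc.IH[OF Suc.prems]] by simp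
qed (simp add: sc_0)

lemma sc_mult: "x \<in> S \<Longrightarrow> y \<in> S \<Longrightarrow> sc i (x \<otimes> y) = sc i x \<otimes> sc i y"
  by (simp add: sc_def S_carrier m_assoc inv_solve_left)

lemma sc_d: "x \<in> S \<Longrightarrow> sc d x = x" by (simp add: sc_def S_carrier s_pow)

lemma sc_mult_d: "x \<in> S \<Longrightarrow> sc (d * k) x = x"
  by (induction k) (simp_all add: sc_0 sc_add sc_d sc_closed)

lemma sc_bij: "bij_betw (sc i) S S"
proof (rule bij_betw_byWitness[of _ "sc ((d - 1) * i)"])
  have e: "(d - 1) * i + i = d * i" "i + (d - 1) * i = d * i" using d_pos by (cases d; simp)+
  show "\<forall>x\<in>S. sc ((d - 1) * i) (sc i x) = x" "\<forall>x\<in>S. sc i (sc ((d - 1) * i) x) = x"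
    using sc_add e sc_mult_d by (metis, metis)
qed (auto simp: sc_closed)

lemma sp_mult: "x \<in> S \<Longrightarrow> s [^] i \<otimes> x = sc i x \<otimes> s [^] i"
  by (simp add: sc_def S_carrier m_assoc)

lemma sp_mod: "s [^] (i mod d) = s [^] (i::nat)"
proof -
  have "s [^] (d * (i div d) + i mod d) = s [^] (i mod d)"
    unfolding nat_pow_mult[OF s_closed, symmetric] nat_pow_pow[OF s_closed, symmetric] s_pow by (simp add: nat_pow_one)
  then show ?thesis by simp
qed

lemma prod_form: "x \<in> S \<Longrightarrow> y \<in> S \<Longrightarrow> (x \<otimes> s [^] i) \<otimes> (y \<otimes> s [^] j) = (x \<otimes> sc i y) \<otimes> s [^] ((i + j) mod d)"
proof -
  assume xy: "x \<in> S" "y \<in> S"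
  have "(x \<otimes> s [^] i) \<otimes> (y \<otimes> s [^] j) = x \<otimes> (s [^] i \<otimes> y) \<otimes> s [^] j" using xy by (simp add: S_carrier m_assoc)
  also have "\<dots> = x \<otimes> sc i y \<otimes> (s [^] i \<otimes> s [^] j)" using xy by (simp add: sp_mult S_carrier sc_closed m_assoc)
  finally show ?thesis using s_closed by (simp add: nat_pow_mult sp_mod)
qed

definition ix :: "'a \<Rightarrow> nat" where "ix g = (THE i. i < d \<and> (\<exists>x\<in>S. g = x \<otimes> s [^] i))"
definition sx :: "'a \<Rightarrow> 'a" where "sx g = (THE x. x \<in> S \<and> (\<exists>i<d. g = x \<otimes> s [^] i))"

lemma ix_sx: "x \<in> S \<Longrightarrow> i < d \<Longrightarrow> ix (x \<otimes> s [^] i) = i" "x \<in> S \<Longrightarrow> i < d \<Longrightarrow> sx (x \<otimes> s [^] i) = x"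
  unfolding ix_def sx_def using unique by (blast intro!: the_equality)+

lemma ix_sx_form: assumes "g \<in> carrier G" shows "sx g \<in> S" "ix g < d" "g = sx g \<otimes> s [^] ix g"
  using decompose[OF assms] ix_sx by auto

lemma ix_mult: "g \<in> carrier G \<Longrightarrow> h \<in> carrier G \<Longrightarrow> ix (g \<otimes> h) = (ix g + ix h) mod d"
  and sx_mult: "g \<in> carrier G \<Longrightarrow> h \<in> carrier G \<Longrightarrow> sx (g \<otimes> h) = sx g \<otimes> sc (ix g) (sx h)"
proof -
  assume gh: "g \<in> carrier G" "h \<in> carrier G"
  note g = ix_sx_form[OF gh(1)] and h = ix_sx_form[OF gh(2)]
  have e: "g \<otimes> h = (sx g \<otimes> sc (ix g) (sx h)) \<otimes> s [^] ((ix g + ix h) mod d)"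
    using prod_form[OF g(1) h(1), of "ix g" "ix h"] g(3) h(3) by simp
  have "sx g \<otimes> sc (ix g) (sx h) \<in> S" "(ix g + ix h) mod d < d" using g h sc_closed S_mult d_pos by auto
  then show "ix (g \<otimes> h) = (ix g + ix h) mod d" "sx (g \<otimes> h) = sx g \<otimes> sc (ix g) (sx h)"
    using ix_sx unfolding e by auto
qed

lemma ix_S: "x \<in> S \<Longrightarrow> ix x = 0" "x \<in> S \<Longrightarrow> sx x = x"
  using ix_sx[of x 0] d_pos by (simp_all add: S_carrier)

lemma card_multiples: "t dvd d \<Longrightarrow> t > 0 \<Longrightarrow> card {i. i < d \<and> t dvd i} = d div t"
proof -
  assume t: "t dvd d" "t > 0"
  have "bij_betw (\<lambda>k. t * k) {..<d div t} {i. i < d \<and> t dvd i}"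
    by (rule bij_betw_byWitness[of _ "\<lambda>i. i div t"]) (use t in \<open>auto simp: dvd_def\<close>)
  then show ?thesis using bij_betw_same_card by fastforce
qed

text \<open>For t dividing d this is the subgroup generated by S and the t-th power of s, the
  inertia group of a character of S whose orbit has length t.\<close>

definition Mt :: "nat \<Rightarrow> 'a set" where "Mt t = {g \<in> carrier G. t dvd ix g}"

lemma Mt_subgroup: assumes t: "t dvd d" shows "subgroup (Mt t) G"
proof (rule subgroupI)
  show "Mt t \<subseteq> carrier G" by (auto simp: Mt_def)
  have "\<one> \<in> Mt t" using ix_S(1)[OF S_one] by (simp add: Mt_def)
  then show "Mt t \<noteq> {}" by blast
  show "a \<otimes> b \<in> Mt t" if "a \<in> Mt t" "b \<in> Mt t" for a b
    using that t by (auto simp: Mt_def ix_mult dvd_mod)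
  show "inv a \<in> Mt t" if a: "a \<in> Mt t" for a
  proof -
    have ac: "a \<in> carrier G" "t dvd ix a" using a by (auto simp: Mt_def)
    have "(ix a + ix (inv a)) mod d = 0" using ix_mult[OF ac(1) inv_closed[OF ac(1)]] ix_S(1)[OF S_one] ac by simp
    then have "d dvd ix a + ix (inv a)" by auto
    then have "t dvd ix a + ix (inv a)" using t dvd_trans by blast
    then show ?thesis using ac by (simp add: Mt_def dvd_add_right_iff)
  qed
qed

lemma card_Mt: assumes t: "t dvd d" "t > 0" shows "card (Mt t) = card S * (d div t)"
proof -
  have "bij_betw (\<lambda>(x,i). x \<otimes> s [^] i) (S \<times> {i. i < d \<and> t dvd i}) (Mt t)"
    by (rule bij_betw_byWitness[of _ "\<lambda>g. (sx g, ix g)"])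
      (use ix_sx ix_sx_form in \<open>auto simp: Mt_def S_carrier\<close>)
  then have "card (Mt t) = card (S \<times> {i. i < d \<and> t dvd i})" by (rule bij_betw_same_card[symmetric])
  then show ?thesis using card_multiples[OF t] by (simp add: card_cartesian_product)
qed

lemma carrier_Mt: "Mt 1 = carrier G" by (auto simp: Mt_def)

lemma S_subset_Mt: "S \<subseteq> Mt t" by (auto simp: Mt_def ix_S S_carrier)

definition cj :: "nat \<Rightarrow> ('a \<Rightarrow> complex) \<Rightarrow> 'a \<Rightarrow> complex" where
  "cj i \<chi> = (\<lambda>x\<in>S. \<chi> (sc i x))"

lemma cj_Irr: "\<chi> \<in> Irr SG \<Longrightarrow> cj i \<chi> \<in> Irr SG"
  unfolding cj_def using SG.Irr_automorphism[of \<chi> "sc i"] sc_bij[of i] sc_mult by simp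

lemma cj_add: "\<chi> \<in> Irr SG \<Longrightarrow> cj (i + j) \<chi> = cj j (cj i \<chi>)"
  unfolding cj_def by (rule restrict_ext) (simp add: sc_add sc_closed)

lemma cj_0: "\<chi> \<in> Irr SG \<Longrightarrow> cj 0 \<chi> = \<chi>"
  using cj_Irr by (intro SG.Irr_eqI) (auto simp: cj_def sc_0)

text \<open>An intertwiner A between the representation and its twist by the t-th power of s is a
  candidate for the image of that power. With t * e = d, twisting e times is the identity, so
  \<open>A ^\<^sub>m e\<close> is scalar by Schur's lemma; dividing A by an e-th root of this scalar
  makes the relation of the cyclic quotient hold.\<close>

lemma extend_invariant:
  assumes c: "\<chi> \<in> Irr SG" and t: "t dvd d" "t > 0" and inv: "cj t \<chi> = \<chi>"
  obtains \<theta> where "\<theta> \<in> Irr (G\<lparr>carrier := Mt t\<rparr>)" "\<And>x. x \<in> S \<Longrightarrow> \<theta> x = \<chi> x"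
proof -
  obtain n \<rho> where r: "irreducible_rep SG n \<rho>" "mrep SG n \<rho>" "n > 0" "\<chi> \<one>\<^bsub>SG\<^esub> = of_nat n"
    "\<And>g. g \<in> carrier SG \<Longrightarrow> \<chi> g = mtr (\<rho> g)" using SG.IrrE[OF c] by metis
  have R: "\<rho> x \<in> carrier_mat n n" "\<rho> \<one> = 1\<^sub>m n" "\<rho> (x \<otimes> y) = \<rho> x * \<rho> y" if "x \<in> S" "y \<in> S" for x y
    using SG.mrepD[OF r(2)] that by auto
  define e where "e = d div t"
  have de: "d = t * e" and e0: "e > 0" using t d_pos unfolding e_def by auto
  let ?\<sigma> = "\<lambda>x. \<rho> (sc t x)"
  have ms: "mrep SG n ?\<sigma>"
    unfolding mrep_def using R sc_closed sc_mult S_one R(2)[OF S_one S_one]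
    by (auto simp: sc_def)
  have irs: "irreducible_rep SG n ?\<sigma>"
    unfolding irreducible_rep_iff[OF SG.is_group]
  proof (intro conjI allI impI)
    fix W assume W: "vsub n W" "\<forall>g\<in>carrier SG. \<forall>w\<in>W. \<rho> (sc t g) *\<^sub>v w \<in> W"
    have "\<rho> g *\<^sub>v w \<in> W" if g: "g \<in> S" and w: "w \<in> W" for g w
    proof -
      obtain x where "x \<in> S" "g = sc t x" using sc_bij[of t] g unfolding bij_betw_def by blast
      then show ?thesis using W w by auto
    qed
    then show "W = {0\<^sub>v n} \<or> W = carrier_vec n"
      using r(1) W(1) unfolding irreducible_rep_iff[OF SG.is_group] by simp
  qed (use r(3) ms in auto)
  have tr: "mtr (\<rho> g) = mtr (?\<sigma> g)" if "g \<in> carrier SG" for g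
    using r(5)[of g] r(5)[of "sc t g"] that sc_closed fun_cong[OF inv, of g] by (simp add: cj_def)
  obtain A B where A: "A \<in> carrier_mat n n" and B: "B \<in> carrier_mat n n" and AB: "A * B = 1\<^sub>m n" "B * A = 1\<^sub>m n"
    and int: "\<And>x. x \<in> S \<Longrightarrow> A * \<rho> x = \<rho> (sc t x) * A"
    using SG.intertwiner_exists[OF r(1) irs tr] by auto
  have intp: "A ^\<^sub>m k * \<rho> x = \<rho> (sc (t * k) x) * A ^\<^sub>m k" if x: "x \<in> S" for k x
    using x
  proof (induction k arbitrary: x)
    case 0
    then show ?case using A R(1)[OF 0 0] by (simp add: sc_0)
  next
    case (Suc k)
    have Ak: "A ^\<^sub>m k \<in> carrier_mat n n" using A by simp
    note c1 = R(1)[OF Suc.prems Suc.prems] and sx = sc_closed[OF Suc.prems, of t]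
    have "A ^\<^sub>m Suc k * \<rho> x = A ^\<^sub>m k * (A * \<rho> x)" using A Ak c1 by (simp add: assoc_mult_mat[of _ n n _ n _ n])
    also have "\<dots> = A ^\<^sub>m k * \<rho> (sc t x) * A"
      unfolding int[OF Suc.prems] by (rule assoc_mult_mat[symmetric, OF Ak R(1)[OF sx sx] A])
    also have "\<dots> = \<rho> (sc (t * k) (sc t x)) * A ^\<^sub>m k * A" unfolding Suc.IH[OF sx] ..
    also have "\<dots> = \<rho> (sc (t * k) (sc t x)) * (A ^\<^sub>m k * A)"
      by (rule assoc_mult_mat[OF _ Ak A]) (rule R(1)[OF sc_closed[OF sx] S_one])
    also have "sc (t * k) (sc t x) = sc (t * Suc k) x" using sc_add[OF Suc.prems, of "t * k" t] by (simp add: add.commute)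
    finally show ?case by simp
  qed
  have "A ^\<^sub>m e * \<rho> g = \<rho> g * A ^\<^sub>m e" if "g \<in> carrier SG" for g
    using intp[of g e] that by (simp add: de[symmetric] sc_d)
  then obtain c where c': "A ^\<^sub>m e = c \<cdot>\<^sub>m 1\<^sub>m n"
    using Schur_scalar[OF SG.is_group r(1), of "A ^\<^sub>m e"] A by auto
  have detA: "det A \<noteq> 0"
    using det_mult[OF A B] AB(1) by auto
  have "c \<noteq> 0"
  proof
    assume "c = 0"
    then have "det (A ^\<^sub>m e) = det (0 \<cdot>\<^sub>m 1\<^sub>m n :: complex mat)" using c' by simp
    also have "\<dots> = 0" using r(3) by (subst det_smult) auto
    finally have "det (A ^\<^sub>m e) = 0" .
    moreover have "det (A ^\<^sub>m k) = det A ^ k" for k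
    proof (induction k)
      case (Suc k)
      then show ?case using det_mult[OF pow_carrier_mat[OF A, of k] A] by (simp add: mult.commute)
    qed (use A in simp)
    ultimately have "det A ^ e = 0" by simp
    with detA show False by simp
  qed
  then obtain z where z: "z \<noteq> 0" "z ^ e = c" using complex_root_exists e0 by metis
  define A' where "A' = inverse z \<cdot>\<^sub>m A"
  have A': "A' \<in> carrier_mat n n" using A by (simp add: A'_def)
  have pow: "A' ^\<^sub>m k = inverse z ^ k \<cdot>\<^sub>m A ^\<^sub>m k" for k
  proof (induction k)
    case (Suc k)
    have Ak: "A ^\<^sub>m k \<in> carrier_mat n n" using A by simp
    show ?case using A Ak unfolding pow_mat.simps unfolding Suc unfolding A'_def
      by (simp add: mult_smult_assoc_mat[of _ n n _ n] mult_smult_distrib[of _ n n _ n] smult_smult_mat' mult.commute)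
  qed (use A in \<open>auto simp: A'_def\<close>)
  have A'e: "A' ^\<^sub>m e = 1\<^sub>m n" unfolding pow c' using z by (auto simp: power_inverse smult_smult_mat')
  have A'k: "A' ^\<^sub>m k \<in> carrier_mat n n" for k using A' by simp
  have add: "A' ^\<^sub>m (j + k) = A' ^\<^sub>m j * A' ^\<^sub>m k" for j k
  proof (induction k)
    case (Suc k)
    then show ?case using assoc_mult_mat[OF A'k[of j] A'k[of k] A'] by simp
  qed (use A' A'k[of j] in simp)
  have "A' ^\<^sub>m (e * k) = 1\<^sub>m n" for k by (induction k) (use A' in \<open>simp_all add: add A'e\<close>)
  then have A'mod: "A' ^\<^sub>m (k mod e) = A' ^\<^sub>m k" for k
    using add[of "e * (k div e)" "k mod e"] left_mult_one_mat[OF A'k[of "k mod e"]] by simp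
  have int': "A' ^\<^sub>m k * \<rho> x = \<rho> (sc (t * k) x) * A' ^\<^sub>m k" if x: "x \<in> S" for k x
  proof -
    have Ak: "A ^\<^sub>m k \<in> carrier_mat n n" using A by simp
    show ?thesis unfolding pow
      using intp[OF x, of k] mult_smult_assoc_mat[OF Ak R(1)[OF x x]] mult_smult_distrib[OF R(1)[OF sc_closed[OF x] x] Ak] by simp
  qed
  define \<tau> where "\<tau> g = \<rho> (sx g) * A' ^\<^sub>m (ix g div t)" for g
  let ?M = "G\<lparr>carrier := Mt t\<rparr>"
  interpret M: fin_group ?M by (rule fin_group_subgroup[OF Mt_subgroup[OF t(1)]])
  have mc: "g \<in> carrier G" "t dvd ix g" if "g \<in> Mt t" for g using that by (auto simp: Mt_def)
  have tS: "\<tau> x = \<rho> x" if "x \<in> S" for x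
    using ix_S[OF that] R(1)[OF that that] A' by (simp add: \<tau>_def)
  have mt: "mrep ?M n \<tau>"
    unfolding mrep_def
  proof (intro conjI ballI)
    show "\<tau> g \<in> carrier_mat n n" if "g \<in> carrier ?M" for g
      unfolding \<tau>_def using that R(1)[OF ix_sx_form(1) S_one] A'k mc(1) by (auto intro!: mult_carrier_mat)
    show "\<tau> \<one>\<^bsub>?M\<^esub> = 1\<^sub>m n" using tS[OF S_one] R(2)[OF S_one S_one] by simp
    fix g h assume "g \<in> carrier ?M" "h \<in> carrier ?M"
    then have gh: "g \<in> carrier G" "h \<in> carrier G" "t dvd ix g" "t dvd ix h" using mc by auto
    note g = ix_sx_form[OF gh(1)] and h = ix_sx_form[OF gh(2)]
    define a b where "a = ix g div t" and "b = ix h div t"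
    have ab: "ix g = t * a" "ix h = t * b" using gh unfolding a_def b_def by auto
    have "ix (g \<otimes> h) = (t * (a + b)) mod (t * e)" using ix_mult[OF gh(1,2)] ab de by (simp add: distrib_left)
    then have i: "ix (g \<otimes> h) div t = (a + b) mod e" using t by (simp add: mult_mod_right[symmetric])
    note c1 = R(1)[OF g(1) g(1)] and c2 = R(1)[OF h(1) h(1)] and c3 = R(1)[OF sc_closed[OF h(1)] h(1)]
    have "\<tau> (g \<otimes> h) = \<rho> (sx g) * \<rho> (sc (t * a) (sx h)) * (A' ^\<^sub>m a * A' ^\<^sub>m b)"
      unfolding \<tau>_def i A'mod sx_mult[OF gh(1,2)] ab add R(3)[OF g(1) sc_closed[OF h(1)]] ..
    also have "\<dots> = \<rho> (sx g) * ((\<rho> (sc (t * a) (sx h)) * A' ^\<^sub>m a) * A' ^\<^sub>m b)"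
      using c1 c3[of "t * a"] A'k mult_carrier_mat[OF A'k[of a] A'k[of b]] by (simp add: assoc_mult_mat[of _ n n _ n _ n])
    also have "\<dots> = \<rho> (sx g) * ((A' ^\<^sub>m a * \<rho> (sx h)) * A' ^\<^sub>m b)" unfolding int'[OF h(1)] ..
    also have "\<dots> = \<tau> g * \<tau> h"
      using c1 c2 A'k unfolding \<tau>_def a_def[symmetric] b_def[symmetric] by (simp add: assoc_mult_mat[of _ n n _ n _ n])
    finally show "\<tau> (g \<otimes>\<^bsub>?M\<^esub> h) = \<tau> g * \<tau> h" by simp
  qed
  have "irreducible_rep ?M n \<tau>"
    unfolding irreducible_rep_iff[OF M.is_group]
  proof (intro conjI allI impI)
    fix W assume W: "vsub n W" "\<forall>g\<in>carrier ?M. \<forall>w\<in>W. \<tau> g *\<^sub>v w \<in> W"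
    have "\<rho> g *\<^sub>v w \<in> W" if g: "g \<in> S" and w: "w \<in> W" for g w
    proof -
      have "g \<in> carrier ?M" using subsetD[OF S_subset_Mt[of t] g] by simp
      then have "\<tau> g *\<^sub>v w \<in> W" using W(2) w by blast
      then show ?thesis by (simp only: tS[OF g])
    qed
    then show "W = {0\<^sub>v n} \<or> W = carrier_vec n"
      using r(1) W(1) unfolding irreducible_rep_iff[OF SG.is_group] by simp
  qed (use r(3) mt in auto)
  then have "rep_character ?M \<tau> \<in> Irr ?M" by (rule M.IrrI)
  moreover have "rep_character ?M \<tau> x = \<chi> x" if "x \<in> S" for x
    using tS[OF that] r(5)[of x] that S_subset_Mt[of t] by (auto simp: rep_character_def sum_list_diag_mat)
  ultimately show ?thesis using that by blast
qed

text \<open>Let \<open>\<theta>\<close> extend \<open>\<chi>\<close> to the inertia group and let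
  \<open>\<psi>\<close> be a constituent of the character induced from \<open>\<theta>\<close>. The
  degree of the induced character bounds that of \<open>\<psi>\<close> above by t times the degree
  of \<open>\<chi>\<close>; the restriction of \<open>\<psi>\<close> to S contains the t distinct
  conjugates of \<open>\<chi>\<close>, which gives the same lower bound.\<close>

theorem orbit_degree:
  assumes c: "\<chi> \<in> Irr SG" and t: "t dvd d" "t > 0" and inv: "cj t \<chi> = \<chi>"
    and least: "\<And>i. 0 < i \<Longrightarrow> i < t \<Longrightarrow> cj i \<chi> \<noteq> \<chi>"
  shows "of_nat t * \<chi> \<one> \<in> cd G"
proof -
  let ?M = "G\<lparr>carrier := Mt t\<rparr>"
  obtain \<theta> where th: "\<theta> \<in> Irr (?M)" "\<And>x. x \<in> S \<Longrightarrow> \<theta> x = \<chi> x"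
    using extend_invariant[OF c t inv] by metis
  note MS = Mt_subgroup[OF t(1)]
  interpret M: fin_group ?M by (rule fin_group_subgroup[OF MS])
  have cS: "card S > 0" using SG.card_pos by simp
  have cG: "card (carrier G) = card S * d" using card_Mt[of 1] carrier_Mt by simp
  define m where "m \<psi> = (\<Sum>g\<in>Mt t. \<psi> g * \<theta> (inv g)) / of_nat (card (Mt t))" for \<psi>
  obtain e where e: "d = t * e" "e > 0" using t d_pos by (auto simp: dvd_def)
  have "(\<Sum>\<psi>\<in>Irr G. m \<psi> * \<psi> \<one>) = of_nat (card (carrier G)) / of_nat (card (Mt t)) * \<theta> \<one>"
    unfolding m_def by (rule sum_Irr_restriction[OF MS])
  also have "\<dots> = of_nat t * \<chi> \<one>"
    using cS e t th(2)[OF S_one] unfolding cG card_Mt[OF t] by simp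
  finally have sum: "(\<Sum>\<psi>\<in>Irr G. m \<psi> * \<psi> \<one>) = of_nat t * \<chi> \<one>" .
  obtain n where n: "n > 0" "\<chi> \<one> = of_nat n" using SG.Irr_one[OF c] by auto
  have mn: "\<exists>k::nat. m \<psi> = of_nat k" if "\<psi> \<in> Irr G" for \<psi>
    using restrict_multiplicity[OF MS that] th(1) unfolding m_def by blast
  then obtain mm where mm: "\<And>\<psi>. \<psi> \<in> Irr G \<Longrightarrow> m \<psi> = of_nat (mm \<psi> :: nat)" by metis
  obtain dd where dd: "\<And>\<psi>. \<psi> \<in> Irr G \<Longrightarrow> \<psi> \<one> = of_nat (dd \<psi> :: nat)" using Irr_one by metis
  have "of_nat (\<Sum>\<psi>\<in>Irr G. mm \<psi> * dd \<psi>) = (of_nat (t * n) :: complex)"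
    using sum n(2) mm dd by (simp cong: sum.cong)
  then have s: "(\<Sum>\<psi>\<in>Irr G. mm \<psi> * dd \<psi>) = t * n" by (metis of_nat_eq_iff)
  have "t * n > 0" using t n by simp
  then have "\<exists>\<psi>\<in>Irr G. mm \<psi> * dd \<psi> \<noteq> 0"
    using s sum.neutral[of "Irr G" "\<lambda>\<psi>. mm \<psi> * dd \<psi>"] by force
  then obtain \<psi> where psi: "\<psi> \<in> Irr G" "mm \<psi> * dd \<psi> > 0" by auto
  have "mm \<psi> * dd \<psi> \<le> t * n" unfolding s[symmetric] using psi(1) by (intro member_le_sum) auto
  then have upper: "dd \<psi> \<le> t * n" using psi(2) by (cases "mm \<psi>") auto
  obtain k :: "('a \<Rightarrow> complex) \<Rightarrow> nat" where
    k: "\<And>\<xi>. \<xi> \<in> Irr SG \<Longrightarrow> (\<Sum>g\<in>S. \<psi> g * \<xi> (inv g)) / of_nat (card S) = of_nat (k \<xi>)"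
    "\<And>g. g \<in> S \<Longrightarrow> \<psi> g = (\<Sum>\<xi>\<in>Irr SG. of_nat (k \<xi>) * \<xi> g)"
    using restrict_multiplicity[OF S psi(1)] by blast
  obtain l :: "('a \<Rightarrow> complex) \<Rightarrow> nat" where
    l: "\<And>\<xi>. \<xi> \<in> Irr (?M) \<Longrightarrow> (\<Sum>g\<in>Mt t. \<psi> g * \<xi> (inv g)) / of_nat (card (Mt t)) = of_nat (l \<xi>)"
    "\<And>g. g \<in> Mt t \<Longrightarrow> \<psi> g = (\<Sum>\<xi>\<in>Irr (?M). of_nat (l \<xi>) * \<xi> g)"
    using restrict_multiplicity[OF MS psi(1)] by blast
  have "l \<theta> = mm \<psi>" using l(1)[OF th(1)] mm[OF psi(1)] unfolding m_def by (metis of_nat_eq_iff)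
  then have lpos: "l \<theta> > 0" using psi(2) by auto
  have SM: "subgroup S (?M)"
    by (rule subgroup_incl[OF S MS S_subset_Mt])
  have SGe: "?M\<lparr>carrier := S\<rparr> = SG" by simp
  \<comment> \<open>Restriction in stages: \<open>\<psi>\<close> contains \<open>\<theta>\<close> on
    the inertia group, and \<open>\<theta>\<close> contains \<open>\<chi>\<close> on S; all other
    contributions are non-negative.\<close>
  have "k \<chi> > 0"
  proof -
    have "\<exists>j::nat. (\<Sum>g\<in>S. \<xi> g * \<chi> (inv g)) / of_nat (card S) = of_nat j" if x: "\<xi> \<in> Irr (?M)" for \<xi>
    proof -
      have "\<exists>j::nat. (\<Sum>g\<in>S. \<xi> g * \<chi> (inv\<^bsub>?M\<^esub> g)) / of_nat (card S) = of_nat j"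
      proof -
        obtain m :: "('a \<Rightarrow> complex) \<Rightarrow> nat" where "\<forall>\<xi>'\<in>Irr SG. (\<Sum>g\<in>S. \<xi> g * \<xi>' (inv\<^bsub>?M\<^esub> g)) / of_nat (card S) = of_nat (m \<xi>')"
          using M.restrict_multiplicity[OF SM x] unfolding SGe by blast
        then show ?thesis using c by (intro exI[of _ "m \<chi>"]) blast
      qed
      moreover have "inv\<^bsub>?M\<^esub> g = inv g" if "g \<in> S" for g
        by (rule inv_subgroup[OF MS]) (use that S_subset_Mt in auto)
      ultimately show ?thesis by (simp cong: sum.cong)
    qed
    then obtain j where j: "\<And>\<xi>. \<xi> \<in> Irr (?M) \<Longrightarrow> (\<Sum>g\<in>S. \<xi> g * \<chi> (inv g)) / of_nat (card S) = of_nat (j \<xi> :: nat)" using bchoice[of "Irr (?M)" "\<lambda>\<xi> j. (\<Sum>g\<in>S. \<xi> g * \<chi> (inv g)) / of_nat (card S) = of_nat j"] by blast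
    have "(\<Sum>g\<in>S. \<theta> g * \<chi> (inv g)) / of_nat (card S) = SG.ip \<chi> \<chi>"
      unfolding ip_subgroup[OF S] by (simp add: th(2))
    then have j1: "j \<theta> = 1" using j[OF th(1)] SG.ip_Irr[OF c c] by simp
    have "of_nat (k \<chi>) = (\<Sum>g\<in>S. (\<Sum>\<xi>\<in>Irr (?M). of_nat (l \<xi>) * \<xi> g) * \<chi> (inv g)) / of_nat (card S)"
      unfolding k(1)[OF c, symmetric]
      by (intro arg_cong[where f="\<lambda>x. x / _"] sum.cong refl) (use l(2) S_subset_Mt in auto)
    also have "(\<Sum>g\<in>S. (\<Sum>\<xi>\<in>Irr (?M). of_nat (l \<xi>) * \<xi> g) * \<chi> (inv g)) =
      (\<Sum>\<xi>\<in>Irr (?M). of_nat (l \<xi>) * (\<Sum>g\<in>S. \<xi> g * \<chi> (inv g)))"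
      unfolding sum_distrib_left sum_distrib_right by (subst sum.swap) (simp add: mult.assoc)
    also have "\<dots> / of_nat (card S) = of_nat (\<Sum>\<xi>\<in>Irr (?M). l \<xi> * j \<xi>)"
      unfolding sum_divide_distrib by (simp add: j flip: times_divide_eq_right)
    finally have "k \<chi> = (\<Sum>\<xi>\<in>Irr (?M). l \<xi> * j \<xi>)" by (metis of_nat_eq_iff)
    moreover have "\<dots> \<ge> l \<theta> * j \<theta>" using th(1) by (intro member_le_sum) auto
    ultimately show ?thesis using lpos j1 by simp
  qed
  \<comment> \<open>Values of \<open>\<psi>\<close> are invariant under conjugation by s, so all
    conjugates of \<open>\<chi>\<close> occur equally often.\<close>
  have kc: "k (cj i \<chi>) = k \<chi>" for i
  proof -
    have "(\<Sum>g\<in>S. \<psi> g * cj i \<chi> (inv g)) = (\<Sum>g\<in>S. \<psi> (sc i g) * \<chi> (inv (sc i g)))"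
    proof (intro sum.cong refl)
      fix g assume g: "g \<in> S"
      have "sc i (inv g) = inv (sc i g)" using g by (simp add: sc_def S_carrier inv_mult_group m_assoc)
      moreover have "\<psi> (sc i g) = \<psi> g" using Irr_conj[OF psi(1) S_carrier[OF g], of "s [^] i"] by (simp add: sc_def)
      ultimately show "\<psi> g * cj i \<chi> (inv g) = \<psi> (sc i g) * \<chi> (inv (sc i g))"
        using g S_inv by (simp add: cj_def)
    qed
    also have "\<dots> = (\<Sum>g\<in>S. \<psi> g * \<chi> (inv g))"
      by (rule sum.reindex_bij_betw[OF sc_bij, of "\<lambda>g. \<psi> g * \<chi> (inv g)"])
    finally have "of_nat (k (cj i \<chi>)) = (of_nat (k \<chi>) :: complex)"
      using k(1)[OF c] k(1)[OF cj_Irr[OF c]] by metis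
    then show ?thesis by simp
  qed
  have inj: "inj_on (\<lambda>i. cj i \<chi>) {..<t}"
  proof (rule linorder_inj_onI)
    fix i j assume ij: "i < j" "i \<in> {..<t}" "j \<in> {..<t}"
    show "cj i \<chi> \<noteq> cj j \<chi>"
    proof
      assume "cj i \<chi> = cj j \<chi>"
      then have "cj (t - i) (cj i \<chi>) = cj (t - i) (cj j \<chi>)" by simp
      then have "cj t \<chi> = cj (t + (j - i)) \<chi>"
        using ij by (simp add: cj_add[OF c, symmetric] add.commute)
      then have "\<chi> = cj (j - i) \<chi>" using inv cj_add[OF c, of t "j - i"] by simp
      moreover have "0 < j - i" "j - i < t" using ij by auto
      ultimately show False using least by metis
    qed
  qed auto
  have "of_nat (dd \<psi>) = (\<Sum>\<xi>\<in>Irr SG. of_nat (k \<xi>) * \<xi> \<one>)" using k(2)[OF S_one] dd[OF psi(1)] by simp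
  moreover obtain ds where ds: "\<And>\<xi>. \<xi> \<in> Irr SG \<Longrightarrow> \<xi> \<one> = of_nat (ds \<xi> :: nat)" using SG.Irr_one by simp metis
  ultimately have "of_nat (dd \<psi>) = (of_nat (\<Sum>\<xi>\<in>Irr SG. k \<xi> * ds \<xi>) :: complex)" by (simp cong: sum.cong)
  then have ddk: "dd \<psi> = (\<Sum>\<xi>\<in>Irr SG. k \<xi> * ds \<xi>)" by (metis of_nat_eq_iff)
  have dsc: "ds (cj i \<chi>) = n" for i
  proof -
    have "of_nat (ds (cj i \<chi>)) = cj i \<chi> \<one>" using ds[OF cj_Irr[OF c]] by simp
    also have "\<dots> = of_nat n" using n(2) S_one by (simp add: cj_def sc_def)
    finally show ?thesis by simp
  qed
  have "t * n \<le> (\<Sum>i<t. k (cj i \<chi>) * ds (cj i \<chi>))"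
    using \<open>k \<chi> > 0\<close> by (simp add: kc dsc)
  also have "\<dots> = (\<Sum>\<xi>\<in>(\<lambda>i. cj i \<chi>) ` {..<t}. k \<xi> * ds \<xi>)" using sum.reindex[OF inj, of "\<lambda>\<xi>. k \<xi> * ds \<xi>"] by simp
  also have "\<dots> \<le> dd \<psi>" unfolding ddk by (rule sum_mono2) (use cj_Irr[OF c] in auto)
  finally have "dd \<psi> = t * n" using upper by simp
  then have "\<psi> \<one> = of_nat t * \<chi> \<one>" using dd[OF psi(1)] n(2) by simp
  then show ?thesis using psi(1) unfolding cd_def by (auto intro!: exI[of _ \<psi>])
qed

end

section \<open>The finite field, its twist and its additive character\<close>

locale suzuki_field =
  fixes f :: nat and F :: "'a::{field,finite} itself"
  assumes card_F: "card (UNIV :: 'a set) = 2 ^ (2 * f + 1)" and f_gt: "f > 1"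
begin

definition "n = 2 * f + 1"
definition "q = (2::nat) ^ n"
definition "r = (2::nat) ^ (f + 1)"

lemma card_UNIV_q: "card (UNIV :: 'a set) = q" by (simp add: q_def n_def card_F)

lemma r_sq: "r * r = 2 * q"
proof -
  have "f + 1 + (f + 1) = Suc n" by (simp add: n_def)
  then show ?thesis unfolding r_def q_def power_add[symmetric] power_Suc[symmetric] by simp
qed

lemma n_lt_r: "n < r"
proof -
  have "2 * k + 1 < 2 ^ (k + 1)" if "k \<ge> 2" for k :: nat
    using that by (induction k rule: dec_induct) auto
  then show ?thesis using f_gt unfolding r_def n_def by simp
qed

lemma q_ge: "q \<ge> 32"
proof -
  have "(2::nat) ^ 5 \<le> 2 ^ n" using f_gt by (intro power_increasing) (auto simp: n_def)
  then show ?thesis unfolding q_def by simp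
qed

lemma r_ge: "r \<ge> 8"
proof -
  have "(2::nat) ^ 3 \<le> 2 ^ (f + 1)" using f_gt by (intro power_increasing) auto
  then show ?thesis unfolding r_def by simp
qed

text \<open>Translation by 1 permutes the field, so the order of the field times 1 is zero; this
  order is a power of 2.\<close>

lemma two_zero: "(2::'a) = 0"
proof -
  have "(\<Sum>x\<in>UNIV. x + 1) = (\<Sum>x\<in>UNIV. x :: 'a)"
    by (rule sum.reindex_bij_witness[of _ "\<lambda>x. x - 1" "\<lambda>x. x + 1"]) auto
  then have "of_nat (card (UNIV :: 'a set)) = (0 :: 'a)" by (simp add: sum.distrib)
  then have "(2::'a) ^ (2 * f + 1) = 0" unfolding card_F by simp
  then show ?thesis by auto
qed

lemma add_self [simp]: "(x::'a) + x = 0"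
  using two_zero by (metis mult_2 mult_zero_left)

lemma minus_self [simp]: "- (x::'a) = x"
  by (rule minus_unique) simp

lemma diff_add [simp]: "(x::'a) - y = x + y"
  using add_uminus_conv_diff[of x y] by simp

lemma add_self_left [simp]: "(x::'a) + (x + y) = y"
  by (simp add: add.assoc[symmetric])

lemma add_eq_0 [simp]: "(x::'a) + y = 0 \<longleftrightarrow> x = y"
  by (metis add_self add_self_left add.right_neutral)

lemma add_eq_iff: "(x::'a) + y = z \<longleftrightarrow> x = z + y"
  by (metis add.assoc add.right_neutral add_self)

lemma frob_add: "((x::'a) + y) ^ (2 ^ k) = x ^ (2 ^ k) + y ^ (2 ^ k)"
proof (induction k)
  case (Suc k)
  have "(x + y) ^ (2 ^ Suc k) = ((x + y) ^ (2 ^ k))\<^sup>2" by (simp add: power_mult[symmetric] mult.commute)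
  also have "\<dots> = (x ^ (2 ^ k))\<^sup>2 + (y ^ (2 ^ k))\<^sup>2" unfolding Suc by (simp add: power2_sum two_zero)
  finally show ?case by (simp add: power_mult[symmetric] mult.commute)
qed simp

lemma frob_inj: "(x::'a) ^ (2 ^ k) = y ^ (2 ^ k) \<longleftrightarrow> x = y"
proof
  assume "x ^ (2 ^ k) = y ^ (2 ^ k)"
  then have "(x + y) ^ (2 ^ k) = 0" by (simp add: frob_add)
  then show "x = y" by simp
qed simp

lemma pow_q1: assumes "(x::'a) \<noteq> 0" shows "x ^ (q - 1) = 1"
proof -
  let ?U = "UNIV - {0::'a}"
  have c: "card ?U = q - 1" by (simp add: card_Diff_singleton card_UNIV_q)
  have "(\<Prod>y\<in>?U. x * y) = (\<Prod>y\<in>?U. y)"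
    by (rule prod.reindex_bij_witness[of _ "\<lambda>y. y / x" "\<lambda>y. x * y"]) (use assms in auto)
  then have "x ^ (q - 1) * (\<Prod>y\<in>?U. y) = 1 * (\<Prod>y\<in>?U. y)" by (simp add: prod.distrib c)
  moreover have "(\<Prod>y\<in>?U. y) \<noteq> 0" by simp
  ultimately show ?thesis by (metis mult_right_cancel)
qed

lemma pow_q: "(x::'a) ^ (2 ^ n) = x"
proof (cases "x = 0")
  case False
  have "x ^ q = x * x ^ (q - 1)" using q_ge by (metis One_nat_def Suc_pred le_zero_eq neq0_conv numeral_neq_zero power_Suc)
  then show ?thesis using pow_q1[OF False] by (simp add: q_def)
qed simp

definition th :: "'a \<Rightarrow> 'a" where "th x = x ^ (2 ^ (f + 1))"

lemma th_add [simp]: "th (x + y) = th x + th y" unfolding th_def by (rule frob_add)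

lemma th_inj [simp]: "th x = th y \<longleftrightarrow> x = y" unfolding th_def by (rule frob_inj)

lemma th_simps [simp]: "th 0 = 0" "th 1 = 1" "th (x * y) = th x * th y"
  "th (x / y) = th x / th y" "th (inverse x) = inverse (th x)" "th (x ^ k) = th x ^ k" "th x = 0 \<longleftrightarrow> x = 0"
  by (auto simp: th_def power_mult_distrib power_divide power_inverse power_mult[symmetric] mult.commute simp del: power_Suc)

lemma bij_th: "bij th"
  unfolding bij_def using finite_UNIV_inj_surj[of th] by (simp add: inj_def)

lemma th_th [simp]: "th (th x) = x\<^sup>2"
proof -
  have "th (th x) = x ^ (2 ^ (f + 1 + (f + 1)))" unfolding th_def power_mult[symmetric] power_add ..
  also have "f + 1 + (f + 1) = Suc n" by (simp add: n_def)
  also have "x ^ (2 ^ Suc n) = (x ^ (2 ^ n))\<^sup>2" by (simp add: power_mult[symmetric] mult.commute)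
  finally show ?thesis by (simp only: pow_q)
qed

lemma th_frob: "th (x ^ (2 ^ k)) = th x ^ (2 ^ k)" by simp

text \<open>Applying the twist to x * th x = 1 gives th x * x^2 = 1, and dividing leaves x = 1.
  Together with multiplicativity this makes x * th x a bijection of the field; it is the scaling by
  which the torus acts on the centre of P.\<close>

lemma mult_th_eq_1: "x * th x = 1 \<longleftrightarrow> x = 1"
proof
  assume e: "x * th x = 1"
  then have "th x * x\<^sup>2 = 1" using th_simps(3)[of x "th x"] by (metis th_simps(2,3) th_th)
  moreover have "th x * x\<^sup>2 = (x * th x) * x" by (simp add: power2_eq_square)
  ultimately show "x = 1" using e by simp
qed simp

lemma mult_th_inj: "x * th x = y * th y \<longleftrightarrow> x = y"
proof (cases "y = 0")
  case False
  have "x * th x = y * th y \<longleftrightarrow> (x / y) * th (x / y) = 1" using False by (simp add: field_simps)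
  also have "\<dots> \<longleftrightarrow> x / y = 1" by (rule mult_th_eq_1)
  finally show ?thesis using False by simp
qed simp

lemma bij_mult_th: "bij (\<lambda>x. x * th x)"
  unfolding bij_def using finite_UNIV_inj_surj[of "\<lambda>x. x * th x"] by (simp add: inj_def mult_th_inj)

definition Tr :: "'a \<Rightarrow> 'a" where "Tr x = (\<Sum>i<n. x ^ (2 ^ i))"

lemma Tr_add: "Tr (x + y) = Tr x + Tr y" by (simp add: Tr_def frob_add sum.distrib)

lemma Tr_sq: "Tr (x\<^sup>2) = Tr x"
proof -
  have "Tr (x\<^sup>2) = (\<Sum>i<n. x ^ (2 ^ Suc i))" unfolding Tr_def by (simp add: power_mult[symmetric])
  then have "x + Tr (x\<^sup>2) = (\<Sum>i<Suc n. x ^ (2 ^ i))" by (subst sum.lessThan_Suc_shift) simp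
  also have "\<dots> = Tr x + x" unfolding Tr_def sum.lessThan_Suc pow_q ..
  finally show ?thesis by (metis add.commute add_self_left)
qed

lemma Tr_sq': "Tr x ^ 2 = Tr x"
proof -
  have "(\<Sum>i\<in>A. x ^ (2 ^ i))\<^sup>2 = (\<Sum>i\<in>A. (x\<^sup>2) ^ (2 ^ i))" if "finite A" for A
    using that by (induction A rule: finite_induct) (simp_all add: power2_sum two_zero power_mult[symmetric] mult.commute)
  then show ?thesis using Tr_sq[of x] unfolding Tr_def by simp
qed

lemma Tr_cases: "Tr x = 0 \<or> Tr x = 1"
proof -
  have "Tr x * (Tr x + 1) = 0" using Tr_sq'[of x] by (simp add: distrib_left power2_eq_square)
  then show ?thesis by auto
qed

lemma Tr_1: "Tr 1 = 1" by (simp add: Tr_def two_zero n_def)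

text \<open>With the absolute trace \<open>Tr\<close> this is the non-trivial additive character
  invariant under the Frobenius map. Being real and Frobenius invariant, it leads to a family
  \<open>Om\<close> that is stable under duality and under field automorphisms.\<close>

definition lam :: "'a \<Rightarrow> complex" where "lam x = (if Tr x = 0 then 1 else -1)"

lemma lam_add: "lam (x + y) = lam x * lam y"
  unfolding lam_def Tr_add using Tr_cases[of x] Tr_cases[of y] by auto

lemma lam_0 [simp]: "lam 0 = 1" by (simp add: lam_def Tr_def)
lemma lam_1 [simp]: "lam 1 = -1" by (simp add: lam_def Tr_1)
lemma lam_sq [simp]: "lam x * lam x = 1" by (simp add: lam_def)
lemma lam_cases: "lam x = 1 \<or> lam x = -1" by (simp add: lam_def)
lemma lam_nz [simp]: "lam x \<noteq> 0" by (simp add: lam_def)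

lemma lam_frob: "lam (x ^ (2 ^ k)) = lam x"
proof -
  have "Tr (x ^ (2 ^ k)) = Tr x" 
  proof (induction k)
    case (Suc k)
    have "Tr (x ^ (2 ^ Suc k)) = Tr ((x ^ (2 ^ k))\<^sup>2)" by (simp add: power_mult[symmetric] mult.commute)
    then show ?case using Suc by (simp add: Tr_sq)
  qed simp
  then show ?thesis by (simp add: lam_def)
qed

lemma lam_th: "lam (th x) = lam x" unfolding th_def by (rule lam_frob)

lemma sum_lam: "(\<Sum>x\<in>UNIV. lam x) = 0"
proof -
  have "(\<Sum>x\<in>UNIV. lam (x + 1)) = (\<Sum>x\<in>UNIV. lam x)"
    by (rule sum.reindex_bij_witness[of _ "\<lambda>x. x + 1" "\<lambda>x. x + 1"]) (auto simp: add.assoc)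
  then show ?thesis by (simp add: lam_add sum_negf)
qed

lemma sum_lam_mult: "(\<Sum>x\<in>UNIV. lam (c * x)) = (if c = 0 then of_nat q else 0)"
proof (cases "c = 0")
  case False
  have "(\<Sum>x\<in>UNIV. lam (c * x)) = (\<Sum>x\<in>UNIV. lam x)"
    by (rule sum.reindex_bij_witness[of _ "\<lambda>x. x / c" "\<lambda>x. c * x"]) (use False in auto)
  then show ?thesis using False sum_lam by simp
qed (simp add: card_UNIV_q)

lemma lam_trivial: "(\<And>x. lam (c * th x) = 1) \<Longrightarrow> c = 0"
proof -
  assume a: "\<And>x. lam (c * th x) = 1"
  then have "(\<Sum>x\<in>UNIV. lam (c * x)) = (\<Sum>x\<in>UNIV. lam (c * th x))"
    using sum.reindex_bij_betw[OF bij_th, of "\<lambda>x. lam (c * x)"] by simp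
  also have "\<dots> = of_nat q" using a by (simp add: card_UNIV_q)
  finally show "c = 0" using sum_lam_mult[of c] q_ge by (auto split: if_splits)
qed

text \<open>The additive map \<open>c \<mapsto> c + \<theta> c\<close> has kernel \<open>{0, 1}\<close>; counting identifies its image with the kernel of \<open>lam\<close>.\<close>

lemma add_th_eq: "c + th c = b + th b \<longleftrightarrow> c = b \<or> c = b + 1"
proof -
  have k: "x + th x = 0 \<longleftrightarrow> x = 0 \<or> x = 1" for x
  proof
    assume "x + th x = 0"
    then have "th x = x" by simp
    then have "x\<^sup>2 = x" using th_th[of x] by simp
    then have "x * (x + 1) = 0" by (simp add: power2_eq_square distrib_left)
    then show "x = 0 \<or> x = 1" by auto
  qed auto
  have "(c + b) + th (c + b) = (c + th c) + (b + th b)" by (simp only: th_add add_ac)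
  then have "c + th c = b + th b \<longleftrightarrow> (c + b) + th (c + b) = 0" by (simp only: add_eq_0)
  also have "\<dots> \<longleftrightarrow> c + b = 0 \<or> c + b = 1" by (rule k)
  also have "\<dots> \<longleftrightarrow> c = b \<or> c = b + 1"
    using add_eq_iff[of c b 0] add_eq_iff[of c b 1] by (simp only: add_0 add.commute[of 1])
  finally show ?thesis .
qed

lemma card_lam_ker: "2 * card {x. lam x = 1} = q"
proof -
  have "card {x. lam x = 1} = card {x. lam x = -1}"
    by (rule bij_betw_same_card[of "\<lambda>x. x + 1"], rule bij_betw_byWitness[of _ "\<lambda>x. x + 1"]) (auto simp: lam_add add.assoc)
  moreover have "card (UNIV :: 'a set) = card ({x. lam x = 1} \<union> {x. lam x = -1})" using lam_cases by (intro arg_cong[where f=card]) auto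
  moreover have "card ({x. lam x = 1} \<union> {x. lam x = -1}) = card {x. lam x = 1} + card {x. lam x = -1}"
    by (rule card_Un_disjoint) auto
  ultimately show ?thesis by (simp add: card_UNIV_q)
qed

lemma range_add_th: "range (\<lambda>c. c + th c) = {x. lam x = 1}"
proof (rule card_subset_eq)
  show "range (\<lambda>c. c + th c) \<subseteq> {x. lam x = 1}" by (auto simp: lam_add lam_th)
  have "card (UNIV :: 'a set) = (\<Sum>y\<in>range (\<lambda>c. c + th c). card {c. c + th c = y})"
    using sum.image_gen[of UNIV "\<lambda>_. 1::nat" "\<lambda>c. c + th c"] by simp
  also have "\<dots> = (\<Sum>y\<in>range (\<lambda>c. c + th c). 2)"
  proof (rule sum.cong[OF refl])
    fix y assume "y \<in> range (\<lambda>c. c + th c)"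
    then obtain b where "y = b + th b" by auto
    then have "{c. c + th c = y} = {b, b + 1}" using add_th_eq by auto
    then show "card {c. c + th c = y} = 2" by simp
  qed
  finally show "card (range (\<lambda>c. c + th c)) = card {x. lam x = 1}" using card_lam_ker by (simp add: card_UNIV_q)
qed simp

lemma generator_exists: "\<exists>g::'a. g \<noteq> 0 \<and> (\<forall>x. x \<noteq> 0 \<longrightarrow> (\<exists>i::nat. x = g ^ i))"
proof -
  have pw: "x [^]\<^bsub>class_ring :: 'a ring\<^esub> (i::nat) = x ^ i" for x :: 'a and i
    by (induction i) (simp_all add: nat_pow_def class_ring_simps mult.commute)
  have "finite (carrier (class_ring :: 'a ring))" by simp
  from field.finite_field_mult_group_has_gen[OF class_field this] obtain a where
    a: "a \<in> carrier (mult_of (class_ring :: 'a ring))" "carrier (mult_of (class_ring :: 'a ring)) = {a [^]\<^bsub>class_ring\<^esub> i | i::nat. i \<in> UNIV}"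
    by auto
  then have "a \<noteq> 0" "\<forall>x. x \<noteq> 0 \<longrightarrow> (\<exists>i::nat. x = a ^ i)"
    unfolding pw by (auto simp: class_ring_simps set_eq_iff)
  then show ?thesis by blast
qed

definition gen :: 'a where "gen = (SOME g. g \<noteq> 0 \<and> (\<forall>x. x \<noteq> 0 \<longrightarrow> (\<exists>i::nat. x = g ^ i)))"

lemma gen: "gen \<noteq> 0" "x \<noteq> 0 \<Longrightarrow> \<exists>i::nat. x = gen ^ i"
  using someI_ex[OF generator_exists] unfolding gen_def by blast+

lemma gen_mod: "gen ^ (i mod (q - 1)) = gen ^ i"
proof -
  have "gen ^ i = (gen ^ (q - 1)) ^ (i div (q - 1)) * gen ^ (i mod (q - 1))"
    unfolding power_mult[symmetric] power_add[symmetric] by simp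
  then show ?thesis using pow_q1[OF gen(1)] by simp
qed

lemma gen_bij: "bij_betw (\<lambda>i. gen ^ i) {..<q - 1} {x. x \<noteq> 0}"
proof -
  have im: "(\<lambda>i. gen ^ i) ` {..<q - 1} = {x. x \<noteq> 0}"
  proof
    show "{x. x \<noteq> 0} \<subseteq> (\<lambda>i. gen ^ i) ` {..<q - 1}"
    proof
      fix x :: 'a assume "x \<in> {x. x \<noteq> 0}"
      then obtain i where "x = gen ^ i" using gen(2) by auto
      then show "x \<in> (\<lambda>i. gen ^ i) ` {..<q - 1}"
        using gen_mod[of i] q_ge by (intro image_eqI[of _ _ "i mod (q - 1)"]) auto
    qed
  qed (use gen(1) in auto)
  have "{x::'a. x \<noteq> 0} = UNIV - {0}" by auto
  then have "card {x::'a. x \<noteq> 0} = q - 1" by (simp add: card_Diff_singleton card_UNIV_q)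
  then have "inj_on (\<lambda>i. gen ^ i) {..<q - 1}" by (intro eq_card_imp_inj_on) (simp_all only: im card_lessThan finite_lessThan)
  with im show ?thesis by (simp add: bij_betw_def)
qed

lemma gen_eq: "gen ^ i = gen ^ j \<longleftrightarrow> i mod (q - 1) = j mod (q - 1)"
proof
  assume "gen ^ i = gen ^ j"
  then have "gen ^ (i mod (q - 1)) = gen ^ (j mod (q - 1))" by (simp only: gen_mod)
  then show "i mod (q - 1) = j mod (q - 1)"
    using gen_bij q_ge unfolding bij_betw_def inj_on_def by auto
qed (metis gen_mod)

text \<open>The factors X + gen^(2^i) are permuted by squaring, so the coefficients of their product
  lie in the prime field and are fixed by \<open>B\<close>. Hence \<open>B gen\<close> is again a
  root, that is, a Frobenius conjugate of \<open>gen\<close>, and \<open>gen\<close> generates the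
  multiplicative group.\<close>

lemma field_automorphism_frobenius:
  assumes add: "\<And>x y. B (x + y) = B x + (B y :: 'a)" and mult: "\<And>x y. B (x * y) = B x * B y" and one: "B 1 = 1"
  shows "\<exists>j<n. \<forall>x. B x = x ^ (2 ^ j)"
proof -
  have B0: "B 0 = 0" using add[of 0 0] by simp
  interpret B: comm_ring_hom B by unfold_locales (auto simp: add mult one B0)
  interpret sq: comm_ring_hom "\<lambda>x::'a. x\<^sup>2"
    by unfold_locales (auto simp: power_mult_distrib power2_sum two_zero)
  interpret msq: map_poly_comm_ring_hom "\<lambda>x::'a. x\<^sup>2" ..
  define p where "p = (\<Prod>i<n. [:gen ^ (2 ^ i), 1:])"
  have "map_poly (\<lambda>x. x\<^sup>2) p = (\<Prod>i<n. [:gen ^ (2 ^ Suc i), 1:])"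
    unfolding p_def msq.hom_prod by (intro prod.cong refl) (simp add: power_mult[symmetric] mult.commute)
  moreover have "(\<Prod>i<n. [:gen ^ (2 ^ Suc i), 1:]) = p"
  proof -
    have "[:gen ^ (2 ^ 0), 1:] * (\<Prod>i<n. [:gen ^ (2 ^ Suc i), 1:]) = p * [:gen, 1:]"
      unfolding p_def by (subst prod.lessThan_Suc_shift[symmetric]) (simp only: prod.lessThan_Suc pow_q)
    then have "[:gen, 1:] * (\<Prod>i<n. [:gen ^ (2 ^ Suc i), 1:]) = [:gen, 1:] * p"
      by (simp only: power_0 power_one_right mult.commute[of p])
    moreover have "[:gen, 1:] \<noteq> 0" by simp
    ultimately show ?thesis by (metis mult_left_cancel)
  qed
  ultimately have pfix: "map_poly (\<lambda>x. x\<^sup>2) p = p" by simp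
  have "Polynomial.coeff p k = 0 \<or> Polynomial.coeff p k = 1" for k
  proof -
    have "(Polynomial.coeff p k)\<^sup>2 = Polynomial.coeff p k" using arg_cong[OF pfix, of "\<lambda>p. Polynomial.coeff p k"] by (simp add: coeff_map_poly)
    then have "Polynomial.coeff p k * (Polynomial.coeff p k + 1) = 0" by (simp add: power2_eq_square distrib_left)
    then show ?thesis by auto
  qed
  then have "B (Polynomial.coeff p k) = Polynomial.coeff p k" for k using B0 one by metis
  then have "map_poly B p = p" by (intro poly_eqI) (simp add: coeff_map_poly B0)
  moreover have "poly p gen = 0"
    unfolding p_def poly_prod by (rule prod_zero) (auto intro!: bexI[of _ 0] simp: n_def)
  ultimately have "poly p (B gen) = 0" using B.poly_map_poly[of p gen] B0 by simp
  then obtain j where j: "j < n" "B gen = gen ^ (2 ^ j)" unfolding p_def poly_prod by (auto simp: add.commute)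
  have Bp: "B (x ^ k) = B x ^ k" for x k by (induction k) (simp_all add: one mult)
  have "B x = x ^ (2 ^ j)" for x
  proof (cases "x = 0")
    case False
    then obtain i where "x = gen ^ i" using gen(2) by blast
    then show ?thesis using j Bp by (simp add: power_mult[symmetric] mult.commute)
  qed (simp add: B0)
  with j show ?thesis by blast
qed

end

section \<open>Bruhat decomposition of the Suzuki group in coordinates\<close>

text \<open>
  The matrix groups give an instance with \<open>u a b = suzuki_S f a b\<close>, \<open>h k = suzuki_M f (inverse k)\<close>
  and \<open>w = suzuki_T\<close>. The group itself is allowed to be larger than the Suzuki group \<open>Sz\<close>, so that
  extensions by field automorphisms are instances, too.
\<close>

locale suzuki = fin_group G + suzuki_field f F
  for G (structure) and f and F :: "'k::{field,finite} itself" +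
  fixes u :: "'k \<Rightarrow> 'k \<Rightarrow> 'a" and h :: "'k \<Rightarrow> 'a" and w :: 'a
  assumes u_closed [simp]: "u a b \<in> carrier G"
    and h_closed [simp]: "k \<noteq> 0 \<Longrightarrow> h k \<in> carrier G"
    and w_closed [simp]: "w \<in> carrier G"
    and u_mult: "u a b \<otimes> u c d = u (a + c) (b + d + th a * c)"
    and h_mult: "k \<noteq> 0 \<Longrightarrow> l \<noteq> 0 \<Longrightarrow> h k \<otimes> h l = h (k * l)"
    and h_u: "k \<noteq> 0 \<Longrightarrow> h k \<otimes> u a b = u (k * a) (k * th k * b) \<otimes> h k"
    and w_w: "w \<otimes> w = \<one>"
    and w_h: "k \<noteq> 0 \<Longrightarrow> w \<otimes> h k = h (inverse k) \<otimes> w"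
    and rel: "a \<noteq> 0 \<or> b \<noteq> 0 \<Longrightarrow> \<exists>a' b' k a'' b''. k \<noteq> 0 \<and> w \<otimes> u a b \<otimes> w = u a' b' \<otimes> h k \<otimes> w \<otimes> u a'' b''"
    and uh_inj: "k \<noteq> 0 \<Longrightarrow> l \<noteq> 0 \<Longrightarrow> u a b \<otimes> h k = u c d \<otimes> h l \<Longrightarrow> a = c \<and> b = d \<and> k = l"
    and w_notin: "k \<noteq> 0 \<Longrightarrow> w \<noteq> u a b \<otimes> h k"
begin

lemma inv_left: "x \<in> carrier G \<Longrightarrow> y \<in> carrier G \<Longrightarrow> inv x \<otimes> (x \<otimes> y) = y"
  and left_inv: "x \<in> carrier G \<Longrightarrow> y \<in> carrier G \<Longrightarrow> x \<otimes> (inv x \<otimes> y) = y"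
  by (simp_all add: m_assoc[symmetric])

lemma cancel_both:
  "b \<in> carrier G \<Longrightarrow> x \<in> carrier G \<Longrightarrow> v \<in> carrier G \<Longrightarrow> inv b \<otimes> (b \<otimes> x \<otimes> v) \<otimes> inv v = x"
  by (simp add: m_assoc inv_left)

lemma u_0 [simp]: "u 0 0 = \<one>"
proof -
  have "u 0 0 \<otimes> u 0 0 = u 0 0" by (simp add: u_mult)
  then show ?thesis by (metis l_cancel_one u_closed)
qed

lemma h_1 [simp]: "h 1 = \<one>"
proof -
  have "h 1 \<otimes> h 1 = h 1" by (simp add: h_mult)
  then show ?thesis by (metis l_cancel_one h_closed zero_neq_one)
qed

lemma assoc2: 
  assumes "x \<in> carrier G"
  shows "u a b \<otimes> (u c d \<otimes> x) = u (a + c) (b + d + th a * c) \<otimes> x"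
    "k \<noteq> 0 \<Longrightarrow> l \<noteq> 0 \<Longrightarrow> h k \<otimes> (h l \<otimes> x) = h (k * l) \<otimes> x"
    "k \<noteq> 0 \<Longrightarrow> h k \<otimes> (u a b \<otimes> x) = u (k * a) (k * th k * b) \<otimes> (h k \<otimes> x)"
    "w \<otimes> (w \<otimes> x) = x"
    "k \<noteq> 0 \<Longrightarrow> w \<otimes> (h k \<otimes> x) = h (inverse k) \<otimes> (w \<otimes> x)"
  using assms by (simp_all add: m_assoc[symmetric] u_mult h_mult h_u w_w w_h)

lemmas nf = m_assoc assoc2 u_mult h_mult h_u w_w w_h

lemma inv_u: "inv (u a b) = u a (b + a * th a)"
  by (rule inv_equality) (simp_all add: u_mult mult.commute add_ac)

lemma inv_h: "k \<noteq> 0 \<Longrightarrow> inv (h k) = h (inverse k)"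
  by (rule inv_equality) (simp_all add: h_mult)

lemma inv_w [simp]: "inv w = w" by (rule inv_equality) (simp_all add: w_w)

lemma u_inj: "u a b = u c d \<longleftrightarrow> a = c \<and> b = d"
  using uh_inj[of 1 1 a b c d] by auto

lemma u_eq_one: "u a b = \<one> \<longleftrightarrow> a = 0 \<and> b = 0"
  using u_inj[of a b 0 0] by simp

lemma h_inj: "k \<noteq> 0 \<Longrightarrow> l \<noteq> 0 \<Longrightarrow> h k = h l \<longleftrightarrow> k = l"
  using uh_inj[of k l 0 0 0 0] by auto

lemma u_ne_h: "k \<noteq> 0 \<Longrightarrow> k \<noteq> 1 \<Longrightarrow> u a b \<noteq> h k"
  using uh_inj[of 1 k a b 0 0] by auto

text \<open>P is the Sylow 2-subgroup, B its normaliser and C the big Bruhat cell; B and C together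
  form \<open>Sz\<close>, the Suzuki group inside the possibly larger group G.\<close>

definition P where "P = range (\<lambda>(a,b). u a b)"
definition B where "B = {u a b \<otimes> h k | a b k. k \<noteq> 0}"
definition C where "C = {u a b \<otimes> h k \<otimes> w \<otimes> u c d | a b k c d. k \<noteq> 0}"
definition Sz where "Sz = B \<union> C"

lemma BI: "k \<noteq> 0 \<Longrightarrow> u a b \<otimes> h k \<in> B" unfolding B_def by blast
lemma CI: "k \<noteq> 0 \<Longrightarrow> u a b \<otimes> h k \<otimes> w \<otimes> u c d \<in> C" unfolding C_def by blast
lemma BE: "x \<in> B \<Longrightarrow> (\<And>a b k. k \<noteq> 0 \<Longrightarrow> x = u a b \<otimes> h k \<Longrightarrow> thesis) \<Longrightarrow> thesis" unfolding B_def by blast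
lemma CE: "x \<in> C \<Longrightarrow> (\<And>a b k c d. k \<noteq> 0 \<Longrightarrow> x = u a b \<otimes> h k \<otimes> w \<otimes> u c d \<Longrightarrow> thesis) \<Longrightarrow> thesis" unfolding C_def by blast

lemma B_carrier: "x \<in> B \<Longrightarrow> x \<in> carrier G" by (auto elim: BE)
lemma C_carrier: "x \<in> C \<Longrightarrow> x \<in> carrier G" by (auto elim: CE)
lemma Sz_carrier: "x \<in> Sz \<Longrightarrow> x \<in> carrier G" using B_carrier C_carrier unfolding Sz_def by auto

lemma u_B: "u a b \<in> B" using BI[of 1 a b] by simp
lemma h_B: "k \<noteq> 0 \<Longrightarrow> h k \<in> B" using BI[of k 0 0] by simp
lemma w_C: "w \<in> C" using CI[of 1 0 0 0 0] by simp

lemma B_mult: "x \<in> B \<Longrightarrow> y \<in> B \<Longrightarrow> x \<otimes> y \<in> B"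
proof (elim BE)
  fix a b k c d l assume "k \<noteq> (0::'k)" "l \<noteq> (0::'k)" "x = u a b \<otimes> h k" "y = u c d \<otimes> h l"
  then have "x \<otimes> y = u (a + k * c) (b + k * th k * d + th a * (k * c)) \<otimes> h (k * l)" by (simp add: nf)
  then show ?thesis using BI[of "k * l"] \<open>k \<noteq> 0\<close> \<open>l \<noteq> 0\<close> by simp
qed

lemma inv_uh: "k \<noteq> 0 \<Longrightarrow> inv (u a b \<otimes> h k) = h (inverse k) \<otimes> u a (b + a * th a)"
  by (simp add: inv_mult_group inv_u inv_h)

lemma B_inv: "x \<in> B \<Longrightarrow> inv x \<in> B"
  by (elim BE) (simp add: inv_uh B_mult h_B u_B)

lemma subgroup_B: "subgroup B G"
  by (rule subgroupI) (use B_carrier u_B B_mult B_inv in auto)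

lemma BC: "x \<in> B \<Longrightarrow> y \<in> C \<Longrightarrow> x \<otimes> y \<in> C"
proof (elim BE CE)
  fix a b k c d l a' b' assume "k \<noteq> (0::'k)" "l \<noteq> (0::'k)" "x = u a b \<otimes> h k" "y = u c d \<otimes> h l \<otimes> w \<otimes> u a' b'"
  then have "x \<otimes> y = u (a + k * c) (b + k * th k * d + th a * (k * c)) \<otimes> h (k * l) \<otimes> w \<otimes> u a' b'" by (simp add: nf)
  then show ?thesis using CI[of "k * l"] \<open>k \<noteq> 0\<close> \<open>l \<noteq> 0\<close> by simp
qed

lemma u_h_swap: "k \<noteq> 0 \<Longrightarrow> u a b \<otimes> h k = h k \<otimes> u (a / k) (b / (k * th k))"
  by (simp add: h_u)

lemma CB: "y \<in> C \<Longrightarrow> x \<in> B \<Longrightarrow> y \<otimes> x \<in> C"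
proof (elim BE CE)
  fix a b k c d l a' b' assume l: "l \<noteq> (0::'k)" and k: "k \<noteq> (0::'k)" and y: "y = u c d \<otimes> h l \<otimes> w \<otimes> u a' b'" and x: "x = u a b \<otimes> h k"
  let ?e = "(a' + a) / k" and ?g = "(b' + b + th a' * a) / (k * th k)"
  have "y \<otimes> x = u c d \<otimes> h l \<otimes> w \<otimes> ((u a' b' \<otimes> u a b) \<otimes> h k)" unfolding x y using k l by (simp add: m_assoc)
  also have "\<dots> = u c d \<otimes> h l \<otimes> w \<otimes> (h k \<otimes> u ?e ?g)" unfolding u_mult u_h_swap[OF k] ..
  also have "\<dots> = u c d \<otimes> (h l \<otimes> h (inverse k)) \<otimes> w \<otimes> u ?e ?g" using k l by (simp add: m_assoc assoc2(5))
  also have "\<dots> = u c d \<otimes> h (l * inverse k) \<otimes> w \<otimes> u ?e ?g" using k l by (simp add: h_mult)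
  finally show ?thesis using CI[of "l * inverse k"] k l by simp
qed

lemma wuw: "a \<noteq> 0 \<or> b \<noteq> 0 \<Longrightarrow> w \<otimes> u a b \<otimes> w \<in> C"
  using rel[of a b] unfolding C_def by blast

lemma B_C_disjoint: "B \<inter> C = {}"
proof (rule ccontr)
  assume "B \<inter> C \<noteq> {}"
  then obtain x where x: "x \<in> B" "x \<in> C" by blast
  from x(2) obtain a b k c d where k: "k \<noteq> 0" and e: "x = u a b \<otimes> h k \<otimes> w \<otimes> u c d" by (rule CE)
  have "w = inv (u a b \<otimes> h k) \<otimes> x \<otimes> inv (u c d)"
    unfolding e using k by (intro cancel_both[symmetric]) auto
  also have "\<dots> \<in> B" by (intro B_mult B_inv u_B BI k x)
  finally show False using w_notin by (metis BE)
qed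

lemma wuw_B: "w \<otimes> u a b \<otimes> w \<in> B \<longleftrightarrow> a = 0 \<and> b = 0"
proof
  assume "w \<otimes> u a b \<otimes> w \<in> B"
  then show "a = 0 \<and> b = 0" using wuw[of a b] B_C_disjoint by auto
next
  assume "a = 0 \<and> b = 0"
  then show "w \<otimes> u a b \<otimes> w \<in> B" using u_B[of 0 0] by (simp add: w_w)
qed

lemma C_w: "x \<in> C \<Longrightarrow> x \<otimes> w \<in> Sz"
proof (elim CE)
  fix a b k c d assume k: "k \<noteq> (0::'k)" and e: "x = u a b \<otimes> h k \<otimes> w \<otimes> u c d"
  have x: "x \<otimes> w = (u a b \<otimes> h k) \<otimes> (w \<otimes> u c d \<otimes> w)" unfolding e using k by (simp add: m_assoc)
  show ?thesis
  proof (cases "c = 0 \<and> d = 0")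
    case True
    then have "w \<otimes> u c d \<otimes> w \<in> B" by (rule wuw_B[THEN iffD2])
    then show ?thesis unfolding x using B_mult[OF BI[OF k]] by (simp add: Sz_def)
  next
    case False
    then show ?thesis unfolding x using BC[OF BI[OF k] wuw[of c d]] by (simp add: Sz_def)
  qed
qed

text \<open>It is enough that \<open>Sz\<close> is stable under right multiplication by B and by w,
  because every element of C is a product of such factors. Stability under w rests on the relation
  that places w u w in the big cell.\<close>

lemma Sz_mult: assumes "x \<in> Sz" "y \<in> Sz" shows "x \<otimes> y \<in> Sz"
proof -
  have SB: "x \<otimes> b \<in> Sz" if "x \<in> Sz" "b \<in> B" for x b
    using that B_mult CB unfolding Sz_def by blast
  have Sw: "x \<otimes> w \<in> Sz" if "x \<in> Sz" for x
  proof (cases "x \<in> B")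
    case True
    then show ?thesis using BC[OF _ w_C] by (simp add: Sz_def)
  qed (use that C_w in \<open>auto simp: Sz_def\<close>)
  show ?thesis
  proof (cases "y \<in> B")
    case False
    then have "y \<in> C" using assms by (simp add: Sz_def)
    then obtain a b k c d where k: "k \<noteq> 0" and e: "y = u a b \<otimes> h k \<otimes> w \<otimes> u c d" by (rule CE)
    have "x \<otimes> y = x \<otimes> (u a b \<otimes> h k) \<otimes> w \<otimes> u c d" unfolding e using k Sz_carrier[OF assms(1)] by (simp add: m_assoc)
    then show ?thesis using SB[OF Sw[OF SB[OF assms(1) BI[OF k]]] u_B] by simp
  qed (use SB assms in auto)
qed

lemma Sz_inv: "x \<in> Sz \<Longrightarrow> inv x \<in> Sz"
proof (cases "x \<in> B")
  case False
  assume "x \<in> Sz"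
  with False have "x \<in> C" by (simp add: Sz_def)
  then obtain a b k c d where k: "k \<noteq> 0" and e: "x = u a b \<otimes> h k \<otimes> w \<otimes> u c d" by (rule CE)
  have "inv x = inv (u c d) \<otimes> w \<otimes> inv (u a b \<otimes> h k)" unfolding e using k by (simp add: inv_mult_group m_assoc)
  moreover have "inv (u c d) \<in> Sz" "w \<in> Sz" "inv (u a b \<otimes> h k) \<in> Sz"
    using B_inv[OF u_B] w_C B_inv[OF BI[OF k]] by (auto simp: Sz_def)
  ultimately show ?thesis using Sz_mult by simp
qed (auto simp: Sz_def B_inv)

lemma subgroup_Sz: "subgroup Sz G"
  by (rule subgroupI) (use Sz_carrier w_C Sz_mult Sz_inv in \<open>auto simp: Sz_def\<close>)

lemma u_Sz [simp]: "u a b \<in> Sz" using u_B by (simp add: Sz_def)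
lemma h_Sz [simp]: "k \<noteq> 0 \<Longrightarrow> h k \<in> Sz" using h_B by (simp add: Sz_def)
lemma w_Sz [simp]: "w \<in> Sz" using w_C by (simp add: Sz_def)
lemma one_Sz [simp]: "\<one> \<in> Sz" using subgroup.one_closed[OF subgroup_Sz] .

text \<open>Cancelling the outer factors leaves w v w in B with v in P, which forces v = 1; the rest
  is uniqueness of coordinates in B.\<close>

lemma C_inj:
  assumes "k \<noteq> 0" "l \<noteq> 0" "u a b \<otimes> h k \<otimes> w \<otimes> u c d = u a' b' \<otimes> h l \<otimes> w \<otimes> u c' d'"
  shows "a = a' \<and> b = b' \<and> k = l \<and> c = c' \<and> d = d'"
proof -
  let ?x = "u a b \<otimes> h k" and ?y = "u a' b' \<otimes> h l"
  have e: "w \<otimes> (u c d \<otimes> inv (u c' d')) \<otimes> w = inv ?x \<otimes> ?y"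
  proof -
    have c: "?x \<in> carrier G" "?y \<in> carrier G" using assms(1,2) by auto
    have "inv ?x \<otimes> (?x \<otimes> w \<otimes> u c d) \<otimes> inv (u c' d') \<otimes> w = inv ?x \<otimes> (?y \<otimes> w \<otimes> u c' d') \<otimes> inv (u c' d') \<otimes> w"
      using assms(3) by simp
    moreover have "inv X \<otimes> (X \<otimes> w \<otimes> V) \<otimes> inv V' \<otimes> w = w \<otimes> (V \<otimes> inv V') \<otimes> w"
      if "X \<in> carrier G" "V \<in> carrier G" "V' \<in> carrier G" for X V V' using that by (simp add: m_assoc inv_left)
    moreover have "inv X \<otimes> (Y \<otimes> w \<otimes> V) \<otimes> inv V \<otimes> w = inv X \<otimes> Y"
      if "X \<in> carrier G" "Y \<in> carrier G" "V \<in> carrier G" for X Y V using that by (simp add: m_assoc left_inv w_w)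
    ultimately show ?thesis using c by (metis u_closed)
  qed
  obtain g i where gi: "u c d \<otimes> inv (u c' d') = u g i" unfolding inv_u u_mult by blast
  have "w \<otimes> u g i \<otimes> w \<in> B" using e gi B_mult[OF B_inv[OF BI[OF assms(1)]] BI[OF assms(2)]] by simp
  then have "u c d \<otimes> inv (u c' d') = \<one>" using gi by (simp add: wuw_B)
  then have cd: "u c d = u c' d'" by (metis inv_closed inv_equality inv_inv u_closed)
  then have "?x \<otimes> w \<otimes> u c d = ?y \<otimes> w \<otimes> u c d" using assms(3) by simp
  then have "?x = ?y" using assms(1,2) by simp
  then show ?thesis using uh_inj[OF assms(1,2)] cd u_inj by blast
qed

lemma bij_P: "bij_betw (\<lambda>(a,b). u a b) UNIV P"
  unfolding P_def by (rule inj_on_imp_bij_betw) (auto simp: inj_on_def u_inj)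

lemma bij_B: "bij_betw (\<lambda>((a,b),k). u a b \<otimes> h k) (UNIV \<times> {k. k \<noteq> 0}) B"
  unfolding bij_betw_def
proof
  show "inj_on (\<lambda>((a, b), k). u a b \<otimes> h k) (UNIV \<times> {k. k \<noteq> 0})"
  proof (rule inj_onI)
    fix x y assume xy: "x \<in> UNIV \<times> {k. k \<noteq> 0}" "y \<in> UNIV \<times> {k. k \<noteq> 0}"
      "(case x of (x, xa) \<Rightarrow> (case x of (a, b) \<Rightarrow> \<lambda>k. u a b \<otimes> h k) xa) = (case y of (x, xa) \<Rightarrow> (case x of (a, b) \<Rightarrow> \<lambda>k. u a b \<otimes> h k) xa)"
    obtain a b k where x: "x = ((a,b),k)" by (metis surj_pair)
    obtain a' b' l where y: "y = ((a',b'),l)" by (metis surj_pair)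
    show "x = y" using xy uh_inj[of k l a b a' b'] unfolding x y by simp
  qed
qed (auto simp: B_def image_iff; blast)

lemma bij_C: "bij_betw (\<lambda>(((a,b),k),(c,d)). u a b \<otimes> h k \<otimes> w \<otimes> u c d) ((UNIV \<times> {k. k \<noteq> 0}) \<times> UNIV) C"
  unfolding bij_betw_def
proof
  show "inj_on (\<lambda>(((a,b),k),(c,d)). u a b \<otimes> h k \<otimes> w \<otimes> u c d) ((UNIV \<times> {k. k \<noteq> 0}) \<times> UNIV)"
  proof (rule inj_onI)
    fix x y assume xy: "x \<in> (UNIV \<times> {k. k \<noteq> 0}) \<times> UNIV" "y \<in> (UNIV \<times> {k. k \<noteq> 0}) \<times> UNIV"
      "(case x of (x, xa) \<Rightarrow> (case x of (x, xa) \<Rightarrow> (case x of (a, b) \<Rightarrow> \<lambda>k (c, d). u a b \<otimes> h k \<otimes> w \<otimes> u c d) xa) xa) =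
       (case y of (x, xa) \<Rightarrow> (case x of (x, xa) \<Rightarrow> (case x of (a, b) \<Rightarrow> \<lambda>k (c, d). u a b \<otimes> h k \<otimes> w \<otimes> u c d) xa) xa)"
    obtain a b k c d where x: "x = (((a,b),k),(c,d))" by (metis surj_pair)
    obtain a' b' l c' d' where y: "y = (((a',b'),l),(c',d'))" by (metis surj_pair)
    show "x = y" using xy C_inj[of k l a b c d a' b' c' d'] unfolding x y by simp
  qed
qed (auto simp: C_def image_iff; blast)

lemma card_nz: "card {k::'k. k \<noteq> 0} = q - 1"
proof -
  have "{x::'k. x \<noteq> 0} = UNIV - {0}" by auto
  then show ?thesis by (simp add: card_Diff_singleton card_UNIV_q)
qed

lemma card_P: "card P = q\<^sup>2"
  using bij_betw_same_card[OF bij_P] by (simp add: card_UNIV_q power2_eq_square flip: UNIV_Times_UNIV)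

lemma card_B: "card B = q\<^sup>2 * (q - 1)"
  using bij_betw_same_card[OF bij_B] by (simp add: card_UNIV_q card_nz card_cartesian_product power2_eq_square flip: UNIV_Times_UNIV)

lemma card_C: "card C = q\<^sup>2 * (q - 1) * q\<^sup>2"
  using bij_betw_same_card[OF bij_C] by (simp add: card_UNIV_q card_nz card_cartesian_product power2_eq_square flip: UNIV_Times_UNIV)

lemma card_Sz: "card Sz = q\<^sup>2 * (q - 1) * (q\<^sup>2 + 1)"
proof -
  have "finite B" "finite C" using bij_betw_finite[OF bij_B] bij_betw_finite[OF bij_C] by simp_all
  then show ?thesis unfolding Sz_def by (subst card_Un_disjoint) (simp_all add: B_C_disjoint card_B card_C)
qed

subsection \<open>Conjugacy\<close>

lemma conj_eqI: "g \<in> carrier G \<Longrightarrow> x \<in> carrier G \<Longrightarrow> y \<in> carrier G \<Longrightarrow> g \<otimes> x = y \<otimes> g \<Longrightarrow> g \<otimes> x \<otimes> inv g = y"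
  by (simp add: m_assoc)

lemma conj_u: "k \<noteq> 0 \<Longrightarrow> (u a b \<otimes> h k) \<otimes> u c d \<otimes> inv (u a b \<otimes> h k) =
    u (k * c) (k * th k * d + th a * (k * c) + th (k * c) * a)"
proof -
  assume k: "k \<noteq> 0"
  have "(u a b \<otimes> h k) \<otimes> u c d = u (k * c) (k * th k * d + th a * (k * c) + th (k * c) * a) \<otimes> (u a b \<otimes> h k)"
    using k by (simp add: nf add_ac mult_ac)
  then show ?thesis using k by (intro conj_eqI) simp_all
qed

lemma conj_h: "k \<noteq> 0 \<Longrightarrow> l \<noteq> 0 \<Longrightarrow> (u a b \<otimes> h k) \<otimes> h l \<otimes> inv (u a b \<otimes> h k) =
    u (a + l * a) (b + l * th l * (b + a * th a) + th a * (l * a)) \<otimes> h l"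
proof -
  assume k: "k \<noteq> 0" "l \<noteq> 0"
  have "u (a + l * a) (b + l * th l * (b + a * th a) + th a * (l * a)) \<otimes> h l \<otimes> (u a b \<otimes> h k) = (u a b \<otimes> h k) \<otimes> h l"
    using k by (simp add: nf algebra_simps)
  then show ?thesis using k by (intro conj_eqI) simp_all
qed

text \<open>Conjugation by w keeps a product of a unipotent and a torus element in B only if the
  unipotent factor is trivial, since otherwise w u w lies in the big cell. So an element of B that
  an element of C conjugates back into B is conjugate under P to a torus element, and w inverts the
  latter.\<close>

lemma conj_C_unipotent:
  assumes g: "g \<in> C" and x: "x \<in> B" and r: "g \<otimes> x \<otimes> inv g \<in> B"
  obtains a b k c d l where "k \<noteq> 0" "l \<noteq> 0" "g = u a b \<otimes> h k \<otimes> w \<otimes> u c d" "u c d \<otimes> x \<otimes> inv (u c d) = h l"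
    "g \<otimes> x \<otimes> inv g = (u a b \<otimes> h k) \<otimes> h (inverse l) \<otimes> inv (u a b \<otimes> h k)"
proof -
  obtain a b k c d where k: "k \<noteq> 0" and e: "g = u a b \<otimes> h k \<otimes> w \<otimes> u c d" using g by (rule CE)
  have "u c d \<otimes> x \<otimes> inv (u c d) \<in> B" by (intro B_mult B_inv u_B x)
  then obtain a' b' l where l: "l \<noteq> 0" and y: "u c d \<otimes> x \<otimes> inv (u c d) = u a' b' \<otimes> h l" by (rule BE)
  let ?X = "u a b \<otimes> h k"
  have c: "?X \<in> carrier G" "x \<in> carrier G" using k B_carrier[OF x] by auto
  have "inv g = inv (u c d) \<otimes> w \<otimes> inv ?X" unfolding e using k by (simp add: inv_mult_group m_assoc)
  then have gx: "g \<otimes> x \<otimes> inv g = ?X \<otimes> (w \<otimes> (u c d \<otimes> x \<otimes> inv (u c d)) \<otimes> w) \<otimes> inv ?X"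
    unfolding e using c k by (simp add: m_assoc)
  have "inv ?X \<otimes> (g \<otimes> x \<otimes> inv g) \<otimes> ?X \<in> B" by (intro B_mult B_inv r BI k)
  moreover have "inv ?X \<otimes> (?X \<otimes> Y \<otimes> inv ?X) \<otimes> ?X = Y" if "Y \<in> carrier G" for Y
    using cancel_both[OF c(1) that inv_closed[OF c(1)]] c(1) by simp
  ultimately have "w \<otimes> (u a' b' \<otimes> h l) \<otimes> w \<in> B" unfolding gx y using l by simp
  moreover have e2: "w \<otimes> (u a' b' \<otimes> h l) \<otimes> w = (w \<otimes> u a' b' \<otimes> w) \<otimes> h (inverse l)"
    using l by (simp add: m_assoc assoc2 w_h)
  ultimately have "(w \<otimes> u a' b' \<otimes> w) \<otimes> h (inverse l) \<in> B" by simp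
  then have "(w \<otimes> u a' b' \<otimes> w) \<otimes> h (inverse l) \<otimes> inv (h (inverse l)) \<in> B"
    by (rule B_mult) (use l in \<open>simp add: B_inv h_B\<close>)
  then have "w \<otimes> u a' b' \<otimes> w \<in> B" using l by (simp add: m_assoc)
  then have z: "a' = 0" "b' = 0" by (simp_all add: wuw_B)
  show ?thesis
    by (rule that[OF k l e]) (use y z l gx e2 w_w in \<open>simp_all\<close>)
qed

text \<open>The order of the centraliser of x if x and y are conjugate, and 0 otherwise: the
  right-hand side of column orthogonality.\<close>

definition ncj :: "'a \<Rightarrow> 'a \<Rightarrow> nat" where "ncj x y = card {g \<in> Sz. g \<otimes> x \<otimes> inv g = y}"

lemma conj_unipotent_B:
  assumes g: "g \<in> Sz" and x: "c \<noteq> 0 \<or> d \<noteq> 0" and r: "g \<otimes> u c d \<otimes> inv g \<in> B"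
  shows "g \<in> B"
proof (rule ccontr)
  assume "g \<notin> B"
  then have "g \<in> C" using g by (simp add: Sz_def)
  then obtain a' b' l where l: "l \<noteq> 0" "u a' b' \<otimes> u c d \<otimes> inv (u a' b') = h l"
    using conj_C_unipotent[OF _ u_B r] by metis
  have "u a' b' \<otimes> u c d \<otimes> inv (u a' b') = u c (d + th a' * c + th c * a')" using conj_u[of 1 a' b' c d] by simp
  then have "u c (d + th a' * c + th c * a') = h l" using l by simp
  then have "u c (d + th a' * c + th c * a') \<otimes> h 1 = u 0 0 \<otimes> h l" using l by simp
  then have "c = 0 \<and> d + th a' * c + th c * a' = 0" using uh_inj l(1) by (metis zero_neq_one)
  with x show False by auto
qed

text \<open>The torus and its coset by w make up its normaliser. An element of B carrying a
  non-trivial torus element into the torus has no unipotent part, because 1 + k and 1 + k * th k are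
  nonzero; elements of C reduce to this case.\<close>

lemma conj_h_B:
  assumes g: "g \<in> Sz" and k: "k \<noteq> 0" "k \<noteq> 1" "l \<noteq> 0"
  shows "g \<otimes> h k \<otimes> inv g = h l \<longleftrightarrow> (\<exists>i. i \<noteq> 0 \<and> (g = h i \<and> k = l \<or> g = h i \<otimes> w \<and> inverse k = l))"
proof
  have fix_h: "a = 0 \<and> b = 0 \<and> k = l" if i: "i \<noteq> 0" and k: "k \<noteq> 0" "k \<noteq> 1" and l: "l \<noteq> 0" and e: "(u a b \<otimes> h i) \<otimes> h k \<otimes> inv (u a b \<otimes> h i) = h l" for a b i k l
  proof -
    have "u (a + k * a) (b + k * th k * (b + a * th a) + th a * (k * a)) \<otimes> h k = u 0 0 \<otimes> h l"
      using e unfolding conj_h[OF i k(1)] using l by simp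
    from uh_inj[OF k(1) l this]
    have z: "a + k * a = 0" "b + k * th k * (b + a * th a) + th a * (k * a) = 0" "k = l" by blast+
    have "(1 + k) * a = 0" using z(1) by (simp add: distrib_right del: add_eq_0)
    then have a: "a = 0" using k by auto
    have "(1 + k * th k) * b = 0" using z(2) a by (simp add: distrib_right del: add_eq_0)
    then have "b = 0" using k mult_th_eq_1[of k] by auto
    with a z show ?thesis by simp
  qed
  assume e: "g \<otimes> h k \<otimes> inv g = h l"
  show "\<exists>i. i \<noteq> 0 \<and> (g = h i \<and> k = l \<or> g = h i \<otimes> w \<and> inverse k = l)"
  proof (cases "g \<in> B")
    case True
    then obtain a b i where i: "i \<noteq> 0" "g = u a b \<otimes> h i" by (rule BE)
    then have "a = 0 \<and> b = 0 \<and> k = l" using fix_h[OF i(1) k(1,2,3), of a b] e by simp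
    then show ?thesis using i by (intro exI[of _ i]) simp
  next
    case False
    then have "g \<in> C" using g by (simp add: Sz_def)
    moreover have "g \<otimes> h k \<otimes> inv g \<in> B" using e h_B k by simp
    ultimately obtain a b i c d j where ij: "i \<noteq> 0" "j \<noteq> 0" "g = u a b \<otimes> h i \<otimes> w \<otimes> u c d" "u c d \<otimes> h k \<otimes> inv (u c d) = h j"
      "g \<otimes> h k \<otimes> inv g = (u a b \<otimes> h i) \<otimes> h (inverse j) \<otimes> inv (u a b \<otimes> h i)"
      using conj_C_unipotent[of g "h k"] h_B[OF k(1)] by metis
    have cd: "c = 0" "d = 0" "k = j" using fix_h[of 1 k j c d] ij k by auto
    have "inverse j \<noteq> 0" "inverse j \<noteq> 1" using ij cd k by auto
    then have "a = 0" "b = 0" "inverse j = l" using fix_h[of i "inverse j" l a b] ij e k by auto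
    then show ?thesis using ij cd by auto
  qed
next
  assume "\<exists>i. i \<noteq> 0 \<and> (g = h i \<and> k = l \<or> g = h i \<otimes> w \<and> inverse k = l)"
  then obtain i where i: "i \<noteq> 0" "g = h i \<and> k = l \<or> g = h i \<otimes> w \<and> inverse k = l" by blast
  then show "g \<otimes> h k \<otimes> inv g = h l"
  proof (elim disjE conjE)
    assume "g = h i" "k = l"
    then show ?thesis using i k by (simp add: inv_h h_mult) (simp add: field_simps)
  next
    assume "g = h i \<otimes> w" "inverse k = l"
    then show ?thesis using i k by (simp add: inv_mult_group inv_h m_assoc assoc2 w_h w_w h_mult) (simp add: field_simps)
  qed
qed

lemma ncj_h: assumes "k \<noteq> 0" "k \<noteq> 1" "l \<noteq> 0"
  shows "ncj (h k) (h l) = (q - 1) * ((if k = l then 1 else 0) + (if inverse k = l then 1 else 0))"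
proof -
  have "{g \<in> Sz. g \<otimes> h k \<otimes> inv g = h l} =
     (if k = l then h ` {i. i \<noteq> 0} else {}) \<union> (if inverse k = l then (\<lambda>i. h i \<otimes> w) ` {i. i \<noteq> 0} else {})"
    using conj_h_B[OF _ assms] Sz_mult[OF h_Sz w_Sz] by auto
  moreover have "card (h ` {i. i \<noteq> 0}) = q - 1" by (subst card_image) (auto simp: inj_on_def h_inj card_nz)
  moreover have "card ((\<lambda>i. h i \<otimes> w) ` {i. i \<noteq> 0}) = q - 1" by (subst card_image) (auto simp: inj_on_def h_inj card_nz)
  moreover have "k \<noteq> inverse k"
  proof
    assume "k = inverse k"
    then have "k\<^sup>2 = 1" using assms(1) by (metis power2_eq_square right_inverse)
    then have "(k + 1) ^ (2 ^ 1) = 0" unfolding frob_add by simp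
    then show False using assms(2) by simp
  qed
  ultimately show ?thesis unfolding ncj_def by (auto split: if_splits)
qed

text \<open>Class representatives of the involutions and of the elements of order four; the latter
  form two classes, interchanged by inversion.\<close>

abbreviation "ze \<equiv> u 0 1"
abbreviation "e1 \<equiv> u 1 0"
abbreviation "e2 \<equiv> u 1 1"

lemma inv_ze: "inv ze = ze" and inv_e1: "inv e1 = e2" and inv_e2: "inv e2 = e1" by (simp_all add: inv_u)

lemma ncj_one: "ncj \<one> x = (if x = \<one> then card Sz else 0)"
proof -
  have "{g \<in> Sz. g \<otimes> \<one> \<otimes> inv g = x} = (if x = \<one> then Sz else {})" using Sz_carrier by auto
  then show ?thesis by (simp add: ncj_def)
qed

lemma ncj_u:
  assumes "c \<noteq> 0 \<or> d \<noteq> 0"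
  shows "ncj (u c d) (u c' d') = card {((a::'k,b::'k),k). k \<noteq> 0 \<and> k * c = c' \<and> k * th k * d + th a * (k * c) + th (k * c) * a = d'}"
proof -
  let ?F = "\<lambda>((a,b),k). u a b \<otimes> h k"
  let ?X = "{((a::'k,b::'k),k). k \<noteq> 0 \<and> k * c = c' \<and> k * th k * d + th a * (k * c) + th (k * c) * a = d'}"
  have "{g \<in> Sz. g \<otimes> u c d \<otimes> inv g = u c' d'} = ?F ` ?X"
  proof (intro subset_antisym subsetI)
    fix g assume "g \<in> {g \<in> Sz. g \<otimes> u c d \<otimes> inv g = u c' d'}"
    then have g: "g \<in> Sz" "g \<otimes> u c d \<otimes> inv g = u c' d'" by auto
    then have "g \<in> B" using conj_unipotent_B[OF g(1) assms] u_B by simp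
    then obtain a b k where k: "k \<noteq> 0" "g = u a b \<otimes> h k" by (rule BE)
    then show "g \<in> ?F ` ?X" using g(2) conj_u[OF k(1)] u_inj by (intro image_eqI[of _ _ "((a,b),k)"]) auto
  next
    fix g assume "g \<in> ?F ` ?X"
    then obtain a b k where "k \<noteq> 0" "k * c = c'" "k * th k * d + th a * (k * c) + th (k * c) * a = d'" "g = u a b \<otimes> h k" by auto
    then show "g \<in> {g \<in> Sz. g \<otimes> u c d \<otimes> inv g = u c' d'}" using conj_u[of k a b c d] BI[of k a b] by (simp add: Sz_def del: th_simps(3))
  qed
  moreover have "inj_on ?F ?X" by (rule inj_on_subset[OF bij_betw_imp_inj_on[OF bij_B]]) auto
  ultimately show ?thesis unfolding ncj_def by (simp only: card_image)
qed

lemma ncj_ze: "ncj ze ze = q\<^sup>2" "ncj ze e1 = 0" "ncj ze e2 = 0"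
proof -
  have "ncj ze ze = card {((a::'k,b::'k),k). k \<noteq> 0 \<and> k * th k = 1}" by (subst ncj_u) simp_all
  also have "{((a::'k,b::'k),k). k \<noteq> 0 \<and> k * th k = 1} = (UNIV \<times> UNIV) \<times> {1}" using mult_th_eq_1 by auto
  also have "card \<dots> = q\<^sup>2" by (simp only: card_cartesian_product card_UNIV_q power2_eq_square) simp
  finally show "ncj ze ze = q\<^sup>2" .
qed (subst ncj_u; simp add: case_prod_unfold)+

lemma ncj_u_1: "ncj (u 1 d) (u 1 d') = q * card {a. a + th a = d + d'}"
proof -
  have e: "d + th a + a = d' \<longleftrightarrow> a + th a = d + d'" for a
  proof -
    have "d + th a + a = (a + th a) + d" by (simp only: add_ac)
    then have "d + th a + a = d' \<longleftrightarrow> (a + th a) + d = d'" by (simp only:)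
    also have "\<dots> \<longleftrightarrow> a + th a = d' + d" by (rule add_eq_iff)
    finally show ?thesis by (simp only: add.commute[of d'])
  qed
  have mem: "((a,b),k) \<in> {((a,b),k). k \<noteq> 0 \<and> k * 1 = (1::'k) \<and> k * th k * d + th a * (k * 1) + th (k * 1) * a = d'} \<longleftrightarrow>
     ((a,b),k) \<in> ({a. a + th a = d + d'} \<times> UNIV) \<times> {1}" for a b k
    using e[of a] by (cases "k = 1") simp_all
  have "{((a::'k,b::'k),k). k \<noteq> 0 \<and> k * 1 = (1::'k) \<and> k * th k * d + th a * (k * 1) + th (k * 1) * a = d'} =
     ({a. a + th a = d + d'} \<times> UNIV) \<times> {1}"
  proof (intro Set.set_eqI)
    fix x :: "('k \<times> 'k) \<times> 'k"
    obtain a b k where "x = ((a,b),k)" by (metis surj_pair)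
    then show "x \<in> {((a,b),k). k \<noteq> 0 \<and> k * 1 = (1::'k) \<and> k * th k * d + th a * (k * 1) + th (k * 1) * a = d'} \<longleftrightarrow>
      x \<in> ({a. a + th a = d + d'} \<times> UNIV) \<times> {1}" by (simp only: mem)
  qed
  then have "ncj (u 1 d) (u 1 d') = card (({a. a + th a = d + d'} \<times> (UNIV :: 'k set)) \<times> {1 :: 'k})"
    by (subst ncj_u) (simp_all only:, simp)
  then show ?thesis by (simp only: card_cartesian_product card_UNIV_q) simp
qed

text \<open>Conjugation in P changes the second coordinate of u 1 d by a + th a. These sums lie in
  the kernel of \<open>lam\<close> while lam 1 = -1, so e1 and e2 are not conjugate; the factor 2
  counts the solutions 0 and 1 of a + th a = 0.\<close>

lemma ncj_e: "ncj e1 e1 = 2 * q" "ncj e2 e2 = 2 * q" "ncj e1 e2 = 0" "ncj e2 e1 = 0"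
proof -
  have k: "a + th a = 0 \<longleftrightarrow> a = 0 \<or> a = 1" for a using add_th_eq[of a 0] by (simp del: add_eq_0)
  have z: "{a. a + th a = 0} = {0,1}" unfolding k by auto
  have n1: "a + th a \<noteq> 1" for a
  proof
    assume "a + th a = 1"
    then have "lam (a + th a) = -1" by simp
    then show False unfolding lam_add lam_th by simp
  qed
  have e: "(0::'k) + 0 = 0" "(1::'k) + 1 = 0" "(0::'k) + 1 = 1" "(1::'k) + 0 = 1" by simp_all
  show "ncj e1 e1 = 2 * q" "ncj e2 e2 = 2 * q" unfolding ncj_u_1 e z by simp_all
  show "ncj e1 e2 = 0" "ncj e2 e1 = 0" unfolding ncj_u_1 e using n1 by simp_all
qed

lemma ncj_u_h:
  assumes "c \<noteq> 0 \<or> d \<noteq> 0" "l \<noteq> 0" "l \<noteq> 1"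
  shows "ncj (u c d) (h l) = 0"
proof -
  have "g \<otimes> u c d \<otimes> inv g \<noteq> h l" if g: "g \<in> Sz" for g
  proof
    assume e: "g \<otimes> u c d \<otimes> inv g = h l"
    then have "g \<in> B" using conj_unipotent_B[OF g assms(1)] h_B assms by simp
    then obtain a b k where "k \<noteq> 0" "g = u a b \<otimes> h k" by (rule BE)
    then show False using e conj_u u_ne_h assms by simp
  qed
  then have "{g \<in> Sz. g \<otimes> u c d \<otimes> inv g = h l} = {}" by blast
  then show ?thesis unfolding ncj_def by (simp only: card.empty)
qed

lemma conj_center: "b \<noteq> 0 \<Longrightarrow> \<exists>g\<in>Sz. u 0 b = g \<otimes> ze \<otimes> inv g"
proof -
  assume b: "b \<noteq> 0"
  obtain k where k: "b = k * th k" using bij_mult_th unfolding bij_def surj_def by blast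
  with b have k0: "k \<noteq> 0" by auto
  have "u 0 b = (u 0 0 \<otimes> h k) \<otimes> ze \<otimes> inv (u 0 0 \<otimes> h k)" unfolding conj_u[OF k0] k by simp
  then show ?thesis using k0 by (intro bexI[of _ "u 0 0 \<otimes> h k"]) auto
qed

text \<open>The torus scales the first coordinate to 1 and the second to b / (a * th a); conjugation
  in P then alters the second by an arbitrary value of c + th c, that is, by the kernel of
  \<open>lam\<close>. So \<open>lam\<close> of the scaled coordinate decides the class.\<close>

lemma conj_order_four:
  assumes a: "a \<noteq> 0"
  shows "\<exists>g\<in>Sz. u a b = g \<otimes> (if lam (b / (a * th a)) = 1 then e1 else e2) \<otimes> inv g"
proof -
  define \<epsilon> where "\<epsilon> = (if lam (b / (a * th a)) = 1 then 0 else 1 :: 'k)"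
  have "lam (b / (a * th a) + \<epsilon>) = 1" using lam_cases[of "b / (a * th a)"] by (auto simp: \<epsilon>_def lam_add)
  then have "b / (a * th a) + \<epsilon> \<in> range (\<lambda>c. c + th c)" unfolding range_add_th by simp
  then obtain c where "b / (a * th a) + \<epsilon> = c + th c" by auto
  then have "b / (a * th a) = c + th c + \<epsilon>" by (simp add: add_eq_iff)
  then have c: "b = a * th a * (\<epsilon> + c + th c)" using a by (simp add: field_simps)
  have "u a b = (u (a * c) 0 \<otimes> h a) \<otimes> u 1 \<epsilon> \<otimes> inv (u (a * c) 0 \<otimes> h a)"
    unfolding conj_u[OF a] c by (simp add: algebra_simps)
  moreover have "u 1 \<epsilon> = (if lam (b / (a * th a)) = 1 then e1 else e2)" by (simp add: \<epsilon>_def)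
  ultimately show ?thesis using a Sz_mult by (intro bexI[of _ "u (a * c) 0 \<otimes> h a"]) auto
qed

text \<open>The equations for the conjugating element are linear with coefficients 1 + k and 1 + k *
  th k, both nonzero when k is not 1; the first coordinate is solved before the second.\<close>

lemma conj_semisimple_P:
  assumes k: "k \<noteq> 0" "k \<noteq> 1"
  shows "\<exists>c d. u a b \<otimes> h k = u c d \<otimes> h k \<otimes> inv (u c d)"
proof -
  define c where "c = a / (1 + k)"
  have nz: "1 + k \<noteq> 0" "1 + k * th k \<noteq> 0" using k mult_th_eq_1[of k] by auto
  have "(1 + k) * c = a" using nz(1) unfolding c_def by simp
  then have a: "a = c + k * c" by (simp only: distrib_right mult_1)
  define d where "d = (b + k * th k * (c * th c) + th c * (k * c)) / (1 + k * th k)"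
  have "(1 + k * th k) * d = b + k * th k * (c * th c) + th c * (k * c)" using nz unfolding d_def by simp
  then have "b + (k * th k * (c * th c) + th c * (k * c)) = (1 + k * th k) * d" by (simp only: add.assoc)
  then have "b = (1 + k * th k) * d + (k * th k * (c * th c) + th c * (k * c))" by (rule add_eq_iff[THEN iffD1])
  then have b: "b = d + k * th k * (d + c * th c) + th c * (k * c)" by (simp only: distrib_left distrib_right mult_1 add.assoc)
  have "u a b \<otimes> h k = (u c d \<otimes> h 1) \<otimes> h k \<otimes> inv (u c d \<otimes> h 1)"
    by (subst conj_h) (use k a b in auto)
  then have "u a b \<otimes> h k = u c d \<otimes> h k \<otimes> inv (u c d)" by simp
  then show ?thesis by blast
qed

lemma conj_semisimple:
  assumes "k \<noteq> 0" "k \<noteq> 1"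
  shows "\<exists>g\<in>Sz. u a b \<otimes> h k = g \<otimes> h k \<otimes> inv g"
  using conj_semisimple_P[OF assms, of a b] u_Sz by blast

section \<open>Column orthogonality and summation in coordinates\<close>

abbreviation "SG \<equiv> G\<lparr>carrier := Sz\<rparr>"

sublocale SG: fin_group SG by (rule fin_group_subgroup[OF subgroup_Sz])

lemma inv_SG: "x \<in> Sz \<Longrightarrow> inv\<^bsub>SG\<^esub> x = inv x" by (rule inv_subgroup[OF subgroup_Sz])

lemma Irr_conj_Sz: "\<chi> \<in> Irr SG \<Longrightarrow> x \<in> Sz \<Longrightarrow> g \<in> Sz \<Longrightarrow> \<chi> (g \<otimes> x \<otimes> inv g) = \<chi> x"
  using SG.Irr_conj[of \<chi> x g] inv_SG by simp

lemma Irr_comm_Sz: "\<chi> \<in> Irr SG \<Longrightarrow> x \<in> Sz \<Longrightarrow> y \<in> Sz \<Longrightarrow> \<chi> (x \<otimes> y) = \<chi> (y \<otimes> x)"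
  using SG.Irr_comm[of \<chi> x y] by simp

lemma column_Sz:
  assumes "x \<in> Sz" "y \<in> Sz"
  shows "(\<Sum>\<chi>\<in>Irr SG. \<chi> x * \<chi> (inv y)) = of_nat (ncj y x)"
proof -
  have "{g \<in> Sz. g \<otimes> y \<otimes> inv\<^bsub>SG\<^esub> g = x} = {g \<in> Sz. g \<otimes> y \<otimes> inv g = x}" using inv_SG by auto
  then show ?thesis using SG.column_orthogonality[of x y] assms inv_SG[OF assms(2)] unfolding ncj_def by simp
qed

lemma multiplicity_nat:
  assumes H: "subgroup H G" "H \<subseteq> Sz" and c: "\<chi> \<in> Irr SG" and x: "\<xi> \<in> Irr (G\<lparr>carrier := H\<rparr>)"
  shows "(\<Sum>g\<in>H. \<chi> g * \<xi> (inv g)) / of_nat (card H) \<in> \<nat>"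
proof -
  have HS: "subgroup H SG" by (rule subgroup_incl[OF H(1) subgroup_Sz H(2)])
  have e: "SG\<lparr>carrier := H\<rparr> = G\<lparr>carrier := H\<rparr>" by simp
  have "(\<Sum>g\<in>H. \<chi> g * \<xi> (inv\<^bsub>SG\<^esub> g)) / of_nat (card H) \<in> \<nat>"
  proof -
    obtain m :: "('a \<Rightarrow> complex) \<Rightarrow> nat" where "\<forall>\<xi>\<in>Irr (G\<lparr>carrier := H\<rparr>). (\<Sum>g\<in>H. \<chi> g * \<xi> (inv\<^bsub>SG\<^esub> g)) / of_nat (card H) = of_nat (m \<xi>)"
      using SG.restrict_multiplicity[OF HS c] unfolding e by blast
    then have "(\<Sum>g\<in>H. \<chi> g * \<xi> (inv\<^bsub>SG\<^esub> g)) / of_nat (card H) = of_nat (m \<xi>)" using x by blast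
    then show ?thesis by (simp only: of_nat_in_Nats)
  qed
  moreover have "inv\<^bsub>SG\<^esub> g = inv g" if "g \<in> H" for g using inv_SG H(2) that by auto
  ultimately show ?thesis by simp
qed

lemma u_P [simp]: "u a b \<in> P" unfolding P_def by (rule range_eqI[of _ _ "(a,b)"]) simp

lemma PE: "x \<in> P \<Longrightarrow> (\<And>a b. x = u a b \<Longrightarrow> thesis) \<Longrightarrow> thesis" unfolding P_def by auto

lemma P_mult: "x \<in> P \<Longrightarrow> y \<in> P \<Longrightarrow> x \<otimes> y \<in> P" by (elim PE) (simp add: u_mult)

lemma P_inv: "x \<in> P \<Longrightarrow> inv x \<in> P" by (elim PE) (simp add: inv_u)

lemma subgroup_P: "subgroup P G"
proof (rule subgroupI)
  show "P \<noteq> {}" using u_P by blast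
qed (use P_mult P_inv in \<open>auto elim: PE\<close>)

lemma P_subset: "P \<subseteq> Sz" by (auto elim: PE)
lemma B_subset: "B \<subseteq> Sz" by (auto simp: Sz_def)

definition crd where "crd = inv_into (UNIV \<times> {k. k \<noteq> 0}) (\<lambda>((a,b),k). u a b \<otimes> h k)"

lemma crd [simp]: "k \<noteq> 0 \<Longrightarrow> crd (u a b \<otimes> h k) = ((a,b),k)"
  unfolding crd_def using inv_into_f_f[OF bij_betw_imp_inj_on[OF bij_B], of "((a,b),k)"] by simp

lemma crd_u [simp]: "crd (u a b) = ((a,b),1)"
  using crd[of 1 a b] by simp

lemma sum_P: "(\<Sum>g\<in>P. Fn g) = (\<Sum>a\<in>UNIV. \<Sum>b\<in>UNIV. Fn (u a b))"
  using sum.reindex_bij_betw[OF bij_P, of Fn, symmetric]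
  by (simp add: sum.cartesian_product case_prod_unfold flip: UNIV_Times_UNIV)

lemma sum_B: "(\<Sum>g\<in>B. Fn g) = (\<Sum>k\<in>{k. k \<noteq> 0}. \<Sum>a\<in>UNIV. \<Sum>b\<in>UNIV. Fn (u a b \<otimes> h k))"
proof -
  have "(\<Sum>g\<in>B. Fn g) = (\<Sum>(x,k)\<in>(UNIV \<times> UNIV) \<times> {k. k \<noteq> 0}. Fn (u (fst x) (snd x) \<otimes> h k))"
    using sum.reindex_bij_betw[OF bij_B, of Fn, symmetric] by (simp add: case_prod_unfold)
  also have "\<dots> = (\<Sum>k\<in>{k. k \<noteq> 0}. \<Sum>x\<in>UNIV \<times> UNIV. Fn (u (fst x) (snd x) \<otimes> h k))"
    unfolding sum.cartesian_product[symmetric] by (rule sum.swap)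
  finally show ?thesis by (simp only: sum.cartesian_product case_prod_unfold)
qed

lemma sum_C: "(\<Sum>g\<in>C. Fn g) = (\<Sum>k\<in>{k. k \<noteq> 0}. \<Sum>x\<in>UNIV. \<Sum>y\<in>UNIV. Fn (u (fst x) (snd x) \<otimes> h k \<otimes> w \<otimes> u (fst y) (snd y)))"
proof -
  define R where "R x k = (\<Sum>y\<in>UNIV. Fn (u (fst x) (snd x) \<otimes> h k \<otimes> w \<otimes> u (fst y) (snd y)))" for x k
  have "(\<Sum>g\<in>C. Fn g) = (\<Sum>(p,y)\<in>(UNIV \<times> {k. k \<noteq> 0}) \<times> UNIV. Fn (u (fst (fst p)) (snd (fst p)) \<otimes> h (snd p) \<otimes> w \<otimes> u (fst y) (snd y)))"
    using sum.reindex_bij_betw[OF bij_C, of Fn, symmetric] by (simp add: case_prod_unfold)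
  also have "\<dots> = (\<Sum>p\<in>UNIV \<times> {k. k \<noteq> 0}. R (fst p) (snd p))"
    unfolding R_def by (simp only: sum.cartesian_product case_prod_unfold)
  also have "\<dots> = (\<Sum>x\<in>UNIV. \<Sum>k\<in>{k. k \<noteq> 0}. R x k)" by (simp only: sum.cartesian_product case_prod_unfold)
  also have "\<dots> = (\<Sum>k\<in>{k. k \<noteq> 0}. \<Sum>x\<in>UNIV. R x k)" by (rule sum.swap)
  finally show ?thesis unfolding R_def .
qed

subsection \<open>Values on the Borel subgroup\<close>

lemma chi_center:
  assumes "\<chi> \<in> Irr SG" "b \<noteq> 0" shows "\<chi> (u 0 b) = \<chi> ze"
  using conj_center[OF assms(2)] Irr_conj_Sz[OF assms(1)] by force

lemma chi_order_four:
  assumes "\<chi> \<in> Irr SG" "a \<noteq> 0"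
  shows "\<chi> (u a b) = (if lam (b / (a * th a)) = 1 then \<chi> e1 else \<chi> e2)"
proof -
  obtain g where "g \<in> Sz" "u a b = g \<otimes> (if lam (b / (a * th a)) = 1 then e1 else e2) \<otimes> inv g"
    using conj_order_four[OF assms(2)] by blast
  then show ?thesis using Irr_conj_Sz[OF assms(1)] by auto
qed

lemma chi_semisimple:
  assumes "\<chi> \<in> Irr SG" "k \<noteq> 0" "k \<noteq> 1" shows "\<chi> (u a b \<otimes> h k) = \<chi> (h k)"
  using conj_semisimple[OF assms(2,3), of a b] Irr_conj_Sz[OF assms(1)] assms(2) by force

lemma card_lam_kers: "of_nat (card {x. lam x = 1}) = (of_nat q / 2 :: complex)"
  "of_nat (card {x. lam x \<noteq> 1}) = (of_nat q / 2 :: complex)"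
proof -
  have "of_nat (2 * card {x. lam x = 1}) = (of_nat q :: complex)" using card_lam_ker by simp
  then show e: "of_nat (card {x. lam x = 1}) = (of_nat q / 2 :: complex)" by (simp add: field_simps)
  have "card ({x. lam x = 1} \<union> {x. lam x \<noteq> 1}) = card {x. lam x = 1} + card {x. lam x \<noteq> 1}"
    by (rule card_Un_disjoint) auto
  moreover have "{x. lam x = 1} \<union> {x. lam x \<noteq> 1} = (UNIV :: 'k set)" by auto
  ultimately have "card (UNIV :: 'k set) = card {x. lam x = 1} + card {x. lam x \<noteq> 1}" by simp
  then have "of_nat q = (of_nat (card {x. lam x = 1}) + of_nat (card {x. lam x \<noteq> 1}) :: complex)"
    by (simp add: card_UNIV_q flip: of_nat_add)
  then show "of_nat (card {x. lam x \<noteq> 1}) = (of_nat q / 2 :: complex)" unfolding e by (simp add: field_simps)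
qed

lemma sum_scale: "a \<noteq> 0 \<Longrightarrow> (\<Sum>b\<in>UNIV. Fn (b / (a * th a))) = (\<Sum>y\<in>UNIV. Fn y :: complex)" for a :: 'k
  by (rule sum.reindex_bij_witness[of _ "\<lambda>y. y * (a * th a)" "\<lambda>b. b / (a * th a)"]) auto

lemma sum_nz: "(\<Sum>b\<in>UNIV. Fn b) = Fn 0 + (\<Sum>b\<in>{b. b \<noteq> 0}. Fn b)" for Fn :: "'k \<Rightarrow> complex"
proof -
  have "UNIV = insert 0 {b::'k. b \<noteq> 0}" by auto
  then have "(\<Sum>b\<in>UNIV. Fn b) = (\<Sum>b\<in>insert 0 {b. b \<noteq> 0}. Fn b)" by simp
  then show ?thesis by simp
qed

lemma sum_01: "(\<Sum>a\<in>UNIV. if a \<in> {0,1::'k} then H a else 0) = H 0 + (H 1 :: complex)"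
proof -
  have "(\<Sum>a\<in>UNIV. if a \<in> {0,1::'k} then H a else 0) = sum H {0,1}"
    by (rule sum.mono_neutral_cong_right) auto
  then show ?thesis by simp
qed

lemma of_nat_q1: "of_nat (q - 1) = (of_nat q - 1 :: complex)" using q_ge by (simp add: of_nat_diff)

lemma of_nat_q1' [simp]: "of_nat (q - Suc 0) = (of_nat q - 1 :: complex)" using of_nat_q1 by simp

lemma sum_lam_nz: "(\<Sum>b\<in>{b. b \<noteq> 0}. lam b) = -1"
  using sum_nz[of lam] sum_lam by (simp add: add_eq_0_iff)

text \<open>On a coset of the centre of P a character takes few values: a single one on the
  non-trivial central elements, and off the centre two values on halves of equal size, told apart by
  \<open>lam\<close>.\<close>

lemma sum_chi_fibre:
  assumes c: "\<chi> \<in> Irr SG"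
  shows "(\<Sum>b\<in>UNIV. \<chi> (u 0 b)) = \<chi> \<one> + (of_nat q - 1) * \<chi> ze"
    "a \<noteq> 0 \<Longrightarrow> (\<Sum>b\<in>UNIV. \<chi> (u a b)) = of_nat q / 2 * (\<chi> e1 + \<chi> e2)"
    "(\<Sum>b\<in>UNIV. \<chi> (u 0 b) * lam b) = \<chi> \<one> - \<chi> ze"
    "(\<Sum>b\<in>UNIV. \<chi> (u 1 b) * lam b) = of_nat q / 2 * (\<chi> e1 - \<chi> e2)"
proof -
  show "(\<Sum>b\<in>UNIV. \<chi> (u 0 b)) = \<chi> \<one> + (of_nat q - 1) * \<chi> ze"
  proof -
    have "(\<Sum>b\<in>{b. b \<noteq> 0}. \<chi> (u 0 b)) = (\<Sum>b\<in>{b::'k. b \<noteq> 0}. \<chi> ze)"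
      by (intro sum.cong refl chi_center[OF c]) auto
    then show ?thesis by (subst sum_nz) (simp add: card_nz of_nat_q1)
  qed
  have split: "(\<Sum>y\<in>UNIV. if lam y = 1 then A else B) = of_nat q / 2 * A + of_nat q / 2 * B" for A B :: complex
    by (simp add: sum.If_cases card_lam_kers Compl_eq flip: Collect_neg_eq)
  show "(\<Sum>b\<in>UNIV. \<chi> (u a b)) = of_nat q / 2 * (\<chi> e1 + \<chi> e2)" if a: "a \<noteq> 0"
  proof -
    have "(\<Sum>b\<in>UNIV. \<chi> (u a b)) = (\<Sum>b\<in>UNIV. if lam (b / (a * th a)) = 1 then \<chi> e1 else \<chi> e2)"
      by (intro sum.cong refl chi_order_four[OF c a])
    also have "\<dots> = (\<Sum>y\<in>UNIV. if lam y = 1 then \<chi> e1 else \<chi> e2)" by (rule sum_scale[OF a])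
    finally show ?thesis by (simp add: split distrib_left)
  qed
  show "(\<Sum>b\<in>UNIV. \<chi> (u 0 b) * lam b) = \<chi> \<one> - \<chi> ze"
  proof -
    have "(\<Sum>b\<in>{b. b \<noteq> 0}. \<chi> (u 0 b) * lam b) = \<chi> ze * (\<Sum>b\<in>{b. b \<noteq> 0}. lam b)"
      unfolding sum_distrib_left by (intro sum.cong refl, subst chi_center[OF c]) auto
    then show ?thesis by (subst sum_nz) (simp add: sum_lam_nz)
  qed
  show "(\<Sum>b\<in>UNIV. \<chi> (u 1 b) * lam b) = of_nat q / 2 * (\<chi> e1 - \<chi> e2)"
  proof -
    have "(\<Sum>b\<in>UNIV. \<chi> (u 1 b) * lam b) = (\<Sum>b\<in>UNIV. if lam b = 1 then \<chi> e1 else - \<chi> e2)"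
    proof (intro sum.cong refl)
      fix b show "\<chi> (u 1 b) * lam b = (if lam b = 1 then \<chi> e1 else - \<chi> e2)"
        by (subst chi_order_four[OF c, of 1]) (use lam_cases[of b] in auto)
    qed
    then show ?thesis by (simp add: split algebra_simps)
  qed
qed

subsection \<open>Multiplicities of characters of the Sylow 2-subgroup\<close>

text \<open>
  The multiplicities in the restriction to \<open>P\<close> of the trivial character, of the linear character
  mapping \<open>u a b\<close> to \<open>lam a\<close>, and of the two irreducible characters of degree \<open>r / 2\<close> (one for each
  square root \<open>s\<close> of -1), computed from the values on representatives of the classes of 2-elements.
\<close>

definition "mu_m \<chi> = (\<chi> \<one> + (of_nat q - 1) * \<chi> ze + (of_nat q - 1) * of_nat q / 2 * (\<chi> e1 + \<chi> e2)) / of_nat (q\<^sup>2)" for \<chi> :: "'a \<Rightarrow> complex"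
definition "mu_a \<chi> = (\<chi> \<one> + (of_nat q - 1) * \<chi> ze - of_nat q / 2 * (\<chi> e1 + \<chi> e2)) / of_nat (q\<^sup>2)" for \<chi> :: "'a \<Rightarrow> complex"
definition "mu_b s \<chi> = (of_nat r / 2) * (\<chi> \<one> - \<chi> ze - s * of_nat q / 2 * (\<chi> e1 - \<chi> e2)) / of_nat (q\<^sup>2)" for \<chi> :: "'a \<Rightarrow> complex"

abbreviation "PG \<equiv> G\<lparr>carrier := P\<rparr>"

lemma PG_fin: "fin_group PG" by (rule fin_group_subgroup[OF subgroup_P])

lemma mu_a_sum:
  assumes c: "\<chi> \<in> Irr SG"
  shows "(\<Sum>a\<in>UNIV. \<Sum>b\<in>UNIV. lam a * \<chi> (u a b)) = mu_a \<chi> * of_nat (q\<^sup>2)"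
    "(\<Sum>a\<in>UNIV. \<Sum>b\<in>UNIV. \<chi> (u a b)) = mu_m \<chi> * of_nat (q\<^sup>2)"
proof -
  have "(\<Sum>a\<in>UNIV. lam a * (\<Sum>b\<in>UNIV. \<chi> (u a b))) = \<chi> \<one> + (of_nat q - 1) * \<chi> ze + (\<Sum>a\<in>{a. a \<noteq> 0}. lam a) * (of_nat q / 2 * (\<chi> e1 + \<chi> e2))"
    unfolding sum_distrib_right by (subst sum_nz) (simp add: sum_chi_fibre[OF c])
  then show "(\<Sum>a\<in>UNIV. \<Sum>b\<in>UNIV. lam a * \<chi> (u a b)) = mu_a \<chi> * of_nat (q\<^sup>2)"
    using q_ge unfolding sum_distrib_left[symmetric] mu_a_def by (simp add: sum_lam_nz)
  have "(\<Sum>a\<in>UNIV. (\<Sum>b\<in>UNIV. \<chi> (u a b))) = \<chi> \<one> + (of_nat q - 1) * \<chi> ze + (of_nat q - 1) * (of_nat q / 2 * (\<chi> e1 + \<chi> e2))"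
    by (subst sum_nz) (simp add: sum_chi_fibre[OF c] card_nz of_nat_q1)
  then show "(\<Sum>a\<in>UNIV. \<Sum>b\<in>UNIV. \<chi> (u a b)) = mu_m \<chi> * of_nat (q\<^sup>2)"
    using q_ge unfolding mu_m_def by simp
qed

lemma mu_m_nat: assumes c: "\<chi> \<in> Irr SG" shows "mu_m \<chi> \<in> \<nat>"
proof -
  interpret PG: fin_group PG by (rule PG_fin)
  have l: "(\<lambda>g\<in>P. 1) \<in> Irr PG" using PG.linear_Irr[of "\<lambda>_. 1"] by simp
  have "(\<Sum>g\<in>P. \<chi> g * (\<lambda>g\<in>P. 1) (inv g)) = mu_m \<chi> * of_nat (q\<^sup>2)"
    using mu_a_sum(2)[OF c] subgroup.m_inv_closed[OF subgroup_P] by (simp add: sum_P[symmetric])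
  then show ?thesis using multiplicity_nat[OF subgroup_P P_subset c l] q_ge by (simp add: card_P)
qed

lemma mu_a_nat: assumes c: "\<chi> \<in> Irr SG" shows "mu_a \<chi> \<in> \<nat>"
proof -
  interpret PG: fin_group PG by (rule PG_fin)
  define L where "L g = lam (fst (fst (crd g)))" for g
  have l: "(\<lambda>g\<in>P. L g) \<in> Irr PG"
  proof -
    have "L (x \<otimes> y) = L x * L y" if xy: "x \<in> P" "y \<in> P" for x y
      using xy by (elim PE) (simp add: u_mult L_def lam_add)
    moreover have "L \<one> = 1" using crd_u[of 0 0] by (simp add: L_def)
    ultimately show ?thesis using PG.linear_Irr[of L] by simp
  qed
  have "(\<Sum>g\<in>P. \<chi> g * (\<lambda>g\<in>P. L g) (inv g)) = (\<Sum>g\<in>P. \<chi> g * L (inv g))"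
    by (intro sum.cong refl) (simp add: subgroup.m_inv_closed[OF subgroup_P])
  also have "\<dots> = mu_a \<chi> * of_nat (q\<^sup>2)"
    unfolding sum_P by (subst mu_a_sum(1)[OF c, symmetric]) (simp add: L_def inv_u mult.commute)
  finally show ?thesis using multiplicity_nat[OF subgroup_P P_subset c l] q_ge by (simp add: card_P)
qed

text \<open>Wanted is an irreducible character of P with the centre acting by \<open>lam\<close> and
  e1 acting by s. Modulo the kernel of \<open>lam\<close> in the centre, e1 is central in P, and its
  square acts by lam 1 = -1, whence a square root of -1. Elements whose first coordinate is not 0 or
  1 have commutators on which \<open>lam\<close> is -1, so the character vanishes there, and its
  norm gives the degree r / 2.\<close>

lemma order_two_char:
  assumes s: "s\<^sup>2 = (-1 :: complex)"
  obtains \<xi> where "\<xi> \<in> Irr PG" "\<And>b. \<xi> (u 0 b) = of_nat r / 2 * lam b" "\<And>b. \<xi> (u 1 b) = of_nat r / 2 * s * lam b"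
    "\<And>a b. a \<noteq> 0 \<Longrightarrow> a \<noteq> 1 \<Longrightarrow> \<xi> (u a b) = 0"
proof -
  interpret PG: fin_group PG by (rule PG_fin)
  have uP: "u a b \<in> P" for a b by simp
  have inv_PG: "inv\<^bsub>PG\<^esub> (u a b) = inv (u a b)" for a b by (rule inv_subgroup[OF subgroup_P uP])
  have cPG: "of_nat (card (carrier PG)) = (of_nat (q\<^sup>2) :: complex)" by (simp add: card_P)
  have reg: "(\<Sum>\<xi>\<in>Irr PG. \<xi> \<one> * \<xi> (u a b)) = (if a = 0 \<and> b = 0 then of_nat (q\<^sup>2) else 0)" for a b
    using PG.sum_Irr_regular[of "u a b"] uP by (simp add: card_P u_eq_one)
  \<comment> \<open>Up to normalisation, the pairing with the idempotent for \<open>lam\<close> on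
    the centre and s at e1. Summed over the regular character only the identity contributes, so some
    irreducible character has T nonzero.\<close>
  define T where "T \<xi> = (\<Sum>b\<in>UNIV. lam b * \<xi> (u 0 b)) - s * (\<Sum>b\<in>UNIV. lam b * \<xi> (u 1 b))" for \<xi> :: "'a \<Rightarrow> complex"
  have "(\<Sum>\<xi>\<in>Irr PG. \<xi> \<one> * T \<xi>) = (\<Sum>b\<in>UNIV. lam b * (\<Sum>\<xi>\<in>Irr PG. \<xi> \<one> * \<xi> (u 0 b))) - s * (\<Sum>b\<in>UNIV. lam b * (\<Sum>\<xi>\<in>Irr PG. \<xi> \<one> * \<xi> (u 1 b)))"
    unfolding T_def right_diff_distrib sum_subtractf sum_distrib_left
    by (subst (1 2) sum.swap) (simp add: mult_ac)
  also have "\<dots> = (\<Sum>b\<in>UNIV. if b = (0::'k) then of_nat (q\<^sup>2) else 0)" 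
    unfolding reg by (simp add: if_distrib[of "\<lambda>x. lam _ * x"] cong: if_cong)
  also have "\<dots> \<noteq> 0" using q_ge by simp
  finally obtain \<xi> where xi: "\<xi> \<in> Irr PG" and T: "T \<xi> \<noteq> 0" by (metis (no_types, lifting) mult_zero_right sum.neutral)
  define n where "n = \<xi> \<one>"
  have n0: "n \<noteq> 0" and nn: "n \<in> \<nat>" using PG.Irr_one[OF xi] by (auto simp: n_def)
  have conj: "u c d \<otimes> u a b \<otimes> inv (u c d) = u a b \<otimes> u 0 (th c * a + th a * c)" for a b c d
    using conj_u[of 1 c d a b] by (simp add: u_mult add.assoc)
  \<comment> \<open>When conjugating x does not affect the value at y * x, the class average is that
    value itself, and it factorises as if x acted by a scalar.\<close>
  have scalar: "\<xi> (y \<otimes> x) = \<xi> y * \<xi> x / n" if y: "y \<in> P" and x: "x \<in> P" and k: "\<And>c d. \<xi> (y \<otimes> (u c d \<otimes> x \<otimes> inv (u c d))) = \<xi> (y \<otimes> x)" for x y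
  proof -
    have "(\<Sum>g\<in>P. \<xi> (y \<otimes> (g \<otimes> x \<otimes> inv\<^bsub>PG\<^esub> g))) = of_nat (q\<^sup>2) * \<xi> (y \<otimes> x)"
      by (subst sum_P) (simp add: inv_PG k card_UNIV_q power2_eq_square)
    then show ?thesis using PG.Irr_average[OF xi, of y x] x y q_ge n0 cPG unfolding n_def by (simp add: field_simps)
  qed
  have Zc: "\<xi> (y \<otimes> u 0 b) = \<xi> y * \<xi> (u 0 b) / n" if "y \<in> P" for y b
    by (rule scalar[OF that uP]) (simp add: conj u_0)
  define \<nu> where "\<nu> b = \<xi> (u 0 b) / n" for b
  have Zn: "\<xi> (y \<otimes> u 0 b) = \<xi> y * \<nu> b" if "y \<in> P" for y b using Zc[OF that] by (simp add: \<nu>_def)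
  have \<xi>0: "\<xi> (u 0 b) = n * \<nu> b" for b using n0 by (simp add: \<nu>_def)
  have \<nu>_add: "\<nu> (b + c) = \<nu> b * \<nu> c" for b c
    using Zn[OF uP, of 0 b c] n0 by (simp add: u_mult \<nu>_def)
  define E where "E = \<xi> e1"
  have \<xi>1: "\<xi> (u 1 b) = E * \<nu> b" for b using Zn[OF uP, of 1 0 b] by (simp add: u_mult E_def)
  have T2: "T \<xi> = (\<Sum>b\<in>UNIV. lam b * \<nu> b) * (n - s * E)"
  proof -
    have "(\<Sum>b\<in>UNIV. lam b * \<xi> (u 0 b)) = (\<Sum>b\<in>UNIV. lam b * \<nu> b) * n"
      unfolding \<xi>0 sum_distrib_right by (intro sum.cong refl) (simp only: mult_ac)
    moreover have "(\<Sum>b\<in>UNIV. lam b * \<xi> (u 1 b)) = (\<Sum>b\<in>UNIV. lam b * \<nu> b) * E"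
      unfolding \<xi>1 sum_distrib_right by (intro sum.cong refl) (simp only: mult_ac)
    ultimately show ?thesis unfolding T_def by (simp add: algebra_simps)
  qed
  have nu: "\<nu> c = lam c" for c
  proof -
    have "(\<Sum>b\<in>UNIV. lam (b + c) * \<nu> (b + c)) = (\<Sum>b\<in>UNIV. lam b * \<nu> b)"
      by (rule sum.reindex_bij_witness[of _ "\<lambda>x. x + c" "\<lambda>x. x + c"]) (auto simp: add.assoc)
    moreover have "(\<Sum>b\<in>UNIV. lam (b + c) * \<nu> (b + c)) = (\<Sum>b\<in>UNIV. lam b * \<nu> b) * (lam c * \<nu> c)"
      unfolding sum_distrib_right by (intro sum.cong refl) (simp only: lam_add \<nu>_add mult_ac)
    ultimately have "(\<Sum>b\<in>UNIV. lam b * \<nu> b) * (lam c * \<nu> c) = (\<Sum>b\<in>UNIV. lam b * \<nu> b) * 1" by simp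
    moreover have "(\<Sum>b\<in>UNIV. lam b * \<nu> b) \<noteq> 0" using T T2 by auto
    ultimately have "lam c * \<nu> c = 1" by (metis mult_left_cancel)
    then have "lam c * (lam c * \<nu> c) = lam c" by simp
    then show ?thesis by (simp add: mult.assoc[symmetric])
  qed
  have "\<xi> (e1 \<otimes> e1) = E * E / n"
  unfolding E_def
  proof (rule scalar[OF uP uP])
    fix c d
    have "e1 \<otimes> (u c d \<otimes> e1 \<otimes> inv (u c d)) = (e1 \<otimes> e1) \<otimes> u 0 (th c + c)" unfolding conj by (simp add: m_assoc)
    also have "\<xi> \<dots> = \<xi> (e1 \<otimes> e1) * lam (th c + c)" unfolding nu[symmetric] by (rule Zn[OF P_mult[OF uP uP]])
    also have "lam (th c + c) = 1" by (simp add: lam_add lam_th)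
    finally show "\<xi> (e1 \<otimes> (u c d \<otimes> e1 \<otimes> inv (u c d))) = \<xi> (e1 \<otimes> e1)" by simp
  qed
  moreover have "\<xi> (e1 \<otimes> e1) = - n" using \<xi>0[of 1] nu[of 1] by (simp add: u_mult)
  ultimately have "E * E = - n * n" using n0 by (simp add: field_simps)
  then have "(E - s * n) * (E + s * n) = 0" using s by (simp add: algebra_simps power2_eq_square)
  \<comment> \<open>T fixes the sign of the square root: the opposite choice would make the factor n
    - s * E vanish.\<close>
  moreover have "E + s * n \<noteq> 0"
  proof
    assume "E + s * n = 0"
    then have "s * E = - (s * s) * n" by (simp add: add_eq_0_iff2)
    then have "n - s * E = 0" using s by (simp add: power2_eq_square)
    then show False using T T2 by simp
  qed
  ultimately have xe: "E = s * n" by simp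
  have van: "\<xi> (u a b) = 0" if a: "a \<noteq> 0" "a \<noteq> 1" for a b
  proof (rule ccontr)
    assume nz: "\<xi> (u a b) \<noteq> 0"
    \<comment> \<open>Conjugation by u c 0 multiplies the value by this sign; a nonzero value would
      make the sign trivial for all c, which happens only for a = 0 and a = 1.\<close>
    have "lam ((a + a\<^sup>2) * th c) = 1" for c
    proof -
      have "\<xi> (u a b) = \<xi> (u c 0 \<otimes> u a b \<otimes> inv (u c 0))"
        using PG.Irr_conj[OF xi, of "u a b" "u c 0"] uP inv_PG by simp
      also have "\<dots> = \<xi> (u a b) * lam (th c * a + th a * c)" unfolding conj nu[symmetric] by (rule Zn[OF uP])
      finally have "lam (th c * a + th a * c) = 1" using nz by simp
      then have "lam (th c * a) * lam (th (th a * c)) = 1" by (simp only: lam_add lam_th)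
      then show ?thesis by (simp only: lam_add[symmetric] th_simps(3) th_th) (simp add: algebra_simps)
    qed
    then have "a + a\<^sup>2 = 0" by (rule lam_trivial)
    then have "a * (1 + a) = 0" by (simp only: distrib_left mult_1_right power2_eq_square)
    with a show False by auto
  qed
  have "of_nat (q\<^sup>2) = (\<Sum>g\<in>P. \<xi> g * \<xi> (inv\<^bsub>PG\<^esub> g))"
    using PG.ip_Irr[OF xi xi] q_ge unfolding PG.ip_def by (simp add: card_P field_simps)
  also have "\<dots> = (\<Sum>a\<in>UNIV. \<Sum>b\<in>UNIV. \<xi> (u a b) * \<xi> (u a (b + a * th a)))" unfolding sum_P inv_PG inv_u ..
  also have "\<dots> = (\<Sum>a\<in>UNIV. if a \<in> {0,1::'k} then of_nat q * (n * n) else 0)"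
  proof (rule sum.cong[OF refl])
    fix a :: 'k
    consider "a = 0" | "a = 1" | "a \<noteq> 0" "a \<noteq> 1" by blast
    then show "(\<Sum>b\<in>UNIV. \<xi> (u a b) * \<xi> (u a (b + a * th a))) = (if a \<in> {0,1} then of_nat q * (n * n) else 0)"
    proof cases
      case 1
      have e: "n * lam b * (n * lam b) = n * n" for b
      proof -
        have "n * lam b * (n * lam b) = (lam b * lam b) * (n * n)" by (simp only: mult_ac)
        then show ?thesis by simp
      qed
      show ?thesis using 1 by (simp only: add_0 mult_zero_left add_0_right \<xi>0 nu e) (simp add: card_UNIV_q)
    next
      case 2
      have e: "s * n * lam b * (s * n * lam (b + 1)) = n * n" for b
      proof -
        have "s * n * lam b * (s * n * lam (b + 1)) = s\<^sup>2 * (lam b * lam b) * lam 1 * (n * n)"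
          by (simp only: lam_add power2_eq_square mult_ac)
        then show ?thesis using s by simp
      qed
      show ?thesis using 2 by (simp only: th_simps(2) mult_1_right \<xi>1 nu xe e) (simp add: card_UNIV_q)
    qed (simp add: van)
  qed
  also have "\<dots> = 2 * (of_nat q * (n * n))" unfolding sum_01 by simp
  finally have "n * n = of_nat q / 2" using q_ge by (simp add: power2_eq_square)
  obtain k :: nat where k: "n = of_nat k" using nn by (auto elim: Nats_cases)
  have "of_nat (2 * (k * k)) = (of_nat q :: complex)" using \<open>n * n = of_nat q / 2\<close> k by (simp add: mult.commute)
  then have "2 * (k * k) = q" by (metis of_nat_eq_iff)
  then have "(2 * k) * (2 * k) = r * r" using r_sq by simp
  then have "2 * k = r" by (metis power2_eq_square power2_eq_iff_nonneg zero_le)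
  then have n: "n = of_nat r / 2" unfolding k by (metis nonzero_mult_div_cancel_left of_nat_mult of_nat_numeral zero_neq_numeral)
  show ?thesis
    by (rule that[OF xi]) (use \<xi>0 \<xi>1 nu xe van n in \<open>auto simp: mult_ac\<close>)
qed

lemma mu_b_nat:
  assumes c: "\<chi> \<in> Irr SG" and s: "s\<^sup>2 = -1"
  shows "mu_b s \<chi> \<in> \<nat>"
proof -
  obtain \<xi> where xi: "\<xi> \<in> Irr PG" "\<And>b. \<xi> (u 0 b) = of_nat r / 2 * lam b" "\<And>b. \<xi> (u 1 b) = of_nat r / 2 * s * lam b"
    "\<And>a b. a \<noteq> 0 \<Longrightarrow> a \<noteq> 1 \<Longrightarrow> \<xi> (u a b) = 0" using order_two_char[OF s] by metis
  let ?x = "\<Sum>b\<in>UNIV. \<chi> (u 0 b) * lam b" and ?y = "\<Sum>b\<in>UNIV. \<chi> (u 1 b) * lam b"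
  have "(\<Sum>g\<in>P. \<chi> g * \<xi> (inv g)) = (\<Sum>a\<in>UNIV. \<Sum>b\<in>UNIV. \<chi> (u a b) * \<xi> (u a (b + a * th a)))"
    unfolding sum_P inv_u ..
  also have "\<dots> = (\<Sum>a\<in>UNIV. if a \<in> {0,1::'k} then (if a = 0 then of_nat r / 2 * ?x else - (of_nat r / 2) * s * ?y) else 0)"
  proof (rule sum.cong[OF refl])
    fix a :: 'k
    consider "a = 0" | "a = 1" | "a \<noteq> 0" "a \<noteq> 1" by blast
    then show "(\<Sum>b\<in>UNIV. \<chi> (u a b) * \<xi> (u a (b + a * th a))) =
      (if a \<in> {0,1} then (if a = 0 then of_nat r / 2 * ?x else - (of_nat r / 2) * s * ?y) else 0)"
      by cases (simp_all add: xi lam_add sum_distrib_left sum_negf mult_ac)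
  qed
  also have "\<dots> = of_nat r / 2 * ?x - of_nat r / 2 * s * ?y" unfolding sum_01 by simp
  also have "\<dots> = mu_b s \<chi> * of_nat (q\<^sup>2)"
  proof -
    have m: "mu_b s \<chi> * of_nat (q\<^sup>2) = of_nat r / 2 * (\<chi> \<one> - \<chi> ze - s * of_nat q / 2 * (\<chi> e1 - \<chi> e2))"
      unfolding mu_b_def using q_ge by simp
    show ?thesis unfolding sum_chi_fibre(3,4)[OF c] m by (simp add: field_simps)
  qed
  finally show ?thesis using multiplicity_nat[OF subgroup_P P_subset c xi(1)] q_ge by (simp add: card_P)
qed

section \<open>Characters of the torus and multiplicities along B\<close>

definition dl :: "'k \<Rightarrow> nat" where "dl k = inv_into {..<q - 1} (\<lambda>i. gen ^ i) k"

lemma dl: "k \<noteq> 0 \<Longrightarrow> gen ^ dl k = k" "k \<noteq> 0 \<Longrightarrow> dl k < q - 1"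
  using bij_betw_inv_into_right[OF gen_bij, of k] bij_betw_apply[OF bij_betw_inv_into[OF gen_bij], of k]
  by (auto simp: dl_def)

lemma dl_gen: "dl (gen ^ i) = i mod (q - 1)"
proof -
  have "gen ^ dl (gen ^ i) = gen ^ i" using dl(1) gen(1) by simp
  then show ?thesis using gen_eq dl(2)[of "gen ^ i"] gen(1) by (metis mod_less power_not_zero)
qed

definition zt :: complex where "zt = cis (2 * pi / real (q - 1))"

lemma zt_pow: "zt ^ i = cis (2 * pi * real i / real (q - 1))"
  unfolding zt_def DeMoivre by (simp add: mult_ac)

lemma zt_order: "zt ^ (q - 1) = 1"
  unfolding zt_pow using q_ge by simp

lemma zt_mod: "zt ^ (i mod (q - 1)) = zt ^ i"
proof -
  have "zt ^ i = (zt ^ (q - 1)) ^ (i div (q - 1)) * zt ^ (i mod (q - 1))"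
    unfolding power_mult[symmetric] power_add[symmetric] by simp
  then show ?thesis using zt_order by simp
qed

lemma zt_eq: "zt ^ i = zt ^ j \<longleftrightarrow> i mod (q - 1) = j mod (q - 1)"
proof
  assume "zt ^ i = zt ^ j"
  then have e: "zt ^ (i mod (q - 1)) = zt ^ (j mod (q - 1))" by (simp only: zt_mod)
  have "inj_on (\<lambda>k. cis (2 * pi * real k / real (q - 1))) {..<q - 1}"
    using bij_betw_roots_unity[of "q - 1"] q_ge by (simp add: bij_betw_def)
  then show "i mod (q - 1) = j mod (q - 1)"
    using e q_ge unfolding zt_pow by (auto simp: inj_on_def)
qed (metis zt_mod)

lemma zt_eq_1: "zt ^ i = 1 \<longleftrightarrow> (q - 1) dvd i"
  using zt_eq[of i 0] by (simp add: dvd_eq_mod_eq_0)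

text \<open>The characters of the cyclic torus, via the discrete logarithm \<open>dl\<close> to the
  base \<open>gen\<close> and the root of unity \<open>zt\<close>; the index j matters only modulo q
  - 1.\<close>

definition al :: "nat \<Rightarrow> 'k \<Rightarrow> complex" where "al j k = zt ^ (j * dl k)"

lemma al_gen: "al j (gen ^ i) = zt ^ (j * i)"
proof -
  have "zt ^ (j * (i mod (q - 1))) = zt ^ (j * i)" unfolding zt_eq by (simp add: mod_mult_right_eq)
  then show ?thesis by (simp add: al_def dl_gen)
qed

lemma al_1 [simp]: "al j 1 = 1" using al_gen[of j 0] by simp

lemma al_mult: "k \<noteq> 0 \<Longrightarrow> l \<noteq> 0 \<Longrightarrow> al j (k * l) = al j k * al j l"
proof -
  assume kl: "k \<noteq> 0" "l \<noteq> 0"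
  then have "k * l = gen ^ (dl k + dl l)" using dl(1) by (simp add: power_add)
  then show ?thesis using al_gen[of j "dl k + dl l"] by (simp add: al_def distrib_left power_add)
qed

lemma al_nz [simp]: "al j k \<noteq> 0" by (simp add: al_def zt_def)

lemma al_add: "al i k * al j k = al (i + j) k" by (simp add: al_def distrib_right power_add)

lemma al_0 [simp]: "al 0 k = 1" by (simp add: al_def)

lemma al_q1: "al (q - 1) k = 1" by (simp only: al_def power_mult zt_order power_one)

lemma al_inverse: "k \<noteq> 0 \<Longrightarrow> i \<le> q - 1 \<Longrightarrow> al i (inverse k) = al (q - 1 - i) k"
proof -
  assume k: "k \<noteq> 0" and i: "i \<le> q - 1"
  have "al i k * al i (inverse k) = 1" using al_mult[OF k, of "inverse k" i] k by simp
  moreover have "al i k * al (q - 1 - i) k = 1"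
  proof -
    have "i + (q - 1 - i) = q - 1" using i by simp
    then show ?thesis by (simp only: al_add al_q1)
  qed
  ultimately show ?thesis by (metis al_nz mult_left_cancel)
qed

lemma sum_al: "(\<Sum>k\<in>{k. k \<noteq> 0}. al i k) = (if (q - 1) dvd i then of_nat q - 1 else 0)"
proof -
  have "(\<Sum>k\<in>{k. k \<noteq> 0}. al i k) = (\<Sum>l<q - 1. (zt ^ i) ^ l)"
    by (subst sum.reindex_bij_betw[OF gen_bij, symmetric]) (simp add: al_gen power_mult)
  also have "\<dots> = (if (q - 1) dvd i then of_nat q - 1 else 0)"
  proof (cases "(q - 1) dvd i")
    case False
    then have "zt ^ i \<noteq> 1" by (simp add: zt_eq_1)
    moreover have "(zt ^ i) ^ (q - 1) = 1" using zt_order by (simp add: power_mult[symmetric] mult.commute[of i] power_mult)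
    ultimately show ?thesis using False geometric_sum[of "zt ^ i" "q - 1"] by simp
  qed (simp add: zt_eq_1[THEN iffD2] of_nat_q1)
  finally show ?thesis .
qed

lemma dvd_small: "i < 2 * (q - 1) \<Longrightarrow> (q - 1) dvd i \<longleftrightarrow> i = 0 \<or> i = q - 1"
proof -
  assume i: "i < 2 * (q - 1)"
  show ?thesis
  proof
    assume "(q - 1) dvd i"
    then obtain c where c: "i = (q - 1) * c" by (auto simp: dvd_def)
    then have "c < 2" using i by (metis mult.commute mult_less_cancel2)
    then show "i = 0 \<or> i = q - 1" using c by (cases c) (auto simp: less_Suc_eq)
  qed auto
qed

lemma sum_al_orth:
  assumes "i < q - 1" "j < q - 1"
  shows "(\<Sum>k\<in>{k. k \<noteq> 0}. al i (inverse k) * al j k) = (if i = j then of_nat q - 1 else 0)"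
    "(\<Sum>k\<in>{k. k \<noteq> 0}. al i (inverse k) * al j (inverse k)) = (if i + j = 0 \<or> i + j = q - 1 then of_nat q - 1 else 0)"
proof -
  have "(\<Sum>k\<in>{k. k \<noteq> 0}. al i (inverse k) * al j k) = (\<Sum>k\<in>{k. k \<noteq> 0}. al (q - 1 - i + j) k)"
    by (intro sum.cong refl) (use assms in \<open>simp add: al_inverse al_add\<close>)
  also have "\<dots> = (if i = j then of_nat q - 1 else 0)"
    unfolding sum_al by (subst dvd_small) (use assms in auto)
  finally show "(\<Sum>k\<in>{k. k \<noteq> 0}. al i (inverse k) * al j k) = (if i = j then of_nat q - 1 else 0)" .
  have "(\<Sum>k\<in>{k. k \<noteq> 0}. al i (inverse k) * al j (inverse k)) = (\<Sum>k\<in>{k. k \<noteq> 0}. al (i + j) (inverse k))"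
    by (simp add: al_add)
  also have "\<dots> = (\<Sum>k\<in>{k. k \<noteq> 0}. al (i + j) k)"
    by (rule sum.reindex_bij_witness[of _ inverse inverse]) auto
  also have "\<dots> = (if i + j = 0 \<or> i + j = q - 1 then of_nat q - 1 else 0)"
    unfolding sum_al by (subst dvd_small) (use assms in auto)
  finally show "(\<Sum>k\<in>{k. k \<noteq> 0}. al i (inverse k) * al j (inverse k)) = (if i + j = 0 \<or> i + j = q - 1 then of_nat q - 1 else 0)" .
qed

lemma sum_al_dual:
  assumes "k \<noteq> 0" shows "(\<Sum>j<q - 1. al j k) = (if k = 1 then of_nat q - 1 else 0)"
proof -
  have "(\<Sum>j<q - 1. al j k) = (\<Sum>j<q - 1. (zt ^ dl k) ^ j)" by (simp add: al_def power_mult[symmetric] mult.commute)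
  also have "\<dots> = (if k = 1 then of_nat q - 1 else 0)"
  proof (cases "k = 1")
    case True
    then have "dl k = 0" using dl_gen[of 0] by simp
    then show ?thesis using True by (simp add: of_nat_q1)
  next
    case False
    then have "dl k \<noteq> 0" using dl(1)[OF assms] by (metis power_0)
    then have "\<not> (q - 1) dvd dl k" using dl(2)[OF assms] by (auto dest: dvd_imp_le)
    then have "zt ^ dl k \<noteq> 1" by (simp add: zt_eq_1)
    moreover have "(zt ^ dl k) ^ (q - 1) = 1" using zt_order by (simp add: power_mult[symmetric] mult.commute[of "dl k"] power_mult)
    ultimately show ?thesis using False geometric_sum[of "zt ^ dl k" "q - 1"] by simp
  qed
  finally show ?thesis .
qed

abbreviation "Tx \<equiv> {k::'k. k \<noteq> 0 \<and> k \<noteq> 1}"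

lemma sum_Tx: "(\<Sum>k\<in>{k. k \<noteq> 0}. Fn k) = Fn 1 + (\<Sum>k\<in>Tx. Fn k)" for Fn :: "'k \<Rightarrow> complex"
proof -
  have "{k::'k. k \<noteq> 0} = insert 1 Tx" by auto
  then show ?thesis by simp
qed

text \<open>The multiplicity in the restriction to \<open>B\<close> of the linear character mapping \<open>u a b \<otimes> h k\<close> to \<open>al j k\<close>.\<close>

definition mu_t :: "nat \<Rightarrow> ('a \<Rightarrow> complex) \<Rightarrow> complex" where
  "mu_t j \<chi> = (mu_m \<chi> + (\<Sum>k\<in>Tx. \<chi> (h k) * al j (inverse k))) / (of_nat q - 1)"

lemma q1_nz: "of_nat q - 1 \<noteq> (0::complex)"
  using q_ge of_nat_q1 by (metis diff_is_0_eq le_trans not_less_eq_eq numeral_le_one_iff of_nat_eq_0_iff semiring_norm(69) One_nat_def)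

lemma mu_t_nat: assumes c: "\<chi> \<in> Irr SG" shows "mu_t j \<chi> \<in> \<nat>"
proof -
  interpret BG: fin_group "G\<lparr>carrier := B\<rparr>" by (rule fin_group_subgroup[OF subgroup_B])
  define L where "L g = al j (snd (crd g))" for g
  have l: "(\<lambda>g\<in>B. L g) \<in> Irr (G\<lparr>carrier := B\<rparr>)"
  proof -
    have "L (x \<otimes> y) = L x * L y" if xy: "x \<in> B" "y \<in> B" for x y
      using xy
    proof (elim BE)
      fix a b k c d l assume k: "k \<noteq> (0::'k)" "l \<noteq> (0::'k)" and e: "x = u a b \<otimes> h k" "y = u c d \<otimes> h l"
      have "x \<otimes> y = u (a + k * c) (b + k * th k * d + th a * (k * c)) \<otimes> h (k * l)" using k e by (simp add: nf)
      then show ?thesis using k e by (simp add: L_def al_mult)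
    qed
    moreover have "L \<one> = 1" using crd_u[of 0 0] by (simp add: L_def)
    ultimately show ?thesis using BG.linear_Irr[of L] by simp
  qed
  have Li: "L (inv (u a b \<otimes> h k)) = al j (inverse k)" if k: "k \<noteq> 0" for a b k
  proof -
    have "inv (u a b \<otimes> h k) = u (inverse k * a) (inverse k * th (inverse k) * (b + a * th a)) \<otimes> h (inverse k)"
      using k by (simp add: inv_uh h_u)
    then show ?thesis using k by (simp add: L_def)
  qed
  have "(\<Sum>g\<in>B. \<chi> g * (\<lambda>g\<in>B. L g) (inv g)) = (\<Sum>g\<in>B. \<chi> g * L (inv g))"
    by (intro sum.cong refl) (simp add: B_inv)
  also have "\<dots> = (\<Sum>k\<in>{k. k \<noteq> 0}. (\<Sum>a\<in>UNIV. \<Sum>b\<in>UNIV. \<chi> (u a b \<otimes> h k)) * al j (inverse k))"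
    unfolding sum_B sum_distrib_right by (intro sum.cong refl) (simp add: Li)
  also have "\<dots> = mu_m \<chi> * of_nat (q\<^sup>2) + (\<Sum>k\<in>Tx. (of_nat (q\<^sup>2) * \<chi> (h k)) * al j (inverse k))"
  proof -
    have "(\<Sum>a\<in>UNIV. \<Sum>b\<in>UNIV. \<chi> (u a b \<otimes> h k)) = of_nat (q\<^sup>2) * \<chi> (h k)" if "k \<in> Tx" for k
      using that by (simp add: chi_semisimple[OF c] card_UNIV_q power2_eq_square)
    then have "(\<Sum>k\<in>Tx. (\<Sum>a\<in>UNIV. \<Sum>b\<in>UNIV. \<chi> (u a b \<otimes> h k)) * al j (inverse k)) = (\<Sum>k\<in>Tx. (of_nat (q\<^sup>2) * \<chi> (h k)) * al j (inverse k))"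
      by (intro sum.cong refl) simp
    then show ?thesis by (subst sum_Tx) (simp add: mu_a_sum(2)[OF c])
  qed
  also have "\<dots> = of_nat (q\<^sup>2) * (mu_m \<chi> + (\<Sum>k\<in>Tx. \<chi> (h k) * al j (inverse k)))"
    by (simp add: distrib_left sum_distrib_left mult_ac)
  also have "\<dots> = mu_t j \<chi> * of_nat (card B)"
    using q1_nz unfolding card_B mu_t_def by (simp add: of_nat_q1)
  finally show ?thesis using multiplicity_nat[OF subgroup_B B_subset c l] q_ge by (simp add: card_B)
qed

subsection \<open>Sums over the irreducible characters\<close>

text \<open>The multiplicities along P are all linear forms in these four values, so one bilinear
  formula for such forms gives all their sums of products.\<close>

definition lin :: "complex \<Rightarrow> complex \<Rightarrow> complex \<Rightarrow> complex \<Rightarrow> ('a \<Rightarrow> complex) \<Rightarrow> complex" where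
  "lin v1 v2 v3 v4 \<chi> = v1 * \<chi> \<one> + v2 * \<chi> ze + v3 * \<chi> e1 + v4 * \<chi> e2"

lemma col: "x \<in> Sz \<Longrightarrow> y \<in> Sz \<Longrightarrow> (\<Sum>\<chi>\<in>Irr SG. \<chi> x * \<chi> y) = of_nat (ncj (inv y) x)"
  using column_Sz[of x "inv y"] Sz_inv Sz_carrier by simp

lemma unipotent_ne: "ze \<noteq> \<one>" "e1 \<noteq> \<one>" "e2 \<noteq> \<one>" by (simp_all add: u_eq_one)

lemma cols:
  "(\<Sum>\<chi>\<in>Irr SG. \<chi> \<one> * \<chi> \<one>) = of_nat (card Sz)"
  "(\<Sum>\<chi>\<in>Irr SG. \<chi> ze * \<chi> \<one>) = 0" "(\<Sum>\<chi>\<in>Irr SG. \<chi> e1 * \<chi> \<one>) = 0" "(\<Sum>\<chi>\<in>Irr SG. \<chi> e2 * \<chi> \<one>) = 0"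
  "(\<Sum>\<chi>\<in>Irr SG. \<chi> ze * \<chi> ze) = of_nat (q\<^sup>2)" "(\<Sum>\<chi>\<in>Irr SG. \<chi> e1 * \<chi> ze) = 0" "(\<Sum>\<chi>\<in>Irr SG. \<chi> e2 * \<chi> ze) = 0"
  "(\<Sum>\<chi>\<in>Irr SG. \<chi> e1 * \<chi> e1) = 0" "(\<Sum>\<chi>\<in>Irr SG. \<chi> e2 * \<chi> e1) = 0 + 2 * of_nat q" "(\<Sum>\<chi>\<in>Irr SG. \<chi> e2 * \<chi> e2) = 0"
  by (simp_all add: col ncj_one unipotent_ne inv_ze inv_e1 inv_e2 ncj_ze ncj_e)

text \<open>The third and fourth coefficients are paired crosswise because e1 and e2 are inverse to
  each other; the weights are the centraliser orders.\<close>

lemma sum_lin: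
  "(\<Sum>\<chi>\<in>Irr SG. lin v1 v2 v3 v4 \<chi> * lin w1 w2 w3 w4 \<chi>) =
     v1 * w1 * of_nat (card Sz) + v2 * w2 * of_nat (q\<^sup>2) + (v3 * w4 + v4 * w3) * (2 * of_nat q)"
proof -
  let ?S = "\<lambda>x y. \<Sum>\<chi>\<in>Irr SG. \<chi> x * \<chi> y"
  have "(\<Sum>\<chi>\<in>Irr SG. lin v1 v2 v3 v4 \<chi> * lin w1 w2 w3 w4 \<chi>) =
    v1 * w1 * ?S \<one> \<one> + v1 * w2 * ?S ze \<one> + v1 * w3 * ?S e1 \<one> + v1 * w4 * ?S e2 \<one> +
    (v2 * w1 * ?S ze \<one> + v2 * w2 * ?S ze ze + v2 * w3 * ?S e1 ze + v2 * w4 * ?S e2 ze) +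
    (v3 * w1 * ?S e1 \<one> + v3 * w2 * ?S e1 ze + v3 * w3 * ?S e1 e1 + v3 * w4 * ?S e2 e1) +
    (v4 * w1 * ?S e2 \<one> + v4 * w2 * ?S e2 ze + v4 * w3 * ?S e2 e1 + v4 * w4 * ?S e2 e2)"
    unfolding sum_distrib_left sum.distrib[symmetric] lin_def by (intro sum.cong refl) (simp add: algebra_simps)
  then show ?thesis unfolding cols by (simp add: algebra_simps)
qed

lemma card_Sz_c: "of_nat (card Sz) = (of_nat q)\<^sup>2 * (of_nat q - 1) * ((of_nat q)\<^sup>2 + 1 :: complex)"
  unfolding card_Sz of_nat_mult of_nat_q1 by simp

lemma r_sq_c: "of_nat r * of_nat r = (2 * of_nat q :: complex)"
  using r_sq by (metis of_nat_mult of_nat_numeral)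

lemma mu_lin:
  "mu_m \<chi> = lin 1 (of_nat q - 1) ((of_nat q - 1) * of_nat q / 2) ((of_nat q - 1) * of_nat q / 2) \<chi> / (of_nat q)\<^sup>2"
  "mu_a \<chi> = lin 1 (of_nat q - 1) (- (of_nat q / 2)) (- (of_nat q / 2)) \<chi> / (of_nat q)\<^sup>2"
  "mu_b s \<chi> = of_nat r / 2 * (lin 1 (-1) (- (s * of_nat q / 2)) (s * of_nat q / 2) \<chi> / (of_nat q)\<^sup>2)"
  unfolding mu_m_def mu_a_def mu_b_def lin_def of_nat_power times_divide_eq_right[symmetric] times_divide_eq_right[of _ _ "(of_nat q)\<^sup>2", symmetric]
  by (rule arg_cong[where f="\<lambda>x. x / _"], simp add: field_simps)+
    (simp add: diff_divide_distrib add_divide_distrib right_diff_distrib distrib_left)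

lemma sum_lin2: "(\<Sum>\<chi>\<in>Irr SG. (x * (lin v1 v2 v3 v4 \<chi> / (of_nat q)\<^sup>2)) * (y * (lin w1 w2 w3 w4 \<chi> / (of_nat q)\<^sup>2))) =
   x * y * (v1 * w1 * ((of_nat q - 1) * ((of_nat q)\<^sup>2 + 1)) + v2 * w2 + (v3 * w4 + v4 * w3) * 2 / of_nat q) / (of_nat q)\<^sup>2"
proof -
  have q0: "of_nat q \<noteq> (0::complex)" using q_ge by simp
  have "(\<Sum>\<chi>\<in>Irr SG. (x * (lin v1 v2 v3 v4 \<chi> / (of_nat q)\<^sup>2)) * (y * (lin w1 w2 w3 w4 \<chi> / (of_nat q)\<^sup>2))) =
    x * y / ((of_nat q)\<^sup>2 * (of_nat q)\<^sup>2) * (\<Sum>\<chi>\<in>Irr SG. lin v1 v2 v3 v4 \<chi> * lin w1 w2 w3 w4 \<chi>)"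
    unfolding sum_distrib_left by (intro sum.cong refl) simp
  also have "\<dots> = x * y * (v1 * w1 * ((of_nat q - 1) * ((of_nat q)\<^sup>2 + 1)) + v2 * w2 + (v3 * w4 + v4 * w3) * 2 / of_nat q) / (of_nat q)\<^sup>2"
    unfolding sum_lin card_Sz_c using q0 by (simp add: field_simps power2_eq_square)
  finally show ?thesis .
qed

text \<open>By Frobenius reciprocity these are the inner products of the characters induced from the
  corresponding characters of P. The pairing of \<open>mu_b s\<close> with itself exceeds the one
  with its dual by 1, which is what betrays a non-real character.\<close>

lemma sums_mu:
  "(\<Sum>\<chi>\<in>Irr SG. mu_a \<chi> * mu_a \<chi>) = of_nat q"
  "(\<Sum>\<chi>\<in>Irr SG. mu_m \<chi> * mu_m \<chi>) = 2 * (of_nat q - 1)"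
  "(\<Sum>\<chi>\<in>Irr SG. mu_m \<chi> * mu_a \<chi>) = of_nat q - 1"
  "(\<Sum>\<chi>\<in>Irr SG. mu_m \<chi> * mu_b s \<chi>) = of_nat r / 2 * (of_nat q - 1)"
  "(\<Sum>\<chi>\<in>Irr SG. mu_a \<chi> * mu_b s \<chi>) = of_nat r / 2 * (of_nat q - 1)"
  "s * s = -1 \<Longrightarrow> (\<Sum>\<chi>\<in>Irr SG. mu_b s \<chi> * mu_b s \<chi>) = 1 + of_nat q * (of_nat q - 1) / 2"
  "s * s = -1 \<Longrightarrow> (\<Sum>\<chi>\<in>Irr SG. mu_b s \<chi> * mu_b (- s) \<chi>) = of_nat q * (of_nat q - 1) / 2"
proof -
  have q0: "of_nat q \<noteq> (0::complex)" using q_ge by simp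
  note L = mu_lin sum_lin2[where x=1 and y=1, unfolded mult_1] sum_lin2[where x=1, unfolded mult_1] sum_lin2
  show "(\<Sum>\<chi>\<in>Irr SG. mu_a \<chi> * mu_a \<chi>) = of_nat q" "(\<Sum>\<chi>\<in>Irr SG. mu_m \<chi> * mu_m \<chi>) = 2 * (of_nat q - 1)"
    "(\<Sum>\<chi>\<in>Irr SG. mu_m \<chi> * mu_a \<chi>) = of_nat q - 1"
    unfolding mu_lin sum_lin2[where x=1 and y=1, unfolded mult_1]
    using q0 by (simp_all add: field_simps power2_eq_square)
  show "(\<Sum>\<chi>\<in>Irr SG. mu_m \<chi> * mu_b s \<chi>) = of_nat r / 2 * (of_nat q - 1)"
    "(\<Sum>\<chi>\<in>Irr SG. mu_a \<chi> * mu_b s \<chi>) = of_nat r / 2 * (of_nat q - 1)"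
    unfolding mu_lin sum_lin2[where x=1, unfolded mult_1]
    using q0 by (simp_all add: field_simps power2_eq_square)
  have rr: "of_nat r / 2 * (of_nat r / 2) = (of_nat q / 2 :: complex)" using r_sq_c by simp
  show "(\<Sum>\<chi>\<in>Irr SG. mu_b s \<chi> * mu_b s \<chi>) = 1 + of_nat q * (of_nat q - 1) / 2" if s: "s * s = -1"
  proof -
    have "- (s * of_nat q / 2) * (s * of_nat q / 2) + s * of_nat q / 2 * - (s * of_nat q / 2) = - (s * s) * (of_nat q)\<^sup>2 / 2"
      by (simp add: power2_eq_square)
    then have v: "- (s * of_nat q / 2) * (s * of_nat q / 2) + s * of_nat q / 2 * - (s * of_nat q / 2) = (of_nat q)\<^sup>2 / 2"
      unfolding s by simp
    show ?thesis unfolding mu_lin sum_lin2 rr v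
      using q0 by (simp add: field_simps power2_eq_square)
  qed
  show "(\<Sum>\<chi>\<in>Irr SG. mu_b s \<chi> * mu_b (- s) \<chi>) = of_nat q * (of_nat q - 1) / 2" if s: "s * s = -1"
  proof -
    have "- (s * of_nat q / 2) * (- s * of_nat q / 2) + s * of_nat q / 2 * - (- s * of_nat q / 2) = (s * s) * (of_nat q)\<^sup>2 / 2"
      by (simp add: power2_eq_square)
    then have v: "- (s * of_nat q / 2) * (- s * of_nat q / 2) + s * of_nat q / 2 * - (- s * of_nat q / 2) = - ((of_nat q)\<^sup>2 / 2)"
      unfolding s by simp
    show ?thesis unfolding mu_lin sum_lin2 rr v
      using q0 by (simp add: field_simps power2_eq_square)
  qed
qed

lemma col_h:
  assumes k: "k \<in> Tx"
  shows "l \<in> Tx \<Longrightarrow> (\<Sum>\<chi>\<in>Irr SG. \<chi> (h k) * \<chi> (h l)) = (of_nat q - 1) * ((if l = inverse k then 1 else 0) + (if l = k then 1 else 0))"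
    "(\<Sum>\<chi>\<in>Irr SG. \<chi> (h k) * lin v1 v2 v3 v4 \<chi>) = 0"
proof -
  show "(\<Sum>\<chi>\<in>Irr SG. \<chi> (h k) * \<chi> (h l)) = (of_nat q - 1) * ((if l = inverse k then 1 else 0) + (if l = k then 1 else 0))" if l: "l \<in> Tx"
  proof -
    have "inverse l = k \<longleftrightarrow> l = inverse k" by auto
    moreover have "inverse (inverse l) = k \<longleftrightarrow> l = k" by simp
    moreover have "(\<Sum>\<chi>\<in>Irr SG. \<chi> (h k) * \<chi> (h l)) = of_nat (ncj (h (inverse l)) (h k))"
      using col[of "h k" "h l"] k l by (simp add: inv_h)
    ultimately show ?thesis using ncj_h[of "inverse l" k] k l by (simp add: of_nat_q1)
  qed
  have z: "(\<Sum>\<chi>\<in>Irr SG. \<chi> (h k) * \<chi> x) = 0" if x: "x \<in> {\<one>, ze, e1, e2}" for x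
  proof (cases "x = \<one>")
    case True
    have "h k \<noteq> \<one>" using h_inj[of k 1] k by auto
    then show ?thesis using True col[of "h k" \<one>] k by (simp add: ncj_one)
  next
    case False
    then obtain c d where "inv x = u c d" "c \<noteq> 0 \<or> d \<noteq> 0" using x inv_ze inv_e1 inv_e2 by fastforce
    then show ?thesis using col[of "h k" x] k x ncj_u_h[of c d k] by auto
  qed
  have "(\<Sum>\<chi>\<in>Irr SG. \<chi> (h k) * lin v1 v2 v3 v4 \<chi>) =
    v1 * (\<Sum>\<chi>\<in>Irr SG. \<chi> (h k) * \<chi> \<one>) + v2 * (\<Sum>\<chi>\<in>Irr SG. \<chi> (h k) * \<chi> ze) + v3 * (\<Sum>\<chi>\<in>Irr SG. \<chi> (h k) * \<chi> e1) + v4 * (\<Sum>\<chi>\<in>Irr SG. \<chi> (h k) * \<chi> e2)"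
    unfolding sum_distrib_left sum.distrib[symmetric] lin_def by (intro sum.cong refl) (simp add: algebra_simps)
  then show "(\<Sum>\<chi>\<in>Irr SG. \<chi> (h k) * lin v1 v2 v3 v4 \<chi>) = 0" using z by simp
qed

lemma col_h_mu:
  assumes "k \<in> Tx"
  shows "(\<Sum>\<chi>\<in>Irr SG. \<chi> (h k) * mu_m \<chi>) = 0" "(\<Sum>\<chi>\<in>Irr SG. \<chi> (h k) * mu_a \<chi>) = 0" "(\<Sum>\<chi>\<in>Irr SG. \<chi> (h k) * mu_b s \<chi>) = 0"
proof -
  have z: "(\<Sum>\<chi>\<in>Irr SG. \<chi> (h k) * (x * (lin v1 v2 v3 v4 \<chi> / (of_nat q)\<^sup>2))) = 0" for x v1 v2 v3 v4
  proof -
    have "(\<Sum>\<chi>\<in>Irr SG. \<chi> (h k) * (x * (lin v1 v2 v3 v4 \<chi> / (of_nat q)\<^sup>2))) = x / (of_nat q)\<^sup>2 * (\<Sum>\<chi>\<in>Irr SG. \<chi> (h k) * lin v1 v2 v3 v4 \<chi>)"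
      unfolding sum_distrib_left by (intro sum.cong refl) simp
    then show ?thesis using col_h(2)[OF assms] by simp
  qed
  show "(\<Sum>\<chi>\<in>Irr SG. \<chi> (h k) * mu_m \<chi>) = 0" "(\<Sum>\<chi>\<in>Irr SG. \<chi> (h k) * mu_a \<chi>) = 0" "(\<Sum>\<chi>\<in>Irr SG. \<chi> (h k) * mu_b s \<chi>) = 0"
    unfolding mu_lin by (rule z[where x=1, unfolded mult_1])+ (rule z)
qed

lemma sum_mu_t:
  assumes "\<And>k. k \<in> Tx \<Longrightarrow> (\<Sum>\<chi>\<in>Irr SG. \<chi> (h k) * Fn \<chi>) = 0"
  shows "(\<Sum>\<chi>\<in>Irr SG. mu_t j \<chi> * Fn \<chi>) = (\<Sum>\<chi>\<in>Irr SG. mu_m \<chi> * Fn \<chi>) / (of_nat q - 1)"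
proof -
  have "(\<Sum>\<chi>\<in>Irr SG. (\<Sum>k\<in>Tx. \<chi> (h k) * al j (inverse k)) * Fn \<chi>) = (\<Sum>k\<in>Tx. al j (inverse k) * (\<Sum>\<chi>\<in>Irr SG. \<chi> (h k) * Fn \<chi>))"
    unfolding sum_distrib_left sum_distrib_right by (subst sum.swap) (simp add: mult_ac)
  also have "\<dots> = 0" using assms by simp
  finally have z: "(\<Sum>\<chi>\<in>Irr SG. (\<Sum>k\<in>Tx. \<chi> (h k) * al j (inverse k)) * Fn \<chi>) = 0" .
  have "(\<Sum>\<chi>\<in>Irr SG. mu_t j \<chi> * Fn \<chi>) = ((\<Sum>\<chi>\<in>Irr SG. mu_m \<chi> * Fn \<chi>) + (\<Sum>\<chi>\<in>Irr SG. (\<Sum>k\<in>Tx. \<chi> (h k) * al j (inverse k)) * Fn \<chi>)) / (of_nat q - 1)"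
    unfolding sum.distrib[symmetric] sum_divide_distrib mu_t_def by (intro sum.cong refl) (simp add: distrib_right)
  then show ?thesis using z by simp
qed

lemma sums_mu_t:
  "(\<Sum>\<chi>\<in>Irr SG. mu_t j \<chi> * mu_a \<chi>) = 1"
  "(\<Sum>\<chi>\<in>Irr SG. mu_t j \<chi> * mu_b s \<chi>) = of_nat r / 2"
proof -
  have "(\<Sum>\<chi>\<in>Irr SG. mu_t j \<chi> * mu_a \<chi>) = (\<Sum>\<chi>\<in>Irr SG. mu_m \<chi> * mu_a \<chi>) / (of_nat q - 1)"
    by (rule sum_mu_t) (rule col_h_mu(2))
  then show "(\<Sum>\<chi>\<in>Irr SG. mu_t j \<chi> * mu_a \<chi>) = 1" unfolding sums_mu using q1_nz by simp
  have "(\<Sum>\<chi>\<in>Irr SG. mu_t j \<chi> * mu_b s \<chi>) = (\<Sum>\<chi>\<in>Irr SG. mu_m \<chi> * mu_b s \<chi>) / (of_nat q - 1)"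
    by (rule sum_mu_t) (rule col_h_mu(3))
  also have "\<dots> = of_nat r / 2" unfolding sums_mu by (rule nonzero_mult_div_cancel_right[OF q1_nz])
  finally show "(\<Sum>\<chi>\<in>Irr SG. mu_t j \<chi> * mu_b s \<chi>) = of_nat r / 2" .
qed

text \<open>As in Mackey's formula, the characters induced from \<open>al i\<close> and
  \<open>al j\<close> of B meet only if i and j agree up to sign modulo q - 1: one term belongs to B
  itself and one to the double coset of w, which inverts the torus. The computation uses column
  orthogonality on the torus.\<close>

lemma sum_mu_t_mu_t:
  assumes ij: "i < q - 1" "j < q - 1"
  shows "(\<Sum>\<chi>\<in>Irr SG. mu_t i \<chi> * mu_t j \<chi>) = (if i = j then 1 else 0) + (if i + j = 0 \<or> i + j = q - 1 then 1 else 0)"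
proof -
  let ?A = "\<lambda>j \<chi>. \<Sum>k\<in>Tx. \<chi> (h k) * al j (inverse k)" and ?Q = "of_nat q - 1 :: complex"
  have mA: "(\<Sum>\<chi>\<in>Irr SG. mu_m \<chi> * ?A j \<chi>) = 0" for j
  proof -
    have "(\<Sum>\<chi>\<in>Irr SG. mu_m \<chi> * ?A j \<chi>) = (\<Sum>k\<in>Tx. al j (inverse k) * (\<Sum>\<chi>\<in>Irr SG. \<chi> (h k) * mu_m \<chi>))"
      unfolding sum_distrib_left by (subst sum.swap) (simp add: mult_ac)
    then show ?thesis using col_h_mu(1) by simp
  qed
  have ik: "inverse k \<in> Tx" if "k \<in> Tx" for k using that by auto
  have "(\<Sum>\<chi>\<in>Irr SG. ?A i \<chi> * ?A j \<chi>) = (\<Sum>k\<in>Tx. \<Sum>l\<in>Tx. al i (inverse k) * al j (inverse l) * (\<Sum>\<chi>\<in>Irr SG. \<chi> (h k) * \<chi> (h l)))"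
  proof -
    have "(\<Sum>\<chi>\<in>Irr SG. ?A i \<chi> * ?A j \<chi>) = (\<Sum>\<chi>\<in>Irr SG. \<Sum>k\<in>Tx. \<Sum>l\<in>Tx. al i (inverse k) * al j (inverse l) * (\<chi> (h k) * \<chi> (h l)))"
      unfolding sum_product by (intro sum.cong refl) (simp only: mult_ac)
    also have "\<dots> = (\<Sum>k\<in>Tx. \<Sum>\<chi>\<in>Irr SG. \<Sum>l\<in>Tx. al i (inverse k) * al j (inverse l) * (\<chi> (h k) * \<chi> (h l)))" by (rule sum.swap)
    also have "\<dots> = (\<Sum>k\<in>Tx. \<Sum>l\<in>Tx. \<Sum>\<chi>\<in>Irr SG. al i (inverse k) * al j (inverse l) * (\<chi> (h k) * \<chi> (h l)))"
      by (intro sum.cong refl, rule sum.swap)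
    finally show ?thesis unfolding sum_distrib_left .
  qed
  also have "\<dots> = (\<Sum>k\<in>Tx. ?Q * (al i (inverse k) * al j k) + ?Q * (al i (inverse k) * al j (inverse k)))"
  proof (intro sum.cong refl)
    fix k assume k: "k \<in> Tx"
    have "(\<Sum>l\<in>Tx. al i (inverse k) * al j (inverse l) * (\<Sum>\<chi>\<in>Irr SG. \<chi> (h k) * \<chi> (h l))) =
      (\<Sum>l\<in>Tx. (if l = inverse k then ?Q * (al i (inverse k) * al j k) else 0) + (if l = k then ?Q * (al i (inverse k) * al j (inverse k)) else 0))"
      by (intro sum.cong refl) (subst col_h(1)[OF k], auto)
    then show "(\<Sum>l\<in>Tx. al i (inverse k) * al j (inverse l) * (\<Sum>\<chi>\<in>Irr SG. \<chi> (h k) * \<chi> (h l))) =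
      ?Q * (al i (inverse k) * al j k) + ?Q * (al i (inverse k) * al j (inverse k))"
      using k ik[OF k] by (simp add: sum.distrib)
  qed
  also have "\<dots> = ?Q * (\<Sum>k\<in>Tx. al i (inverse k) * al j k) + ?Q * (\<Sum>k\<in>Tx. al i (inverse k) * al j (inverse k))"
    by (simp add: sum.distrib sum_distrib_left)
  also have "(\<Sum>k\<in>Tx. al i (inverse k) * al j k) = (if i = j then ?Q else 0) - 1"
    using sum_al_orth(1)[OF ij] sum_Tx[of "\<lambda>k. al i (inverse k) * al j k"] by (simp add: eq_diff_eq add.commute)
  also have "(\<Sum>k\<in>Tx. al i (inverse k) * al j (inverse k)) = (if i + j = 0 \<or> i + j = q - 1 then ?Q else 0) - 1"
    using sum_al_orth(2)[OF ij] sum_Tx[of "\<lambda>k. al i (inverse k) * al j (inverse k)"] by (simp add: eq_diff_eq add.commute)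
  finally have AA: "(\<Sum>\<chi>\<in>Irr SG. ?A i \<chi> * ?A j \<chi>) = ?Q * ((if i = j then ?Q else 0) - 1) + ?Q * ((if i + j = 0 \<or> i + j = q - 1 then ?Q else 0) - 1)" .
  have "(\<Sum>\<chi>\<in>Irr SG. mu_t i \<chi> * mu_t j \<chi>) = ((\<Sum>\<chi>\<in>Irr SG. mu_m \<chi> * mu_m \<chi>) + (\<Sum>\<chi>\<in>Irr SG. mu_m \<chi> * ?A j \<chi>) + (\<Sum>\<chi>\<in>Irr SG. mu_m \<chi> * ?A i \<chi>) + (\<Sum>\<chi>\<in>Irr SG. ?A i \<chi> * ?A j \<chi>)) / (?Q * ?Q)"
    unfolding sum.distrib[symmetric] sum_divide_distrib mu_t_def by (intro sum.cong refl) (simp add: algebra_simps)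
  also have "\<dots> = (2 * ?Q + (?Q * ((if i = j then ?Q else 0) - 1) + ?Q * ((if i + j = 0 \<or> i + j = q - 1 then ?Q else 0) - 1))) / (?Q * ?Q)"
    unfolding mA AA sums_mu(2) by simp
  also have "\<dots> = (if i = j then 1 else 0) + (if i + j = 0 \<or> i + j = q - 1 then 1 else 0)"
  proof -
    have "x \<noteq> 0 \<Longrightarrow> (2 * x + (x * ((if P1 then x else 0) - 1) + x * ((if P2 then x else 0) - 1))) / (x * x) = (if P1 then 1 else 0) + (if P2 then 1 else 0)" for x :: complex and P1 P2
      by (simp add: field_simps)
    then show ?thesis using q1_nz by blast
  qed
  finally show ?thesis .
qed

lemma sum_mu_t_m: "(\<Sum>j<q - 1. mu_t j \<chi>) = mu_m \<chi>"
proof -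
  have "(\<Sum>j<q - 1. \<Sum>k\<in>Tx. \<chi> (h k) * al j (inverse k)) = (\<Sum>k\<in>Tx. \<chi> (h k) * (\<Sum>j<q - 1. al j (inverse k)))"
    unfolding sum_distrib_left by (rule sum.swap)
  also have "\<dots> = 0" by (intro sum.neutral ballI, subst sum_al_dual) auto
  finally have "(\<Sum>j<q - 1. \<Sum>k\<in>Tx. \<chi> (h k) * al j (inverse k)) = 0" .
  then have "(\<Sum>j<q - 1. mu_t j \<chi>) = of_nat (q - 1) * mu_m \<chi> / (of_nat q - 1)"
    unfolding mu_t_def sum_divide_distrib[symmetric] by (simp add: sum.distrib)
  then show ?thesis using q1_nz by (simp add: of_nat_q1)
qed

text \<open>The restriction to P splits into the trivial character, q - 1 further linear characters
  permuted transitively by the torus, and two families of q - 1 characters of degree r / 2, one for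
  each square root of -1. Conjugate characters occur equally often; evaluation at the identity and
  at \<open>ze\<close> gives the two formulas.\<close>

lemma degree_formula:
  assumes s: "s * s = -1"
  shows "\<chi> \<one> = mu_m \<chi> + (of_nat q - 1) * mu_a \<chi> + (of_nat q - 1) * (of_nat r / 2) * (mu_b s \<chi> + mu_b (- s) \<chi>)"
    "\<chi> ze = mu_m \<chi> + (of_nat q - 1) * mu_a \<chi> - (of_nat r / 2) * (mu_b s \<chi> + mu_b (- s) \<chi>)"
proof -
  have q0: "of_nat q \<noteq> (0::complex)" using q_ge by simp
  have b: "(of_nat r / 2) * (mu_b s \<chi> + mu_b (- s) \<chi>) = (\<chi> \<one> - \<chi> ze) / of_nat q"
  proof -
    have e: "(of_nat r / 2) * (mu_b s \<chi> + mu_b (- s) \<chi>) = (of_nat r * of_nat r / 4) * (2 * (\<chi> \<one> - \<chi> ze)) / of_nat (q\<^sup>2)"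
      unfolding mu_b_def using q0 by (simp add: field_simps)
    have l: "(2 * x / 4) * (2 * y) / x\<^sup>2 = y / x" if "x \<noteq> 0" for x y :: complex
    proof -
      have "(2 * x / 4) * (2 * y) = x * y" by simp
      then show ?thesis using that by (simp add: power2_eq_square)
    qed
    show ?thesis unfolding e r_sq_c of_nat_power by (rule l[OF q0])
  qed
  have m: "mu_m \<chi> + (of_nat q - 1) * mu_a \<chi> = (\<chi> \<one> + (of_nat q - 1) * \<chi> ze) / of_nat q"
    unfolding mu_m_def mu_a_def using q0 by (simp add: field_simps power2_eq_square)
  show "\<chi> \<one> = mu_m \<chi> + (of_nat q - 1) * mu_a \<chi> + (of_nat q - 1) * (of_nat r / 2) * (mu_b s \<chi> + mu_b (- s) \<chi>)"
    unfolding m mult.assoc b using q0 by (simp add: field_simps)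
  show "\<chi> ze = mu_m \<chi> + (of_nat q - 1) * mu_a \<chi> - (of_nat r / 2) * (mu_b s \<chi> + mu_b (- s) \<chi>)"
    unfolding m b using q0 by (simp add: field_simps)
qed

end

section \<open>Inverses of square arrays and integrality of central characters\<close>

lemma square_inverse:
  fixes A :: "'x \<Rightarrow> 'y \<Rightarrow> complex" and B :: "'y \<Rightarrow> 'x \<Rightarrow> complex"
  assumes fin: "finite X" "finite Y" and card: "card X = card Y"
    and inv: "\<And>x x'. x \<in> X \<Longrightarrow> x' \<in> X \<Longrightarrow> (\<Sum>y\<in>Y. A x y * B y x') = (if x = x' then 1 else 0)"
    and y: "y \<in> Y" "y' \<in> Y"
  shows "(\<Sum>x\<in>X. B y x * A x y') = (if y = y' then 1 else 0)"
proof -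
  let ?n = "card X"
  obtain e where e: "bij_betw e {..<?n} X"
    using ex_bij_betw_nat_finite[OF fin(1)] by (auto simp: atLeast0LessThan)
  obtain d where d: "bij_betw d {..<?n} Y"
    using ex_bij_betw_nat_finite[OF fin(2)] card by (auto simp: atLeast0LessThan)
  have ei: "e i \<in> X" "e i = e j \<longleftrightarrow> i = j" if "i < ?n" "j < ?n" for i j
    using e that unfolding bij_betw_def inj_on_def by auto
  have di: "d i = d j \<longleftrightarrow> i = j" if "i < ?n" "j < ?n" for i j
    using d that unfolding bij_betw_def inj_on_def by auto
  define M where "M = mat ?n ?n (\<lambda>(i,j). A (e i) (d j))"
  define N where "N = mat ?n ?n (\<lambda>(i,j). B (d i) (e j))"
  have c: "M \<in> carrier_mat ?n ?n" "N \<in> carrier_mat ?n ?n" by (simp_all add: M_def N_def)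
  have "M * N = 1\<^sub>m ?n"
  proof (rule eq_matI)
    fix i j assume "i < dim_row (1\<^sub>m ?n)" "j < dim_col (1\<^sub>m ?n)"
    then have ij: "i < ?n" "j < ?n" by auto
    have "(M * N) $$ (i,j) = (\<Sum>l<?n. A (e i) (d l) * B (d l) (e j))"
      unfolding index_mult_mat_sum[OF c ij] using ij by (intro sum.cong refl) (simp add: M_def N_def)
    also have "\<dots> = (\<Sum>y\<in>Y. A (e i) y * B y (e j))" by (rule sum.reindex_bij_betw[OF d])
    finally show "(M * N) $$ (i,j) = 1\<^sub>m ?n $$ (i,j)" using inv[of "e i" "e j"] ei[OF ij] ei[OF ij(2,1)] ij by simp
  qed (use c in auto)
  then have NM: "N * M = 1\<^sub>m ?n" by (rule mat_mult_left_right_inverse[OF c])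
  obtain i j where ij: "i < ?n" "j < ?n" "y = d i" "y' = d j" using y d unfolding bij_betw_def by (auto simp: image_iff)
  have "(\<Sum>x\<in>X. B y x * A x y') = (\<Sum>l<?n. B (d i) (e l) * A (e l) (d j))"
    unfolding ij(3,4) by (rule sum.reindex_bij_betw[OF e, symmetric])
  also have "\<dots> = (N * M) $$ (i,j)"
    unfolding index_mult_mat_sum[OF c(2,1) ij(1,2)] using ij by (intro sum.cong refl) (simp add: M_def N_def)
  finally show ?thesis unfolding NM using ij di by simp
qed

lemma smult_one_mat': "1 \<cdot>\<^sub>m A = (A :: complex mat)"
  by (rule eq_matI) auto

lemma algebraic_int_eigenvalue:
  fixes M :: "int mat" and v :: "complex vec"
  assumes M: "M \<in> carrier_mat n n" and ev: "eigenvector (map_mat of_int M) v k"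
  shows "algebraic_int k"
proof -
  have c: "map_mat of_int M \<in> carrier_mat n n" using M by simp
  have "poly (char_poly (map_mat of_int M)) k = 0"
    using ev eigenvalue_root_char_poly[OF c] unfolding eigenvalue_def by blast
  then have "poly (map_poly of_int (char_poly M)) k = 0" by (simp only: of_int_hom.char_poly_hom[OF M])
  moreover have "lead_coeff (char_poly M) = 1" using degree_monic_char_poly[OF M] by simp
  ultimately show ?thesis by (intro algebraic_int.intros[of "map_poly of_int (char_poly M)"]) (auto simp: coeff_map_poly)
qed

context fin_group
begin

text \<open>The values of the character, listed over the group, form an eigenvector of the 0-1
  matrix of multiplication by the conjugacy class of z, and the eigenvalue is the central character.
  It is therefore a root of a monic integral polynomial; c is the order of the centraliser.\<close>

lemma class_sum_algebraic_int:
  assumes x: "\<chi> \<in> Irr G" and z: "z \<in> carrier G" and c: "card {h \<in> carrier G. h \<otimes> z \<otimes> inv h = z} = c"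
  shows "algebraic_int (of_nat (card (carrier G)) / of_nat c * \<chi> z / \<chi> \<one>)"
proof -
  let ?Z = "\<lambda>y. {h \<in> carrier G. h \<otimes> z \<otimes> inv h = y}"
  let ?N = "card (carrier G)"
  define K where "K = (\<lambda>h. h \<otimes> z \<otimes> inv h) ` carrier G"
  have Kc: "y \<in> carrier G" if "y \<in> K" for y using that z by (auto simp: K_def)
  have fK: "finite K" by (simp add: K_def)
  have "\<one> \<in> ?Z z" using z by simp
  then have "card (?Z z) \<noteq> 0" by (subst card_0_eq) auto
  then have c0: "c \<noteq> 0" unfolding c .
  have fib: "card (?Z y) = c" if y: "y \<in> K" for y
  proof -
    obtain g where g: "g \<in> carrier G" "y = g \<otimes> z \<otimes> inv g" using y by (auto simp: K_def)
    have "bij_betw (\<lambda>h. g \<otimes> h) (?Z z) (?Z y)"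
    proof (rule bij_betw_byWitness[of _ "\<lambda>h. inv g \<otimes> h"])
      show "\<forall>h\<in>?Z z. inv g \<otimes> (g \<otimes> h) = h" using g by (simp add: m_assoc[symmetric])
      show "\<forall>h\<in>?Z y. g \<otimes> (inv g \<otimes> h) = h" using g by (simp add: m_assoc[symmetric])
      have "g \<otimes> h \<otimes> z \<otimes> inv (g \<otimes> h) = y" if h: "h \<in> carrier G" "h \<otimes> z \<otimes> inv h = z" for h
      proof -
        have "g \<otimes> h \<otimes> z \<otimes> inv (g \<otimes> h) = g \<otimes> (h \<otimes> z \<otimes> inv h) \<otimes> inv g" using g h(1) z by (simp add: inv_mult_group m_assoc)
        then show ?thesis using h g by simp
      qed
      then show "(\<lambda>h. g \<otimes> h) ` ?Z z \<subseteq> ?Z y" using g by auto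
      have "inv g \<otimes> h \<otimes> z \<otimes> inv (inv g \<otimes> h) = z" if h: "h \<in> carrier G" "h \<otimes> z \<otimes> inv h = y" for h
      proof -
        have "inv g \<otimes> h \<otimes> z \<otimes> inv (inv g \<otimes> h) = inv g \<otimes> (h \<otimes> z \<otimes> inv h) \<otimes> g" using g h(1) z by (simp add: inv_mult_group m_assoc)
        also have "\<dots> = inv g \<otimes> (g \<otimes> z \<otimes> inv g) \<otimes> g" using h g by simp
        also have "\<dots> = z" using g z by (simp add: m_assoc) (simp add: m_assoc[symmetric])
        finally show ?thesis .
      qed
      then show "(\<lambda>h. inv g \<otimes> h) ` ?Z y \<subseteq> ?Z z" using g by auto
    qed
    then show ?thesis using bij_betw_same_card c by force
  qed
  have avg: "of_nat c * (\<Sum>y\<in>K. \<chi> (x \<otimes> y)) = of_nat ?N / \<chi> \<one> * \<chi> x * \<chi> z" if x': "x \<in> carrier G" for x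
  proof -
    have "(\<Sum>h\<in>carrier G. \<chi> (x \<otimes> (h \<otimes> z \<otimes> inv h))) = (\<Sum>y\<in>K. \<Sum>h\<in>?Z y. \<chi> (x \<otimes> (h \<otimes> z \<otimes> inv h)))"
      unfolding K_def by (rule sum.image_gen) simp
    also have "\<dots> = (\<Sum>y\<in>K. of_nat c * \<chi> (x \<otimes> y))" by (intro sum.cong refl) (simp add: fib)
    finally show ?thesis using Irr_average[OF x x' z] by (simp add: sum_distrib_left)
  qed
  obtain e where e: "bij_betw e {..<?N} (carrier G)"
    using ex_bij_betw_nat_finite[OF fin] by (auto simp: atLeast0LessThan)
  have ec: "e i \<in> carrier G" if "i < ?N" for i using e that unfolding bij_betw_def by auto
  define M where "M = mat ?N ?N (\<lambda>(i,j). if inv (e i) \<otimes> e j \<in> K then 1 else 0 :: int)"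
  define v where "v = vec ?N (\<lambda>i. \<chi> (e i))"
  let ?k = "of_nat ?N / of_nat c * \<chi> z / \<chi> \<one>"
  have "map_mat of_int M *\<^sub>v v = ?k \<cdot>\<^sub>v v"
  proof (rule eq_vecI)
    fix i assume "i < dim_vec (?k \<cdot>\<^sub>v v)"
    then have i: "i < ?N" by (simp add: v_def)
    have "(map_mat of_int M *\<^sub>v v) $ i = (\<Sum>j<?N. (if inv (e i) \<otimes> e j \<in> K then 1 else 0) * \<chi> (e j))"
      using i by (auto simp: M_def v_def scalar_prod_def atLeast0LessThan intro!: sum.cong)
    also have "\<dots> = (\<Sum>g\<in>carrier G. (if inv (e i) \<otimes> g \<in> K then 1 else 0) * \<chi> g)"
      by (rule sum.reindex_bij_betw[OF e])
    also have "\<dots> = (\<Sum>g\<in>{g \<in> carrier G. inv (e i) \<otimes> g \<in> K}. \<chi> g)"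
      by (subst sum.inter_filter) (auto intro!: sum.cong)
    also have "\<dots> = (\<Sum>y\<in>K. \<chi> (e i \<otimes> y))"
      by (rule sum.reindex_bij_witness[of _ "\<lambda>y. e i \<otimes> y" "\<lambda>g. inv (e i) \<otimes> g"]) (use ec[OF i] Kc in \<open>auto simp: m_assoc[symmetric]\<close>)
    also have "\<dots> = ?k * \<chi> (e i)" using avg[OF ec[OF i]] c0 Irr_one_nz[OF x] by (simp add: field_simps)
    finally show "(map_mat of_int M *\<^sub>v v) $ i = (?k \<cdot>\<^sub>v v) $ i" using i by (simp add: v_def)
  qed (simp add: M_def v_def)
  moreover have "v \<noteq> 0\<^sub>v ?N"
  proof
    assume v0: "v = 0\<^sub>v ?N"
    obtain i where i: "i < ?N" "e i = \<one>" using e unfolding bij_betw_def by (metis imageE lessThan_iff one_closed)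
    have "v $ i = \<chi> \<one>" using i by (simp add: v_def)
    then show False using v0 i Irr_one_nz[OF x] by simp
  qed
  ultimately have "eigenvector (map_mat of_int M) v ?k" unfolding eigenvector_def by (simp add: M_def v_def)
  then show ?thesis by (rule algebraic_int_eigenvalue[of M ?N, rotated]) (simp add: M_def)
qed

lemma average_trace:
  assumes r: "irreducible_rep G n \<rho>" and X: "X \<in> carrier_mat n n" and Y: "Y \<in> carrier_mat n n" and Z: "Z \<in> carrier_mat n n"
  shows "(\<Sum>g\<in>carrier G. mtr (Y * (\<rho> g * X * \<rho> (inv g)) * Z)) = of_nat (card (carrier G)) * mtr X / of_nat n * mtr (Y * Z)"
proof -
  note R = mrepD[OF irrD(1)[OF r]]
  have car: "\<rho> g * X * \<rho> (inv g) \<in> carrier_mat n n" if "g \<in> carrier G" for g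
    by (rule mult_carrier_mat[OF mult_carrier_mat[OF R(1)[OF that] X] R(1)[OF inv_closed[OF that]]])
  have car2: "Y * (\<rho> g * X * \<rho> (inv g)) \<in> carrier_mat n n" if "g \<in> carrier G" for g using Y car[OF that] by simp
  let ?c = "of_nat (card (carrier G)) * mtr X / of_nat n"
  have "(\<Sum>g\<in>carrier G. mtr (Y * (\<rho> g * X * \<rho> (inv g)) * Z)) = mtr (msum n n (carrier G) (\<lambda>g. Y * (\<rho> g * X * \<rho> (inv g)) * Z))"
    by (rule mtr_msum[symmetric]) (rule mult_carrier_mat[OF car2 Z])
  also have "\<dots> = mtr (Y * msum n n (carrier G) (\<lambda>g. \<rho> g * X * \<rho> (inv g)) * Z)"
    by (simp only: mult_msum[OF Y car] msum_mult[OF Z car2])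
  also have "\<dots> = mtr (Y * (?c \<cdot>\<^sub>m 1\<^sub>m n) * Z)" unfolding avg_same[OF r X] ..
  also have "Y * (?c \<cdot>\<^sub>m 1\<^sub>m n) * Z = ?c \<cdot>\<^sub>m (Y * Z)"
    using Y Z by (simp add: mult_smult_distrib[OF Y, of "1\<^sub>m n" n] mult_smult_assoc_mat[OF Y Z])
  also have "mtr \<dots> = ?c * mtr (Y * Z)" by (rule mtr_smult[of _ n]) (use Y Z in simp)
  finally show ?thesis .
qed

end

section \<open>The Hecke algebra of a linear character of P\<close>

context suzuki
begin

definition biq :: "('a \<Rightarrow> complex) \<Rightarrow> bool" where
  "biq \<phi> \<longleftrightarrow> (\<forall>x\<in>Sz. \<forall>a b. \<phi> (u a b \<otimes> x) = lam a * \<phi> x \<and> \<phi> (x \<otimes> u a b) = lam a * \<phi> x)"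

lemma biqD: "biq \<phi> \<Longrightarrow> x \<in> Sz \<Longrightarrow> \<phi> (u a b \<otimes> x) = lam a * \<phi> x" "biq \<phi> \<Longrightarrow> x \<in> Sz \<Longrightarrow> \<phi> (x \<otimes> u a b) = lam a * \<phi> x"
  by (auto simp: biq_def)

text \<open>Equivariance on the two sides has to be compatible: at a torus element k other than 1
  the two sides scale by lam c and lam (k * c), which differ for some c, so the value there is zero.
  On the big cell no such condition arises.\<close>

lemma biq_values:
  assumes b: "biq \<phi>"
  shows "\<phi> (u a b) = lam a * \<phi> \<one>" "k \<noteq> 0 \<Longrightarrow> k \<noteq> 1 \<Longrightarrow> \<phi> (u a b \<otimes> h k) = 0"
    "k \<noteq> 0 \<Longrightarrow> \<phi> (u a b \<otimes> h k \<otimes> w \<otimes> u c d) = lam a * lam c * \<phi> (h k \<otimes> w)"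
proof -
  show "\<phi> (u a b) = lam a * \<phi> \<one>" using biqD(1)[OF b one_Sz, of a b] by simp
  show "\<phi> (u a b \<otimes> h k) = 0" if k: "k \<noteq> 0" "k \<noteq> 1"
  proof -
    have nz: "1 + k \<noteq> 0" using k by simp
    \<comment> \<open>Chosen so that c + k * c = 1, where \<open>lam\<close> is -1.\<close>
    define c where "c = 1 / (1 + k)"
    have "(1 + k) * c = 1" using nz by (simp add: c_def)
    then have ck: "c + k * c = 1" by (simp only: distrib_right mult_1)
    have "lam c * \<phi> (h k) = \<phi> (h k \<otimes> u c 0)" using biqD(2)[OF b h_Sz[OF k(1)]] by simp
    also have "\<dots> = lam (k * c) * \<phi> (h k)" using biqD(1)[OF b h_Sz[OF k(1)]] by (simp add: h_u k)
    finally have "lam c * (lam c * \<phi> (h k)) = lam (c + k * c) * \<phi> (h k)" by (simp add: lam_add)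
    then have "\<phi> (h k) = - \<phi> (h k)" unfolding ck by (simp add: mult.assoc[symmetric])
    then have "\<phi> (h k) = 0" by simp
    then show ?thesis using biqD(1)[OF b h_Sz[OF k(1)]] by simp
  qed
  show "\<phi> (u a b \<otimes> h k \<otimes> w \<otimes> u c d) = lam a * lam c * \<phi> (h k \<otimes> w)" if k: "k \<noteq> 0"
  proof -
    have hw: "h k \<otimes> w \<in> Sz" using k by (simp add: Sz_mult)
    have "u a b \<otimes> h k \<otimes> w \<otimes> u c d = u a b \<otimes> ((h k \<otimes> w) \<otimes> u c d)" using k by (simp add: m_assoc)
    also have "\<phi> \<dots> = lam a * \<phi> ((h k \<otimes> w) \<otimes> u c d)" by (rule biqD(1)[OF b Sz_mult[OF hw u_Sz]])
    also have "\<dots> = lam a * (lam c * \<phi> (h k \<otimes> w))" using biqD(2)[OF b hw] by simp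
    finally show ?thesis by simp
  qed
qed

text \<open>Every double coset supporting a bi-equivariant function contains an involution; this is Gelfand's trick.\<close>

lemma biq_inv:
  assumes b: "biq \<phi>" and x: "x \<in> Sz"
  shows "\<phi> (inv x) = \<phi> x"
proof (cases "x \<in> B")
  case True
  then obtain a b' k where k: "k \<noteq> 0" "x = u a b' \<otimes> h k" by (rule BE)
  have i: "inv x = u (inverse k * a) (inverse k * th (inverse k) * (b' + a * th a)) \<otimes> h (inverse k)"
    using k by (simp add: inv_uh h_u)
  show ?thesis
  proof (cases "k = 1")
    case True
    then show ?thesis using k by (simp add: inv_u biq_values(1)[OF b])
  next
    case False
    then have "inverse k \<noteq> 1" by auto
    then have "\<phi> (inv x) = 0" unfolding i using biq_values(2)[OF b] k(1) by simp
    then show ?thesis unfolding k(2) biq_values(2)[OF b k(1) False] .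
  qed
next
  case False
  then have "x \<in> C" using x by (simp add: Sz_def)
  then obtain a b' k c d where k: "k \<noteq> 0" and e: "x = u a b' \<otimes> h k \<otimes> w \<otimes> u c d" by (rule CE)
  have "inv x = inv (u c d) \<otimes> (w \<otimes> inv (h k)) \<otimes> inv (u a b')" unfolding e using k by (simp add: inv_mult_group m_assoc)
  also have "\<dots> = u c (d + c * th c) \<otimes> h k \<otimes> w \<otimes> u a (b' + a * th a)" using k by (simp add: inv_u inv_h w_h m_assoc)
  finally show ?thesis unfolding e using biq_values(3)[OF b k] by simp
qed

text \<open>The support consists of the double coset P and the q - 1 double cosets of the elements h
  k w, of sizes q^2 and q^4; the inverse disappears by inversion invariance.\<close>

lemma biq_sum:
  assumes b: "biq \<phi>" "biq \<phi>'"
  shows "(\<Sum>x\<in>Sz. \<phi> x * \<phi>' (inv x)) = of_nat (q\<^sup>2) * (\<phi> \<one> * \<phi>' \<one>) + of_nat (q ^ 4) * (\<Sum>k\<in>{k. k \<noteq> 0}. \<phi> (h k \<otimes> w) * \<phi>' (h k \<otimes> w))"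
proof -
  have "(\<Sum>x\<in>Sz. \<phi> x * \<phi>' (inv x)) = (\<Sum>x\<in>Sz. \<phi> x * \<phi>' x)" by (intro sum.cong refl) (simp add: biq_inv[OF b(2)])
  also have "\<dots> = (\<Sum>x\<in>B. \<phi> x * \<phi>' x) + (\<Sum>x\<in>C. \<phi> x * \<phi>' x)"
    unfolding Sz_def using bij_betw_finite[OF bij_B] bij_betw_finite[OF bij_C] B_C_disjoint by (intro sum.union_disjoint) auto
  also have "(\<Sum>x\<in>B. \<phi> x * \<phi>' x) = of_nat (q\<^sup>2) * (\<phi> \<one> * \<phi>' \<one>)"
  proof -
    have "(\<Sum>x\<in>B. \<phi> x * \<phi>' x) = (\<Sum>a\<in>UNIV. \<Sum>b\<in>UNIV. \<phi> (u a b) * \<phi>' (u a b)) + (\<Sum>k\<in>Tx. \<Sum>a\<in>UNIV. \<Sum>b\<in>UNIV. \<phi> (u a b \<otimes> h k) * \<phi>' (u a b \<otimes> h k))"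
      unfolding sum_B by (subst sum_Tx) simp
    also have "(\<Sum>k\<in>Tx. \<Sum>a\<in>UNIV. \<Sum>b\<in>UNIV. \<phi> (u a b \<otimes> h k) * \<phi>' (u a b \<otimes> h k)) = 0"
      by (intro sum.neutral ballI) (simp add: biq_values(2)[OF b(1)])
    also have "(\<Sum>a\<in>UNIV. \<Sum>b\<in>UNIV. \<phi> (u a b) * \<phi>' (u a b)) = (\<Sum>a\<in>(UNIV :: 'k set). \<Sum>b\<in>(UNIV :: 'k set). \<phi> \<one> * \<phi>' \<one>)"
    proof (intro sum.cong refl)
      fix a b' :: 'k
      have "\<phi> (u a b') * \<phi>' (u a b') = (lam a * lam a) * (\<phi> \<one> * \<phi>' \<one>)"
        unfolding biq_values(1)[OF b(1)] biq_values(1)[OF b(2)] by (simp only: mult_ac)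
      then show "\<phi> (u a b') * \<phi>' (u a b') = \<phi> \<one> * \<phi>' \<one>" by simp
    qed
    finally show ?thesis by (simp add: card_UNIV_q power2_eq_square)
  qed
  also have "(\<Sum>x\<in>C. \<phi> x * \<phi>' x) = (\<Sum>k\<in>{k. k \<noteq> 0}. \<Sum>x\<in>(UNIV :: ('k \<times> 'k) set). \<Sum>y\<in>(UNIV :: ('k \<times> 'k) set). \<phi> (h k \<otimes> w) * \<phi>' (h k \<otimes> w))"
    unfolding sum_C
  proof (intro sum.cong refl)
    fix k :: 'k and x y :: "'k \<times> 'k" assume "k \<in> {k. k \<noteq> 0}"
    then have k: "k \<noteq> 0" by simp
    let ?g = "u (fst x) (snd x) \<otimes> h k \<otimes> w \<otimes> u (fst y) (snd y)"
    have "\<phi> ?g * \<phi>' ?g = (lam (fst x) * lam (fst x)) * (lam (fst y) * lam (fst y)) * (\<phi> (h k \<otimes> w) * \<phi>' (h k \<otimes> w))"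
      unfolding biq_values(3)[OF b(1) k] biq_values(3)[OF b(2) k] by (simp only: mult_ac)
    then show "\<phi> ?g * \<phi>' ?g = \<phi> (h k \<otimes> w) * \<phi>' (h k \<otimes> w)" by simp
  qed
  also have "\<dots> = of_nat (q ^ 4) * (\<Sum>k\<in>{k. k \<noteq> 0}. \<phi> (h k \<otimes> w) * \<phi>' (h k \<otimes> w))"
    by (simp add: card_UNIV_q sum_distrib_left power4_eq_xxxx mult.assoc flip: UNIV_Times_UNIV)
  finally show ?thesis .
qed

definition chE :: "('a \<Rightarrow> complex) \<Rightarrow> 'a \<Rightarrow> complex" where
  "chE \<chi> x = (\<Sum>p\<in>UNIV. lam (fst p) * \<chi> (u (fst p) (snd p) \<otimes> x)) / of_nat (q\<^sup>2)"

lemma chE_one: assumes "\<chi> \<in> Irr SG" shows "chE \<chi> \<one> = mu_a \<chi>"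
proof -
  have "(\<Sum>p\<in>UNIV. lam (fst p) * \<chi> (u (fst p) (snd p) \<otimes> \<one>)) = (\<Sum>a\<in>UNIV. \<Sum>b\<in>UNIV. lam a * \<chi> (u a b))"
    by (simp add: sum.cartesian_product case_prod_unfold)
  then show ?thesis unfolding chE_def mu_a_sum(1)[OF assms] using q_ge by simp
qed

text \<open>The idempotent projecting onto the vectors on which P acts by the linear character; as
  \<open>lam\<close> is its own inverse, no inverse appears in the sum. Its trace is the
  multiplicity \<open>mu_a\<close>, and \<open>chE\<close> is the trace of the representation
  composed with it.\<close>

definition Em :: "nat \<Rightarrow> ('a \<Rightarrow> complex mat) \<Rightarrow> complex mat" where
  "Em e \<rho> = (1 / of_nat (q\<^sup>2)) \<cdot>\<^sub>m msum e e UNIV (\<lambda>p. lam (fst p) \<cdot>\<^sub>m \<rho> (u (fst p) (snd p)))"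

lemma Em_props:
  assumes m: "mrep SG e \<rho>"
  shows "Em e \<rho> \<in> carrier_mat e e" "\<rho> (u a b) * Em e \<rho> = lam a \<cdot>\<^sub>m Em e \<rho>" "Em e \<rho> * \<rho> (u a b) = lam a \<cdot>\<^sub>m Em e \<rho>"
    "Em e \<rho> * Em e \<rho> = Em e \<rho>" "x \<in> Sz \<Longrightarrow> mtr (Em e \<rho> * \<rho> x) = chE (\<lambda>g. mtr (\<rho> g)) x"
proof -
  let ?t = "\<lambda>p. lam (fst p) \<cdot>\<^sub>m \<rho> (u (fst p) (snd p))"
  have R: "\<rho> x \<in> carrier_mat e e" "y \<in> Sz \<Longrightarrow> \<rho> (x \<otimes> y) = \<rho> x * \<rho> y" if "x \<in> Sz" for x y
    using SG.mrepD[OF m] that by auto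
  let ?S = "msum e e UNIV (\<lambda>p. ?t p)"
  have t: "?t p \<in> carrier_mat e e" for p using R(1)[OF u_Sz] by simp
  have S: "?S \<in> carrier_mat e e" by simp
  show E: "Em e \<rho> \<in> carrier_mat e e" by (simp add: Em_def)
  have left: "\<rho> (u a b) * ?S = lam a \<cdot>\<^sub>m ?S" for a b
  proof -
    have "\<rho> (u a b) * ?S = msum e e UNIV (\<lambda>p. \<rho> (u a b) * ?t p)"
      by (rule mult_msum[OF R(1)[OF u_Sz] t])
    also have "\<dots> = msum e e UNIV (\<lambda>p. (\<lambda>p. lam a \<cdot>\<^sub>m ?t p) (a + fst p, b + snd p + th a * fst p))"
    proof (rule msum_cong)
      fix p :: "'k \<times> 'k"
      have "\<rho> (u a b) * ?t p = lam (fst p) \<cdot>\<^sub>m \<rho> (u (a + fst p) (b + snd p + th a * fst p))"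
        using mult_smult_distrib[OF R(1)[OF u_Sz] R(1)[OF u_Sz]] R(2)[OF u_Sz u_Sz] by (simp add: u_mult)
      moreover have "lam a * lam (a + fst p) = lam (fst p)" by (simp add: lam_add mult.assoc[symmetric])
      ultimately show "\<rho> (u a b) * ?t p = (\<lambda>p. lam a \<cdot>\<^sub>m ?t p) (a + fst p, b + snd p + th a * fst p)"
        by (simp add: smult_smult_mat')
    qed
    also have "\<dots> = msum e e UNIV (\<lambda>p. lam a \<cdot>\<^sub>m ?t p)"
      by (rule msum_reindex, rule bij_betw_byWitness[of _ "\<lambda>p. (a + fst p, b + snd p + th a * (a + fst p))"]) (auto simp: add_ac)
    also have "\<dots> = lam a \<cdot>\<^sub>m ?S" by (rule msum_smult[OF t])
    finally show ?thesis .
  qed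
  have right: "?S * \<rho> (u a b) = lam a \<cdot>\<^sub>m ?S" for a b
  proof -
    have "?S * \<rho> (u a b) = msum e e UNIV (\<lambda>p. ?t p * \<rho> (u a b))"
      by (rule msum_mult[OF R(1)[OF u_Sz] t])
    also have "\<dots> = msum e e UNIV (\<lambda>p. (\<lambda>p. lam a \<cdot>\<^sub>m ?t p) (fst p + a, snd p + b + th (fst p) * a))"
    proof (rule msum_cong)
      fix p :: "'k \<times> 'k"
      have "?t p * \<rho> (u a b) = lam (fst p) \<cdot>\<^sub>m \<rho> (u (fst p + a) (snd p + b + th (fst p) * a))"
        using mult_smult_assoc_mat[OF R(1)[OF u_Sz] R(1)[OF u_Sz]] R(2)[OF u_Sz u_Sz] by (simp add: u_mult)
      moreover have "lam a * lam (fst p + a) = lam (fst p)" by (simp add: lam_add mult.left_commute)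
      ultimately show "?t p * \<rho> (u a b) = (\<lambda>p. lam a \<cdot>\<^sub>m ?t p) (fst p + a, snd p + b + th (fst p) * a)"
        by (simp add: smult_smult_mat')
    qed
    also have "\<dots> = msum e e UNIV (\<lambda>p. lam a \<cdot>\<^sub>m ?t p)"
      by (rule msum_reindex, rule bij_betw_byWitness[of _ "\<lambda>p. (fst p + a, snd p + b + th (fst p + a) * a)"]) (auto simp: add_ac)
    also have "\<dots> = lam a \<cdot>\<^sub>m ?S" by (rule msum_smult[OF t])
    finally show ?thesis .
  qed
  show l: "\<rho> (u a b) * Em e \<rho> = lam a \<cdot>\<^sub>m Em e \<rho>" for a b
    unfolding Em_def mult_smult_distrib[OF R(1)[OF u_Sz] S] left by (simp add: smult_smult_mat' mult.commute)
  show "Em e \<rho> * \<rho> (u a b) = lam a \<cdot>\<^sub>m Em e \<rho>"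
    unfolding Em_def mult_smult_assoc_mat[OF S R(1)[OF u_Sz]] right by (simp add: smult_smult_mat' mult.commute)
  show "Em e \<rho> * Em e \<rho> = Em e \<rho>"
  proof -
    have "?S * Em e \<rho> = msum e e UNIV (\<lambda>p. ?t p * Em e \<rho>)" by (rule msum_mult[OF E t])
    also have "\<dots> = msum e e UNIV (\<lambda>p :: 'k \<times> 'k. Em e \<rho>)"
    proof (rule msum_cong)
      fix p :: "'k \<times> 'k"
      have "?t p * Em e \<rho> = lam (fst p) \<cdot>\<^sub>m (lam (fst p) \<cdot>\<^sub>m Em e \<rho>)"
        using mult_smult_assoc_mat[OF R(1)[OF u_Sz] E] l by simp
      then show "?t p * Em e \<rho> = Em e \<rho>" by (simp add: smult_smult_mat' smult_one_mat')
    qed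
    also have "\<dots> = of_nat (q\<^sup>2) \<cdot>\<^sub>m Em e \<rho>"
      by (rule eq_matI) (use E in \<open>auto simp: msum_index card_UNIV_q power2_eq_square simp flip: UNIV_Times_UNIV\<close>)
    finally have "?S * Em e \<rho> = of_nat (q\<^sup>2) \<cdot>\<^sub>m Em e \<rho>" .
    then have "(1 / of_nat (q\<^sup>2)) \<cdot>\<^sub>m (?S * Em e \<rho>) = Em e \<rho>" using q_ge by (simp add: smult_smult_mat' smult_one_mat')
    then have "((1 / of_nat (q\<^sup>2)) \<cdot>\<^sub>m ?S) * Em e \<rho> = Em e \<rho>" unfolding mult_smult_assoc_mat[OF S E] .
    then show ?thesis by (subst (1) Em_def)
  qed
  show "mtr (Em e \<rho> * \<rho> x) = chE (\<lambda>g. mtr (\<rho> g)) x" if x: "x \<in> Sz"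
  proof -
    have "?S * \<rho> x = msum e e UNIV (\<lambda>p. ?t p * \<rho> x)" by (rule msum_mult[OF R(1)[OF x] t])
    also have "\<dots> = msum e e UNIV (\<lambda>p. lam (fst p) \<cdot>\<^sub>m \<rho> (u (fst p) (snd p) \<otimes> x))"
      by (rule msum_cong) (simp add: mult_smult_assoc_mat[OF R(1)[OF u_Sz] R(1)[OF x]] R(2)[OF u_Sz x])
    finally have ee: "?S * \<rho> x = \<dots>" .
    have "mtr (Em e \<rho> * \<rho> x) = 1 / of_nat (q\<^sup>2) * mtr (?S * \<rho> x)"
      unfolding Em_def mult_smult_assoc_mat[OF S R(1)[OF x]] by (rule mtr_smult[of _ e]) (rule mult_carrier_mat[OF S R(1)[OF x]])
    also have "mtr (?S * \<rho> x) = (\<Sum>p\<in>UNIV. mtr (lam (fst p) \<cdot>\<^sub>m \<rho> (u (fst p) (snd p) \<otimes> x)))"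
      unfolding ee by (rule mtr_msum) (use R(1)[OF Sz_mult[OF u_Sz x]] in simp)
    also have "\<dots> = (\<Sum>p\<in>UNIV. lam (fst p) * mtr (\<rho> (u (fst p) (snd p) \<otimes> x)))"
      by (intro sum.cong refl mtr_smult[of _ e]) (rule R(1)[OF Sz_mult[OF u_Sz x]])
    finally show ?thesis by (simp add: chE_def)
  qed
qed

lemma biq_mtr:
  assumes m: "mrep SG e \<rho>" and X: "X \<in> carrier_mat e e"
  shows "biq (\<lambda>x. mtr (Em e \<rho> * X * Em e \<rho> * \<rho> x))"
  unfolding biq_def
proof (intro ballI allI conjI)
  fix x a b assume x: "x \<in> Sz"
  note E = Em_props[OF m]
  have R: "\<rho> x \<in> carrier_mat e e" "y \<in> Sz \<Longrightarrow> \<rho> (x \<otimes> y) = \<rho> x * \<rho> y" if "x \<in> Sz" for x y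
    using SG.mrepD[OF m] that by auto
  let ?E = "Em e \<rho>" and ?u = "\<rho> (u a b)"
  have c: "?E \<in> carrier_mat e e" "?u \<in> carrier_mat e e" "\<rho> x \<in> carrier_mat e e" using E(1) R(1) x by auto
  have EXE: "?E * X * ?E \<in> carrier_mat e e" "?E * X \<in> carrier_mat e e" using c X by auto
  have "mtr (?E * X * ?E * \<rho> (u a b \<otimes> x)) = mtr (?E * X * (?E * ?u) * \<rho> x)"
    using c X EXE by (simp add: R(2)[OF u_Sz x] assoc_mult_mat[of _ e e _ e _ e])
  also have "?E * X * (?E * ?u) * \<rho> x = lam a \<cdot>\<^sub>m (?E * X * ?E * \<rho> x)"
    unfolding E(3) mult_smult_distrib[OF EXE(2) c(1)] by (rule mult_smult_assoc_mat[OF EXE(1) c(3)])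
  also have "mtr \<dots> = lam a * mtr (?E * X * ?E * \<rho> x)" by (rule mtr_smult[of _ e]) (use EXE c in simp)
  finally show "mtr (?E * X * ?E * \<rho> (u a b \<otimes> x)) = lam a * mtr (?E * X * ?E * \<rho> x)" .
  have "mtr (?E * X * ?E * \<rho> (x \<otimes> u a b)) = mtr ((?E * X * ?E * \<rho> x) * ?u)"
    unfolding R(2)[OF x u_Sz] using assoc_mult_mat[OF EXE(1) c(3,2)] by simp
  also have "\<dots> = mtr (?u * (?E * X * ?E * \<rho> x))" by (rule mtr_comm[of _ e e]) (use EXE c in auto)
  also have "?u * (?E * X * ?E * \<rho> x) = (?u * ?E) * (X * ?E * \<rho> x)"
    using c X by (simp add: assoc_mult_mat[of _ e e _ e _ e])
  also have "\<dots> = lam a \<cdot>\<^sub>m (?E * (X * ?E * \<rho> x))" unfolding E(2) by (rule mult_smult_assoc_mat[OF c(1), of _ e]) (use c X in simp)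
  also have "?E * (X * ?E * \<rho> x) = ?E * X * ?E * \<rho> x" using c X by (simp add: assoc_mult_mat[of _ e e _ e _ e])
  also have "mtr (lam a \<cdot>\<^sub>m \<dots>) = lam a * mtr (?E * X * ?E * \<rho> x)" by (rule mtr_smult[of _ e]) (use EXE c in simp)
  finally show "mtr (?E * X * ?E * \<rho> (x \<otimes> u a b)) = lam a * mtr (?E * X * ?E * \<rho> x)" .
qed

end

lemma mtr_nondegenerate:
  assumes A: "A \<in> carrier_mat n n" and B: "B \<in> carrier_mat n n"
    and e: "\<And>X. X \<in> carrier_mat n n \<Longrightarrow> mtr (X * A) = mtr (X * B)"
  shows "A = B"
proof (rule eq_matI)
  fix i j assume "i < dim_row B" "j < dim_col B"
  then have ij: "i < n" "j < n" using B by auto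
  define X where "X = mat n n (\<lambda>(a,b). if a = j \<and> b = i then 1 else 0 :: complex)"
  have X: "X \<in> carrier_mat n n" by (simp add: X_def)
  have "mtr (X * C) = C $$ (i,j)" if C: "C \<in> carrier_mat n n" for C
  proof -
    have "mtr (X * C) = (\<Sum>a<n. \<Sum>l<n. X $$ (a,l) * C $$ (l,a))"
      unfolding mtr_def using X C by (intro sum.cong) (auto simp: index_mult_mat_sum[OF X C] simp del: index_mult_mat(1))
    also have "\<dots> = (\<Sum>a<n. if a = j then C $$ (i,a) else 0)"
    proof (intro sum.cong refl)
      fix a assume a: "a \<in> {..<n}"
      have "(\<Sum>l<n. X $$ (a,l) * C $$ (l,a)) = (\<Sum>l<n. if l = i then (if a = j then C $$ (i,a) else 0) else 0)"
        using a by (intro sum.cong refl) (auto simp: X_def)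
      then show "(\<Sum>l<n. X $$ (a,l) * C $$ (l,a)) = (if a = j then C $$ (i,a) else 0)" using ij by simp
    qed
    finally show ?thesis using ij by simp
  qed
  then show "A $$ (i,j) = B $$ (i,j)" using e[OF X] A B by simp
qed (use A B in auto)

context suzuki
begin

lemma Em_expand:
  assumes m: "mrep SG e \<rho>" and Y: "Y \<in> carrier_mat e e" and Z: "Z \<in> carrier_mat e e"
  shows "Y * Em e \<rho> * Z = (1 / of_nat (q\<^sup>2)) \<cdot>\<^sub>m msum e e UNIV (\<lambda>p. lam (fst p) \<cdot>\<^sub>m (Y * \<rho> (u (fst p) (snd p)) * Z))"
proof -
  have R: "\<rho> (u a b) \<in> carrier_mat e e" for a b using SG.mrepD(1)[OF m] by simp
  let ?t = "\<lambda>p. lam (fst p) \<cdot>\<^sub>m \<rho> (u (fst p) (snd p))"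
  have t: "?t p \<in> carrier_mat e e" for p using R by simp
  have S: "msum e e UNIV ?t \<in> carrier_mat e e" by simp
  have Yt: "Y * ?t p \<in> carrier_mat e e" for p using Y t by (rule mult_carrier_mat)
  have "Y * Em e \<rho> * Z = (1 / of_nat (q\<^sup>2)) \<cdot>\<^sub>m (Y * msum e e UNIV ?t * Z)"
    unfolding Em_def mult_smult_distrib[OF Y S] by (rule mult_smult_assoc_mat[OF mult_carrier_mat[OF Y S] Z])
  also have "Y * msum e e UNIV ?t * Z = msum e e UNIV (\<lambda>p. Y * ?t p * Z)"
    by (simp only: mult_msum[OF Y t] msum_mult[OF Z Yt])
  also have "\<dots> = msum e e UNIV (\<lambda>p. lam (fst p) \<cdot>\<^sub>m (Y * \<rho> (u (fst p) (snd p)) * Z))"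
    by (rule msum_cong) (simp add: mult_smult_distrib[OF Y R] mult_smult_assoc_mat[OF mult_carrier_mat[OF Y R] Z])
  finally show ?thesis .
qed

text \<open>For every matrix X the trace of X times the compressed matrix of x is a bi-equivariant
  function of x, hence invariant under inversion; the trace form is non-degenerate.\<close>

lemma Hecke_inv:
  assumes m: "mrep SG e \<rho>" and x: "x \<in> Sz"
  shows "Em e \<rho> * \<rho> (inv x) * Em e \<rho> = Em e \<rho> * \<rho> x * Em e \<rho>"
proof -
  have E: "Em e \<rho> \<in> carrier_mat e e" by (rule Em_props(1)[OF m])
  have R: "\<rho> y \<in> carrier_mat e e" if "y \<in> Sz" for y using SG.mrepD(1)[OF m] that by simp
  have t: "mtr (X * (Em e \<rho> * \<rho> y * Em e \<rho>)) = mtr (Em e \<rho> * X * Em e \<rho> * \<rho> y)"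
    if X: "(X :: complex mat) \<in> carrier_mat e e" and y: "y \<in> Sz" for X y
  proof -
    have "X * (Em e \<rho> * \<rho> y * Em e \<rho>) = (X * Em e \<rho> * \<rho> y) * Em e \<rho>"
      using X E R[OF y] by (simp add: assoc_mult_mat[of _ e e _ e _ e])
    also have "mtr \<dots> = mtr (Em e \<rho> * (X * Em e \<rho> * \<rho> y))" by (rule mtr_comm[of _ e e]) (use X E R[OF y] in auto)
    finally show ?thesis using X E R[OF y] by (simp add: assoc_mult_mat[of _ e e _ e _ e])
  qed
  show ?thesis
  proof (rule mtr_nondegenerate)
    fix X :: "complex mat" assume X: "X \<in> carrier_mat e e"
    show "mtr (X * (Em e \<rho> * \<rho> (inv x) * Em e \<rho>)) = mtr (X * (Em e \<rho> * \<rho> x * Em e \<rho>))"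
      unfolding t[OF X x] t[OF X Sz_inv[OF x]] by (rule biq_inv[OF biq_mtr[OF m X] x])
  qed (use E R[OF x] R[OF Sz_inv[OF x]] in auto)
qed

text \<open>Inversion reverses products but fixes each compressed matrix \<open>A x\<close>, so a
  product of two of them does not depend on the order. To apply this, \<open>A x * A y\<close> is
  expanded as an average of compressed matrices.\<close>

lemma Hecke_commute:
  assumes m: "mrep SG e \<rho>" and x: "x \<in> Sz" and y: "y \<in> Sz"
  defines "A \<equiv> \<lambda>x. Em e \<rho> * \<rho> x * Em e \<rho>"
  shows "A x * A y = A y * A x"
proof -
  have E: "Em e \<rho> \<in> carrier_mat e e" by (rule Em_props(1)[OF m])
  have EE: "Em e \<rho> * (Em e \<rho> * X) = Em e \<rho> * X" if "(X :: complex mat) \<in> carrier_mat e e" for X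
    using assoc_mult_mat[OF E E that] Em_props(4)[OF m] by simp
  have R: "\<rho> y \<in> carrier_mat e e" if "y \<in> Sz" for y using SG.mrepD(1)[OF m] that by simp
  have Rm: "\<rho> (x \<otimes> y) = \<rho> x * \<rho> y" if "x \<in> Sz" "y \<in> Sz" for x y using SG.mrepD(3)[OF m] that by simp
  have Ainv: "A (inv x) = A x" if "x \<in> Sz" for x unfolding A_def by (rule Hecke_inv[OF m that])
  have Am: "A x * A y = (1 / of_nat (q\<^sup>2)) \<cdot>\<^sub>m msum e e UNIV (\<lambda>p. lam (fst p) \<cdot>\<^sub>m A (x \<otimes> u (fst p) (snd p) \<otimes> y))"
    if xy: "x \<in> Sz" "y \<in> Sz" for x y
  proof -
    have "A x * A y = (Em e \<rho> * \<rho> x) * Em e \<rho> * (\<rho> y * Em e \<rho>)"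
      unfolding A_def using E R[OF xy(1)] R[OF xy(2)] by (simp add: assoc_mult_mat[of _ e e _ e _ e] EE)
    also have "\<dots> = (1 / of_nat (q\<^sup>2)) \<cdot>\<^sub>m msum e e UNIV (\<lambda>p. lam (fst p) \<cdot>\<^sub>m (Em e \<rho> * \<rho> x * \<rho> (u (fst p) (snd p)) * (\<rho> y * Em e \<rho>)))"
      by (rule Em_expand[OF m]) (use E R[OF xy(1)] R[OF xy(2)] in auto)
    also have "msum e e UNIV (\<lambda>p. lam (fst p) \<cdot>\<^sub>m (Em e \<rho> * \<rho> x * \<rho> (u (fst p) (snd p)) * (\<rho> y * Em e \<rho>))) =
      msum e e UNIV (\<lambda>p. lam (fst p) \<cdot>\<^sub>m A (x \<otimes> u (fst p) (snd p) \<otimes> y))"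
      unfolding A_def using E R[OF xy(1)] R[OF xy(2)] R[OF u_Sz]
      by (intro msum_cong) (simp add: Rm xy Sz_mult assoc_mult_mat[of _ e e _ e _ e] mult_carrier_mat[of _ e e _ e])
    finally show ?thesis .
  qed
  have "A y * A x = A (inv y) * A (inv x)" using Ainv x y by simp
  also have "\<dots> = (1 / of_nat (q\<^sup>2)) \<cdot>\<^sub>m msum e e UNIV (\<lambda>p. lam (fst p) \<cdot>\<^sub>m A (inv y \<otimes> u (fst p) (snd p) \<otimes> inv x))"
    by (rule Am[OF Sz_inv[OF y] Sz_inv[OF x]])
  also have "msum e e UNIV (\<lambda>p. lam (fst p) \<cdot>\<^sub>m A (inv y \<otimes> u (fst p) (snd p) \<otimes> inv x)) =
    msum e e UNIV (\<lambda>p. (\<lambda>p. lam (fst p) \<cdot>\<^sub>m A (inv y \<otimes> u (fst p) (snd p) \<otimes> inv x)) (fst p, snd p + fst p * th (fst p)))"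
    by (rule msum_reindex[symmetric], rule bij_betw_byWitness[of _ "\<lambda>p. (fst p, snd p + fst p * th (fst p))"]) (auto simp: add.assoc)
  also have "\<dots> = msum e e UNIV (\<lambda>p. lam (fst p) \<cdot>\<^sub>m A (x \<otimes> u (fst p) (snd p) \<otimes> y))"
  proof (rule msum_cong)
    fix p :: "'k \<times> 'k"
    let ?g = "x \<otimes> u (fst p) (snd p) \<otimes> y"
    have "inv ?g = inv y \<otimes> u (fst p) (snd p + fst p * th (fst p)) \<otimes> inv x"
      using x y Sz_carrier by (simp add: inv_mult_group inv_u m_assoc)
    then show "(\<lambda>p. lam (fst p) \<cdot>\<^sub>m A (inv y \<otimes> u (fst p) (snd p) \<otimes> inv x)) (fst p, snd p + fst p * th (fst p)) = lam (fst p) \<cdot>\<^sub>m A ?g"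
      using Ainv[of ?g] x y by (simp add: Sz_mult)
  qed
  finally show ?thesis using Am[OF x y] by simp
qed

lemma IrrE_Sz:
  assumes "\<chi> \<in> Irr SG"
  shows "\<exists>e \<rho>. irreducible_rep SG e \<rho> \<and> \<chi> = rep_character SG \<rho> \<and> \<chi> \<one> = of_nat e \<and> e > 0 \<and> (\<forall>x\<in>Sz. \<chi> x = mtr (\<rho> x)) \<and>
    mu_a \<chi> = mtr (Em e \<rho>) \<and> (\<forall>x\<in>Sz. chE \<chi> x = mtr (Em e \<rho> * \<rho> x))"
proof -
  obtain e \<rho> where r: "irreducible_rep SG e \<rho>" "\<chi> = rep_character SG \<rho>" using assms unfolding Irr_def by blast
  note m = SG.irrD[OF r(1)]
  have v: "\<chi> x = mtr (\<rho> x)" if "x \<in> Sz" for x using that r(2) by (simp add: rep_character_def sum_list_diag_mat)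
  have c: "chE \<chi> x = mtr (Em e \<rho> * \<rho> x)" if "x \<in> Sz" for x
    unfolding Em_props(5)[OF m(1) that] unfolding chE_def using that by (simp add: v Sz_mult)
  have "\<rho> \<one> = 1\<^sub>m e" using SG.mrepD(2)[OF m(1)] by simp
  then have "mu_a \<chi> = mtr (Em e \<rho>)" "\<chi> \<one> = of_nat e"
    using c[of \<one>] v[of \<one>] chE_one[OF assms] right_mult_one_mat[OF Em_props(1)[OF m(1)]] by simp_all
  then show ?thesis using r m(2) v c by blast
qed

text \<open>Let a be the trace of the idempotent. The traces of A g A h A g^-1 A h^-1, summed over
  all g and h, are evaluated twice: directly, Schur averaging gives a constant times a; after
  commuting the two middle factors it gives the same constant times a^3. Hence a = a^3, and a is a
  natural number. This replaces the search for a common eigenvector of the Hecke algebra.\<close>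

lemma mu_a_01:
  assumes c: "\<chi> \<in> Irr SG" shows "mu_a \<chi> = 0 \<or> mu_a \<chi> = 1"
proof -
  obtain e \<rho> where r: "irreducible_rep SG e \<rho>" and e0: "e > 0" and a: "mu_a \<chi> = mtr (Em e \<rho>)" using IrrE_Sz[OF c] by blast
  note m = SG.irrD(1)[OF r]
  let ?E = "Em e \<rho>"
  let ?a = "mtr ?E" and ?N = "of_nat (card Sz) / of_nat e :: complex"
  have E: "?E \<in> carrier_mat e e" and EE: "?E * ?E = ?E" by (rule Em_props(1)[OF m], rule Em_props(4)[OF m])
  have EEX: "?E * (?E * X) = ?E * X" if "(X :: complex mat) \<in> carrier_mat e e" for X
    using assoc_mult_mat[OF E E that] EE by simp
  have R: "\<rho> y \<in> carrier_mat e e" if "y \<in> Sz" for y using SG.mrepD(1)[OF m] that by simp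
  define A where "A x = ?E * \<rho> x * ?E" for x
  have A: "A x \<in> carrier_mat e e" if "x \<in> Sz" for x using E R[OF that] by (simp add: A_def)
  have trA: "mtr (A x) = mtr (?E * \<rho> x)" "mtr (A x) = mtr (\<rho> x * ?E)" if "x \<in> Sz" for x
  proof -
    have "mtr (A x) = mtr (?E * (?E * \<rho> x))" unfolding A_def by (rule mtr_comm[of _ e e]) (use E R[OF that] in auto)
    then show "mtr (A x) = mtr (?E * \<rho> x)" using EEX R[OF that] by simp
    then show "mtr (A x) = mtr (\<rho> x * ?E)" using mtr_comm[OF E R[OF that]] by simp
  qed
  have inv_SG': "inv\<^bsub>SG\<^esub> x = inv x" if "x \<in> Sz" for x by (rule inv_SG[OF that])
  have avg: "(\<Sum>g\<in>Sz. mtr (Y * (\<rho> g * X * \<rho> (inv g)) * Z)) = ?N * mtr X * mtr (Y * Z)"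
    if "(X :: complex mat) \<in> carrier_mat e e" "Y \<in> carrier_mat e e" "Z \<in> carrier_mat e e" for X Y Z
    using SG.average_trace[OF r that] by (simp add: inv_SG')
  have orth: "(\<Sum>g\<in>Sz. mtr (A g) * mtr (A (inv g))) = ?N * ?a"
  proof -
    have "(\<Sum>g\<in>Sz. mtr (A g) * mtr (A (inv g))) = (\<Sum>g\<in>Sz. mtr (?E * \<rho> g) * mtr (\<rho> (inv g) * ?E))"
      by (intro sum.cong refl) (simp add: trA(1) trA(2)[OF Sz_inv])
    then show ?thesis using SG.trace_orth(2)[OF r r E E] by (simp add: inv_SG' EE)
  qed
  let ?T = "\<lambda>h. \<Sum>g\<in>Sz. mtr (A g * A h * A (inv g) * A (inv h))"
  have "(\<Sum>h\<in>Sz. ?T h) = ?N * (\<Sum>h\<in>Sz. mtr (A h) * mtr (A (inv h)))"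
  proof (unfold sum_distrib_left, rule sum.cong[OF refl])
    fix h assume h: "h \<in> Sz"
    have "?T h = (\<Sum>g\<in>Sz. mtr (?E * (\<rho> g * A h * \<rho> (inv g)) * A (inv h)))"
    proof (intro sum.cong refl)
      fix g assume g: "g \<in> Sz"
      have "A g * A h * A (inv g) * A (inv h) = ?E * (\<rho> g * A h * \<rho> (inv g)) * A (inv h)"
        unfolding A_def using E R[OF g] R[OF h] R[OF Sz_inv[OF g]] R[OF Sz_inv[OF h]]
        by (simp add: assoc_mult_mat[of _ e e _ e _ e] EEX)
      then show "mtr (A g * A h * A (inv g) * A (inv h)) = mtr (?E * (\<rho> g * A h * \<rho> (inv g)) * A (inv h))" by simp
    qed
    also have "\<dots> = ?N * mtr (A h) * mtr (?E * A (inv h))" by (rule avg[OF A[OF h] E A[OF Sz_inv[OF h]]])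
    also have "?E * A (inv h) = A (inv h)" unfolding A_def using E R[OF Sz_inv[OF h]]
      by (simp add: assoc_mult_mat[of _ e e _ e _ e] EEX)
    finally show "?T h = ?N * (mtr (A h) * mtr (A (inv h)))" by simp
  qed
  also have "\<dots> = ?N * (?N * ?a)" unfolding orth ..
  finally have 1: "(\<Sum>h\<in>Sz. ?T h) = ?N * (?N * ?a)" .
  have "(\<Sum>h\<in>Sz. ?T h) = (\<Sum>h\<in>Sz. ?N * ?a * mtr (?E * (\<rho> h * ?E * \<rho> (inv h)) * ?E))"
  proof (rule sum.cong[OF refl])
    fix h assume h: "h \<in> Sz"
    have "?T h = (\<Sum>g\<in>Sz. mtr (?E * (\<rho> g * ?E * \<rho> (inv g)) * (A h * A (inv h))))"
    proof (intro sum.cong refl)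
      fix g assume g: "g \<in> Sz"
      have "A g * A h * A (inv g) * A (inv h) = A g * (A h * A (inv g)) * A (inv h)"
        using A g h Sz_inv by (simp add: assoc_mult_mat[of _ e e _ e _ e])
      also have "A h * A (inv g) = A (inv g) * A h" unfolding A_def by (rule Hecke_commute[OF m h Sz_inv[OF g]])
      also have "A g * (A (inv g) * A h) * A (inv h) = ?E * (\<rho> g * ?E * \<rho> (inv g)) * (A h * A (inv h))"
        unfolding A_def using E R[OF g] R[OF h] R[OF Sz_inv[OF g]] R[OF Sz_inv[OF h]]
        by (simp add: assoc_mult_mat[of _ e e _ e _ e] EEX)
      finally show "mtr (A g * A h * A (inv g) * A (inv h)) = mtr (?E * (\<rho> g * ?E * \<rho> (inv g)) * (A h * A (inv h)))" by simp
    qed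
    also have "\<dots> = ?N * ?a * mtr (?E * (A h * A (inv h)))"
      by (rule avg[OF E E mult_carrier_mat[OF A[OF h] A[OF Sz_inv[OF h]]]])
    also have "?E * (A h * A (inv h)) = ?E * (\<rho> h * ?E * \<rho> (inv h)) * ?E"
      unfolding A_def using E R[OF h] R[OF Sz_inv[OF h]]
      by (simp add: assoc_mult_mat[of _ e e _ e _ e] EEX)
    finally show "?T h = ?N * ?a * mtr (?E * (\<rho> h * ?E * \<rho> (inv h)) * ?E)" .
  qed
  also have "\<dots> = ?N * ?a * (?N * ?a * ?a)" unfolding sum_distrib_left[symmetric] avg[OF E E E] EE ..
  finally have "?N * (?N * ?a) = ?N * ?a * (?N * ?a * ?a)" using 1 by simp
  moreover have "?N \<noteq> 0" using e0 SG.card_pos by simp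
  ultimately have "?a = ?a * ?a * ?a" by (simp add: mult_ac)
  then have "?a * (?a - 1) * (?a + 1) = 0" by (simp add: algebra_simps)
  moreover have "?a + 1 \<noteq> 0"
  proof -
    obtain k where "?a = of_nat k" using mu_a_nat[OF c] a by (auto elim: Nats_cases)
    then have "?a + 1 = of_nat (k + 1)" by simp
    then show ?thesis by (simp only: of_nat_eq_0_iff)
  qed
  ultimately show ?thesis unfolding a by auto
qed

section \<open>Constituents of the induced character: number, reality, fixed points\<close>

lemma biq_chE: assumes c: "\<chi> \<in> Irr SG" shows "biq (chE \<chi>)"
proof -
  obtain e \<rho> where r: "irreducible_rep SG e \<rho>" and x: "\<forall>x\<in>Sz. chE \<chi> x = mtr (Em e \<rho> * \<rho> x)" using IrrE_Sz[OF c] by blast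
  note m = SG.irrD(1)[OF r]
  have "Em e \<rho> * Em e \<rho> * Em e \<rho> = Em e \<rho>" by (simp add: Em_props(4)[OF m])
  then have "biq (\<lambda>x. mtr (Em e \<rho> * \<rho> x))" using biq_mtr[OF m Em_props(1)[OF m]] by simp
  then show ?thesis using x Sz_mult[OF u_Sz] Sz_mult[OF _ u_Sz] unfolding biq_def by simp
qed

lemma chE_orth:
  assumes c: "\<chi> \<in> Irr SG" "\<xi> \<in> Irr SG"
  shows "(\<Sum>x\<in>Sz. chE \<chi> x * chE \<xi> (inv x)) = (if \<chi> = \<xi> then of_nat (card Sz) / \<chi> \<one> * mu_a \<chi> else 0)"
proof -
  obtain e \<rho> where r: "irreducible_rep SG e \<rho>" "\<chi> = rep_character SG \<rho>" "\<chi> \<one> = of_nat e" "mu_a \<chi> = mtr (Em e \<rho>)"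
    "\<forall>x\<in>Sz. chE \<chi> x = mtr (Em e \<rho> * \<rho> x)" using IrrE_Sz[OF c(1)] by blast
  obtain e' \<rho>' where r': "irreducible_rep SG e' \<rho>'" "\<xi> = rep_character SG \<rho>'" 
    "\<forall>x\<in>Sz. chE \<xi> x = mtr (Em e' \<rho>' * \<rho>' x)" using IrrE_Sz[OF c(2)] by blast
  have sw: "mtr (Em e \<rho> * \<rho> x) = mtr (\<rho> x * Em e \<rho>)" if "irreducible_rep SG e \<rho>" "x \<in> Sz" for e \<rho> x
    using mtr_comm[OF Em_props(1) SG.mrepD(1)] SG.irrD(1)[OF that(1)] that(2) by simp
  show ?thesis
  proof (cases "\<chi> = \<xi>")
    case True
    have "(\<Sum>x\<in>Sz. chE \<chi> x * chE \<chi> (inv x)) = (\<Sum>x\<in>Sz. mtr (Em e \<rho> * \<rho> x) * mtr (\<rho> (inv x) * Em e \<rho>))"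
      using r(5) sw[OF r(1)] Sz_inv by (intro sum.cong refl) simp
    moreover have "\<dots> = of_nat (card Sz) / of_nat e * mtr (Em e \<rho> * Em e \<rho>)"
      using SG.trace_orth(2)[OF r(1) r(1) Em_props(1) Em_props(1)] SG.irrD(1)[OF r(1)] by (simp add: inv_SG)
    ultimately show ?thesis using True r(3,4) Em_props(4)[OF SG.irrD(1)[OF r(1)]] by simp
  next
    case False
    have "(\<Sum>x\<in>Sz. chE \<chi> x * chE \<xi> (inv x)) = (\<Sum>x\<in>Sz. mtr (Em e \<rho> * \<rho> x) * mtr (\<rho>' (inv x) * Em e' \<rho>'))"
      using r(5) r'(3) sw[OF r'(1)] Sz_inv by (intro sum.cong refl) simp
    moreover have "\<dots> = 0"
      using SG.trace_orth(1)[OF r(1) r'(1) Em_props(1) Em_props(1)] SG.irrD(1)[OF r(1)] SG.irrD(1)[OF r'(1)] False r(2) r'(2) by (simp add: inv_SG)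
    ultimately show ?thesis using False by simp
  qed
qed

text \<open>The constituents of the character induced from the linear character \<open>u a b \<mapsto> lam a\<close> of \<open>P\<close>.\<close>

definition "Om = {\<chi> \<in> Irr SG. mu_a \<chi> = 1}"

lemma finite_Om: "finite Om" by (simp add: Om_def)

lemma card_Om: "card Om = q"
proof -
  have "of_nat q = (\<Sum>\<chi>\<in>Irr SG. mu_a \<chi> * mu_a \<chi>)" by (simp add: sums_mu)
  also have "\<dots> = (\<Sum>\<chi>\<in>Irr SG. if mu_a \<chi> = 1 then 1 else 0)" using mu_a_01 by (intro sum.cong refl) fastforce
  also have "\<dots> = of_nat (card Om)" by (simp add: sum.If_cases Om_def Collect_conj_eq)
  finally show ?thesis by (metis of_nat_eq_iff)
qed

text \<open>Values of \<open>chE\<close> at representatives of the supporting double cosets, with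
  index 0 standing for P itself. Weighted by degree and double coset size they give the inverse
  matrix \<open>omA\<close>. This is the character table of the Hecke algebra, square because
  \<open>Om\<close> has as many members as the field.\<close>

definition omB :: "'k \<Rightarrow> ('a \<Rightarrow> complex) \<Rightarrow> complex" where
  "omB k \<chi> = (if k = 0 then 1 else chE \<chi> (h k \<otimes> w))"

definition omA :: "('a \<Rightarrow> complex) \<Rightarrow> 'k \<Rightarrow> complex" where
  "omA \<chi> k = \<chi> \<one> / of_nat (card Sz) * of_nat (if k = 0 then q\<^sup>2 else q ^ 4) * omB k \<chi>"

lemma omA_omB:
  assumes "\<chi> \<in> Om" "\<xi> \<in> Om"
  shows "(\<Sum>k\<in>UNIV. omA \<chi> k * omB k \<xi>) = (if \<chi> = \<xi> then 1 else 0)"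
proof -
  have c: "\<chi> \<in> Irr SG" "\<xi> \<in> Irr SG" "mu_a \<chi> = 1" "mu_a \<xi> = 1" using assms by (auto simp: Om_def)
  have "(\<Sum>k\<in>UNIV. omA \<chi> k * omB k \<xi>) = \<chi> \<one> / of_nat (card Sz) * (of_nat (q\<^sup>2) * (1 * 1) +
    of_nat (q ^ 4) * (\<Sum>k\<in>{k. k \<noteq> 0}. chE \<chi> (h k \<otimes> w) * chE \<xi> (h k \<otimes> w)))"
    by (subst sum_nz) (simp add: omA_def omB_def sum_distrib_left distrib_left mult_ac)
  also have "\<dots> = \<chi> \<one> / of_nat (card Sz) * (\<Sum>x\<in>Sz. chE \<chi> x * chE \<xi> (inv x))"
    unfolding biq_sum[OF biq_chE[OF c(1)] biq_chE[OF c(2)]] chE_one[OF c(1)] chE_one[OF c(2)] c(3,4) ..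
  also have "\<dots> = (if \<chi> = \<xi> then 1 else 0)"
    unfolding chE_orth[OF c(1,2)] c(3) using SG.Irr_one_nz[OF c(1)] SG.card_pos by auto
  finally show ?thesis .
qed

lemma omB_omA: "(\<Sum>\<chi>\<in>Om. omB k \<chi> * omA \<chi> l) = (if k = l then 1 else 0)"
  by (rule square_inverse[OF finite_Om _ _ omA_omB]) (simp_all add: card_Om card_UNIV_q)

lemma omB_inj:
  assumes "\<chi> \<in> Om" "\<xi> \<in> Om" "\<And>k. k \<noteq> 0 \<Longrightarrow> chE \<chi> (h k \<otimes> w) = chE \<xi> (h k \<otimes> w)"
  shows "\<chi> = \<xi>"
proof -
  have "(\<Sum>k\<in>UNIV. omA \<chi> k * omB k \<xi>) = (\<Sum>k\<in>UNIV. omA \<chi> k * omB k \<chi>)"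
    by (intro sum.cong refl) (simp add: omB_def assms(3))
  then show ?thesis using omA_omB[OF assms(1,2)] omA_omB[OF assms(1,1)] by (simp split: if_splits)
qed

text \<open>The function \<open>chE\<close> of the dual character arises from that of the character
  by inversion, under which it is invariant. Members of \<open>Om\<close> are separated by these
  values, so each of them equals its dual.\<close>

lemma Om_real:
  assumes c: "\<chi> \<in> Om" and x: "x \<in> Sz" shows "\<chi> (inv x) = \<chi> x"
proof -
  have ci: "\<chi> \<in> Irr SG" "mu_a \<chi> = 1" using c by (auto simp: Om_def)
  define \<xi> where "\<xi> = (\<lambda>g\<in>Sz. \<chi> (inv g))"
  have "\<xi> \<in> Irr SG"
  proof -
    have "(\<lambda>g\<in>Sz. \<chi> (inv\<^bsub>SG\<^esub> g)) = \<xi>" unfolding \<xi>_def by (rule restrict_ext) (simp add: inv_SG)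
    then show ?thesis using SG.Irr_dual[OF ci(1)] by simp
  qed
  moreover have "mu_a \<xi> = mu_a \<chi>" by (simp add: mu_a_def \<xi>_def inv_ze inv_e1 inv_e2 add.commute)
  ultimately have xi: "\<xi> \<in> Om" using ci(2) by (simp add: Om_def)
  have "chE \<xi> y = chE \<chi> (inv y)" if y: "y \<in> Sz" for y
  proof -
    have "(\<Sum>p\<in>UNIV. lam (fst p) * \<xi> (u (fst p) (snd p) \<otimes> y)) = (\<Sum>p\<in>UNIV. lam (fst p) * \<chi> (inv (u (fst p) (snd p)) \<otimes> inv y))"
    proof (intro sum.cong refl)
      fix p :: "'k \<times> 'k"
      have "inv (u (fst p) (snd p) \<otimes> y) = inv y \<otimes> inv (u (fst p) (snd p))" using y Sz_carrier by (simp add: inv_mult_group)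
      then show "lam (fst p) * \<xi> (u (fst p) (snd p) \<otimes> y) = lam (fst p) * \<chi> (inv (u (fst p) (snd p)) \<otimes> inv y)"
        using Irr_comm_Sz[OF ci(1) Sz_inv[OF y] Sz_inv[OF u_Sz]] y by (simp add: \<xi>_def Sz_mult)
    qed
    also have "\<dots> = (\<Sum>p\<in>UNIV. lam (fst p) * \<chi> (u (fst p) (snd p) \<otimes> inv y))"
      by (rule sum.reindex_bij_witness[of _ "\<lambda>p. (fst p, snd p + fst p * th (fst p))" "\<lambda>p. (fst p, snd p + fst p * th (fst p))"])
        (auto simp: inv_u add.assoc)
    finally show ?thesis by (simp add: chE_def)
  qed
  then have "\<xi> = \<chi>" using biq_inv[OF biq_chE[OF ci(1)]] by (intro omB_inj[OF xi c]) (simp add: Sz_mult)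
  then have "\<xi> x = \<chi> x" by simp
  then show ?thesis using x by (simp add: \<xi>_def)
qed

text \<open>As in Brauer's permutation lemma, the automorphism permutes the rows and the columns of
  an invertible matrix compatibly, so the two permutations have equal trace. The rows are members of
  \<open>Om\<close>, the columns field elements.\<close>

lemma card_fixed_Om:
  assumes bij: "bij_betw sg Sz Sz" and hom: "\<And>x y. x \<in> Sz \<Longrightarrow> y \<in> Sz \<Longrightarrow> sg (x \<otimes> y) = sg x \<otimes> sg y"
    and su: "\<And>a b. sg (u a b) = u (\<tau> a) (\<tau> b)" and sh: "\<And>k. k \<noteq> 0 \<Longrightarrow> sg (h k) = h (\<tau> k)" and sw: "sg w = w"
    and t: "bij \<tau>" "\<And>a. lam (\<tau> a) = lam a" "\<tau> 0 = 0"
  shows "\<chi> \<in> Om \<Longrightarrow> (\<lambda>x\<in>Sz. \<chi> (sg x)) \<in> Om"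
    "card {\<chi>\<in>Om. (\<lambda>x\<in>Sz. \<chi> (sg x)) = \<chi>} = card {x. \<tau> x = x}"
proof -
  let ?\<pi> = "\<lambda>\<chi>. (\<lambda>x\<in>Sz. \<chi> (sg x))"
  have sgSz: "sg x \<in> Sz" if "x \<in> Sz" for x using bij that by (auto simp: bij_betw_def)
  have chE: "chE (?\<pi> \<chi>) x = chE \<chi> (sg x)" if x: "x \<in> Sz" for \<chi> x
  proof -
    have "(\<Sum>p\<in>UNIV. lam (fst p) * ?\<pi> \<chi> (u (fst p) (snd p) \<otimes> x)) = (\<Sum>p\<in>UNIV. lam (fst (map_prod \<tau> \<tau> p)) * \<chi> (u (fst (map_prod \<tau> \<tau> p)) (snd (map_prod \<tau> \<tau> p)) \<otimes> sg x))"
      using x by (intro sum.cong refl) (simp add: Sz_mult hom su t(2))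
    also have "\<dots> = (\<Sum>p\<in>UNIV. lam (fst p) * \<chi> (u (fst p) (snd p) \<otimes> sg x))"
      by (rule sum.reindex_bij_betw) (use bij_betw_map_prod[OF t(1) t(1)] in simp)
    finally show ?thesis by (simp add: chE_def)
  qed
  show Om: "?\<pi> \<chi> \<in> Om" if c: "\<chi> \<in> Om" for \<chi>
  proof -
    have ci: "\<chi> \<in> Irr SG" "mu_a \<chi> = 1" using c by (auto simp: Om_def)
    have i: "?\<pi> \<chi> \<in> Irr SG" using SG.Irr_automorphism[OF ci(1), of sg] bij hom by simp
    have "sg \<one> = \<one>" using su[of 0 0] t(3) by simp
    then show ?thesis using i chE_one[OF i] chE[OF one_Sz, of \<chi>] chE_one[OF ci(1)] ci by (simp add: Om_def)
  qed
  have tz: "\<tau> k \<noteq> 0" if "k \<noteq> 0" for k using t(1,3) that by (metis bij_def injD)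
  have B: "omB k (?\<pi> \<chi>) = omB (\<tau> k) \<chi>" for k \<chi>
    using tz[of k] by (auto simp: omB_def chE Sz_mult hom sh sw t(3))
  have "of_nat (card {\<chi>\<in>Om. ?\<pi> \<chi> = \<chi>}) = (\<Sum>\<chi>\<in>Om. if \<chi> = ?\<pi> \<chi> then 1 else 0 :: complex)"
  proof -
    have e: "(?\<pi> \<chi> = \<chi>) = (\<chi> = ?\<pi> \<chi>)" for \<chi> by (rule eq_commute)
    show ?thesis unfolding e by (subst sum.If_cases[OF finite_Om]) (simp add: Int_def)
  qed
  also have "\<dots> = (\<Sum>\<chi>\<in>Om. \<Sum>k\<in>UNIV. omA \<chi> k * omB k (?\<pi> \<chi>))"
    by (intro sum.cong refl) (simp only: omA_omB Om)
  also have "\<dots> = (\<Sum>k\<in>UNIV. \<Sum>\<chi>\<in>Om. omB (\<tau> k) \<chi> * omA \<chi> k)"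
    unfolding B by (subst sum.swap) (simp only: mult.commute)
  also have "\<dots> = of_nat (card {x. \<tau> x = x})" unfolding omB_omA by (simp add: sum.If_cases)
  finally show "card {\<chi>\<in>Om. ?\<pi> \<chi> = \<chi>} = card {x. \<tau> x = x}" by (simp only: of_nat_eq_iff)
qed

end

section \<open>Multiplicities as integers and the degrees they force\<close>

lemma sum_sq_one:
  fixes g :: "'x \<Rightarrow> int"
  assumes fin: "finite A" and s: "(\<Sum>x\<in>A. g x * g x) = 1"
  shows "\<exists>x\<in>A. g x * g x = 1 \<and> (\<forall>y\<in>A. y \<noteq> x \<longrightarrow> g y = 0)"
proof -
  obtain x where x: "x \<in> A" "g x \<noteq> 0" using s by (metis (mono_tags, lifting) mult_zero_left sum.neutral zero_neq_one)
  have "(\<Sum>x\<in>A. g x * g x) = g x * g x + (\<Sum>y\<in>A - {x}. g y * g y)" by (rule sum.remove[OF fin x(1)])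
  moreover have "0 < g x * g x" using x(2) by (metis mult_eq_0_iff not_square_less_zero linorder_neqE_linordered_idom)
  moreover have "0 \<le> (\<Sum>y\<in>A - {x}. g y * g y)" by (rule sum_nonneg) simp
  ultimately have "g x * g x = 1" "(\<Sum>y\<in>A - {x}. g y * g y) = 0" using s by linarith+
  then have "\<forall>y\<in>A - {x}. g y * g y = 0" using fin by (subst (asm) sum_nonneg_eq_0_iff) auto
  then show ?thesis using x(1) \<open>g x * g x = 1\<close> by auto
qed

lemma int_sq_one: "0 \<le> x \<Longrightarrow> x * x = 1 \<Longrightarrow> x = (1::int)"
  by (simp add: zmult_eq_1_iff)

context suzuki
begin

text \<open>Transports multiplicities from complex numbers to integers, where sums of non-negative
  terms can be bounded and split.\<close>

definition iv :: "complex \<Rightarrow> int" where "iv z = \<lfloor>Re z\<rfloor>"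

lemma iv: "z \<in> \<nat> \<Longrightarrow> of_int (iv z) = z" "z \<in> \<nat> \<Longrightarrow> iv z \<ge> 0"
  by (auto simp: iv_def elim!: Nats_cases)

definition "fm \<chi> = iv (mu_m \<chi>)"
definition "fa \<chi> = iv (mu_a \<chi>)"
definition "fb \<chi> = iv (mu_b \<i> \<chi>)"
definition "fc \<chi> = iv (mu_b (- \<i>) \<chi>)"
definition "ft j \<chi> = iv (mu_t j \<chi>)"

lemma of_int_f:
  assumes "\<chi> \<in> Irr SG"
  shows "of_int (fm \<chi>) = mu_m \<chi>" "of_int (fa \<chi>) = mu_a \<chi>" "of_int (fb \<chi>) = mu_b \<i> \<chi>" "of_int (fc \<chi>) = mu_b (- \<i>) \<chi>"
    "of_int (ft j \<chi>) = mu_t j \<chi>"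
  using mu_m_nat[OF assms] mu_a_nat[OF assms] mu_b_nat[OF assms] mu_t_nat[OF assms]
  by (simp_all add: fm_def fa_def fb_def fc_def ft_def iv(1))

lemma f_nonneg:
  assumes "\<chi> \<in> Irr SG"
  shows "fm \<chi> \<ge> 0" "fa \<chi> \<ge> 0" "fb \<chi> \<ge> 0" "fc \<chi> \<ge> 0" "ft j \<chi> \<ge> 0"
  using mu_m_nat[OF assms] mu_a_nat[OF assms] mu_b_nat[OF assms] mu_t_nat[OF assms]
  by (simp_all add: fm_def fa_def fb_def fc_def ft_def iv(2))

lemma r_rr: "r = 2 * 2 ^ f" and q_rr: "q = 2 * 2 ^ f * 2 ^ f"
proof -
  show "r = 2 * 2 ^ f" by (simp add: r_def)
  then show "q = 2 * 2 ^ f * 2 ^ f" using r_sq by simp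
qed

text \<open>These are r / 2 and q, both expressed through 2^f so that their relation is visible to
  algebraic simplification.\<close>

abbreviation "rr \<equiv> 2 ^ f :: int"
abbreviation "qi \<equiv> 2 * rr * rr"

lemma rr_ge: "rr \<ge> 4"
proof -
  have "int r \<ge> 8" using r_ge by linarith
  then show ?thesis by (simp add: r_rr)
qed

lemma qi: "int q = qi" "of_nat q = (of_int qi :: complex)" "of_nat r / 2 = (of_int rr :: complex)"
  by (simp_all add: q_rr r_rr)

lemma qr_c: "of_nat q = (2 * 2 ^ f * 2 ^ f :: complex)" "of_nat r = (2 * 2 ^ f :: complex)"
  by (simp_all add: q_rr r_rr)

lemma to_int_sum:
  assumes "\<And>\<chi>. \<chi> \<in> Irr SG \<Longrightarrow> of_int (p \<chi>) = (p' \<chi> :: complex)" "\<And>\<chi>. \<chi> \<in> Irr SG \<Longrightarrow> of_int (s \<chi>) = (s' \<chi> :: complex)"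
    and "(\<Sum>\<chi>\<in>Irr SG. p' \<chi> * s' \<chi>) = of_int k"
  shows "(\<Sum>\<chi>\<in>Irr SG. p \<chi> * s \<chi>) = k"
proof -
  have "of_int (\<Sum>\<chi>\<in>Irr SG. p \<chi> * s \<chi>) = (of_int k :: complex)" using assms by simp
  then show ?thesis by (simp only: of_int_eq_iff)
qed

lemma fsums:
  "(\<Sum>\<chi>\<in>Irr SG. fa \<chi> * fa \<chi>) = qi"
  "(\<Sum>\<chi>\<in>Irr SG. fm \<chi> * fa \<chi>) = qi - 1"
  "(\<Sum>\<chi>\<in>Irr SG. fa \<chi> * fb \<chi>) = rr * (qi - 1)"
  "(\<Sum>\<chi>\<in>Irr SG. fa \<chi> * fc \<chi>) = rr * (qi - 1)"
  "(\<Sum>\<chi>\<in>Irr SG. fb \<chi> * fb \<chi>) = 1 + rr * rr * (qi - 1)"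
  "(\<Sum>\<chi>\<in>Irr SG. fc \<chi> * fc \<chi>) = 1 + rr * rr * (qi - 1)"
  "(\<Sum>\<chi>\<in>Irr SG. fb \<chi> * fc \<chi>) = rr * rr * (qi - 1)"
  "(\<Sum>\<chi>\<in>Irr SG. ft j \<chi> * fa \<chi>) = 1"
  "(\<Sum>\<chi>\<in>Irr SG. ft j \<chi> * fb \<chi>) = rr"
  "(\<Sum>\<chi>\<in>Irr SG. ft j \<chi> * fc \<chi>) = rr"
  "i < q - 1 \<Longrightarrow> j < q - 1 \<Longrightarrow> (\<Sum>\<chi>\<in>Irr SG. ft i \<chi> * ft j \<chi>) = (if i = j then 1 else 0) + (if i + j = 0 \<or> i + j = q - 1 then 1 else 0)"
  apply (rule to_int_sum[OF of_int_f(2) of_int_f(2)]; (assumption | simp add: sums_mu qr_c))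
  apply (rule to_int_sum[OF of_int_f(1) of_int_f(2)]; (assumption | simp add: sums_mu qr_c))
  apply (rule to_int_sum[OF of_int_f(2) of_int_f(3)]; (assumption | simp add: sums_mu qr_c))
  apply (rule to_int_sum[OF of_int_f(2) of_int_f(4)]; (assumption | simp add: sums_mu qr_c))
  apply (rule to_int_sum[OF of_int_f(3) of_int_f(3)]; (assumption | simp add: sums_mu qr_c))
  apply (rule to_int_sum[OF of_int_f(4) of_int_f(4)]; (assumption | simp add: sums_mu qr_c))
  apply (rule to_int_sum[OF of_int_f(3) of_int_f(4)]; (assumption | simp add: sums_mu qr_c))
  apply (rule to_int_sum[OF of_int_f(5) of_int_f(2)]; (assumption | simp add: sums_mu_t))
  apply (rule to_int_sum[OF of_int_f(5) of_int_f(3)]; (assumption | simp add: sums_mu_t qr_c))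
  apply (rule to_int_sum[OF of_int_f(5) of_int_f(4)]; (assumption | simp add: sums_mu_t qr_c))
  apply (rule to_int_sum[OF of_int_f(5) of_int_f(5)]; (assumption | simp add: sum_mu_t_mu_t))
  done

text \<open>The characters induced from \<open>al i\<close> and \<open>al j\<close> are disjoint: a
  vanishing sum of non-negative products vanishes term by term.\<close>

lemma ft_zero:
  assumes ij: "i < q - 1" "j < q - 1" "i \<noteq> j" "i + j \<noteq> 0" "i + j \<noteq> q - 1" and c: "\<chi> \<in> Irr SG" and i: "ft i \<chi> \<noteq> 0"
  shows "ft j \<chi> = 0"
proof -
  have "(\<Sum>\<chi>\<in>Irr SG. ft i \<chi> * ft j \<chi>) = 0" using fsums(11)[OF ij(1,2)] ij by simp
  then have "\<forall>\<chi>\<in>Irr SG. ft i \<chi> * ft j \<chi> = 0" by (subst (asm) sum_nonneg_eq_0_iff) (auto simp: f_nonneg)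
  then show ?thesis using c i by fastforce
qed

lemma fm_sum: assumes c: "\<chi> \<in> Irr SG" shows "fm \<chi> = (\<Sum>j<q - 1. ft j \<chi>)"
proof -
  have "of_int (fm \<chi>) = (of_int (\<Sum>j<q - 1. ft j \<chi>) :: complex)"
    unfolding of_int_sum of_int_f[OF c] sum_mu_t_m ..
  then show ?thesis by (simp only: of_int_eq_iff)
qed

lemma degree_int:
  assumes c: "\<chi> \<in> Irr SG"
  shows "\<chi> \<one> = of_int (fm \<chi> + (qi - 1) * fa \<chi> + (qi - 1) * rr * (fb \<chi> + fc \<chi>))"
    "\<chi> ze = of_int (fm \<chi> + (qi - 1) * fa \<chi> - rr * (fb \<chi> + fc \<chi>))"
  unfolding degree_formula[of \<i> \<chi>, simplified] of_int_add of_int_mult of_int_diff of_int_f[OF c] by (simp_all add: qr_c)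

lemma q1_odd: "2 * j \<noteq> q - 1"
proof
  assume "2 * j = q - 1"
  then have "q = 2 * j + 1" using q_ge by linarith
  then have "odd q" by simp
  then show False by (simp add: q_rr)
qed

text \<open>The multiplicity vector of \<open>al j\<close> has norm 1, so it is the indicator of a
  single character; every sum of products with it then reads off one multiplicity of this character.
  The value 2 of \<open>fm\<close> comes from the indices j and q - 1 - j, which differ as q - 1 is
  odd.\<close>

lemma principal:
  assumes j: "0 < j" "j < q - 1"
  shows "\<exists>\<chi>\<in>Irr SG. ft j \<chi> = 1 \<and> (\<forall>\<xi>\<in>Irr SG. \<xi> \<noteq> \<chi> \<longrightarrow> ft j \<xi> = 0) \<and> fa \<chi> = 1 \<and> fb \<chi> = rr \<and> fc \<chi> = rr \<and> fm \<chi> = 2"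
proof -
  have "(\<Sum>\<chi>\<in>Irr SG. ft j \<chi> * ft j \<chi>) = 1" using fsums(11)[OF j(2) j(2)] j q1_odd[of j] by (simp add: mult_2)
  then obtain \<chi> where c: "\<chi> \<in> Irr SG" "ft j \<chi> * ft j \<chi> = 1" "\<forall>\<xi>\<in>Irr SG. \<xi> \<noteq> \<chi> \<longrightarrow> ft j \<xi> = 0"
    using sum_sq_one[OF SG.finite_Irr, of "ft j"] by blast
  have c1: "ft j \<chi> = 1" using int_sq_one f_nonneg(5)[OF c(1)] c(2) by blast
  have s: "(\<Sum>\<xi>\<in>Irr SG. ft j \<xi> * s \<xi>) = s \<chi>" for s
  proof -
    have "(\<Sum>\<xi>\<in>Irr SG. ft j \<xi> * s \<xi>) = ft j \<chi> * s \<chi> + (\<Sum>\<xi>\<in>Irr SG - {\<chi>}. ft j \<xi> * s \<xi>)" by (rule sum.remove[OF SG.finite_Irr c(1)])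
    moreover have "(\<Sum>\<xi>\<in>Irr SG - {\<chi>}. ft j \<xi> * s \<xi>) = 0" using c(3) by (intro sum.neutral) simp
    ultimately show ?thesis using c1 by simp
  qed
  have "fm \<chi> = (\<Sum>i<q - 1. (if i = j then 1 else 0) + (if i = q - 1 - j then 1 else 0))"
    unfolding fm_sum[OF c(1)]
  proof (rule sum.cong[OF refl])
    fix i assume i: "i \<in> {..<q - 1}"
    have "ft i \<chi> = (\<Sum>\<xi>\<in>Irr SG. ft j \<xi> * ft i \<xi>)" by (rule s[symmetric])
    also have "\<dots> = (if i = j then 1 else 0) + (if i = q - 1 - j then 1 else 0)"
      using fsums(11)[of j i] i j by auto
    finally show "ft i \<chi> = (if i = j then 1 else 0) + (if i = q - 1 - j then 1 else 0)" .
  qed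
  also have "\<dots> = 2" using j by (simp add: sum.distrib)
  finally have m: "fm \<chi> = 2" .
  show ?thesis using c(1,3) c1 m fsums(8,9,10)[where j=j] unfolding s by blast
qed

definition "tr = (\<lambda>x\<in>Sz. 1 :: complex)"

lemma tr_Irr: "tr \<in> Irr SG" using SG.linear_Irr[of "\<lambda>_. 1"] by (simp add: tr_def)

lemma f_tr: "fm tr = 1" "fa tr = 0" "fb tr = 0" "fc tr = 0" "ft 0 tr = 1" "0 < j \<Longrightarrow> j < q - 1 \<Longrightarrow> ft j tr = 0"
proof -
  have t: "tr x = 1" if "x \<in> Sz" for x using that by (simp add: tr_def)
  have q0: "of_nat q \<noteq> (0::complex)" using q_ge by simp
  have m: "mu_m tr = 1" "mu_a tr = 0" using q0 by (simp_all add: mu_m_def mu_a_def t field_simps power2_eq_square)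
  then show "fm tr = 1" "fa tr = 0" "fb tr = 0" "fc tr = 0" by (simp_all add: fm_def fa_def fb_def fc_def mu_b_def t iv_def)
  have "(of_nat q - 1 :: complex) = 1 + (\<Sum>k\<in>Tx. 1)" using sum_Tx[of "\<lambda>_. 1"] by (simp add: card_nz)
  moreover have "(\<Sum>k\<in>Tx. tr (h k) * al 0 (inverse k)) = (\<Sum>k\<in>Tx. 1)" by (intro sum.cong refl) (simp add: t)
  ultimately have "mu_t 0 tr = 1" using q1_nz unfolding mu_t_def m by simp
  then show t0: "ft 0 tr = 1" by (simp add: ft_def iv_def)
  show "ft j tr = 0" if "0 < j" "j < q - 1"
    by (rule ft_zero[of 0 j, OF _ that(2) _ _ _ tr_Irr]) (use that t0 in auto)
qed

text \<open>The vector of the trivial character of B has norm 2, which leaves exactly one character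
  besides the trivial one; removing the known contribution of the trivial character reads off its
  multiplicities.\<close>

lemma steinberg:
  "\<exists>\<chi>\<in>Irr SG. \<chi> \<noteq> tr \<and> ft 0 \<chi> = 1 \<and> (\<forall>\<xi>\<in>Irr SG. \<xi> \<noteq> \<chi> \<longrightarrow> \<xi> \<noteq> tr \<longrightarrow> ft 0 \<xi> = 0) \<and> fa \<chi> = 1 \<and> fb \<chi> = rr \<and> fc \<chi> = rr \<and> fm \<chi> = 1"
proof -
  have q0: "0 < q - 1" using q_ge by simp
  have rm: "(\<Sum>\<xi>\<in>Irr SG. s \<xi>) = s tr + (\<Sum>\<xi>\<in>Irr SG - {tr}. s \<xi>)" for s :: "('a \<Rightarrow> complex) \<Rightarrow> int"
    by (rule sum.remove[OF SG.finite_Irr tr_Irr])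
  have "(\<Sum>\<chi>\<in>Irr SG. ft 0 \<chi> * ft 0 \<chi>) = 2" using fsums(11)[OF q0 q0] by simp
  then have "(\<Sum>\<chi>\<in>Irr SG - {tr}. ft 0 \<chi> * ft 0 \<chi>) = 1" unfolding rm by (simp add: f_tr)
  then obtain \<chi> where c: "\<chi> \<in> Irr SG - {tr}" "ft 0 \<chi> * ft 0 \<chi> = 1" "\<forall>\<xi>\<in>Irr SG - {tr}. \<xi> \<noteq> \<chi> \<longrightarrow> ft 0 \<xi> = 0"
    using sum_sq_one[of "Irr SG - {tr}" "ft 0"] SG.finite_Irr by blast
  have ci: "\<chi> \<in> Irr SG" using c(1) by simp
  have c1: "ft 0 \<chi> = 1" using int_sq_one f_nonneg(5)[OF ci] c(2) by blast
  have s: "(\<Sum>\<xi>\<in>Irr SG. ft 0 \<xi> * s \<xi>) = s tr + s \<chi>" for s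
  proof -
    have "(\<Sum>\<xi>\<in>Irr SG - {tr}. ft 0 \<xi> * s \<xi>) = ft 0 \<chi> * s \<chi> + (\<Sum>\<xi>\<in>Irr SG - {tr} - {\<chi>}. ft 0 \<xi> * s \<xi>)"
      using c(1) by (intro sum.remove) simp_all
    moreover have "(\<Sum>\<xi>\<in>Irr SG - {tr} - {\<chi>}. ft 0 \<xi> * s \<xi>) = 0" using c(3) by (intro sum.neutral) simp
    ultimately show ?thesis unfolding rm using c1 f_tr(5) by simp
  qed
  have "ft j \<chi> = 0" if "j \<in> {..<q - 1} - {0}" for j
    by (rule ft_zero[of 0 j, OF q0 _ _ _ _ ci]) (use that c1 in auto)
  then have "fm \<chi> = ft 0 \<chi>" unfolding fm_sum[OF ci] using q0 by (subst sum.remove[of _ 0]) auto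
  then have m: "fm \<chi> = 1" using c1 by simp
  have "fa \<chi> = 1" "fb \<chi> = rr" "fc \<chi> = rr"
    using fsums(8,9,10)[where j=0] unfolding s f_tr by simp_all
  then show ?thesis using c(1,3) c1 m by blast
qed

lemma noncuspidal:
  assumes c: "\<chi> \<in> Irr SG" and m: "fm \<chi> \<noteq> 0" and nt: "\<chi> \<noteq> tr"
  shows "fa \<chi> = 1 \<and> fb \<chi> = rr \<and> fc \<chi> = rr \<and> (fm \<chi> = 1 \<and> ft 0 \<chi> \<noteq> 0 \<or> fm \<chi> = 2)"
proof -
  obtain j where j: "j < q - 1" "ft j \<chi> \<noteq> 0"
    using m unfolding fm_sum[OF c] by (metis lessThan_iff sum.neutral)
  show ?thesis
  proof (cases "j = 0")
    case True
    then show ?thesis using steinberg j nt c by metis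
  next
    case False
    then show ?thesis using principal[of j] j c by (metis neq0_conv)
  qed
qed

lemma steinberg_unique:
  assumes "\<chi> \<in> Irr SG" "ft 0 \<chi> \<noteq> 0" "\<chi> \<noteq> tr" "\<xi> \<in> Irr SG" "ft 0 \<xi> \<noteq> 0" "\<xi> \<noteq> tr"
  shows "\<chi> = \<xi>"
  using steinberg assms by metis

lemma fa_Om: "\<chi> \<in> Irr SG \<Longrightarrow> fa \<chi> = (if \<chi> \<in> Om then 1 else 0)"
  using mu_a_01[of \<chi>] by (auto simp: fa_def Om_def iv_def)

lemma fb_fc_Om: assumes "\<chi> \<in> Om" shows "fb \<chi> = fc \<chi>"
proof -
  have "\<chi> e1 = \<chi> e2" using Om_real[OF assms, of e2] by (simp add: inv_e2)
  then show ?thesis by (simp add: fb_def fc_def mu_b_def)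
qed

definition "Xs = {\<chi> \<in> Om. fm \<chi> = 0}"

lemma Xs_Om: "\<chi> \<in> Xs \<Longrightarrow> \<chi> \<in> Om" and Om_Irr: "\<chi> \<in> Om \<Longrightarrow> \<chi> \<in> Irr SG" by (auto simp: Xs_def Om_def)

lemma finite_Xs: "finite Xs" unfolding Xs_def using finite_Om by simp

lemma Om_ne_tr: "\<chi> \<in> Om \<Longrightarrow> \<chi> \<noteq> tr"
  using fa_Om[of tr] tr_Irr f_tr(2) by (auto split: if_splits)

text \<open>The Steinberg character is the only member of \<open>Om\<close> with \<open>fm = 1\<close>.\<close>

lemma sum_fm_subset:
  assumes A: "A \<subseteq> Om - Xs" and St: "\<xi> \<in> Irr SG" "ft 0 \<xi> \<noteq> 0" "\<xi> \<noteq> tr"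
  shows "(\<Sum>\<chi>\<in>A. fm \<chi>) = 2 * int (card A) - (if \<xi> \<in> A then 1 else 0)"
proof -
  have fA: "finite A" using A finite_Om finite_subset by blast
  have "fm \<chi> = 2 - (if \<chi> = \<xi> then 1 else 0)" if a: "\<chi> \<in> A" for \<chi>
  proof -
    have c: "\<chi> \<in> Irr SG" "fm \<chi> \<noteq> 0" "\<chi> \<noteq> tr" using a A Om_Irr Om_ne_tr by (auto simp: Xs_def)
    have "fm \<xi> = 1" using steinberg St by metis
    then show ?thesis using noncuspidal[OF c] steinberg_unique[OF c(1) _ c(3) St] by auto
  qed
  then have "(\<Sum>\<chi>\<in>A. fm \<chi>) = (\<Sum>\<chi>\<in>A. 2 - (if \<chi> = \<xi> then 1 else 0))" by (intro sum.cong refl) simp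
  also have "\<dots> = 2 * int (card A) - (if \<xi> \<in> A then 1 else 0)" using fA by (simp add: sum_subtractf sum.delta)
  finally show ?thesis .
qed

lemma sum_Om: "(\<Sum>\<chi>\<in>Irr SG. s \<chi> * fa \<chi>) = (\<Sum>\<chi>\<in>Om. s \<chi>)"
proof -
  have "(\<Sum>\<chi>\<in>Irr SG. s \<chi> * fa \<chi>) = (\<Sum>\<chi>\<in>Irr SG. if \<chi> \<in> Om then s \<chi> else 0)" by (intro sum.cong refl) (simp add: fa_Om)
  then show ?thesis using SG.finite_Irr by (simp add: sum.If_cases Int_absorb1 Om_Irr subsetI)
qed

text \<open>The multiplicities \<open>fm\<close> of the q members of \<open>Om\<close> add up to q -
  1. The Steinberg character contributes 1 and every other non-cuspidal member 2, so q / 2 members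
  are non-cuspidal and q / 2 are cuspidal.\<close>

lemma card_Xs: "int (card Xs) = rr * rr"
proof -
  obtain \<xi> where St: "\<xi> \<in> Irr SG" "\<xi> \<noteq> tr" "ft 0 \<xi> = 1" "fa \<xi> = 1" "fm \<xi> = 1" using steinberg by blast
  have x: "\<xi> \<in> Om - Xs" using St fa_Om[OF St(1)] by (auto simp: Xs_def split: if_splits)
  have "(\<Sum>\<chi>\<in>Om. fm \<chi>) = qi - 1" using fsums(2) unfolding sum_Om .
  moreover have "(\<Sum>\<chi>\<in>Om. fm \<chi>) = (\<Sum>\<chi>\<in>Om - Xs. fm \<chi>)"
    by (rule sum.mono_neutral_right) (auto simp: finite_Om Xs_def)
  moreover have "(\<Sum>\<chi>\<in>Om - Xs. fm \<chi>) = 2 * int (card (Om - Xs)) - 1"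
    using sum_fm_subset[OF order_refl, of \<xi>] St x by simp
  ultimately have "2 * int (card (Om - Xs)) = qi" by simp
  moreover have "int (card Om) = int (card (Om - Xs)) + int (card Xs)"
  proof -
    have "Xs \<subseteq> Om" using Xs_Om by blast
    then show ?thesis using card_Diff_subset[OF finite_Xs] card_mono[OF finite_Om] by fastforce
  qed
  ultimately show ?thesis unfolding card_Om qi by simp
qed

text \<open>For such a character the central character at the involution would be -(q^2 + 1) / (q +
  1), a rational algebraic integer and hence an integer.\<close>

lemma degree_not_q2_1:
  assumes c: "\<chi> \<in> Irr SG"
  shows "\<not> (\<chi> \<one> = of_int (qi * qi - 1) \<and> \<chi> ze = -1)"
proof
  assume d: "\<chi> \<one> = of_int (qi * qi - 1) \<and> \<chi> ze = -1"
  let ?q = "of_nat q :: complex"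
  have "{g \<in> Sz. g \<otimes> ze \<otimes> inv\<^bsub>SG\<^esub> g = ze} = {g \<in> Sz. g \<otimes> ze \<otimes> inv g = ze}" using inv_SG by auto
  then have "card {g \<in> carrier SG. g \<otimes>\<^bsub>SG\<^esub> ze \<otimes>\<^bsub>SG\<^esub> inv\<^bsub>SG\<^esub> g = ze} = q\<^sup>2" using ncj_ze(1) by (simp add: ncj_def)
  then have "algebraic_int (of_nat (card Sz) / of_nat (q\<^sup>2) * \<chi> ze / \<chi> \<one>)"
    using SG.class_sum_algebraic_int[OF c, of ze] by simp
  moreover have "of_nat (card Sz) / of_nat (q\<^sup>2) * \<chi> ze / \<chi> \<one> = - ((?q\<^sup>2 + 1) / (?q + 1))"
  proof -
    have "\<chi> \<one> = (?q - 1) * (?q + 1)" using d by (simp add: qi(2) algebra_simps)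
    moreover have "x\<^sup>2 * a * b / x\<^sup>2 * -1 / (a * c) = - (b / c)" if "x \<noteq> 0" "a \<noteq> 0" for x a b c :: complex
      using that by (cases "c = 0") (simp_all add: field_simps)
    moreover have "?q \<noteq> 0" using q_ge by simp
    ultimately show ?thesis unfolding card_Sz_c of_nat_power using d q1_nz by simp
  qed
  ultimately have "algebraic_int ((?q\<^sup>2 + 1) / (?q + 1))" by (metis algebraic_int_minus_iff)
  moreover have "(?q\<^sup>2 + 1) / (?q + 1) = of_rat ((of_nat q ^ 2 + 1) / (of_nat q + 1))" by (simp add: of_rat_divide of_rat_add of_rat_power)
  ultimately have "(?q\<^sup>2 + 1) / (?q + 1) \<in> \<int>" by (intro rational_algebraic_int_is_int) auto
  then obtain z where z: "(?q\<^sup>2 + 1) / (?q + 1) = of_int z" by (auto elim: Ints_cases)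
  have "?q + 1 \<noteq> 0" using of_nat_neq_0[of q, where 'a=complex] by (simp add: add.commute)
  then have "?q\<^sup>2 + 1 = of_int z * (?q + 1)" using z by (simp add: field_simps)
  then have "of_int (int q * int q + 1) = (of_int (z * (int q + 1)) :: complex)" by (simp add: power2_eq_square)
  then have "int q * int q + 1 = z * (int q + 1)" by (simp only: of_int_eq_iff)
  \<comment> \<open>From q^2 + 1 = (q + 1)(q - 1) + 2: the divisor q + 1 would have to divide
    2.\<close>
  then have "(int q + 1) * (z - int q + 1) = 2" by (simp add: algebra_simps)
  then have "int q + 1 dvd 2" by (metis dvd_triv_left)
  then show False using q_ge zdvd_imp_le[of "int q + 1" 2] by simp
qed

text \<open>The deviation of \<open>fb\<close> from its value on the non-cuspidal members of
  \<open>Om\<close>. On \<open>Xs\<close> the degree becomes (q - 1)(q + 1 + r x), so x = 0 is the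
  excluded degree q^2 - 1, and 1 and -1 give the two cuspidal degrees.\<close>

definition "fx \<chi> = fb \<chi> - rr"

lemma degree_Xs:
  assumes "\<chi> \<in> Xs"
  shows "\<chi> \<one> = of_int ((qi - 1) * (qi + 1 + 2 * rr * fx \<chi>))" "\<chi> ze = of_int (- 1 - 2 * rr * fx \<chi>)" "fx \<chi> \<noteq> 0"
proof -
  have c: "\<chi> \<in> Irr SG" "fm \<chi> = 0" "fa \<chi> = 1" "fc \<chi> = fb \<chi>" "fb \<chi> = rr + fx \<chi>"
    using assms Om_Irr[OF Xs_Om[OF assms]] fb_fc_Om[OF Xs_Om[OF assms]] fa_Om Xs_Om[OF assms] by (auto simp: Xs_def fx_def)
  show 1: "\<chi> \<one> = of_int ((qi - 1) * (qi + 1 + 2 * rr * fx \<chi>))" "\<chi> ze = of_int (- 1 - 2 * rr * fx \<chi>)"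
    unfolding degree_int[OF c(1)] c(2-5) by (simp_all only: of_int_eq_iff) (simp_all add: algebra_simps)
  show "fx \<chi> \<noteq> 0"
  proof
    assume x: "fx \<chi> = 0"
    have "(qi - 1) * (qi + 1 + 2 * rr * fx \<chi>) = qi * qi - 1" "- 1 - 2 * rr * fx \<chi> = -1" unfolding x by (simp_all add: algebra_simps)
    then show False using degree_not_q2_1[OF c(1)] 1 by (simp only: of_int_minus of_int_1 refl simp_thms)
  qed
qed

text \<open>Outside \<open>Xs\<close> a character is trivial, or has \<open>fb\<close> and
  \<open>fc\<close> equal to rr, or has \<open>fa\<close> equal to 0. Hence it contributes nothing
  to the first moment below and a non-negative amount to the second.\<close>

lemma fx_nonXs:
  assumes c: "\<chi> \<in> Irr SG" and n: "\<chi> \<notin> Xs"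
  shows "(fb \<chi> - rr * fa \<chi>) * (fc \<chi> - rr * fa \<chi>) \<ge> 0" "fa \<chi> * (fb \<chi> - rr * fa \<chi>) = 0"
proof -
  consider "\<chi> = tr" | "fa \<chi> = 1" "fb \<chi> = rr" "fc \<chi> = rr" | "fm \<chi> = 0" using noncuspidal[OF c] by blast
  then have "(fb \<chi> - rr * fa \<chi>) * (fc \<chi> - rr * fa \<chi>) \<ge> 0 \<and> fa \<chi> * (fb \<chi> - rr * fa \<chi>) = 0"
  proof cases
    case 3
    then have "fa \<chi> = 0" using n fa_Om[OF c] by (auto simp: Xs_def)
    then show ?thesis using f_nonneg[OF c] by simp
  qed (simp_all add: f_tr)
  then show "(fb \<chi> - rr * fa \<chi>) * (fc \<chi> - rr * fa \<chi>) \<ge> 0" "fa \<chi> * (fb \<chi> - rr * fa \<chi>) = 0" by auto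
qed

text \<open>First and second moment: over all irreducible characters the deviations weighted by
  \<open>fa\<close> sum to -rr, and the products of the deviations of \<open>fb\<close> and
  \<open>fc\<close> sum to rr^2. The latter bounds the sum of the squares of \<open>fx\<close> over
  \<open>Xs\<close>, which has rr^2 members, all with \<open>fx\<close> nonzero; so every square
  equals 1.\<close>

lemma sum_fx: "(\<Sum>\<chi>\<in>Xs. fx \<chi>) = - rr" and fx_cases: "\<chi> \<in> Xs \<Longrightarrow> fx \<chi> = 1 \<or> fx \<chi> = -1"
proof -
  have X: "Xs \<subseteq> Irr SG" using Om_Irr Xs_Om by blast
  have fX: "fa \<chi> = 1" "fc \<chi> = fb \<chi>" if "\<chi> \<in> Xs" for \<chi>
    using that fa_Om[OF Om_Irr] fb_fc_Om Xs_Om by auto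
  have "(\<Sum>\<chi>\<in>Irr SG. fa \<chi> * (fb \<chi> - rr * fa \<chi>)) = (\<Sum>\<chi>\<in>Irr SG. fa \<chi> * fb \<chi>) - rr * (\<Sum>\<chi>\<in>Irr SG. fa \<chi> * fa \<chi>)"
    unfolding sum_distrib_left sum_subtractf[symmetric] by (intro sum.cong refl) (simp add: algebra_simps)
  then have "(\<Sum>\<chi>\<in>Irr SG. fa \<chi> * (fb \<chi> - rr * fa \<chi>)) = - rr" unfolding fsums by (simp add: algebra_simps)
  moreover have "(\<Sum>\<chi>\<in>Irr SG. fa \<chi> * (fb \<chi> - rr * fa \<chi>)) = (\<Sum>\<chi>\<in>Xs. fa \<chi> * (fb \<chi> - rr * fa \<chi>))"
    by (rule sum.mono_neutral_right) (use X fx_nonXs in auto)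
  moreover have "\<dots> = (\<Sum>\<chi>\<in>Xs. fx \<chi>)" by (intro sum.cong refl) (simp add: fX fx_def)
  ultimately show "(\<Sum>\<chi>\<in>Xs. fx \<chi>) = - rr" by simp
  have "(\<Sum>\<chi>\<in>Irr SG. (fb \<chi> - rr * fa \<chi>) * (fc \<chi> - rr * fa \<chi>)) = (\<Sum>\<chi>\<in>Irr SG. fb \<chi> * fc \<chi>) - rr * (\<Sum>\<chi>\<in>Irr SG. fa \<chi> * fb \<chi>) - rr * (\<Sum>\<chi>\<in>Irr SG. fa \<chi> * fc \<chi>) + rr * rr * (\<Sum>\<chi>\<in>Irr SG. fa \<chi> * fa \<chi>)"
    unfolding sum_distrib_left sum_subtractf[symmetric] sum.distrib[symmetric] by (intro sum.cong refl) (simp add: algebra_simps)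
  also have "\<dots> = rr * rr" unfolding fsums by (simp add: algebra_simps)
  finally have t: "(\<Sum>\<chi>\<in>Irr SG. (fb \<chi> - rr * fa \<chi>) * (fc \<chi> - rr * fa \<chi>)) = rr * rr" .
  have "(\<Sum>\<chi>\<in>Xs. (fb \<chi> - rr * fa \<chi>) * (fc \<chi> - rr * fa \<chi>)) \<le> (\<Sum>\<chi>\<in>Irr SG. (fb \<chi> - rr * fa \<chi>) * (fc \<chi> - rr * fa \<chi>))"
    by (rule sum_mono2) (use X fx_nonXs in auto)
  moreover have "(\<Sum>\<chi>\<in>Xs. (fb \<chi> - rr * fa \<chi>) * (fc \<chi> - rr * fa \<chi>)) = (\<Sum>\<chi>\<in>Xs. fx \<chi> * fx \<chi>)"
    by (intro sum.cong refl) (simp add: fX fx_def)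
  ultimately have le: "(\<Sum>\<chi>\<in>Xs. fx \<chi> * fx \<chi> - 1) \<le> 0" using t card_Xs by (simp add: sum_subtractf)
  have pos: "fx \<chi> * fx \<chi> - 1 \<ge> 0" if "\<chi> \<in> Xs" for \<chi>
  proof -
    have "0 < fx \<chi> * fx \<chi>" using degree_Xs(3)[OF that] by (metis mult_eq_0_iff not_square_less_zero linorder_neqE_linordered_idom)
    then show ?thesis by simp
  qed
  then have "(\<Sum>\<chi>\<in>Xs. fx \<chi> * fx \<chi> - 1) \<ge> 0" by (rule sum_nonneg)
  then have "(\<Sum>\<chi>\<in>Xs. fx \<chi> * fx \<chi> - 1) = 0" using le by simp
  then have "\<forall>\<chi>\<in>Xs. fx \<chi> * fx \<chi> - 1 = 0" using pos finite_Xs by (subst (asm) sum_nonneg_eq_0_iff) auto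
  then have "(fx \<chi> - 1) * (fx \<chi> + 1) = 0" if "\<chi> \<in> Xs" using that by (simp add: algebra_simps)
  then show "fx \<chi> = 1 \<or> fx \<chi> = -1" if "\<chi> \<in> Xs" using that by auto
qed

lemma card_Xs_sign:
  "2 * int (card {\<chi>\<in>Xs. fx \<chi> = 1}) = rr * rr - rr" "2 * int (card {\<chi>\<in>Xs. fx \<chi> = -1}) = rr * rr + rr"
proof -
  let ?P = "{\<chi>\<in>Xs. fx \<chi> = 1}" and ?N = "{\<chi>\<in>Xs. fx \<chi> = -1}"
  have "(\<Sum>\<chi>\<in>Xs. fx \<chi>) = (\<Sum>\<chi>\<in>Xs. (if fx \<chi> = 1 then 1 else 0) - (if fx \<chi> = -1 then 1 else 0))"
    using fx_cases by (intro sum.cong refl) auto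
  also have "\<dots> = int (card ?P) - int (card ?N)"
    using finite_Xs by (simp add: sum_subtractf sum.If_cases Int_def)
  finally have 1: "int (card ?P) - int (card ?N) = - rr" by (simp add: sum_fx)
  have "?P \<union> ?N = Xs" using fx_cases by auto
  moreover have "card (?P \<union> ?N) = card ?P + card ?N"
    using finite_Xs by (intro card_Un_disjoint) auto
  ultimately have "int (card ?P) + int (card ?N) = rr * rr" using card_Xs by simp
  then show "2 * int (card ?P) = rr * rr - rr" "2 * int (card ?N) = rr * rr + rr" using 1 by linarith+
qed

text \<open>The squares of fb - fc have total 2, so a character with fb and fc different exists. It
  lies outside \<open>Om\<close>, whose members are real, and it is cuspidal; what remains of its
  degree is a multiple of (q - 1) * r / 2.\<close>

lemma nonreal:
  "\<exists>\<chi>\<in>Irr SG. \<exists>e>0. \<chi> \<one> = of_int ((qi - 1) * (rr * e))"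
proof -
  have "(\<Sum>\<chi>\<in>Irr SG. (fb \<chi> - fc \<chi>) * (fb \<chi> - fc \<chi>)) = (\<Sum>\<chi>\<in>Irr SG. fb \<chi> * fb \<chi>) + (\<Sum>\<chi>\<in>Irr SG. fc \<chi> * fc \<chi>) - 2 * (\<Sum>\<chi>\<in>Irr SG. fb \<chi> * fc \<chi>)"
    unfolding sum_distrib_left sum_subtractf[symmetric] sum.distrib[symmetric] by (intro sum.cong refl) (simp add: algebra_simps)
  also have "\<dots> \<noteq> 0" unfolding fsums by (simp add: algebra_simps)
  finally obtain \<chi> where c: "\<chi> \<in> Irr SG" "fb \<chi> \<noteq> fc \<chi>"
    by (metis (no_types, lifting) cancel_comm_monoid_add_class.diff_cancel mult_zero_left sum.neutral)
  have a: "fa \<chi> = 0" using fa_Om[OF c(1)] fb_fc_Om c(2) by auto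
  have m: "fm \<chi> = 0" using noncuspidal[OF c(1)] c(2) f_tr by force
  have "fb \<chi> + fc \<chi> > 0" using f_nonneg[OF c(1)] c(2) by linarith
  moreover have "\<chi> \<one> = of_int ((qi - 1) * (rr * (fb \<chi> + fc \<chi>)))" unfolding degree_int[OF c(1)] a m by (simp add: mult.assoc)
  ultimately show ?thesis using c(1) by blast
qed

end

section \<open>Arithmetic of powers of 2 and separation of degrees\<close>

lemma power_sub_1_dvd: "(x::nat) - 1 dvd x ^ c - 1"
proof (induction c)
  case (Suc c)
  show ?case
  proof (cases "x = 0")
    case False
    then have "x ^ Suc c - 1 = x * (x ^ c - 1) + (x - 1)" by (simp add: diff_mult_distrib2)
    then show ?thesis using Suc by simp
  qed simp
qed simp

lemma sum_powers_2: "(\<Sum>j\<le>k. (2::nat) ^ j) < 2 ^ (k + 1)"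
  by (induction k) auto

lemma odd_proper_divisor: assumes "odd d" "t dvd d" "t < (d::nat)" shows "3 * t \<le> d"
proof -
  obtain c where c: "d = t * c" using assms by (auto simp: dvd_def)
  then have "c \<noteq> 0" "c \<noteq> 1" "c \<noteq> 2" using assms by (auto intro!: Nat.gr0I)
  then have "3 \<le> c" by simp
  then show ?thesis unfolding c by (simp add: mult.commute)
qed

text \<open>In the application 2b = r, so that 2b^2 = q and Q = q - 1. The first equation is divided
  by Q and read modulo 2b, where both sides reduce to the orbit lengths, which are smaller than 2b.
  Modulo Q the left sides of the other two are 2t and 1, while the right sides are 0.\<close>

lemma Suzuki_degree_eq:
  fixes Q t t' x y z :: int
  assumes b: "b \<ge> 4" and t: "0 < t" "t < 2 * b" "0 < t'" "t' < 2 * b"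
  defines "Q \<equiv> 2 * b * b - 1"
  shows "t * (Q * (2 * b * b + 1 + 2 * b * x)) = t' * (Q * (2 * b * b + 1 + 2 * b * y)) \<Longrightarrow> t = t' \<and> x = y"
    "t * (2 * b * b * (2 * b * b) + 1) \<noteq> t' * (Q * z)" "2 * b * b * (2 * b * b) \<noteq> t' * (Q * z)"
proof -
  have Q: "Q > 4 * b" using b mult_right_mono[of 4 b b] unfolding Q_def mult.assoc by linarith
  have bb: "2 * b * b * (2 * b * b) = Q * (2 * b * b + 1) + 1" by (simp add: Q_def algebra_simps)
  show "t = t' \<and> x = y" if "t * (Q * (2 * b * b + 1 + 2 * b * x)) = t' * (Q * (2 * b * b + 1 + 2 * b * y))"
  proof -
    have "Q * (t * (2 * b * b + 1 + 2 * b * x)) = Q * (t' * (2 * b * b + 1 + 2 * b * y))" using that by (simp only: mult.left_commute)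
    then have e: "t * (2 * b * b + 1 + 2 * b * x) = t' * (2 * b * b + 1 + 2 * b * y)" using Q b by simp
    then have "t - t' = 2 * b * (t' * (b + y) - t * (b + x))" by (simp add: algebra_simps)
    then have "2 * b dvd t - t'" by (metis dvd_triv_left)
    then have tt: "t = t'" using t zdvd_imp_le[of "2 * b" "t - t'"] zdvd_imp_le[of "2 * b" "t' - t"]
      by (metis dvd_diff_commute diff_gt_0_iff_gt linorder_neqE_linordered_idom less_le_not_le diff_less_eq add_less_cancel_left less_add_same_cancel1 order.strict_trans)
    then show ?thesis using e t b by simp
  qed
  show "t * (2 * b * b * (2 * b * b) + 1) \<noteq> t' * (Q * z)"
  proof
    assume "t * (2 * b * b * (2 * b * b) + 1) = t' * (Q * z)"
    then have "2 * t = Q * (t' * z - t * (2 * b * b + 1))" unfolding bb by (simp add: algebra_simps)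
    then have "Q dvd 2 * t" by (metis dvd_triv_left)
    then show False using zdvd_imp_le[of Q "2 * t"] t Q by simp
  qed
  show "2 * b * b * (2 * b * b) \<noteq> t' * (Q * z)"
  proof
    assume "2 * b * b * (2 * b * b) = t' * (Q * z)"
    then have "1 = Q * (t' * z - (2 * b * b + 1))" unfolding bb by (simp add: algebra_simps)
    then have "Q dvd 1" by (metis dvd_triv_left)
    then show False using zdvd_imp_le[of Q 1] b Q by simp
  qed
qed

section \<open>Extensions by a cyclic group of field automorphisms\<close>

locale suzuki_ext = suzuki G f F u h w
  for G (structure) and f and F :: "'k::{field,finite} itself" and u h w +
  fixes s and m d :: nat
  assumes s_closed: "s \<in> carrier G"
    and s_u: "s \<otimes> u a b \<otimes> inv s = u (a ^ (2 ^ m)) (b ^ (2 ^ m))"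
    and s_h: "k \<noteq> 0 \<Longrightarrow> s \<otimes> h k \<otimes> inv s = h (k ^ (2 ^ m))"
    and s_w: "s \<otimes> w \<otimes> inv s = w"
    and n_md: "n = m * d" and d_gt: "d > 1" and s_pow: "s [^] d = \<one>"
    and decompose: "\<And>g. g \<in> carrier G \<Longrightarrow> \<exists>x\<in>Sz. \<exists>i<d. g = x \<otimes> s [^] i"
    and unique: "\<And>x y i j. x \<in> Sz \<Longrightarrow> y \<in> Sz \<Longrightarrow> i < d \<Longrightarrow> j < d \<Longrightarrow> x \<otimes> s [^] i = y \<otimes> s [^] j \<Longrightarrow> x = y \<and> i = j"
begin

lemma s_mult: "x \<in> carrier G \<Longrightarrow> y \<in> carrier G \<Longrightarrow> s \<otimes> (x \<otimes> y) \<otimes> inv s = (s \<otimes> x \<otimes> inv s) \<otimes> (s \<otimes> y \<otimes> inv s)"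
  using s_closed by (simp add: m_assoc inv_solve_left inv_left)

lemma s_norm: assumes "x \<in> Sz" shows "s \<otimes> x \<otimes> inv s \<in> Sz"
proof -
  consider "x \<in> B" | "x \<in> C" using assms by (auto simp: Sz_def)
  then show ?thesis
  proof cases
    case 1
    then show ?thesis by (elim BE) (simp add: s_mult s_u s_h Sz_mult)
  next
    case 2
    then show ?thesis by (elim CE) (simp add: s_mult s_u s_h s_w Sz_mult)
  qed
qed

sublocale E: cyclic_extension G Sz s d
  by (intro cyclic_extension.intro cyclic_extension_axioms.intro)
    (fact fin_group_axioms subgroup_Sz s_closed s_norm s_pow decompose unique | use d_gt in simp)+

abbreviation "fr i x \<equiv> x ^ (2 ^ (m * i))" for x :: 'k

lemma sc_u: "E.sc i (u a b) = u (fr i a) (fr i b)"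
  and sc_h: "k \<noteq> 0 \<Longrightarrow> E.sc i (h k) = h (fr i k)"
  and sc_w: "E.sc i w = w"
proof -
  have 1: "E.sc (Suc i) x = s \<otimes> E.sc i x \<otimes> inv s" if "x \<in> Sz" for x i
    using E.sc_add[OF that, of 1 i] s_closed E.sc_def[of 1 "E.sc i x"] by simp
  have p: "fr i x ^ (2 ^ m) = fr (Suc i) x" for x :: 'k and i by (simp add: power_mult[symmetric] power_add mult.commute)
  show "E.sc i (u a b) = u (fr i a) (fr i b)"
    by (induction i) (simp_all add: E.sc_0 1 s_u p del: power_Suc mult_Suc_right)
  show "E.sc i (h k) = h (fr i k)" if "k \<noteq> 0"
    by (induction i) (simp_all add: that E.sc_0 1 s_h p del: power_Suc mult_Suc_right)
  show "E.sc i w = w" by (induction i) (simp_all add: E.sc_0 1 s_w)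
qed

lemma bij_fr: "bij (fr i :: 'k \<Rightarrow> 'k)"
proof -
  have "inj (fr i :: 'k \<Rightarrow> 'k)" by (rule injI) (simp add: frob_inj)
  then show ?thesis using finite_UNIV_inj_surj[of "fr i :: 'k \<Rightarrow> 'k"] by (simp add: bij_def)
qed

lemma cj_Om: "\<chi> \<in> Om \<Longrightarrow> E.cj i \<chi> \<in> Om"
  and card_cj_Om: "card {\<chi>\<in>Om. E.cj i \<chi> = \<chi>} = card {x::'k. fr i x = x}"
  unfolding E.cj_def
  by (rule card_fixed_Om[of "E.sc i" "fr i"]; simp add: E.sc_bij E.sc_mult sc_u sc_h sc_w lam_frob bij_fr)+

text \<open>The condition singles out the multiples of (q - 1) / (2^a - 1), the residues fixed under
  multiplication by 2^a modulo q - 1. They occur both as exponents of \<open>gen\<close>, for fixed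
  field elements, and as indices of torus characters.\<close>

lemma card_divisible:
  assumes a: "a dvd n" "a > 0"
  shows "card {i. i < q - 1 \<and> (q - 1) dvd i * (2 ^ a - 1)} = 2 ^ a - 1"
proof -
  have "(2::nat) ^ a > 1" using a by (intro one_less_power) auto
  then have p: "(2::nat) ^ a - 1 > 0" by simp
  have "(2::nat) ^ a - 1 dvd q - 1" using a power_sub_1_dvd[of "2 ^ a"] by (auto simp: q_def dvd_def[of a] power_mult)
  then obtain D where D: "q - 1 = (2 ^ a - 1) * D" by (auto simp: dvd_def)
  have D0: "D > 0" using D q_ge by (cases D) auto
  have "{i. i < q - 1 \<and> (q - 1) dvd i * (2 ^ a - 1)} = (\<lambda>i. D * i) ` {..<2 ^ a - 1}"
  proof (intro equalityI subsetI)
    fix i assume "i \<in> {i. i < q - 1 \<and> (q - 1) dvd i * (2 ^ a - 1)}"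
    then have i: "i < (2 ^ a - 1) * D" "(2 ^ a - 1) * D dvd (2 ^ a - 1) * i" unfolding D by (simp_all add: mult.commute)
    then have "D dvd i" using p by simp
    then obtain l where l: "i = D * l" by (auto simp: dvd_def)
    then show "i \<in> (\<lambda>i. D * i) ` {..<2 ^ a - 1}" using i(1) D0 by (auto simp: mult.commute)
  next
    fix i assume "i \<in> (\<lambda>i. D * i) ` {..<2 ^ a - 1}"
    then obtain l where l: "i = D * l" "l < 2 ^ a - 1" by auto
    then show "i \<in> {i. i < q - 1 \<and> (q - 1) dvd i * (2 ^ a - 1)}" using D0 unfolding D by (simp add: mult.commute mult.assoc)
  qed
  moreover have "inj_on (\<lambda>i. D * i) {..<2 ^ a - 1}" using D0 by (simp add: inj_on_def)
  ultimately show ?thesis by (simp add: card_image)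
qed

lemma mod_q1_iff: "(i * 2 ^ a) mod (q - 1) = i mod (q - 1) \<longleftrightarrow> (q - 1) dvd i * (2 ^ a - 1)"
proof -
  have "i \<le> i * 2 ^ a" by simp
  then show ?thesis using mod_eq_dvd_iff_nat[of i "i * 2 ^ a" "q - 1"] by (simp add: diff_mult_distrib2)
qed

lemma card_fixed_field:
  assumes a: "a dvd n" "a > 0"
  shows "card {x::'k. x ^ (2 ^ a) = x} = 2 ^ a"
proof -
  let ?I = "{i. i < q - 1 \<and> (q - 1) dvd i * (2 ^ a - 1)}"
  have g: "(gen ^ i) ^ (2 ^ a) = gen ^ i \<longleftrightarrow> (q - 1) dvd i * (2 ^ a - 1)" for i
    by (simp only: power_mult[symmetric] gen_eq mod_q1_iff)
  have "{x::'k. x ^ (2 ^ a) = x} = insert 0 ((\<lambda>i. gen ^ i) ` ?I)"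
  proof (intro equalityI subsetI)
    fix x :: 'k assume x: "x \<in> {x. x ^ (2 ^ a) = x}"
    show "x \<in> insert 0 ((\<lambda>i. gen ^ i) ` ?I)"
    proof (cases "x = 0")
      case False
      then have "dl x < q - 1" "x = gen ^ dl x" using dl[of x] by simp_all
      moreover have "(q - 1) dvd dl x * (2 ^ a - 1)" using x g[of "dl x"] dl(1)[OF False] by simp
      ultimately show ?thesis by blast
    qed simp
  qed (use g in auto)
  moreover have "card (insert 0 ((\<lambda>i. gen ^ i) ` ?I)) = Suc (card ((\<lambda>i. gen ^ i) ` ?I))"
    using gen(1) by (intro card_insert_disjoint) auto
  moreover have "inj_on (\<lambda>i. gen ^ i) ?I" using gen_bij by (auto simp: bij_betw_def intro: inj_on_subset)
  ultimately show ?thesis using card_divisible[OF a] by (simp add: card_image)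
qed

lemma m_pos: "m > 0" and n_odd: "odd n" and d_odd: "odd d" and d_less: "d < r"
proof -
  show o: "odd n" by (simp add: n_def)
  then show "m > 0" "odd d" using n_md by (auto intro: Nat.gr0I)
  then have "d \<le> n" unfolding n_md by simp
  then show "d < r" using n_lt_r by simp
qed

lemma card_fixed_pow: assumes "k dvd d" "k > 0" shows "card {\<chi>\<in>Om. E.cj k \<chi> = \<chi>} = 2 ^ (m * k)"
  unfolding card_cj_Om by (rule card_fixed_field) (use assms m_pos n_md in auto)

subsection \<open>Stabilizers\<close>

text \<open>The length of the orbit under the powers of s; \<open>orbit_degree\<close> turns it into
  a degree of G.\<close>

definition tt :: "('a \<Rightarrow> complex) \<Rightarrow> nat" where "tt \<chi> = (LEAST t. t > 0 \<and> E.cj t \<chi> = \<chi>)"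

lemma cj_d: assumes "\<chi> \<in> Irr SG" shows "E.cj d \<chi> = \<chi>"
  by (rule SG.Irr_eqI[OF E.cj_Irr[OF assms] assms]) (simp add: E.cj_def E.sc_d)

lemma tt:
  assumes c: "\<chi> \<in> Irr SG"
  shows "tt \<chi> > 0" "E.cj (tt \<chi>) \<chi> = \<chi>" "E.cj i \<chi> = \<chi> \<Longrightarrow> tt \<chi> dvd i" "tt \<chi> dvd d" "of_nat (tt \<chi>) * \<chi> \<one> \<in> cd G"
proof -
  have "tt \<chi> > 0 \<and> E.cj (tt \<chi>) \<chi> = \<chi>" unfolding tt_def 
    by (rule LeastI[of "\<lambda>t. t > 0 \<and> E.cj t \<chi> = \<chi>" d]) (use cj_d[OF c] d_gt in simp)
  then show t: "tt \<chi> > 0" "E.cj (tt \<chi>) \<chi> = \<chi>" by auto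
  have least: "E.cj i \<chi> \<noteq> \<chi>" if "0 < i" "i < tt \<chi>" for i
    using that not_less_Least unfolding tt_def by blast
  have mult: "E.cj (tt \<chi> * k) \<chi> = \<chi>" for k
    by (induction k) (simp_all add: E.cj_0[OF c] E.cj_add[OF c] t)
  show dv: "tt \<chi> dvd i" if "E.cj i \<chi> = \<chi>" for i
  proof -
    have "E.cj (tt \<chi> * (i div tt \<chi>) + i mod tt \<chi>) \<chi> = E.cj (i mod tt \<chi>) \<chi>" by (simp only: E.cj_add[OF c] mult)
    then have "E.cj (i mod tt \<chi>) \<chi> = \<chi>" using that by simp
    then have "i mod tt \<chi> = 0" using least[of "i mod tt \<chi>"] t(1) by (metis mod_less_divisor neq0_conv)
    then show ?thesis by (simp add: dvd_eq_mod_eq_0)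
  qed
  show "tt \<chi> dvd d" by (rule dv[OF cj_d[OF c]])
  then show "of_nat (tt \<chi>) * \<chi> \<one> \<in> cd G" by (rule E.orbit_degree[OF c _ t least])
qed

text \<open>A member with an orbit shorter than d is fixed by the t-th power of s for a proper
  divisor t of d, and m * t is then at most n / 3 because d is odd. By the fixed point count, the
  number of such members is at most the sum of the 2^j with j up to n / 3, which is smaller than
  2^f.\<close>

lemma regular_orbit:
  assumes A: "A \<subseteq> Om" "card A \<ge> 2 ^ f"
  shows "\<exists>\<chi>\<in>A. tt \<chi> = d"
proof (rule ccontr)
  assume no: "\<not> (\<exists>\<chi>\<in>A. tt \<chi> = d)"
  let ?D = "{t. t dvd d \<and> t < d}"
  have fD: "finite ?D" by simp
  have D0: "t > 0" if "t \<in> ?D" for t using that d_gt by (auto intro: Nat.gr0I)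
  have "A \<subseteq> (\<Union>t\<in>?D. {\<chi>\<in>Om. E.cj t \<chi> = \<chi>})"
  proof
    fix \<chi> assume x: "\<chi> \<in> A"
    then have c: "\<chi> \<in> Om" "\<chi> \<in> Irr SG" "tt \<chi> \<noteq> d" using A(1) Om_Irr no by auto
    then have "tt \<chi> \<in> ?D" using tt(4)[OF c(2)] d_gt dvd_imp_le[OF tt(4)[OF c(2)]] by simp
    then show "\<chi> \<in> (\<Union>t\<in>?D. {\<chi>\<in>Om. E.cj t \<chi> = \<chi>})" using tt(2)[OF c(2)] c(1) by blast
  qed
  then have "card A \<le> card (\<Union>t\<in>?D. {\<chi>\<in>Om. E.cj t \<chi> = \<chi>})" using fD finite_Om by (intro card_mono) auto
  also have "\<dots> \<le> (\<Sum>t\<in>?D. card {\<chi>\<in>Om. E.cj t \<chi> = \<chi>})" by (rule card_UN_le[OF fD])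
  also have "\<dots> = (\<Sum>t\<in>?D. 2 ^ (m * t))" using D0 by (intro sum.cong refl) (simp add: card_fixed_pow)
  also have "\<dots> = (\<Sum>j\<in>(\<lambda>t. m * t) ` ?D. 2 ^ j)" using m_pos by (subst sum.reindex) (auto simp: inj_on_def)
  also have "\<dots> \<le> (\<Sum>j\<le>n div 3. 2 ^ j)"
  proof (rule sum_mono2)
    show "(\<lambda>t. m * t) ` ?D \<subseteq> {..n div 3}"
    proof clarify
      fix t assume "t dvd d" "t < d"
      then have "m * (3 * t) \<le> n" unfolding n_md using odd_proper_divisor[OF d_odd] by simp
      then show "m * t \<le> n div 3" by (simp add: less_eq_div_iff_mult_less_eq)
    qed
  qed auto
  also have "\<dots> < 2 ^ (n div 3 + 1)" by (rule sum_powers_2)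
  \<comment> \<open>The exponent n div 3 + 1 is at most f from f = 2 on, with equality
    there.\<close>
  also have "\<dots> \<le> (2::nat) ^ f" using f_gt by (intro power_increasing) (auto simp: n_def)
  finally show False using A(2) by simp
qed

lemma Xs_sign_large: "card {\<chi>\<in>Xs. fx \<chi> = 1} \<ge> 2 ^ f" "card {\<chi>\<in>Xs. fx \<chi> = -1} \<ge> 2 ^ f"
proof -
  have "rr * 4 \<le> rr * rr" by (rule mult_left_mono) (use rr_ge in auto)
  then have "int (2 ^ f) \<le> int (card {\<chi>\<in>Xs. fx \<chi> = 1})" "int (2 ^ f) \<le> int (card {\<chi>\<in>Xs. fx \<chi> = -1})"
    unfolding of_nat_power of_nat_numeral using card_Xs_sign rr_ge by linarith+
  then show "card {\<chi>\<in>Xs. fx \<chi> = 1} \<ge> 2 ^ f" "card {\<chi>\<in>Xs. fx \<chi> = -1} \<ge> 2 ^ f" by (simp_all only: of_nat_le_iff)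
qed

subsection \<open>Action on the principal series\<close>

lemma mu_t_mod: "mu_t (j mod (q - 1)) \<chi> = mu_t j \<chi>"
proof -
  have "al (j mod (q - 1)) k = al j k" for k
    unfolding al_def zt_eq by (simp add: mod_mult_left_eq)
  then show ?thesis by (simp add: mu_t_def)
qed

lemma mu_t_cj: assumes c: "\<chi> \<in> Irr SG" shows "mu_t (j * 2 ^ (m * i)) (E.cj i \<chi>) = mu_t j \<chi>"
proof -
  have v: "E.cj i \<chi> x = \<chi> (E.sc i x)" if "x \<in> Sz" for x using that by (simp add: E.cj_def)
  have one: "E.sc i \<one> = \<one>" using sc_u[of i 0 0] by (simp add: power_0_left)
  have mm: "mu_m (E.cj i \<chi>) = mu_m \<chi>" by (simp add: mu_m_def v one sc_u power_0_left)
  have al_fr: "al (j * 2 ^ (m * i)) k = al j (fr i k)" if "k \<noteq> 0" for k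
  proof -
    have "fr i k = gen ^ (dl k * 2 ^ (m * i))" using dl(1)[OF that] by (simp add: power_mult)
    then show ?thesis by (simp add: al_gen) (simp add: al_def mult_ac)
  qed
  have "(\<Sum>k\<in>Tx. E.cj i \<chi> (h k) * al (j * 2 ^ (m * i)) (inverse k)) = (\<Sum>k\<in>Tx. (\<lambda>k. \<chi> (h k) * al j (inverse k)) (fr i k))"
    by (intro sum.cong refl) (simp add: v sc_h al_fr power_inverse)
  also have "\<dots> = (\<Sum>k\<in>Tx. \<chi> (h k) * al j (inverse k))"
  proof (rule sum.reindex_bij_betw)
    have "inj (fr i :: 'k \<Rightarrow> 'k)" using bij_fr by (rule bij_is_inj)
    then have inj: "inj_on (fr i) Tx" by (rule inj_on_subset) simp
    have ne: "fr i k \<noteq> 1" if "k \<noteq> 1" for k :: 'k using frob_inj[of k "m * i" 1] that unfolding power_one by blast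
    have "fr i ` Tx \<subseteq> Tx"
    proof (rule image_subsetI)
      fix k :: 'k assume "k \<in> Tx"
      then have "k \<noteq> 0" "k \<noteq> 1" by auto
      then show "fr i k \<in> Tx" using ne[of k] power_not_zero[of k] by blast
    qed
    then show "bij_betw (fr i) Tx Tx" unfolding bij_betw_def using inj by (intro conjI endo_inj_surj finite)
  qed
  finally show ?thesis by (simp add: mu_t_def mm)
qed

lemma ft_cj: assumes "\<chi> \<in> Irr SG" shows "ft ((j * 2 ^ (m * i)) mod (q - 1)) (E.cj i \<chi>) = ft j \<chi>"
  by (simp only: ft_def mu_t_mod mu_t_cj[OF assms])

text \<open>Invariance makes multiplication by 2^(m * k) fix the index j up to sign modulo q - 1.
  The negative sign is impossible: n / (m * k) is odd, so 2^(m * k) + 1 divides q + 1 and is prime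
  to q - 1.\<close>

lemma principal_fixed:
  assumes j: "0 < j" "j < q - 1" and c: "\<chi> \<in> Irr SG" "ft j \<chi> \<noteq> 0" and k: "k dvd d" "k > 0" and inv: "E.cj k \<chi> = \<chi>"
  shows "(q - 1) dvd j * (2 ^ (m * k) - 1)"
proof -
  let ?j = "(j * 2 ^ (m * k)) mod (q - 1)"
  have q0: "q - 1 > 0" using j by simp
  have fj: "ft ?j \<chi> \<noteq> 0" using ft_cj[OF c(1), of j k] inv c(2) by simp
  have "?j = j \<or> j + ?j = q - 1"
  proof (rule ccontr)
    assume "\<not> (?j = j \<or> j + ?j = q - 1)"
    then have "ft ?j \<chi> = 0" by (intro ft_zero[of j ?j, OF j(2) _ _ _ _ c]) (use q0 j in auto)
    then show False using fj by simp
  qed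
  then show ?thesis
  proof
    assume "?j = j"
    then show ?thesis using mod_q1_iff[of j "m * k"] j by simp
  next
    assume e: "j + ?j = q - 1"
    have "(j * 2 ^ (m * k) + j) mod (q - 1) = (?j + j) mod (q - 1)" by (rule mod_add_left_eq[symmetric])
    also have "\<dots> = 0" unfolding add.commute[of ?j j] e by (rule mod_self)
    finally have dv: "(q - 1) dvd j * (2 ^ (m * k) + 1)" by (simp only: dvd_eq_mod_eq_0 distrib_left mult_1_right)
    obtain c where c: "d = k * c" using k by (auto simp: dvd_def)
    have nc: "n = (m * k) * c" "odd c" using n_md n_odd c by auto
    have "coprime (q - 1) (2 ^ (m * k) + 1)"
    proof (rule coprimeI)
      fix l assume l: "l dvd q - 1" "l dvd 2 ^ (m * k) + (1::nat)"
      have "int l dvd (2 ^ (m * k)) ^ c + 1 ^ c"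
      proof -
        have "(2 ^ (m * k) :: int) + 1 dvd (2 ^ (m * k)) ^ c + 1"
        proof -
          have "(2 ^ (m * k) :: int) - (-1) dvd (2 ^ (m * k)) ^ c - (-1) ^ c" unfolding power_diff_sumr2 by simp
          then show ?thesis using nc(2) by simp
        qed
        moreover have "int l dvd int (2 ^ (m * k) + 1)" using l(2) by (simp only: int_dvd_int_iff)
        then have "int l dvd 2 ^ (m * k) + 1" by (simp only: of_nat_add of_nat_power of_nat_numeral of_nat_1)
        ultimately show ?thesis unfolding power_one by (rule dvd_trans[rotated])
      qed
      then have "int l dvd int q + 1" by (simp add: q_def nc(1) power_mult)
      moreover have "int l dvd int (q - 1)" using l(1) by (simp only: int_dvd_int_iff)
      then have "int l dvd int q - 1" using q_ge by (simp add: of_nat_diff)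
      ultimately have "int l dvd (int q + 1) - (int q - 1)" by (rule dvd_diff)
      then have "l dvd 2" by (simp add: int_dvd_int_iff[symmetric])
      then have "l = 1 \<or> l = 2" using dvd_imp_le[of l 2] by (cases "l = 0") auto
      moreover have "\<not> 2 dvd 2 ^ (m * k) + (1::nat)" using m_pos k by simp
      ultimately show "is_unit l" using l(2) by auto
    qed
    then have "(q - 1) dvd j" using dv by (simp only: coprime_dvd_mult_left_iff)
    then show ?thesis using j dvd_imp_le by auto
  qed
qed

text \<open>Pairs of an invariant non-cuspidal member of \<open>Om\<close> and an index j with
  \<open>ft j\<close> nonzero are counted twice: each member has weight 2, the Steinberg character
  weight 1, and at most 2^(m * k) - 1 indices are admissible, each met by at most one
  member.\<close>

lemma card_fixed_noncuspidal:
  assumes k: "k dvd d" "k > 0"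
  shows "2 * card {\<chi>\<in>Om - Xs. E.cj k \<chi> = \<chi>} \<le> 2 ^ (m * k)"
proof -
  obtain \<xi> where St: "\<xi> \<in> Irr SG" "\<xi> \<noteq> tr" "ft 0 \<xi> = 1" "\<forall>\<zeta>\<in>Irr SG. \<zeta> \<noteq> \<xi> \<longrightarrow> \<zeta> \<noteq> tr \<longrightarrow> ft 0 \<zeta> = 0" using steinberg by blast
  let ?N = "{\<chi>\<in>Om - Xs. E.cj k \<chi> = \<chi>}"
  have fN: "finite ?N" using finite_Om by simp
  let ?J = "{j. j < q - 1 \<and> (q - 1) dvd j * (2 ^ (m * k) - 1)}"
  have mk: "m * k dvd n" "m * k > 0" using k n_md m_pos by auto
  have one: "(\<Sum>\<chi>\<in>?N. ft j \<chi>) \<le> (if j \<in> ?J then 1 else 0)" if j: "j < q - 1" for j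
  proof -
    have "\<exists>\<zeta>. ft j \<zeta> \<le> 1 \<and> (\<forall>\<chi>\<in>?N. \<chi> \<noteq> \<zeta> \<longrightarrow> ft j \<chi> = 0)"
    proof (cases "j = 0")
      case True
      then show ?thesis using St Om_Irr Om_ne_tr by (intro exI[of _ \<xi>]) auto
    next
      case False
      then obtain \<zeta> where "ft j \<zeta> = 1" "\<forall>\<chi>\<in>Irr SG. \<chi> \<noteq> \<zeta> \<longrightarrow> ft j \<chi> = 0" using principal[of j] j by blast
      then show ?thesis using Om_Irr by (intro exI[of _ \<zeta>]) auto
    qed
    then obtain \<zeta> where z: "ft j \<zeta> \<le> 1" "\<forall>\<chi>\<in>?N. \<chi> \<noteq> \<zeta> \<longrightarrow> ft j \<chi> = 0" by blast
    have "(\<Sum>\<chi>\<in>?N. ft j \<chi>) = (\<Sum>\<chi>\<in>?N. if \<chi> = \<zeta> then ft j \<zeta> else 0)" using z(2) by (intro sum.cong refl) auto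
    also have "\<dots> \<le> 1" using z(1) fN by (simp add: sum.delta)
    finally have le: "(\<Sum>\<chi>\<in>?N. ft j \<chi>) \<le> 1" .
    show ?thesis
    proof (cases "j \<in> ?J")
      case False
      then have j0: "0 < j" using j by (auto intro: Nat.gr0I)
      have "ft j \<chi> = 0" if "\<chi> \<in> ?N" for \<chi>
        using principal_fixed[OF j0 j _ _ k, of \<chi>] that Om_Irr False j by auto
      then show ?thesis using False by simp
    qed (use le in simp)
  qed
  have "2 * int (card ?N) - (if \<xi> \<in> ?N then 1 else 0) = (\<Sum>\<chi>\<in>?N. fm \<chi>)"
    by (rule sum_fm_subset[symmetric]) (use St in auto)
  also have "\<dots> = (\<Sum>\<chi>\<in>?N. \<Sum>j<q - 1. ft j \<chi>)" by (intro sum.cong refl fm_sum) (use Om_Irr in auto)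
  also have "\<dots> = (\<Sum>j<q - 1. \<Sum>\<chi>\<in>?N. ft j \<chi>)" by (rule sum.swap)
  also have "\<dots> \<le> (\<Sum>j<q - 1. if j \<in> ?J then 1 else 0)" by (rule sum_mono) (use one in auto)
  also have "\<dots> = int (card ({..<q - 1} \<inter> ?J))" by (subst sum.If_cases) (simp_all only: finite_lessThan Collect_mem_eq, simp)
  also have "{..<q - 1} \<inter> ?J = ?J" by auto
  finally have "2 * int (card ?N) - 1 \<le> int (2 ^ (m * k) - 1)" unfolding card_divisible[OF mk] by (auto split: if_splits)
  moreover have "int (2 ^ (m * k) - 1) = 2 ^ (m * k) - 1" by (simp add: of_nat_diff)
  ultimately have "int (2 * card ?N) \<le> int (2 ^ (m * k))" by simp
  then show ?thesis by (simp only: of_nat_le_iff)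
qed

text \<open>The fixed points in \<open>Om\<close> number 2^(m * k), and at most half of them are
  non-cuspidal.\<close>

lemma card_fixed_Xs:
  assumes k: "k dvd d" "k > 0"
  shows "2 ^ (m * k) \<le> 2 * card {\<chi>\<in>Xs. E.cj k \<chi> = \<chi>}" "card {\<chi>\<in>Xs. E.cj k \<chi> = \<chi>} \<le> 2 ^ (m * k)"
proof -
  have "{\<chi>\<in>Om. E.cj k \<chi> = \<chi>} = {\<chi>\<in>Xs. E.cj k \<chi> = \<chi>} \<union> {\<chi>\<in>Om - Xs. E.cj k \<chi> = \<chi>}" using Xs_Om by auto
  then have "card {\<chi>\<in>Om. E.cj k \<chi> = \<chi>} = card {\<chi>\<in>Xs. E.cj k \<chi> = \<chi>} + card {\<chi>\<in>Om - Xs. E.cj k \<chi> = \<chi>}"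
    using finite_Om finite_Xs by (simp add: card_Un_disjoint disjoint_iff)
  then show "2 ^ (m * k) \<le> 2 * card {\<chi>\<in>Xs. E.cj k \<chi> = \<chi>}" "card {\<chi>\<in>Xs. E.cj k \<chi> = \<chi>} \<le> 2 ^ (m * k)"
    using card_fixed_noncuspidal[OF k] card_fixed_pow[OF k] by simp_all
qed

lemma Xs_invariant: "\<exists>\<chi>\<in>Xs. tt \<chi> = 1"
proof -
  have "(0::nat) < 2 ^ (m * 1)" by simp
  then have "card {\<chi>\<in>Xs. E.cj 1 \<chi> = \<chi>} \<noteq> 0" using card_fixed_Xs(1)[of 1] by (intro notI) simp
  then obtain \<chi> where x: "\<chi> \<in> Xs" "E.cj 1 \<chi> = \<chi>" using card.empty by (metis (mono_tags, lifting) Collect_empty_eq)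
  then have "tt \<chi> dvd 1" using tt(3)[OF Om_Irr[OF Xs_Om]] by blast
  then show ?thesis using x(1) by auto
qed

text \<open>At least half of 2^(m * k) cuspidal members are fixed by the k-th power of s and at most
  2^m by s itself. As d is odd, k is at least 3, so the former number is larger and some member is
  fixed by the power alone.\<close>

lemma Xs_intermediate:
  assumes k: "k dvd d" "1 < k" "k < d"
  shows "\<exists>\<chi>\<in>Xs. 1 < tt \<chi> \<and> tt \<chi> < d"
proof -
  have "odd k" using k(1) d_odd by (auto elim: dvdE)
  then have "k \<noteq> 2" by auto
  then have k3: "3 \<le> k" using k by simp
  have "m * 3 \<le> m * k" using k3 by simp
  then have "m * 1 + 1 < m * k" using m_pos by linarith
  then have "(2::nat) ^ (m * 1 + 1) < 2 ^ (m * k)" by (intro power_strict_increasing) auto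
  then have lt: "card {\<chi>\<in>Xs. E.cj 1 \<chi> = \<chi>} < card {\<chi>\<in>Xs. E.cj k \<chi> = \<chi>}"
    using card_fixed_Xs(1)[of k] card_fixed_Xs(2)[of 1] k by simp
  have "\<not> {\<chi>\<in>Xs. E.cj k \<chi> = \<chi>} \<subseteq> {\<chi>\<in>Xs. E.cj 1 \<chi> = \<chi>}"
  proof
    assume "{\<chi>\<in>Xs. E.cj k \<chi> = \<chi>} \<subseteq> {\<chi>\<in>Xs. E.cj 1 \<chi> = \<chi>}"
    then have "card {\<chi>\<in>Xs. E.cj k \<chi> = \<chi>} \<le> card {\<chi>\<in>Xs. E.cj 1 \<chi> = \<chi>}" using finite_Xs by (intro card_mono) auto
    then show False using lt by simp
  qed
  then obtain \<chi> where x: "\<chi> \<in> Xs" "E.cj k \<chi> = \<chi>" "E.cj 1 \<chi> \<noteq> \<chi>" by auto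
  have c: "\<chi> \<in> Irr SG" using x(1) Om_Irr Xs_Om by blast
  have "tt \<chi> \<noteq> 1" using tt(2)[OF c] x(3) by auto
  moreover have "tt \<chi> \<le> k" using tt(3)[OF c x(2)] k by (auto intro: dvd_imp_le)
  ultimately have "1 < tt \<chi> \<and> tt \<chi> < d" using k tt(1)[OF c] by linarith
  then show ?thesis using x(1) by blast
qed

lemma principal_degree:
  assumes c: "\<chi> \<in> Irr SG" "fa \<chi> = 1" "fb \<chi> = rr" "fc \<chi> = rr" "fm \<chi> = 2"
  shows "\<chi> \<one> = of_int (qi * qi + 1)"
  unfolding degree_int[OF c(1)] c(2-5) of_int_eq_iff by (simp add: algebra_simps)

text \<open>The index 1 works: a shorter orbit would require q - 1 to divide 2^a - 1 for some
  positive a below n.\<close>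

lemma principal_regular: "\<exists>\<chi>\<in>Irr SG. \<chi> \<one> = of_int (qi * qi + 1) \<and> tt \<chi> = d"
proof -
  have j: "0 < (1::nat)" "1 < q - 1" using q_ge by auto
  obtain \<chi> where c: "\<chi> \<in> Irr SG" "ft 1 \<chi> = 1" "fa \<chi> = 1" "fb \<chi> = rr" "fc \<chi> = rr" "fm \<chi> = 2" using principal[OF j] by blast
  have "tt \<chi> = d"
  proof (rule ccontr)
    assume ne: "tt \<chi> \<noteq> d"
    then have lt: "tt \<chi> < d" using tt(4)[OF c(1)] d_gt dvd_imp_le[of "tt \<chi>" d] by simp
    have "(q - 1) dvd 1 * (2 ^ (m * tt \<chi>) - 1)"
      by (rule principal_fixed[OF j c(1) _ tt(4)[OF c(1)] tt(1)[OF c(1)] tt(2)[OF c(1)]]) (use c(2) in simp)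
    moreover have "m * tt \<chi> > 0" using m_pos tt(1)[OF c(1)] by simp
    then have "(2::nat) ^ (m * tt \<chi>) > 1" by (intro one_less_power) auto
    ultimately have "q - 1 \<le> 2 ^ (m * tt \<chi>) - 1" by (intro dvd_imp_le) auto
    moreover have "(2::nat) ^ (m * tt \<chi>) < 2 ^ n" using lt m_pos unfolding n_md by (intro power_strict_increasing) auto
    ultimately show False using \<open>(2::nat) ^ (m * tt \<chi>) > 1\<close> unfolding q_def by linarith
  qed
  then show ?thesis using c(1) principal_degree[OF c(1,3-6)] by blast
qed

lemma principal_intermediate:
  assumes k: "k dvd d" "1 < k" "k < d"
  shows "\<exists>\<chi>\<in>Irr SG. \<chi> \<one> = of_int (qi * qi + 1) \<and> tt \<chi> < d"
proof -
  let ?a = "m * k"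
  have a: "?a dvd n" "?a > 1" 
  proof -
    show "?a dvd n" using k n_md by simp
    have "1 * k \<le> m * k" using m_pos by (intro mult_right_mono) auto
    then show "?a > 1" using k by linarith
  qed
  have p: "(2::nat) ^ ?a \<ge> 2 ^ 2" using a(2) by (intro power_increasing) auto
  have "(2::nat) ^ ?a - 1 dvd q - 1" using a(1) power_sub_1_dvd[of "2 ^ ?a"] by (auto simp: q_def dvd_def[of ?a] power_mult)
  \<comment> \<open>The index D = (q - 1) / (2^a - 1) is fixed under multiplication by 2^a modulo q
    - 1, so its character is invariant under the k-th power of s.\<close>
  then obtain D where D: "q - 1 = (2 ^ ?a - 1) * D" by (auto simp: dvd_def)
  have D0: "0 < D" using D q_ge by (cases D) auto
  have "2 * D \<le> q - 1" unfolding D using p by (intro mult_right_mono) auto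
  then have D1: "D < q - 1" using D0 by simp
  obtain \<chi> where c: "\<chi> \<in> Irr SG" "ft D \<chi> = 1" "\<forall>\<xi>\<in>Irr SG. \<xi> \<noteq> \<chi> \<longrightarrow> ft D \<xi> = 0" "fa \<chi> = 1" "fb \<chi> = rr" "fc \<chi> = rr" "fm \<chi> = 2"
    using principal[OF D0 D1] by blast
  have "(q - 1) dvd D * (2 ^ ?a - 1)" unfolding D by (simp add: mult.commute)
  then have "(D * 2 ^ ?a) mod (q - 1) = D" using mod_q1_iff[of D ?a] D1 by simp
  then have "ft D (E.cj k \<chi>) = 1" using ft_cj[OF c(1), of D k] c(2) by simp
  then have "E.cj k \<chi> = \<chi>" using c(3) E.cj_Irr[OF c(1)] by (metis zero_neq_one)
  then have "tt \<chi> < d" using tt(3)[OF c(1)] k dvd_imp_le[of "tt \<chi>" k] by fastforce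
  then show ?thesis using c(1) principal_degree[OF c(1,4-7)] by blast
qed

lemma steinberg_invariant: "\<exists>\<chi>\<in>Irr SG. \<chi> \<one> = of_int (qi * qi) \<and> tt \<chi> = 1"
proof -
  obtain \<chi> where c: "\<chi> \<in> Irr SG" "\<chi> \<noteq> tr" "ft 0 \<chi> = 1" "fa \<chi> = 1" "fb \<chi> = rr" "fc \<chi> = rr" "fm \<chi> = 1" using steinberg by blast
  have deg: "\<chi> \<one> = of_int (qi * qi)"
    unfolding degree_int[OF c(1)] c(4-7) of_int_eq_iff by (simp add: algebra_simps)
  have one: "E.sc 1 \<one> = \<one>" using sc_u[of 1 0 0] by (simp add: power_0_left)
  have "E.cj 1 \<chi> \<noteq> tr"
  proof
    assume "E.cj 1 \<chi> = tr"
    then have "E.cj 1 \<chi> \<one> = tr \<one>" by simp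
    then have "of_int (qi * qi) = (of_int 1 :: complex)" using deg one by (simp add: E.cj_def tr_def)
    then have "qi * qi = 1" by (simp only: of_int_eq_iff)
    then show False using rr_ge by (simp add: zmult_eq_1_iff)
  qed
  moreover have "ft 0 (E.cj 1 \<chi>) = 1" using ft_cj[OF c(1), of 0 1] c(3) by simp
  ultimately have "E.cj 1 \<chi> = \<chi>" using steinberg_unique[OF E.cj_Irr[OF c(1)] _ _ c(1) _ c(2)] c(3) by simp
  then have "tt \<chi> = 1" using tt(3)[OF c(1), of 1] by simp
  then show ?thesis using c(1) deg by blast
qed

subsection \<open>Counting degrees\<close>

text \<open>The list consists of the trivial degree, the Steinberg degree, one even multiple of q -
  1, and four or, for composite d, six odd degrees that are an orbit length times q^2 + 1 or times a
  cuspidal degree. Parity separates the second and third from all others; what is left is decided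
  modulo r and q - 1.\<close>

theorem card_cd:
  "card (cd G) \<ge> 7 \<and> (\<not> prime d \<longrightarrow> card (cd G) \<ge> 9)"
proof -
  have fin_cd: "finite (cd G)" unfolding cd_def using finite_Irr by (simp add: Setcompr_eq_image)
  let ?Q = "2 * rr * rr - 1"
  define L where "L t z = int t * (?Q * (2 * rr * rr + 1 + 2 * rr * z))" for t z
  define Pr where "Pr t = int t * (2 * rr * rr * (2 * rr * rr) + 1)" for t
  have le: "card X \<le> card (cd G)" if "finite X" "\<And>x. x \<in> X \<Longrightarrow> of_int x \<in> cd G" for X :: "int set"
  proof -
    have "card X = card (of_int ` X :: complex set)" by (rule card_image[symmetric]) (simp add: inj_on_def)
    also have "\<dots> \<le> card (cd G)" using that fin_cd by (intro card_mono) auto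
    finally show ?thesis .
  qed
  have cdI: "of_int (int (tt \<chi>) * D) \<in> cd G" if "\<chi> \<in> Irr SG" "\<chi> \<one> = of_int D" for \<chi> D
    using tt(5)[OF that(1)] that(2) by simp
  have tb: "0 < int (tt \<chi>) \<and> int (tt \<chi>) \<le> int d" if "\<chi> \<in> Irr SG" for \<chi>
    using tt(1,4)[OF that] d_gt by (auto intro: dvd_imp_le)
  have dr: "int d < 2 * rr" 
  proof -
    have "int d < int (2 * 2 ^ f)" using d_less unfolding r_rr by (simp only: of_nat_less_iff)
    then show ?thesis by simp
  qed
  have XL: "of_int (L (tt \<chi>) (fx \<chi>)) \<in> cd G" if "\<chi> \<in> Xs" for \<chi>
    unfolding L_def by (rule cdI[OF Om_Irr[OF Xs_Om[OF that]]]) (use degree_Xs(1)[OF that] in simp)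
  have one: "of_int 1 \<in> cd G"
  proof -
    have "(\<lambda>g\<in>carrier G. 1) \<in> Irr G" using linear_Irr[of "\<lambda>_. 1"] by simp
    moreover have "(1::complex) = (\<lambda>g\<in>carrier G. 1) \<one>" by simp
    ultimately show ?thesis unfolding cd_def by (simp only: of_int_1) blast
  qed
  obtain \<chi>2 where c2: "\<chi>2 \<in> Irr SG" "\<chi>2 \<one> = of_int (qi * qi)" "tt \<chi>2 = 1" using steinberg_invariant by blast
  obtain \<chi>3 e where c3: "\<chi>3 \<in> Irr SG" "e > 0" "\<chi>3 \<one> = of_int (?Q * (rr * e))" using nonreal by blast
  obtain \<chi>4 where c4: "\<chi>4 \<in> Irr SG" "\<chi>4 \<one> = of_int (qi * qi + 1)" "tt \<chi>4 = d" using principal_regular by blast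
  obtain \<chi>5 where c5: "\<chi>5 \<in> Xs" "fx \<chi>5 = 1" "tt \<chi>5 = d" using regular_orbit[OF _ Xs_sign_large(1)] Xs_Om by blast
  obtain \<chi>6 where c6: "\<chi>6 \<in> Xs" "fx \<chi>6 = -1" "tt \<chi>6 = d" using regular_orbit[OF _ Xs_sign_large(2)] Xs_Om by blast
  obtain \<chi>7 where c7: "\<chi>7 \<in> Xs" "tt \<chi>7 = 1" using Xs_invariant by blast
  define E3 where "E3 = int (tt \<chi>3) * (?Q * (rr * e))"
  define S2 where "S2 = 2 * rr * rr * (2 * rr * rr)"
  have ev: "even S2" "even E3" using f_gt by (auto simp: S2_def E3_def)
  have Lodd: "odd (L t z)" if "odd t" for t z using that by (simp add: L_def)
  have Podd: "odd (Pr t)" if "odd t" for t using that by (simp add: Pr_def)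
  have todd: "odd (tt \<chi>)" if "\<chi> \<in> Irr SG" for \<chi> using tt(4)[OF that] d_odd by (auto elim: dvdE)
  have S2E3: "S2 \<noteq> E3" unfolding S2_def E3_def using Suzuki_degree_eq(3)[OF rr_ge, of 1 "int (tt \<chi>3)"] tb[OF c3(1)] dr rr_ge by simp
  have Leq: "L t z = L t' z' \<Longrightarrow> t = t' \<and> z = z'" if "0 < t" "t \<le> d" "0 < t'" "t' \<le> d" for t t' z z'
    unfolding L_def using Suzuki_degree_eq(1)[OF rr_ge, of "int t" "int t'" z z'] that dr by simp
  have PL: "Pr t \<noteq> L t' z'" if "0 < t" "t \<le> d" "0 < t'" "t' \<le> d" for t t' z'
    unfolding L_def Pr_def using Suzuki_degree_eq(2)[OF rr_ge, of "int t" "int t'"] that dr by simp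
  have Pinj: "Pr t = Pr t' \<longleftrightarrow> t = t'" for t t'
  proof -
    have "2 * rr * rr * (2 * rr * rr) + 1 > 0" using rr_ge by (intro add_nonneg_pos) auto
    then show ?thesis unfolding Pr_def mult_cancel_right of_nat_eq_iff by (metis less_irrefl)
  qed
  have P1: "Pr t \<noteq> 1" if "0 < t" for t
  proof -
    have "0 < 2 * rr * rr * (2 * rr * rr)" by simp
    then have "2 \<le> 2 * rr * rr * (2 * rr * rr) + 1" by linarith
    then have "1 * 2 \<le> Pr t" unfolding Pr_def using that by (intro mult_mono) auto
    then show ?thesis by simp
  qed
  have L1: "L t z \<noteq> 1" for t z
  proof
    assume "L t z = 1"
    then have "?Q * (int t * (2 * rr * rr + 1 + 2 * rr * z)) = 1" by (simp only: L_def mult.left_commute)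
    then have "?Q dvd 1" by (metis dvd_triv_left)
    then show False using rr_ge zdvd_imp_le[of ?Q 1] mult_mono[of 4 rr 4 rr] by simp
  qed
  have d1: "0 < d" "1 < d" using d_gt by auto
  let ?A = "{1, S2, E3, Pr d, L d 1, L d (-1), L 1 (fx \<chi>7)}"
  have in_cd: "of_int x \<in> cd G" if "x \<in> ?A" for x
  proof -
    have "of_int S2 \<in> cd G" using cdI[OF c2(1,2)] c2(3) by (simp add: S2_def)
    moreover have "of_int E3 \<in> cd G" unfolding E3_def by (rule cdI[OF c3(1,3)])
    moreover have "of_int (Pr d) \<in> cd G" using cdI[OF c4(1,2)] c4(3) by (simp add: Pr_def)
    ultimately show ?thesis using that one XL[OF c5(1)] XL[OF c6(1)] XL[OF c7(1)] c5 c6 c7 by auto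
  qed
  have eo: "x \<noteq> y" if "even x" "odd y" for x y :: int using that by blast
  have L1o: "odd (L 1 z)" for z by (rule Lodd) simp
  note od = Podd[OF d_odd] Lodd[OF d_odd] L1o odd_one
  note neq = eo[OF ev(1) od(1)] eo[OF ev(1) od(2)] eo[OF ev(1) od(3)] eo[OF ev(1) od(4)]
    eo[OF ev(2) od(1)] eo[OF ev(2) od(2)] eo[OF ev(2) od(3)] eo[OF ev(2) od(4)] P1[OF d1(1)] L1 S2E3
  have d0: "1 \<notin> {S2, E3, Pr d, L d 1, L d (-1), L 1 (fx \<chi>7)}"
    and dS: "S2 \<notin> {E3, Pr d, L d 1, L d (-1), L 1 (fx \<chi>7)}" and dE: "E3 \<notin> {Pr d, L d 1, L d (-1), L 1 (fx \<chi>7)}"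
    by (simp_all only: insert_iff empty_iff neq neq[symmetric] simp_thms)
  have dP: "Pr d \<notin> {L d 1, L d (-1), L 1 (fx \<chi>7)}" using PL[of d d 1] PL[of d d "-1"] PL[of d 1 "fx \<chi>7"] d1 by simp
  have dL: "L d 1 \<notin> {L d (-1), L 1 (fx \<chi>7)}" "L d (-1) \<notin> {L 1 (fx \<chi>7)}"
  proof -
    have "L d 1 \<noteq> L d (-1)" using Leq[of d d 1 "-1"] d1 by (intro notI) simp
    moreover have "L d z \<noteq> L 1 z'" for z z' using Leq[of d 1 z z'] d1 by (intro notI) simp
    ultimately show "L d 1 \<notin> {L d (-1), L 1 (fx \<chi>7)}" "L d (-1) \<notin> {L 1 (fx \<chi>7)}" by blast+
  qed
  have cA: "card ?A = 7" using d0 dS dE dP dL by (simp only: card_insert_disjoint finite_insert finite.emptyI card.empty empty_iff not_False_eq_True)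
  have "card ?A \<le> card (cd G)" by (rule le) (use in_cd in auto)
  then have seven: "card (cd G) \<ge> 7" using cA by simp
  moreover have "card (cd G) \<ge> 9" if np: "\<not> prime d"
  proof -
    obtain k where k: "k dvd d" "1 < k" "k < d"
    proof -
      obtain k where "k dvd d" "k \<noteq> 1" "k \<noteq> d" using np d_gt by (auto simp: prime_nat_iff)
      moreover have "k \<noteq> 0" using calculation(1) d_gt by (intro notI) simp
      ultimately show ?thesis using that[of k] dvd_imp_le[of k d] d_gt by simp
    qed
    \<comment> \<open>Any orbit length below d will do here, as d * (q^2 + 1) is the only other
      degree of this shape in the list; the cuspidal orbit chosen next must avoid length 1 as
      well.\<close>
    obtain \<chi>8 where c8: "\<chi>8 \<in> Irr SG" "\<chi>8 \<one> = of_int (qi * qi + 1)" "tt \<chi>8 < d" using principal_intermediate[OF k] by blast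
    obtain \<chi>9 where c9: "\<chi>9 \<in> Xs" "1 < tt \<chi>9" "tt \<chi>9 < d" using Xs_intermediate[OF k] by blast
    have i9: "\<chi>9 \<in> Irr SG" using c9(1) Om_Irr Xs_Om by blast
    let ?x = "Pr (tt \<chi>8)" and ?y = "L (tt \<chi>9) (fx \<chi>9)"
    have p8: "0 < tt \<chi>8" by (rule tt(1)[OF c8(1)])
    have "of_int ?x \<in> cd G" using cdI[OF c8(1,2)] by (simp add: Pr_def)
    then have in9: "of_int z \<in> cd G" if "z \<in> insert ?x (insert ?y ?A)" for z using that in_cd XL[OF c9(1)] by blast
    have n9: "?y \<notin> ?A"
    proof -
      have "?y \<noteq> S2" "?y \<noteq> E3" using eo[OF ev(1) Lodd[OF todd[OF i9]]] eo[OF ev(2) Lodd[OF todd[OF i9]]] by blast+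
      moreover have "?y \<noteq> Pr d" using PL[of d "tt \<chi>9" "fx \<chi>9"] c9 d1 by simp
      moreover have "?y \<noteq> L d z" for z using Leq[of "tt \<chi>9" d "fx \<chi>9" z] c9 d1 by (intro notI) simp
      moreover have "?y \<noteq> L 1 z" for z using Leq[of "tt \<chi>9" 1 "fx \<chi>9" z] c9 d1 by (intro notI) simp
      ultimately show ?thesis using L1[of "tt \<chi>9" "fx \<chi>9"] by blast
    qed
    have n8: "?x \<notin> insert ?y ?A"
    proof -
      have "?x \<noteq> S2" "?x \<noteq> E3" using eo[OF ev(1) Podd[OF todd[OF c8(1)]]] eo[OF ev(2) Podd[OF todd[OF c8(1)]]] by blast+
      moreover have "?x \<noteq> Pr d" using Pinj c8(3) by simp
      moreover have "?x \<noteq> L d z" "?x \<noteq> L 1 z" "?x \<noteq> ?y" for z using PL[of "tt \<chi>8"] p8 c8(3) c9 d1 by simp_all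
      ultimately show ?thesis using P1[OF p8] by blast
    qed
    have "card (insert ?x (insert ?y ?A)) = Suc (Suc (card ?A))"
      using n8 n9 by (simp only: card_insert_disjoint finite_insert finite.emptyI not_False_eq_True)
    then have "card (insert ?x (insert ?y ?A)) = 9" using cA by simp
    moreover have "card (insert ?x (insert ?y ?A)) \<le> card (cd G)" by (rule le) (use in9 in auto)
    ultimately show ?thesis by simp
  qed
  ultimately show ?thesis by blast
qed

end

section \<open>Automorphisms of the Suzuki group\<close>

context suzuki
begin

text \<open>Automorphisms as plain functions, constrained on \<open>Sz\<close> only, so that
  composition can be written directly; extensionality is added when they become elements of the
  automorphism group.\<close>

definition sa :: "('a \<Rightarrow> 'a) \<Rightarrow> bool" where
  "sa \<gamma> \<longleftrightarrow> bij_betw \<gamma> Sz Sz \<and> (\<forall>x\<in>Sz. \<forall>y\<in>Sz. \<gamma> (x \<otimes> y) = \<gamma> x \<otimes> \<gamma> y)"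

lemma saD:
  assumes "sa \<gamma>"
  shows "x \<in> Sz \<Longrightarrow> \<gamma> x \<in> Sz" "x \<in> Sz \<Longrightarrow> y \<in> Sz \<Longrightarrow> \<gamma> (x \<otimes> y) = \<gamma> x \<otimes> \<gamma> y"
    "x \<in> Sz \<Longrightarrow> y \<in> Sz \<Longrightarrow> \<gamma> x = \<gamma> y \<longleftrightarrow> x = y" "y \<in> Sz \<Longrightarrow> \<exists>x\<in>Sz. y = \<gamma> x"
  using assms unfolding sa_def bij_betw_def inj_on_def by (auto simp: image_def)

lemma sa_one: assumes "sa \<gamma>" shows "\<gamma> \<one> = \<one>"
proof -
  have "\<gamma> \<one> \<otimes> \<gamma> \<one> = \<gamma> \<one> \<otimes> \<one>" using saD(2)[OF assms one_Sz one_Sz] Sz_carrier[OF saD(1)[OF assms one_Sz]] by simp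
  then show ?thesis using Sz_carrier[OF saD(1)[OF assms one_Sz]] by (metis one_closed Units_eq Units_l_cancel)
qed

lemma sa_inv: assumes "sa \<gamma>" "x \<in> Sz" shows "\<gamma> (inv x) = inv (\<gamma> x)"
proof -
  have "\<gamma> (inv x) \<otimes> \<gamma> x = \<one>" using saD(2)[OF assms(1) Sz_inv[OF assms(2)] assms(2)] sa_one[OF assms(1)] Sz_carrier[OF assms(2)] by simp
  then show ?thesis using inv_equality Sz_carrier saD(1)[OF assms(1)] Sz_inv assms(2) by metis
qed

lemma sa_comp: "sa \<gamma> \<Longrightarrow> sa \<delta> \<Longrightarrow> sa (\<lambda>x. \<gamma> (\<delta> x))"
proof -
  assume s: "sa \<gamma>" "sa \<delta>"
  then have "bij_betw (\<lambda>x. \<gamma> (\<delta> x)) Sz Sz" using bij_betw_trans[of \<delta> Sz Sz \<gamma> Sz] by (simp add: sa_def comp_def)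
  then show ?thesis using s saD(1)[OF s(2)] by (simp add: sa_def)
qed

lemma conj_mult: "g \<in> carrier G \<Longrightarrow> x \<in> carrier G \<Longrightarrow> y \<in> carrier G \<Longrightarrow>
    g \<otimes> (x \<otimes> y) \<otimes> inv g = (g \<otimes> x \<otimes> inv g) \<otimes> (g \<otimes> y \<otimes> inv g)"
  by (simp add: m_assoc inv_left)

lemma conj_conj: "g \<in> carrier G \<Longrightarrow> k \<in> carrier G \<Longrightarrow> x \<in> carrier G \<Longrightarrow>
    g \<otimes> (k \<otimes> x \<otimes> inv k) \<otimes> inv g = (g \<otimes> k) \<otimes> x \<otimes> inv (g \<otimes> k)"
  by (simp add: m_assoc inv_mult_group)

lemma conj_inv_conj: "g \<in> carrier G \<Longrightarrow> x \<in> carrier G \<Longrightarrow> inv g \<otimes> (g \<otimes> x \<otimes> inv g) \<otimes> g = x"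
  "g \<in> carrier G \<Longrightarrow> x \<in> carrier G \<Longrightarrow> g \<otimes> (inv g \<otimes> x \<otimes> g) \<otimes> inv g = x"
  by (simp_all add: m_assoc inv_left left_inv)

lemma sa_conj: assumes g: "g \<in> Sz" shows "sa (\<lambda>x. g \<otimes> x \<otimes> inv g)"
  unfolding sa_def
proof (intro conjI ballI)
  have gc: "g \<in> carrier G" by (rule Sz_carrier[OF g])
  show "bij_betw (\<lambda>x. g \<otimes> x \<otimes> inv g) Sz Sz"
    by (rule bij_betw_byWitness[of _ "\<lambda>x. inv g \<otimes> x \<otimes> g"])
      (use g gc Sz_carrier conj_inv_conj in \<open>auto simp: Sz_mult Sz_inv\<close>)
  fix x y assume "x \<in> Sz" "y \<in> Sz"
  then show "g \<otimes> (x \<otimes> y) \<otimes> inv g = (g \<otimes> x \<otimes> inv g) \<otimes> (g \<otimes> y \<otimes> inv g)" using conj_mult gc Sz_carrier by blast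
qed

lemma sa_eq_id:
  assumes s: "sa \<gamma>" and f: "\<And>a b. \<gamma> (u a b) = u a b" "\<And>k. k \<noteq> 0 \<Longrightarrow> \<gamma> (h k) = h k" "\<gamma> w = w" and x: "x \<in> Sz"
  shows "\<gamma> x = x"
proof -
  consider "x \<in> B" | "x \<in> C" using x by (auto simp: Sz_def)
  then show ?thesis
  proof cases
    case 1
    then show ?thesis by (elim BE) (simp add: saD(2)[OF s] f)
  next
    case 2
    then show ?thesis by (elim CE) (simp add: saD(2)[OF s] Sz_mult f)
  qed
qed

lemma conj_inv_swap: "g \<in> carrier G \<Longrightarrow> x \<in> carrier G \<Longrightarrow> y \<in> carrier G \<Longrightarrow> g \<otimes> x \<otimes> inv g = y \<Longrightarrow> x = inv g \<otimes> y \<otimes> g"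
  using conj_inv_conj(1) by metis

text \<open>Squaring forces the outer unipotent factors to be inverse to each other, so y is
  conjugate to h k w. In characteristic 2 the inverse of k is a square, and a torus element then
  carries w to h k w.\<close>

lemma involution_C:
  assumes y: "y \<in> C" and i: "y \<otimes> y = \<one>"
  shows "\<exists>g\<in>Sz. y = g \<otimes> w \<otimes> inv g"
proof -
  obtain a b k c d where k: "k \<noteq> 0" and e: "y = u a b \<otimes> h k \<otimes> w \<otimes> u c d" using y by (rule CE)
  let ?p = "u c d \<otimes> u a b"
  have "y \<otimes> y = (u a b \<otimes> h k) \<otimes> (w \<otimes> ?p \<otimes> w) \<otimes> (h (inverse k) \<otimes> u c d)"
    unfolding e using k by (simp add: m_assoc assoc2(5)[where k = "inverse k"])
  then have "inv (u a b \<otimes> h k) \<otimes> \<one> \<otimes> inv (h (inverse k) \<otimes> u c d) = w \<otimes> ?p \<otimes> w"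
    using i k by (metis cancel_both u_closed h_closed w_closed m_closed nonzero_imp_inverse_nonzero)
  moreover have "inv (u a b \<otimes> h k) \<otimes> \<one> \<otimes> inv (h (inverse k) \<otimes> u c d) \<in> B"
    by (intro B_mult B_inv BI u_B h_B k u_B[of 0 0, unfolded u_0]) (use k in simp)
  ultimately have "w \<otimes> ?p \<otimes> w \<in> B" by simp
  then have p: "?p = \<one>" unfolding u_mult wuw_B by (simp add: u_eq_one)
  obtain l where l: "l * l = inverse k"
  proof -
    have "(inverse k) ^ (2 ^ n) = inverse k" by (rule pow_q)
    moreover have "(2::nat) ^ n = 2 ^ (n - 1) + 2 ^ (n - 1)" using f_gt by (cases n) (auto simp: n_def)
    ultimately show ?thesis using that[of "inverse k ^ 2 ^ (n - 1)"] by (simp only: power_add)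
  qed
  then have l0: "l \<noteq> 0" using k by auto
  have "inverse l * inverse l = k" using l by (metis inverse_inverse_eq inverse_mult_distrib)
  then have hk: "h (inverse l) \<otimes> w \<otimes> h l = h k \<otimes> w" using l0 by (simp add: m_assoc w_h assoc2(5) h_mult) (simp add: m_assoc[symmetric] h_mult)
  let ?g = "u a b \<otimes> h (inverse l)"
  have "inv (u a b) = u c d" using p by (intro inv_equality) auto
  then have "?g \<otimes> w \<otimes> inv ?g = u a b \<otimes> (h (inverse l) \<otimes> w \<otimes> h l) \<otimes> u c d"
    using l0 by (simp add: inv_mult_group inv_h m_assoc)
  also have "\<dots> = y" unfolding hk e using k by (simp add: m_assoc)
  finally show ?thesis using l0 by (intro bexI[of _ ?g]) (auto simp: Sz_mult)
qed

text \<open>An involution in B lies in the centre of P, where the torus acts transitively on the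
  non-trivial elements. The others are conjugate to w; so is w ze w, an involution of the big cell,
  and this links w to \<open>ze\<close>.\<close>

lemma involution_conj:
  assumes y: "y \<in> Sz" and i: "y \<otimes> y = \<one>" and ne: "y \<noteq> \<one>"
  shows "\<exists>g\<in>Sz. y = g \<otimes> ze \<otimes> inv g"
proof (cases "y \<in> B")
  case True
  then obtain a b k where k: "k \<noteq> 0" "y = u a b \<otimes> h k" by (rule BE)
  have yy: "y \<otimes> y = u (a + k * a) (b + k * th k * b + th a * (k * a)) \<otimes> h (k * k)" using k by (simp add: nf)
  have E: "u (a + k * a) (b + k * th k * b + th a * (k * a)) \<otimes> h (k * k) = u 0 0 \<otimes> h 1"
    unfolding yy[symmetric] i by simp
  have "a + k * a = 0 \<and> b + k * th k * b + th a * (k * a) = 0 \<and> k * k = 1" by (rule uh_inj[OF _ _ E]) (use k(1) in simp_all)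
  then have kk: "k * k = 1" and bz: "b + k * th k * b + th a * (k * a) = 0" by blast+
  have "k ^ (2 ^ 1) = 1 ^ (2 ^ 1)" using kk by (simp add: power2_eq_square)
  then have k1: "k = 1" unfolding frob_inj .
  then have "a = 0" using bz by (simp del: add_eq_0)
  moreover have "b \<noteq> 0" using ne k k1 \<open>a = 0\<close> by auto
  ultimately show ?thesis using conj_center[of b] k(2) k1 by simp
next
  case False
  then have yC: "y \<in> C" using y by (simp add: Sz_def)
  let ?v = "w \<otimes> ze \<otimes> w"
  have vC: "?v \<in> C" by (rule wuw) simp
  have "?v \<otimes> ?v = w \<otimes> (ze \<otimes> ze) \<otimes> w" by (simp add: m_assoc inv_left[of w, simplified])
  then have vv: "?v \<otimes> ?v = \<one>" by (simp add: u_mult w_w)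
  obtain g where g: "g \<in> Sz" "y = g \<otimes> w \<otimes> inv g" using involution_C[OF yC i] by blast
  obtain k where k: "k \<in> Sz" "?v = k \<otimes> w \<otimes> inv k" using involution_C[OF vC vv] by blast
  have kc: "k \<in> carrier G" "g \<in> carrier G" using k g Sz_carrier by auto
  have "w = inv k \<otimes> ?v \<otimes> k" by (rule conj_inv_swap[OF kc(1) _ _ k(2)[symmetric]]) simp_all
  then have "w = (inv k \<otimes> w) \<otimes> ze \<otimes> inv (inv k \<otimes> w)" using kc by (simp add: inv_mult_group m_assoc)
  then have "y = g \<otimes> ((inv k \<otimes> w) \<otimes> ze \<otimes> inv (inv k \<otimes> w)) \<otimes> inv g" using g(2) by simp
  also have "\<dots> = (g \<otimes> (inv k \<otimes> w)) \<otimes> ze \<otimes> inv (g \<otimes> (inv k \<otimes> w))" by (rule conj_conj) (use kc in auto)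
  finally show ?thesis using g(1) k(1) by (intro bexI[of _ "g \<otimes> (inv k \<otimes> w)"]) (auto simp: Sz_mult Sz_inv)
qed

lemma centralizer_ze: assumes g: "g \<in> Sz" shows "g \<otimes> ze \<otimes> inv g = ze \<longleftrightarrow> g \<in> P"
proof
  assume e: "g \<otimes> ze \<otimes> inv g = ze"
  have "g \<in> B" by (rule conj_unipotent_B[OF g, of 0 1]) (use e u_B in auto)
  then obtain a b k where k: "k \<noteq> 0" "g = u a b \<otimes> h k" by (rule BE)
  have "u 0 (k * th k) = ze" using e unfolding k(2) conj_u[OF k(1)] by simp
  then have "k = 1" by (simp add: u_inj mult_th_eq_1)
  then show "g \<in> P" using k(2) by simp
next
  assume "g \<in> P"
  then obtain a b where "g = u a b" by (rule PE)
  then show "g \<otimes> ze \<otimes> inv g = ze" using conj_u[of 1 a b 0 1] by simp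
qed

text \<open>P is the centraliser of \<open>ze\<close>, hence respected by an automorphism that fixes
  \<open>ze\<close>. B is then respected as well, because its elements are those that conjugate
  \<open>ze\<close> into P.\<close>

lemma sa_P:
  assumes s: "sa \<gamma>" and z: "\<gamma> ze = ze" and x: "x \<in> Sz"
  shows "\<gamma> x \<in> P \<longleftrightarrow> x \<in> P"
proof -
  have "\<gamma> x \<otimes> ze \<otimes> inv (\<gamma> x) = \<gamma> (x \<otimes> ze \<otimes> inv x)"
    using x z by (simp add: saD(2)[OF s] sa_inv[OF s] Sz_mult Sz_inv)
  also have "\<dots> = ze \<longleftrightarrow> x \<otimes> ze \<otimes> inv x = ze"
    using saD(3)[OF s, of "x \<otimes> ze \<otimes> inv x" ze] x z by (simp add: Sz_mult Sz_inv)
  finally show ?thesis using centralizer_ze x saD(1)[OF s x] by simp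
qed

lemma sa_B:
  assumes s: "sa \<gamma>" and z: "\<gamma> ze = ze" and x: "x \<in> B"
  shows "\<gamma> x \<in> B"
proof -
  have xS: "x \<in> Sz" using x by (simp add: Sz_def)
  obtain a b k where k: "k \<noteq> 0" "x = u a b \<otimes> h k" using x by (rule BE)
  have "x \<otimes> ze \<otimes> inv x \<in> P" unfolding k(2) conj_u[OF k(1)] by simp
  then have "\<gamma> (x \<otimes> ze \<otimes> inv x) \<in> P" using sa_P[OF s z] xS by (simp add: Sz_mult Sz_inv)
  then have "\<gamma> x \<otimes> ze \<otimes> inv (\<gamma> x) \<in> P" using xS z by (simp add: saD(2)[OF s] sa_inv[OF s] Sz_mult Sz_inv)
  then have "\<gamma> x \<otimes> ze \<otimes> inv (\<gamma> x) \<in> B" using u_B by (auto elim: PE)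
  then show ?thesis by (rule conj_unipotent_B[OF saD(1)[OF s xS], rotated]) simp
qed

lemma h_pow: "k \<noteq> 0 \<Longrightarrow> h (k ^ i) = h k [^] (i::nat)"
  by (induction i) (simp_all add: h_mult[symmetric] power_Suc2 del: power_Suc)

lemma sa_pow: assumes "sa \<gamma>" "x \<in> Sz" shows "\<gamma> (x [^] (i::nat)) = \<gamma> x [^] i \<and> x [^] i \<in> Sz"
proof (induction i)
  case 0
  then show ?case using sa_one[OF assms(1)] by simp
next
  case (Suc i)
  then show ?case using assms by (simp add: saD(2)[OF assms(1)] Sz_mult)
qed

lemma gen_ne_1: "gen \<noteq> 1"
proof
  assume g: "gen = 1"
  have "x = 0 \<or> x = 1" for x :: 'k using gen(2)[of x] unfolding g by auto
  then have "(UNIV :: 'k set) \<subseteq> {0, 1}" by auto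
  then have "card (UNIV :: 'k set) \<le> card {0, 1::'k}" by (rule card_mono[rotated]) simp
  also have "\<dots> \<le> 2" by (simp add: card_insert_if)
  finally show False using q_ge card_UNIV_q by simp
qed

text \<open>A generator of the torus is mapped to an element of \<open>B\<close> outside \<open>P\<close>, which \<open>P\<close> conjugates back into the torus.\<close>

lemma sa_torus:
  assumes s: "sa \<gamma>" and z: "\<gamma> ze = ze"
  shows "\<exists>g\<in>P. \<forall>x. x \<noteq> 0 \<longrightarrow> (\<exists>y. y \<noteq> 0 \<and> inv g \<otimes> \<gamma> (h x) \<otimes> g = h y)"
proof -
  have g0: "gen \<noteq> (0::'k)" by (rule gen(1))
  have "\<gamma> (h gen) \<in> B" by (rule sa_B[OF s z h_B[OF g0]])
  then obtain a b k where k: "k \<noteq> 0" and e: "\<gamma> (h gen) = u a b \<otimes> h k" by (rule BE)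
  have "h gen \<notin> P" using u_ne_h[OF g0 gen_ne_1] by (metis PE)
  then have "\<gamma> (h gen) \<notin> P" using sa_P[OF s z] g0 by simp
  then have "k \<noteq> 1" using e by auto
  then obtain c d where cd: "u a b \<otimes> h k = u c d \<otimes> h k \<otimes> inv (u c d)" using conj_semisimple_P[OF k] by blast
  let ?g = "u c d"
  have "inv ?g \<otimes> \<gamma> (h x) \<otimes> ?g = h (k ^ dl)" if x: "x = gen ^ dl" for x dl
  proof -
    have "\<gamma> (h x) = (?g \<otimes> h k \<otimes> inv ?g) [^] dl" unfolding x h_pow[OF g0] using sa_pow[OF s h_Sz[OF g0]] e cd by simp
    also have "\<dots> = ?g \<otimes> h k [^] dl \<otimes> inv ?g"
    proof (induction dl)
      case (Suc i)
      then show ?case using k by (simp add: m_assoc inv_left)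
    qed simp
    finally show ?thesis using k by (simp add: conj_inv_conj h_pow)
  qed
  then have "\<exists>y. y \<noteq> 0 \<and> inv ?g \<otimes> \<gamma> (h x) \<otimes> ?g = h y" if "x \<noteq> 0" for x using gen(2)[OF that] k by (metis power_not_zero)
  then show ?thesis by (intro bexI[of _ ?g]) auto
qed

text \<open>In P the elements of trivial square are exactly those with first coordinate 0.\<close>

lemma sa_Z:
  assumes s: "sa \<gamma>" and z: "\<gamma> ze = ze"
  shows "\<exists>c. \<gamma> (u 0 b) = u 0 c"
proof -
  obtain a c where e: "\<gamma> (u 0 b) = u a c" using sa_P[OF s z, of "u 0 b"] by (auto elim: PE)
  have "\<gamma> (u 0 b \<otimes> u 0 b) = u a c \<otimes> u a c" using e saD(2)[OF s] by simp
  then have "u 0 (th a * a) = \<one>" using sa_one[OF s] by (simp add: u_mult)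
  then have "a = 0" by (simp add: u_eq_one)
  then show ?thesis using e by blast
qed

text \<open>The automorphism acts additively on the centre, by \<open>\<beta>\<close>, and
  multiplicatively on the torus, by \<open>\<kappa>\<close>. The torus acts on the centre through x
  * th x, a multiplicative bijection of the field, so \<open>\<beta>\<close> is multiplicative too:
  a field automorphism, hence a power of the Frobenius map. Injectivity of x * th x transfers this
  to \<open>\<kappa>\<close>.\<close>

lemma sa_frobenius:
  assumes s: "sa \<gamma>" and z: "\<gamma> ze = ze" and t: "\<And>x. x \<noteq> 0 \<Longrightarrow> \<exists>y. y \<noteq> 0 \<and> \<gamma> (h x) = h y"
  shows "\<exists>j<n. (\<forall>b. \<gamma> (u 0 b) = u 0 (b ^ (2 ^ j))) \<and> (\<forall>x. x \<noteq> 0 \<longrightarrow> \<gamma> (h x) = h (x ^ (2 ^ j)))"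
proof -
  obtain \<beta> where \<beta>: "\<And>b. \<gamma> (u 0 b) = u 0 (\<beta> b)" using sa_Z[OF s z] by metis
  obtain \<kappa> where \<kappa>: "\<And>x. x \<noteq> 0 \<Longrightarrow> \<kappa> x \<noteq> 0 \<and> \<gamma> (h x) = h (\<kappa> x)" using t by metis
  let ?m = "\<lambda>x::'k. x * th x"
  have \<beta>_add: "\<beta> (x + y) = \<beta> x + \<beta> y" for x y
    using saD(2)[OF s, of "u 0 x" "u 0 y"] by (simp add: \<beta> u_mult u_inj)
  have \<beta>1: "\<beta> 1 = 1" using z by (simp add: \<beta> u_inj)
  have \<beta>0: "\<beta> 0 = 0" using \<beta>_add[of 0 0] by simp
  have \<kappa>_mult: "\<kappa> (x * y) = \<kappa> x * \<kappa> y" if "x \<noteq> 0" "y \<noteq> 0" for x y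
  proof -
    have "\<gamma> (h x \<otimes> h y) = h (\<kappa> x) \<otimes> h (\<kappa> y)" using saD(2)[OF s] \<kappa> that by simp
    then have "h (\<kappa> (x * y)) = h (\<kappa> x * \<kappa> y)" using \<kappa> that by (simp add: h_mult)
    then show ?thesis using h_inj \<kappa> that by simp
  qed
  have \<beta>m: "\<beta> (?m x) = ?m (\<kappa> x)" if x: "x \<noteq> 0" for x
  proof -
    have "\<gamma> (h x \<otimes> ze) = \<gamma> (u 0 (?m x) \<otimes> h x)" using x by (simp add: h_u)
    then have "h (\<kappa> x) \<otimes> ze = u 0 (\<beta> (?m x)) \<otimes> h (\<kappa> x)" using x z \<kappa> \<beta> by (simp add: saD(2)[OF s])
    then have "u 0 (?m (\<kappa> x)) \<otimes> h (\<kappa> x) = u 0 (\<beta> (?m x)) \<otimes> h (\<kappa> x)" using \<kappa>[OF x] by (simp add: h_u)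
    then show ?thesis using uh_inj \<kappa>[OF x] by metis
  qed
  have \<beta>_mult: "\<beta> (x * y) = \<beta> x * \<beta> y" for x y
  proof (cases "x = 0 \<or> y = 0")
    case True
    then show ?thesis using \<beta>0 by auto
  next
    case False
    obtain x' y' where e: "x = ?m x'" "y = ?m y'" using bij_mult_th unfolding bij_def surj_def by blast
    then have nz: "x' \<noteq> 0" "y' \<noteq> 0" using False by auto
    have "x * y = ?m (x' * y')" unfolding e by simp
    then have "\<beta> (x * y) = ?m (\<kappa> x' * \<kappa> y')" using \<beta>m[of "x' * y'"] \<kappa>_mult nz by simp
    then show ?thesis unfolding e \<beta>m[OF nz(1)] \<beta>m[OF nz(2)] by (simp add: mult_ac)
  qed
  obtain j where j: "j < n" "\<And>x. \<beta> x = x ^ (2 ^ j)" using field_automorphism_frobenius[OF \<beta>_add \<beta>_mult \<beta>1] by blast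
  have "\<kappa> x = x ^ (2 ^ j)" if x: "x \<noteq> 0" for x
  proof -
    have "?m (\<kappa> x) = ?m (x ^ (2 ^ j))" unfolding \<beta>m[OF x, symmetric] j(2) by (simp add: th_frob power_mult_distrib)
    then show ?thesis by (simp only: mult_th_inj)
  qed
  then show ?thesis using j \<beta> \<kappa> by auto
qed

text \<open>On P squares determine the first coordinate, and the discrepancy c in the second is
  additive and homogeneous for the torus action, hence zero. The image of w differs from w by a
  torus element, which the relation for w ze w shows to be trivial.\<close>

lemma sa_rigid:
  assumes s: "sa \<gamma>" and z: "\<And>b. \<gamma> (u 0 b) = u 0 b" and t: "\<And>x. x \<noteq> 0 \<Longrightarrow> \<gamma> (h x) = h x" and x: "x \<in> Sz"
  shows "\<gamma> x = x"
proof (rule sa_eq_id[OF s _ t _ x])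
  have zz: "\<gamma> ze = ze" by (rule z)
  have "\<exists>A c. \<gamma> (u a 0) = u A c" for a
  proof -
    have "\<gamma> (u a 0) \<in> P" using sa_P[OF s zz, of "u a 0"] by simp
    then show ?thesis by (rule PE) blast
  qed
  then obtain A c where Ac: "\<And>a. \<gamma> (u a 0) = u (A a) (c a)" by metis
  have A: "A a = a" for a
  proof -
    have "\<gamma> (u a 0 \<otimes> u a 0) = u (A a) (c a) \<otimes> u (A a) (c a)" using Ac saD(2)[OF s] by simp
    then have "u 0 (th a * a) = u 0 (th (A a) * A a)" using z by (simp add: u_mult)
    then have "A a * th (A a) = a * th a" by (simp add: u_inj mult.commute)
    then show ?thesis by (simp only: mult_th_inj)
  qed
  have c_add: "c (a + b) = c a + c b" for a b
  proof -
    have "\<gamma> (u a 0 \<otimes> u b 0) = u a (c a) \<otimes> u b (c b)" using Ac A saD(2)[OF s] by simp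
    moreover have "u a 0 \<otimes> u b 0 = u (a + b) 0 \<otimes> u 0 (th a * b)" by (simp add: u_mult)
    ultimately have "u (a + b) (c (a + b)) \<otimes> u 0 (th a * b) = u a (c a) \<otimes> u b (c b)" using Ac A saD(2)[OF s] z by simp
    then show ?thesis by (simp add: u_mult u_inj)
  qed
  have c_m: "c k = k * th k * c 1" if k: "k \<noteq> 0" for k
  proof -
    have "\<gamma> (h k \<otimes> u 1 0) = \<gamma> (u k 0 \<otimes> h k)" using k by (simp add: h_u)
    then have "h k \<otimes> u 1 (c 1) = u k (c k) \<otimes> h k" using k Ac A t by (simp add: saD(2)[OF s])
    then have "u k (k * th k * c 1) \<otimes> h k = u k (c k) \<otimes> h k" using k by (simp add: h_u)
    then show ?thesis using uh_inj[OF k k] by metis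
  qed
  \<comment> \<open>Homogeneity at 1 + gen against additivity gives (gen + th gen) * c 1 = 0, and x
    + th x vanishes only at 0 and 1.\<close>
  have "c 1 = 0"
  proof -
    have g: "gen \<noteq> (0::'k)" "gen \<noteq> (1::'k)" "1 + gen \<noteq> (0::'k)" using gen(1) gen_ne_1 by auto
    have "(1 + gen) * th (1 + gen) * c 1 = c 1 + gen * th gen * c 1" using c_m[OF g(3)] c_m[OF g(1)] c_add[of 1 gen] by simp
    then have "(gen + th gen) * c 1 = 0" by (simp add: distrib_left distrib_right add_eq_iff add_ac)
    moreover have "gen + th gen \<noteq> 0 + th 0" unfolding add_th_eq using g by simp
    ultimately show ?thesis by (simp del: add_eq_0)
  qed
  then have "c a = 0" for a using c_m[of a] c_add[of 0 0] by (cases "a = 0") simp_all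
  then have u0: "\<gamma> (u a 0) = u a 0" for a using Ac A by simp
  show ua: "\<gamma> (u a b) = u a b" for a b
    using saD(2)[OF s, of "u a 0" "u 0 b"] u0 z by (simp add: u_mult)
  let ?w = "\<gamma> w"
  have wS: "?w \<in> Sz" by (rule saD(1)[OF s w_Sz])
  have wc: "?w \<in> carrier G" by (rule Sz_carrier[OF wS])
  have ww: "?w \<otimes> ?w = \<one>" using saD(2)[OF s w_Sz w_Sz] sa_one[OF s] by (simp add: w_w)
  have wi: "inv ?w = ?w" using ww wc by (intro inv_equality)
  have wh: "?w \<otimes> h k = h (inverse k) \<otimes> ?w" if k: "k \<noteq> 0" for k
    using saD(2)[OF s w_Sz h_Sz[OF k]] saD(2)[OF s h_Sz w_Sz, of "inverse k"] k t by (simp add: w_h)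
  have g: "gen \<noteq> (0::'k)" "gen \<noteq> (1::'k)" "inverse gen \<noteq> (0::'k)" using gen(1) gen_ne_1 by auto
  \<comment> \<open>Both w and its image invert the torus, so their product centralises it and must
    lie in it.\<close>
  have "(?w \<otimes> w) \<otimes> h gen = h gen \<otimes> (?w \<otimes> w)"
  proof -
    have "(?w \<otimes> w) \<otimes> h gen = (?w \<otimes> h (inverse gen)) \<otimes> w" using wc g by (simp add: m_assoc w_h)
    then show ?thesis using wc g by (simp add: wh m_assoc)
  qed
  then have "(?w \<otimes> w) \<otimes> h gen \<otimes> inv (?w \<otimes> w) = h gen" using wc g by (intro conj_eqI) auto
  then obtain i where i: "i \<noteq> 0" "?w \<otimes> w = h i \<or> (?w \<otimes> w = h i \<otimes> w \<and> inverse gen = gen)"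
    using conj_h_B[OF Sz_mult[OF wS w_Sz] g(1,2,1)] by blast
  have "inverse gen \<noteq> gen"
  proof
    assume "inverse gen = gen"
    then have "gen ^ (2 ^ 1) = 1 ^ (2 ^ 1)" using g(1) by (metis power2_eq_square power_one power_one_right right_inverse)
    then show False using g(2) unfolding frob_inj by simp
  qed
  then have "?w \<otimes> w = h i" using i(2) by blast
  then have "?w \<otimes> w \<otimes> w = h i \<otimes> w" by simp
  then have we: "?w = h i \<otimes> w" using wc by (simp add: m_assoc w_w)
  obtain a' b' k a'' b'' where r: "k \<noteq> 0" "w \<otimes> ze \<otimes> w = u a' b' \<otimes> h k \<otimes> w \<otimes> u a'' b''" using rel[of 0 1] by auto
  have "?w \<otimes> ze \<otimes> ?w = u a' b' \<otimes> h k \<otimes> ?w \<otimes> u a'' b''"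
    using arg_cong[OF r(2), of \<gamma>] r(1) by (simp add: saD(2)[OF s] Sz_mult ua t)
  moreover have "?w \<otimes> ze \<otimes> ?w = h i \<otimes> (w \<otimes> ze \<otimes> w) \<otimes> h (inverse i)"
    using i(1) by (simp add: we m_assoc) (simp add: w_h)
  ultimately have e: "h i \<otimes> (u a' b' \<otimes> h k \<otimes> w \<otimes> u a'' b'') \<otimes> h (inverse i) = u a' b' \<otimes> h k \<otimes> (h i \<otimes> w) \<otimes> u a'' b''"
    using r(2) we by simp
  have ii: "inverse i \<noteq> 0" "i * k * i \<noteq> 0" "k * i \<noteq> 0" using i r by auto
  have "h i \<otimes> (u a' b' \<otimes> h k \<otimes> w \<otimes> u a'' b'') \<otimes> h (inverse i) = (h i \<otimes> u a' b') \<otimes> (h k \<otimes> w) \<otimes> (u a'' b'' \<otimes> h (inverse i))"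
    using i(1) r(1) by (simp add: m_assoc)
  also have "\<dots> = u (i * a') (i * th i * b') \<otimes> (h i \<otimes> h k \<otimes> (w \<otimes> h (inverse i))) \<otimes> u (a'' / inverse i) (b'' / (inverse i * th (inverse i)))"
    unfolding h_u[OF i(1)] u_h_swap[OF ii(1)] using i(1) r(1) by (simp add: m_assoc)
  also have "h i \<otimes> h k \<otimes> (w \<otimes> h (inverse i)) = h (i * k * i) \<otimes> w"
    using i(1) r(1) by (simp add: w_h m_assoc[symmetric] h_mult)
  also have "u (i * a') (i * th i * b') \<otimes> (h (i * k * i) \<otimes> w) \<otimes> u (a'' / inverse i) (b'' / (inverse i * th (inverse i))) =
    u (i * a') (i * th i * b') \<otimes> h (i * k * i) \<otimes> w \<otimes> u (a'' / inverse i) (b'' / (inverse i * th (inverse i)))"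
    using ii by (simp add: m_assoc)
  finally have "u (i * a') (i * th i * b') \<otimes> h (i * k * i) \<otimes> w \<otimes> u (a'' / inverse i) (b'' / (inverse i * th (inverse i))) =
    u a' b' \<otimes> h (k * i) \<otimes> w \<otimes> u a'' b''" unfolding e using i(1) r(1) by (simp add: m_assoc h_mult[symmetric])
  \<comment> \<open>The torus coordinate in the big cell is unique; on the left i enters from both
    sides because w inverts the torus.\<close>
  then have "i * k * i = k * i" using C_inj[OF ii(2,3)] by blast
  then have "i = 1" using i(1) r(1) by simp
  then show "\<gamma> w = w" using we by simp
qed

end

section \<open>Factorisation of automorphisms into inner and field automorphisms\<close>

locale suzuki_frob = suzuki G f F u h w
  for G (structure) and f and F :: "'k::{field,finite} itself" and u h w +
  fixes \<Phi> :: "'a \<Rightarrow> 'a"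
  assumes \<Phi>_mult: "x \<in> Sz \<Longrightarrow> y \<in> Sz \<Longrightarrow> \<Phi> (x \<otimes> y) = \<Phi> x \<otimes> \<Phi> y"
    and \<Phi>_u: "\<Phi> (u a b) = u (a\<^sup>2) (b\<^sup>2)" and \<Phi>_h: "k \<noteq> 0 \<Longrightarrow> \<Phi> (h k) = h (k\<^sup>2)" and \<Phi>_w: "\<Phi> w = w"
begin

definition "Fr j = \<Phi> ^^ j"

lemma Fr_mult: "x \<in> Sz \<Longrightarrow> y \<in> Sz \<Longrightarrow> Fr j (x \<otimes> y) = Fr j x \<otimes> Fr j y"
  and Fr_closed: "x \<in> Sz \<Longrightarrow> Fr j x \<in> Sz"
  and Fr_u: "Fr j (u a b) = u (a ^ (2 ^ j)) (b ^ (2 ^ j))"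
  and Fr_h: "k \<noteq> 0 \<Longrightarrow> Fr j (h k) = h (k ^ (2 ^ j))"
  and Fr_w: "Fr j w = w"
proof -
  have c1: "\<Phi> x \<in> Sz" if x: "x \<in> Sz" for x
  proof -
    consider "x \<in> B" | "x \<in> C" using x by (auto simp: Sz_def)
    then show ?thesis
    proof cases
      case 1
      then show ?thesis by (elim BE) (simp add: \<Phi>_mult \<Phi>_u \<Phi>_h Sz_mult)
    next
      case 2
      then show ?thesis by (elim CE) (simp add: \<Phi>_mult \<Phi>_u \<Phi>_h \<Phi>_w Sz_mult)
    qed
  qed
  show c: "Fr j x \<in> Sz" if "x \<in> Sz" for x j using that by (induction j) (simp_all add: Fr_def c1)
  show "Fr j (x \<otimes> y) = Fr j x \<otimes> Fr j y" if "x \<in> Sz" "y \<in> Sz"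
    by (induction j) (use c[unfolded Fr_def] that in \<open>simp_all add: Fr_def \<Phi>_mult\<close>)
  have p: "(x ^ (2 ^ j))\<^sup>2 = x ^ (2 ^ Suc j)" for x :: 'k and j by (simp add: power_mult[symmetric] mult.commute)
  show "Fr j (u a b) = u (a ^ (2 ^ j)) (b ^ (2 ^ j))" by (induction j) (simp_all add: Fr_def \<Phi>_u p del: power_Suc)
  show "Fr j (h k) = h (k ^ (2 ^ j))" if "k \<noteq> 0" by (induction j) (simp_all add: Fr_def \<Phi>_h p that del: power_Suc)
  show "Fr j w = w" by (induction j) (simp_all add: Fr_def \<Phi>_w)
qed

lemma Fr_add: "Fr (i + j) x = Fr i (Fr j x)" by (simp add: Fr_def funpow_add)

lemma Fr_n: assumes x: "x \<in> Sz" shows "Fr n x = x"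
proof -
  consider "x \<in> B" | "x \<in> C" using x by (auto simp: Sz_def)
  then show ?thesis
  proof cases
    case 1
    then show ?thesis by (elim BE) (simp add: Fr_mult Fr_u Fr_h pow_q)
  next
    case 2
    then show ?thesis by (elim CE) (simp add: Fr_mult Fr_u Fr_h Fr_w pow_q Sz_mult)
  qed
qed

lemma Fr_mult_n: assumes "x \<in> Sz" shows "Fr (n * i) x = x"
  by (induction i) (simp_all add: Fr_add Fr_n assms, simp add: Fr_def)

text \<open>The n-th power of the Frobenius map is trivial, so the exponent n * j - j serves as
  minus j within the natural numbers.\<close>

lemma Fr_inverse: assumes "x \<in> Sz" shows "Fr j (Fr (n * j - j) x) = x" "Fr (n * j - j) (Fr j x) = x"
proof -
  have e: "j + (n * j - j) = n * j" "n * j - j + j = n * j" by (simp_all add: n_def)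
  then show "Fr j (Fr (n * j - j) x) = x" "Fr (n * j - j) (Fr j x) = x"
    unfolding Fr_add[symmetric] e using Fr_mult_n[OF assms] by blast+
qed

lemma sa_Fr: "sa (Fr j)"
  unfolding sa_def
proof (intro conjI ballI)
  show "bij_betw (Fr j) Sz Sz"
    by (rule bij_betw_byWitness[of _ "Fr (n * j - j)"]) (auto simp: Fr_inverse Fr_closed)
qed (simp add: Fr_mult)

text \<open>Inner corrections come first: one moves the image of \<open>ze\<close> back to
  \<open>ze\<close>, as all involutions are conjugate, and an element of P moves the image of the
  torus back into the torus. What remains acts on centre and torus as a Frobenius power, and
  cancelling that power leaves a rigid automorphism.\<close>

theorem automorphism:
  assumes s: "sa \<gamma>"
  shows "\<exists>g\<in>Sz. \<exists>j<n. \<forall>x\<in>Sz. \<gamma> x = g \<otimes> Fr j x \<otimes> inv g"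
proof -
  have zS: "\<gamma> ze \<in> Sz" by (rule saD(1)[OF s u_Sz])
  have "\<gamma> ze \<otimes> \<gamma> ze = \<one>" using saD(2)[OF s, of ze ze] sa_one[OF s] by (simp add: u_mult)
  moreover have "\<gamma> ze \<noteq> \<one>" using saD(3)[OF s u_Sz one_Sz, of 0 1] sa_one[OF s] by (simp add: u_eq_one)
  ultimately obtain g where g: "g \<in> Sz" "\<gamma> ze = g \<otimes> ze \<otimes> inv g" using involution_conj[OF zS] by blast
  have gi: "inv g \<in> Sz" by (rule Sz_inv[OF g(1)])
  have gc: "g \<in> carrier G" by (rule Sz_carrier[OF g(1)])
  define \<gamma>1 where "\<gamma>1 x = inv g \<otimes> \<gamma> x \<otimes> g" for x
  have s1: "sa \<gamma>1" using sa_comp[OF sa_conj[OF gi] s] gc unfolding \<gamma>1_def by simp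
  have z1: "\<gamma>1 ze = ze" unfolding \<gamma>1_def g(2) using gc by (simp add: conj_inv_conj)
  obtain p where p: "p \<in> P" "\<And>x. x \<noteq> 0 \<Longrightarrow> \<exists>y. y \<noteq> 0 \<and> inv p \<otimes> \<gamma>1 (h x) \<otimes> p = h y" using sa_torus[OF s1 z1] by blast
  have pS: "p \<in> Sz" using p(1) P_subset by blast
  have pi: "inv p \<in> Sz" by (rule Sz_inv[OF pS])
  have pc: "p \<in> carrier G" by (rule Sz_carrier[OF pS])
  define \<gamma>2 where "\<gamma>2 x = inv p \<otimes> \<gamma>1 x \<otimes> p" for x
  have s2: "sa \<gamma>2" using sa_comp[OF sa_conj[OF pi] s1] pc unfolding \<gamma>2_def by simp
  have z2: "\<gamma>2 ze = ze" unfolding \<gamma>2_def z1 using centralizer_ze[OF pi] P_inv[OF p(1)] pc by simp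
  obtain j where j: "j < n" "\<And>b. \<gamma>2 (u 0 b) = u 0 (b ^ (2 ^ j))" "\<And>x. x \<noteq> 0 \<Longrightarrow> \<gamma>2 (h x) = h (x ^ (2 ^ j))"
    using sa_frobenius[OF s2 z2] p(2) unfolding \<gamma>2_def by blast
  let ?i = "n * j - j"
  have s3: "sa (\<lambda>x. Fr ?i (\<gamma>2 x))" by (rule sa_comp[OF sa_Fr s2])
  have id: "Fr ?i (\<gamma>2 x) = x" if x: "x \<in> Sz" for x
  proof (rule sa_rigid[OF s3 _ _ x])
    show "Fr ?i (\<gamma>2 (u 0 b)) = u 0 b" for b
      using Fr_inverse(2)[of "u 0 b" j] Fr_u[of j 0 b] j(2)[of b] by (simp add: power_0_left)
    show "Fr ?i (\<gamma>2 (h k)) = h k" if "k \<noteq> 0" for k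
      using Fr_inverse(2)[of "h k" j] Fr_h[OF that, of j] j(3)[OF that] that by simp
  qed
  have e2: "\<gamma>2 x = Fr j x" if x: "x \<in> Sz" for x using Fr_inverse(1)[OF saD(1)[OF s2 x], of j] id[OF x] by simp
  have "\<gamma> x = (g \<otimes> p) \<otimes> Fr j x \<otimes> inv (g \<otimes> p)" if x: "x \<in> Sz" for x
  proof -
    have c: "\<gamma> x \<in> carrier G" "\<gamma>1 x \<in> carrier G" "Fr j x \<in> carrier G" using Sz_carrier saD(1) s s1 x Fr_closed by auto
    have "\<gamma>1 x = p \<otimes> Fr j x \<otimes> inv p" using conj_inv_conj(2)[OF pc c(2)] e2[OF x] unfolding \<gamma>2_def by simp
    moreover have "\<gamma> x = g \<otimes> \<gamma>1 x \<otimes> inv g" using conj_inv_conj(2)[OF gc c(1)] unfolding \<gamma>1_def by simp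
    ultimately show ?thesis using conj_conj[OF gc pc c(3)] by simp
  qed
  then show ?thesis using j(1) Sz_mult[OF g(1) pS] by blast
qed

text \<open>An inner automorphism of field type fixes \<open>ze\<close>, so it is induced by an element of \<open>P\<close>, which acts trivially on \<open>B\<close> modulo \<open>P\<close>.\<close>

lemma inner_Fr:
  assumes g: "g \<in> Sz" and e: "\<And>x. x \<in> Sz \<Longrightarrow> g \<otimes> x \<otimes> inv g = Fr j x" and j: "j < n"
  shows "j = 0" "g = \<one>"
proof -
  have "g \<otimes> ze \<otimes> inv g = ze" using e[of ze] by (simp add: Fr_u power_0_left)
  then have "g \<in> P" using centralizer_ze[OF g] by simp
  then obtain a b where ab: "g = u a b" by (rule PE)
  have g0: "gen \<noteq> (0::'k)" by (rule gen(1))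
  have E: "u (a + gen * a) (b + gen * th gen * (b + a * th a) + th a * (gen * a)) \<otimes> h gen = u 0 0 \<otimes> h (gen ^ (2 ^ j))"
    using e[OF h_Sz[OF g0]] conj_h[of 1 gen a b] g0 unfolding ab by (simp add: Fr_h)
  have "a + gen * a = 0 \<and> b + gen * th gen * (b + a * th a) + th a * (gen * a) = 0 \<and> gen = gen ^ (2 ^ j)"
    by (rule uh_inj[OF _ _ E]) (use g0 in simp_all)
  then have z: "a + gen * a = 0" "b + gen * th gen * (b + a * th a) + th a * (gen * a) = 0" "gen = gen ^ (2 ^ j)" by blast+
  have "(1 + gen) * a = 0" using z(1) by (simp only: distrib_right mult_1)
  then have a: "a = 0" using gen_ne_1 by auto
  have "(1 + gen * th gen) * b = 0" using z(2) unfolding a by (simp add: distrib_right del: add_eq_0)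
  then have "b = 0" using mult_th_eq_1[of gen] gen_ne_1 by auto
  then show "g = \<one>" using ab a by simp
  have "gen ^ 1 = gen ^ (2 ^ j)" using z(3) by simp
  then have "1 mod (q - 1) = 2 ^ j mod (q - 1)" unfolding gen_eq .
  moreover have "(2::nat) ^ j < q - 1"
  proof -
    have "(2::nat) ^ j \<le> 2 ^ (n - 1)" using j by (intro power_increasing) auto
    moreover have "2 * 2 ^ (n - 1) = q" using j unfolding q_def by (cases n) auto
    ultimately show ?thesis using q_ge by linarith
  qed
  moreover have "1 < q - 1" using q_ge by linarith
  ultimately have "(2::nat) ^ j = 1" by (simp only: mod_less)
  then show "j = 0" by simp
qed

end

section \<open>Groups between the inner automorphisms and the full automorphism group\<close>

context suzuki
begin

definition IA :: "'a \<Rightarrow> 'a \<Rightarrow> 'a" where "IA g = (\<lambda>x\<in>Sz. g \<otimes> x \<otimes> inv g)"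

lemma Inn_IA: "Inn SG = IA ` Sz"
proof -
  have e: "(\<lambda>x\<in>carrier SG. g \<otimes>\<^bsub>SG\<^esub> x \<otimes>\<^bsub>SG\<^esub> inv\<^bsub>SG\<^esub> g) = IA g" if "g \<in> Sz" for g
    unfolding IA_def using that by (simp add: inv_SG)
  have "Inn SG = (\<lambda>g. \<lambda>x\<in>carrier SG. g \<otimes>\<^bsub>SG\<^esub> x \<otimes>\<^bsub>SG\<^esub> inv\<^bsub>SG\<^esub> g) ` Sz"
    unfolding Inn_def by (simp add: Setcompr_eq_image)
  also have "\<dots> = IA ` Sz" by (rule image_cong[OF refl e])
  finally show ?thesis .
qed

lemma auto_iff: "\<gamma> \<in> auto SG \<longleftrightarrow> \<gamma> \<in> extensional Sz \<and> sa \<gamma>"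
  unfolding auto_def Bij_def hom_def sa_def bij_betw_def by auto

lemma AutoGroup_mult:
  assumes "\<gamma> \<in> auto SG" "\<delta> \<in> auto SG"
  shows "\<gamma> \<otimes>\<^bsub>AutoGroup SG\<^esub> \<delta> = (\<lambda>x\<in>Sz. \<gamma> (\<delta> x))"
  using assms by (simp add: AutoGroup_def BijGroup_def auto_def compose_def)

end

locale suzuki_aut = suzuki_frob G f F u h w \<Phi>
  for G (structure) and f and F :: "'k::{field,finite} itself" and u h w \<Phi> +
  fixes GG
  assumes GG: "subgroup GG (AutoGroup SG)" and Inn_GG: "Inn SG \<subset> GG"
begin

definition "K = AutoGroup SG\<lparr>carrier := GG\<rparr>"

lemma K_simps: "carrier K = GG" "\<one>\<^bsub>K\<^esub> = (\<lambda>x\<in>Sz. x)"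
  by (simp_all add: K_def AutoGroup_def BijGroup_def)

lemma GG_auto: "\<gamma> \<in> GG \<Longrightarrow> \<gamma> \<in> auto SG"
  using subgroup.subset[OF GG] by (auto simp: AutoGroup_def)

lemma GG_sa: "\<gamma> \<in> GG \<Longrightarrow> sa \<gamma>" using GG_auto auto_iff by blast

lemma K_mult: "\<gamma> \<in> GG \<Longrightarrow> \<delta> \<in> GG \<Longrightarrow> \<gamma> \<otimes>\<^bsub>K\<^esub> \<delta> = (\<lambda>x\<in>Sz. \<gamma> (\<delta> x))"
  using AutoGroup_mult GG_auto by (simp add: K_def)

lemma GG_eqI: "\<gamma> \<in> GG \<Longrightarrow> \<delta> \<in> GG \<Longrightarrow> (\<And>x. x \<in> Sz \<Longrightarrow> \<gamma> x = \<delta> x) \<Longrightarrow> \<gamma> = \<delta>"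
  using GG_auto auto_iff by (intro extensionalityI[of _ Sz]) auto

lemma K_group: "group K"
  unfolding K_def by (rule subgroup.subgroup_is_group[OF GG]) (rule SG.AutoGroup)

sublocale K: fin_group K
proof (intro fin_group.intro K_group fin_group_axioms.intro)
  have "finite Sz" using SG.fin by simp
  then have "finite (Sz \<rightarrow>\<^sub>E Sz)" by (rule finite_PiE) (rule \<open>finite Sz\<close>)
  moreover have "GG \<subseteq> Sz \<rightarrow>\<^sub>E Sz" 
  proof
    fix \<gamma> assume "\<gamma> \<in> GG"
    then have "\<gamma> \<in> extensional Sz" "sa \<gamma>" using GG_auto auto_iff by blast+
    then show "\<gamma> \<in> Sz \<rightarrow>\<^sub>E Sz" unfolding PiE_def using saD(1) by blast
  qed
  ultimately show "finite (carrier K)" unfolding K_simps by (rule rev_finite_subset)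
qed

lemma IA_GG: "g \<in> Sz \<Longrightarrow> IA g \<in> GG" using Inn_GG unfolding Inn_IA by blast

lemma IA_apply: "x \<in> Sz \<Longrightarrow> IA g x = g \<otimes> x \<otimes> inv g" by (simp add: IA_def)

lemma IA_mult: assumes g: "g \<in> Sz" "k \<in> Sz" shows "IA g \<otimes>\<^bsub>K\<^esub> IA k = IA (g \<otimes> k)"
  unfolding K_mult[OF IA_GG[OF g(1)] IA_GG[OF g(2)]] unfolding IA_def
  by (rule restrict_ext) (use g in \<open>simp add: conj_conj Sz_carrier Sz_mult Sz_inv\<close>)

lemma IA_one: "IA \<one> = \<one>\<^bsub>K\<^esub>"
  unfolding K_simps IA_def by (rule restrict_ext) (simp add: Sz_carrier)

lemma n_pos: "0 < n" by (simp add: n_def)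

lemma IA_inj: assumes g: "g \<in> Sz" "k \<in> Sz" and e: "IA g = IA k" shows "g = k"
proof -
  have c: "g \<in> carrier G" "k \<in> carrier G" using g Sz_carrier by auto
  have "inv k \<otimes> g = \<one>"
  proof (rule inner_Fr(2)[OF Sz_mult[OF Sz_inv[OF g(2)] g(1)] _ n_pos])
    fix x assume x: "x \<in> Sz"
    have xc: "x \<in> carrier G" by (rule Sz_carrier[OF x])
    have "g \<otimes> x \<otimes> inv g = k \<otimes> x \<otimes> inv k" using fun_cong[OF e, of x] x by (simp add: IA_apply)
    then have "inv k \<otimes> (g \<otimes> x \<otimes> inv g) \<otimes> k = x" using conj_inv_conj(1)[OF c(2) xc] by simp
    then show "(inv k \<otimes> g) \<otimes> x \<otimes> inv (inv k \<otimes> g) = Fr 0 x" using c xc by (simp add: inv_mult_group m_assoc Fr_def)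
  qed
  then have "k \<otimes> (inv k \<otimes> g) = k \<otimes> \<one>" by simp
  then show ?thesis using c by (simp add: left_inv)
qed

definition FA :: "nat \<Rightarrow> 'a \<Rightarrow> 'a" where "FA j = (\<lambda>x\<in>Sz. Fr j x)"

lemma FA_apply: "x \<in> Sz \<Longrightarrow> FA j x = Fr j x" by (simp add: FA_def)

lemma FA_mult: "FA i \<in> GG \<Longrightarrow> FA j \<in> GG \<Longrightarrow> FA i \<otimes>\<^bsub>K\<^esub> FA j = FA (i + j)"
  unfolding K_mult unfolding FA_def by (rule restrict_ext) (simp add: Fr_closed Fr_add)

lemma FA_add: "FA i \<in> GG \<Longrightarrow> FA j \<in> GG \<Longrightarrow> FA (i + j) \<in> GG"
  using FA_mult[of i j] K.m_closed[of "FA i" "FA j"] by (simp add: K_simps)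

lemma FA_multiple_n: "FA (n * i) = \<one>\<^bsub>K\<^esub>"
  unfolding K_simps FA_def by (rule restrict_ext) (rule Fr_mult_n)

lemma FA_add_n: "FA (i + n * j) = FA i"
  unfolding FA_def by (rule restrict_ext) (simp add: Fr_add Fr_mult_n)

lemma FA_mult_closed: "FA j \<in> GG \<Longrightarrow> FA (j * c) \<in> GG"
proof (induction c)
  case 0
  then show ?case using FA_multiple_n[of 0] K.one_closed unfolding K_simps(1) mult_0_right by simp
qed (simp add: FA_add)

text \<open>Adding j another n - 1 times amounts to subtracting it, since the n-th power of the
  Frobenius map is trivial.\<close>

lemma FA_sub: assumes "FA (i + j) \<in> GG" "FA j \<in> GG" shows "FA i \<in> GG"
proof -
  have "FA (i + j + j * (n - 1)) \<in> GG" by (rule FA_add[OF assms(1) FA_mult_closed[OF assms(2)]])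
  moreover have "j + j * (n - 1) = n * j" using n_pos by (cases n) (simp_all add: algebra_simps)
  ultimately show ?thesis using FA_add_n[of i j] by (simp add: add.assoc)
qed

text \<open>The field automorphisms in the group form a cyclic group, generated by the one with the
  least positive exponent m, which divides n; the quotient d = n / m turns out to be the
  index.\<close>

definition "m = (LEAST m. m > 0 \<and> FA m \<in> GG)"

lemma m: "m > 0" "FA m \<in> GG" "FA j \<in> GG \<Longrightarrow> m dvd j" "m dvd n"
proof -
  have n: "FA n \<in> GG" using FA_multiple_n[of 1] K.one_closed by (simp add: K_simps)
  have "m > 0 \<and> FA m \<in> GG" unfolding m_def by (rule LeastI[of "\<lambda>m. m > 0 \<and> FA m \<in> GG" n]) (use n n_pos in simp)
  then show p: "m > 0" "FA m \<in> GG" by auto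
  show dv: "m dvd j" if j: "FA j \<in> GG" for j
  proof -
    have "FA (j mod m + m * (j div m)) \<in> GG" using j by simp
    then have "FA (j mod m) \<in> GG" by (rule FA_sub) (rule FA_mult_closed[OF p(2)])
    then have "\<not> 0 < j mod m" using not_less_Least[of "j mod m" "\<lambda>m. m > 0 \<and> FA m \<in> GG"] mod_less_divisor[OF p(1), of j] unfolding m_def[symmetric] by satx
    then show ?thesis by (simp add: dvd_eq_mod_eq_0)
  qed
  show "m dvd n" by (rule dv[OF n])
qed

lemma GG_form: assumes y: "\<gamma> \<in> GG" shows "\<exists>g\<in>Sz. \<exists>j<n. FA j \<in> GG \<and> \<gamma> = IA g \<otimes>\<^bsub>K\<^esub> FA j"
proof -
  obtain g j where g: "g \<in> Sz" "j < n" "\<And>x. x \<in> Sz \<Longrightarrow> \<gamma> x = g \<otimes> Fr j x \<otimes> inv g"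
    using automorphism[OF GG_sa[OF y]] by blast
  have gi: "inv g \<in> Sz" "g \<in> carrier G" using g(1) Sz_inv Sz_carrier by auto
  have "IA (inv g) \<otimes>\<^bsub>K\<^esub> \<gamma> = FA j"
    unfolding K_mult[OF IA_GG[OF gi(1)] y] FA_def
    by (rule restrict_ext) (use gi saD(1)[OF GG_sa[OF y]] in \<open>simp add: IA_apply g(3) conj_inv_conj Sz_carrier[OF Fr_closed] Fr_closed Sz_mult g(1)\<close>)
  then have F: "FA j \<in> GG" using K.m_closed[of "IA (inv g)" \<gamma>] IA_GG[OF gi(1)] y by (simp add: K_simps)
  have "\<gamma> = IA g \<otimes>\<^bsub>K\<^esub> FA j"
  proof (rule GG_eqI[OF y])
    show "IA g \<otimes>\<^bsub>K\<^esub> FA j \<in> GG" using K.m_closed[of "IA g" "FA j"] IA_GG[OF g(1)] F by (simp add: K_simps)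
    show "\<gamma> x = (IA g \<otimes>\<^bsub>K\<^esub> FA j) x" if "x \<in> Sz" for x
      unfolding K_mult[OF IA_GG[OF g(1)] F] using that by (simp add: g(3) FA_apply IA_apply Fr_closed)
  qed
  then show ?thesis using g(1,2) F by blast
qed

text \<open>If m were n, no non-trivial field automorphism would be present and every element of the
  group would be inner, against the strict inclusion.\<close>

lemma m_less: "m < n"
proof (rule ccontr)
  assume "\<not> m < n"
  then have mn: "m = n" using m(4) n_pos by (simp add: dvd_imp_le le_antisym)
  obtain \<gamma> where y: "\<gamma> \<in> GG" "\<gamma> \<notin> Inn SG" using Inn_GG by blast
  obtain g j where g: "g \<in> Sz" "j < n" "FA j \<in> GG" "\<gamma> = IA g \<otimes>\<^bsub>K\<^esub> FA j" using GG_form[OF y(1)] by blast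
  have "j = 0" using m(3)[OF g(3)] g(2) mn by (auto dest: dvd_imp_le)
  then have "\<gamma> = IA g" using g(4) FA_multiple_n[of 0] K.r_one[of "IA g"] IA_GG[OF g(1)] by (simp add: K_simps(1))
  then show False using y(2) g(1) Inn_IA by blast
qed

lemma FA_IA: assumes g: "g \<in> Sz" shows "FA m \<otimes>\<^bsub>K\<^esub> IA g \<otimes>\<^bsub>K\<^esub> inv\<^bsub>K\<^esub> FA m = IA (Fr m g)"
proof -
  have I: "IA g \<in> GG" "IA (Fr m g) \<in> GG" using IA_GG g Fr_closed by auto
  have gc: "Fr m g \<in> Sz" by (rule Fr_closed[OF g])
  have "FA m \<otimes>\<^bsub>K\<^esub> IA g = IA (Fr m g) \<otimes>\<^bsub>K\<^esub> FA m"
    unfolding K_mult[OF m(2) I(1)] K_mult[OF I(2) m(2)]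
    by (rule restrict_ext) (simp add: g gc FA_apply IA_apply Sz_mult Sz_inv Fr_closed Fr_mult sa_inv[OF sa_Fr])
  moreover have "FA m \<in> carrier K" "IA (Fr m g) \<in> carrier K" using I m(2) by (simp_all only: K_simps(1))
  ultimately show ?thesis by (simp add: K.m_assoc)
qed

lemma FA_pow: "FA m [^]\<^bsub>K\<^esub> i = FA (m * i)"
proof (induction i)
  case 0
  show ?case using FA_multiple_n[of 0] by simp
next
  case (Suc i)
  then show ?case using FA_mult[OF FA_mult_closed[OF m(2)] m(2), of i] by (simp add: add.commute)
qed

text \<open>If two such products agree, the quotient of their inner parts acts as a power of the
  Frobenius map, which is possible only trivially. The assumption i \<le> j keeps the difference of
  the exponents within the natural numbers.\<close>

lemma IA_FA_unique:
  assumes g: "g \<in> Sz" "k \<in> Sz" and ij: "i \<le> j" "m * j < n" and e: "IA g \<otimes>\<^bsub>K\<^esub> FA (m * i) = IA k \<otimes>\<^bsub>K\<^esub> FA (m * j)"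
  shows "g = k \<and> i = j"
proof -
  have F: "FA (m * i) \<in> GG" for i by (rule FA_mult_closed[OF m(2)])
  have c: "g \<in> carrier G" "k \<in> carrier G" using g Sz_carrier by auto
  let ?l = "m * j - m * i"
  have lj: "?l + m * i = m * j" using ij by simp
  have "(inv k \<otimes> g) \<otimes> y \<otimes> inv (inv k \<otimes> g) = Fr ?l y" if y: "y \<in> Sz" for y
  proof -
    obtain x where x: "x \<in> Sz" "y = Fr (m * i) x" using saD(4)[OF sa_Fr y] by blast
    have yc: "y \<in> carrier G" "Fr ?l y \<in> carrier G" using Sz_carrier y Fr_closed by auto
    have "g \<otimes> y \<otimes> inv g = k \<otimes> Fr (m * j) x \<otimes> inv k"
      using fun_cong[OF e, of x] x(1) unfolding K_mult[OF IA_GG[OF g(1)] F] K_mult[OF IA_GG[OF g(2)] F]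
      by (simp add: FA_apply IA_apply Fr_closed x(2))
    also have "Fr (m * j) x = Fr ?l y" unfolding x(2) Fr_add[symmetric] lj ..
    finally have "inv k \<otimes> (g \<otimes> y \<otimes> inv g) \<otimes> k = Fr ?l y" using conj_inv_conj(1)[OF c(2) yc(2)] by simp
    then show ?thesis using c yc by (simp add: inv_mult_group m_assoc)
  qed
  then have z: "?l = 0" "inv k \<otimes> g = \<one>"
    using inner_Fr[OF Sz_mult[OF Sz_inv[OF g(2)] g(1)], of ?l] ij(2) by auto
  have "k \<otimes> (inv k \<otimes> g) = k \<otimes> \<one>" using z(2) by simp
  then have "g = k" using c by (simp add: left_inv)
  moreover have "m * i = m * j" using lj z(1) by simp
  then have "i = j" using m(1) by simp
  ultimately show ?thesis by blast
qed

text \<open>The axioms transfer along the homomorphism from \<open>Sz\<close> onto its inner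
  automorphisms, so the character theory of the simple group becomes available for its copy in K.
  The two uniqueness axioms use that this homomorphism is injective.\<close>

sublocale KS: suzuki K f F "\<lambda>a b. IA (u a b)" "\<lambda>k. IA (h k)" "IA w"
proof (unfold_locales, goal_cases)
  case (9 a b)
  then obtain a' b' k a'' b'' where e: "k \<noteq> 0" "w \<otimes> u a b \<otimes> w = u a' b' \<otimes> h k \<otimes> w \<otimes> u a'' b''" using rel by blast
  show ?case
    by (rule exI[of _ a'], rule exI[of _ b'], rule exI[of _ k], rule exI[of _ a''], rule exI[of _ b''])
      (use e in \<open>simp add: IA_mult Sz_mult\<close>)
next
  case (10 k l a b c d)
  then have "u a b \<otimes> h k = u c d \<otimes> h l" using IA_inj by (simp add: IA_mult Sz_mult)
  then show ?case using uh_inj 10 by blast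
next
  case (11 k a b)
  then show ?case using IA_inj[of w "u a b \<otimes> h k"] w_notin by (auto simp: IA_mult Sz_mult)
qed (simp_all add: K_simps(1) IA_GG IA_mult Sz_mult u_mult h_mult h_u w_w w_h IA_one)

lemma KS_Sz: "KS.Sz = IA ` Sz"
proof -
  have "KS.B = IA ` B"
  proof -
    have "KS.B = {IA (u a b \<otimes> h k) | a b k. k \<noteq> 0}" unfolding KS.B_def by (intro Collect_cong ex_cong1) (auto simp: IA_mult)
    then show ?thesis unfolding B_def by auto
  qed
  moreover have "KS.C = IA ` C"
  proof -
    have "KS.C = {IA (u a b \<otimes> h k \<otimes> w \<otimes> u c d) | a b k c d. k \<noteq> 0}"
      unfolding KS.C_def by (intro Collect_cong ex_cong1) (auto simp: IA_mult Sz_mult)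
    then show ?thesis unfolding C_def image_Collect by blast
  qed
  ultimately show ?thesis unfolding KS.Sz_def Sz_def by auto
qed

definition "d = n div m"

lemma n_md: "n = m * d" using m(4) by (simp add: d_def)

lemma d_gt: "d > 1"
proof -
  have "d \<noteq> 0" "d \<noteq> 1" using n_md m_less n_pos by auto
  then show ?thesis by simp
qed

sublocale KE: suzuki_ext K f F "\<lambda>a b. IA (u a b)" "\<lambda>k. IA (h k)" "IA w" "FA m" m d
proof (intro suzuki_ext.intro KS.suzuki_axioms suzuki_ext_axioms.intro, goal_cases)
  case (8 \<gamma>)
  then have "\<gamma> \<in> GG" by (simp add: K_simps)
  then obtain g j where g: "g \<in> Sz" "j < n" "FA j \<in> GG" "\<gamma> = IA g \<otimes>\<^bsub>K\<^esub> FA j" using GG_form by blast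
  obtain i where i: "j = m * i" using m(3)[OF g(3)] by (auto simp: dvd_def)
  then have "i < d" using g(2) n_md by simp
  then show ?case unfolding KS_Sz FA_pow using g(1,4) i by blast
next
  case (9 x y i j)
  then obtain g k where g: "g \<in> Sz" "k \<in> Sz" "x = IA g" "y = IA k" unfolding KS_Sz by blast
  have l: "m * i < n" "m * j < n" unfolding n_md using 9 m(1) by simp_all
  have "g = k \<and> i = j"
  proof (cases "i \<le> j")
    case True
    then show ?thesis using IA_FA_unique[OF g(1,2) True l(2)] 9(5) unfolding g(3,4) FA_pow by blast
  next
    case False
    then have "j \<le> i" by simp
    then show ?thesis using IA_FA_unique[OF g(2,1) \<open>j \<le> i\<close> l(1)] 9(5) unfolding g(3,4) FA_pow by (metis)
  qed
  then show ?case using g by simp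
qed (use m(2) n_md d_gt FA_multiple_n[of 1] in \<open>simp_all add: K_simps(1) FA_IA Fr_u Fr_h Fr_w FA_pow\<close>)

lemma index: "card (rcosets\<^bsub>K\<^esub> (Inn SG)) = d"
proof -
  have "card (rcosets\<^bsub>K\<^esub> KS.Sz) * card KS.Sz = card (carrier K)"
    using K.lagrange[OF KS.subgroup_Sz] by (simp add: Coset.order_def)
  also have "\<dots> = card KS.Sz * d" using KE.E.card_Mt[of 1] KE.E.carrier_Mt by simp
  finally have "card (rcosets\<^bsub>K\<^esub> KS.Sz) = d" using KS.SG.card_pos by simp
  then show ?thesis unfolding KS_Sz Inn_IA .
qed

end

section \<open>Suzuki's four by four matrices\<close>

lemma mat4_mult:
  "mat_of_rows_list 4 [[a11,a12,a13,a14],[a21,a22,a23,a24],[a31,a32,a33,a34],[a41,a42,a43,a44]] *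
   mat_of_rows_list 4 [[b11,b12,b13,b14],[b21,b22,b23,b24],[b31,b32,b33,b34],[b41,b42,b43,b44]] =
   mat_of_rows_list 4
    [[a11*b11+a12*b21+a13*b31+a14*b41, a11*b12+a12*b22+a13*b32+a14*b42, a11*b13+a12*b23+a13*b33+a14*b43, a11*b14+a12*b24+a13*b34+a14*b44],
     [a21*b11+a22*b21+a23*b31+a24*b41, a21*b12+a22*b22+a23*b32+a24*b42, a21*b13+a22*b23+a23*b33+a24*b43, a21*b14+a22*b24+a23*b34+a24*b44],
     [a31*b11+a32*b21+a33*b31+a34*b41, a31*b12+a32*b22+a33*b32+a34*b42, a31*b13+a32*b23+a33*b33+a34*b43, a31*b14+a32*b24+a33*b34+a34*b44],
     [a41*b11+a42*b21+a43*b31+a44*b41, a41*b12+a42*b22+a43*b32+a44*b42, a41*b13+a42*b23+a43*b33+a44*b43, a41*b14+a42*b24+a43*b34+a44*b44 :: 'a :: comm_ring_1]]"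
  by (rule eq_matI) (auto simp: mat_of_rows_list_def scalar_prod_def numeral_eq_Suc less_Suc_eq add.assoc)

lemma mat4_eq:
  "mat_of_rows_list 4 [[a11,a12,a13,a14],[a21,a22,a23,a24],[a31,a32,a33,a34],[a41,a42,a43,a44]] =
   mat_of_rows_list 4 [[b11,b12,b13,b14],[b21,b22,b23,b24],[b31,b32,b33,b34],[b41,b42,b43,b44]] \<longleftrightarrow>
   a11 = b11 \<and> a12 = b12 \<and> a13 = b13 \<and> a14 = b14 \<and> a21 = b21 \<and> a22 = b22 \<and> a23 = b23 \<and> a24 = b24 \<and>
   a31 = b31 \<and> a32 = b32 \<and> a33 = b33 \<and> a34 = b34 \<and> a41 = b41 \<and> a42 = b42 \<and> a43 = b43 \<and> a44 = b44"
  (is "?A = ?B \<longleftrightarrow> ?R")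
proof
  assume e: "?A = ?B"
  have "?A $$ (i,j) = ?B $$ (i,j)" for i j using e by simp
  note this[of 0 0] this[of 0 1] this[of 0 2] this[of 0 3] this[of 1 0] this[of 1 1] this[of 1 2] this[of 1 3]
    this[of 2 0] this[of 2 1] this[of 2 2] this[of 2 3] this[of 3 0] this[of 3 1] this[of 3 2] this[of 3 3]
  then show ?R by (simp add: mat_of_rows_list_def numeral_eq_Suc)
qed simp

lemma mat4_one: "(1\<^sub>m 4 :: 'a :: comm_ring_1 mat) = mat_of_rows_list 4 [[1,0,0,0],[0,1,0,0],[0,0,1,0],[0,0,0,1]]"
  by (rule eq_matI) (auto simp: mat_of_rows_list_def numeral_eq_Suc less_Suc_eq)

lemma mat4_map: "map_mat g (mat_of_rows_list 4 [[a11,a12,a13,a14],[a21,a22,a23,a24],[a31,a32,a33,a34],[a41,a42,a43,a44]]) =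
   mat_of_rows_list 4 [[g a11,g a12,g a13,g a14],[g a21,g a22,g a23,g a24],[g a31,g a32,g a33,g a34],[g a41,g a42,g a43,g a44]]"
  by (rule eq_matI) (auto simp: mat_of_rows_list_def numeral_eq_Suc less_Suc_eq)

lemma mat4_carrier: "mat_of_rows_list 4 [r1,r2,r3,r4] \<in> carrier_mat 4 4"
  by (simp add: mat_of_rows_list_def numeral_eq_Suc)

lemma finite_GL: "finite (carrier (GL n :: 'a::{field,finite} mat monoid))"
proof (rule finite_subset)
  show "carrier (GL n :: 'a mat monoid) \<subseteq> mat n n ` (({..<n} \<times> {..<n}) \<rightarrow>\<^sub>E UNIV)"
  proof
    fix A :: "'a mat" assume "A \<in> carrier (GL n)"
    then have A: "A \<in> carrier_mat n n" by (simp add: GL_carrier_iff)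
    have "A = mat n n (\<lambda>ij\<in>{..<n} \<times> {..<n}. A $$ ij)" by (rule eq_matI) (use A in auto)
    then show "A \<in> mat n n ` (({..<n} \<times> {..<n}) \<rightarrow>\<^sub>E UNIV)"
      by (rule image_eqI[of _ "mat n n" "\<lambda>ij\<in>{..<n} \<times> {..<n}. A $$ ij"]) auto
  qed
  show "finite (mat n n ` (({..<n} \<times> {..<n}) \<rightarrow>\<^sub>E (UNIV :: 'a set)))" by (intro finite_imageI finite_PiE) auto
qed

context suzuki_field
begin

abbreviation "uS \<equiv> suzuki_S f :: 'a \<Rightarrow> 'a \<Rightarrow> 'a mat"
text \<open>The parameter is inverted because conjugation by \<open>suzuki_M f l\<close> divides the
  first unipotent coordinate by l.\<close>

abbreviation "hM k \<equiv> suzuki_M f (inverse k) :: 'a mat"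
abbreviation "wT \<equiv> suzuki_T :: 'a mat"

lemma twist_th: "suzuki_twist f = th" by (rule ext) (simp add: suzuki_twist_def th_def)

lemmas uS_mat = suzuki_S_def[where 'a = 'a, of f, unfolded Let_def twist_th]

text \<open>This is the inverse map of the twist, and at the same time th x is the square of ph x.
  It accounts for the exponents 2^f in the torus matrices.\<close>

definition "ph x = x ^ (2 ^ f)" for x :: 'a

lemma ph_simps: "ph (x * y) = ph x * ph y" "ph 1 = 1" "ph (inverse x) = inverse (ph x)" "x \<noteq> 0 \<Longrightarrow> ph x \<noteq> 0" "ph x = ph y \<longleftrightarrow> x = y"
  by (simp_all add: ph_def power_mult_distrib power_inverse frob_inj)

lemma th_ph: "th x = ph x * ph x"
  by (simp add: th_def ph_def power_add[symmetric] mult_2)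

lemma ph_th: "ph (th x) = x"
proof -
  have "(2::nat) ^ (f + 1) * 2 ^ f = 2 ^ n" by (simp only: power_add[symmetric]) (simp add: n_def mult_2)
  then have "ph (th x) = x ^ (2 ^ n)" unfolding th_def ph_def power_mult[symmetric] by simp
  then show ?thesis by (simp only: pow_q)
qed

lemma hM_mat: "suzuki_M f l = mat_of_rows_list 4 [[l * ph l,0,0,0],[0,ph l,0,0],[0,0,inverse (ph l),0],[0,0,0,inverse (l * ph l)]]" for l :: 'a
  by (simp add: suzuki_M_def ph_def)

lemma uS_mult: "uS a b * uS c d = uS (a + c) (b + d + th a * c)"
  unfolding uS_mat mat4_mult mat4_eq by (simp add: algebra_simps power2_eq_square)

lemma uS_0: "uS 0 0 = 1\<^sub>m 4" unfolding uS_mat mat4_one by simp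

lemma suzuki_M_mult: "k \<noteq> 0 \<Longrightarrow> l \<noteq> 0 \<Longrightarrow> suzuki_M f k * suzuki_M f l = suzuki_M f (k * l)" for k l :: 'a
  unfolding hM_mat mat4_mult mat4_eq by (simp add: ph_simps mult_ac)

lemma suzuki_M_1: "suzuki_M f 1 = (1\<^sub>m 4 :: 'a mat)" unfolding hM_mat mat4_one by (simp add: ph_simps)

lemma wT_wT: "wT * wT = 1\<^sub>m 4" unfolding suzuki_T_def mat4_mult mat4_one mat4_eq by simp

lemma hM_uS: "k \<noteq> 0 \<Longrightarrow> hM k * uS a b = uS (k * a) (k * th k * b) * hM k"
proof -
  assume k: "k \<noteq> 0"
  define p where "p = ph k"
  have p: "p \<noteq> 0" "ph (inverse k) = inverse p" using k by (simp_all add: p_def ph_simps)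
  have t: "th (k * a) = p * p * th a" "k * th k * b = k * (p * p) * b"
    by (simp_all add: th_ph[of k] p_def)
  have "th (k * th k * b) = p * p * (k * k) * th b" unfolding th_simps th_th by (simp add: th_ph[of k] p_def power2_eq_square)
  then have t2: "th (k * (p * p) * b) = p * p * (k * k) * th b" unfolding t(2) .
  show ?thesis
    unfolding hM_mat uS_mat mat4_mult mat4_eq t t2 p(2) power2_eq_square using k p(1)
    by (simp add: field_simps)
qed

lemma wT_hM: "k \<noteq> 0 \<Longrightarrow> wT * hM k = hM (inverse k) * wT"
  unfolding hM_mat suzuki_T_def mat4_mult mat4_eq by (simp add: ph_simps)

text \<open>For nonzero a, dividing by a^2 * th a leaves 1 + y + th y with y = b / (a * th a); this
  is nonzero because lam (y + th y) = 1 whereas lam 1 = -1. The entry is the one that decides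
  whether w u w lies in the big cell.\<close>

lemma uS_corner_nz:
  assumes "a \<noteq> 0 \<or> b \<noteq> 0" shows "a\<^sup>2 * th a + a * b + th b \<noteq> (0::'a)"
proof (cases "a = 0")
  case True
  then show ?thesis using assms th_inj[of b 0] by simp
next
  case False
  define y where "y = b / (a * th a)"
  have ta: "th a \<noteq> 0" using False th_inj[of a 0] by simp
  have b: "b = a * th a * y" using False ta by (simp add: y_def)
  have "a\<^sup>2 * th a + a * b + th b = (a\<^sup>2 * th a) * (1 + (y + th y))" unfolding b by (simp add: algebra_simps power2_eq_square)
  moreover have "1 + (y + th y) \<noteq> 0"
  proof
    assume "1 + (y + th y) = 0"
    then have "lam 1 = lam (y + th y)" by simp
    then show False by (simp add: lam_add lam_th)
  qed
  ultimately show ?thesis using False ta by simp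
qed

text \<open>The lower left entry c of the unipotent matrix becomes the upper right entry of w u w. A
  product from the big cell has l * ph l in that corner, and its last column and first row determine
  the two unipotent factors: comparison gives the parameters b / c and a / c on the left and
  \<open>\<alpha>\<close> on the right. The identity is verified with the right factor moved to the
  other side, as Y.\<close>

lemma wuw_relation:
  assumes nz: "a \<noteq> 0 \<or> b \<noteq> 0"
  shows "\<exists>a' b' k a'' b''. k \<noteq> 0 \<and> wT * uS a b * wT = uS a' b' * hM k * wT * uS a'' b''"
proof -
  define c where "c = a\<^sup>2 * th a + a * b + th b"
  define e where "e = th c"
  have c: "c \<noteq> 0" unfolding c_def by (rule uS_corner_nz[OF nz])
  then have e: "e \<noteq> 0" using th_inj[of c 0] by (simp add: e_def)
  let ?A = "th a" and ?B = "th b"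
  have c1: "c = a * a * ?A + a * b + ?B" by (simp add: c_def power2_eq_square)
  have e1: "e = a * a * ?A * ?A + ?A * ?B + b * b" by (simp add: e_def c_def power2_eq_square algebra_simps)
  have P1: "?A * c + a * b * ?A + b * b = e" unfolding c1 e1 by (simp add: algebra_simps)
  have P2: "a * e + b * ?B = c * (a * ?A + b)" unfolding c1 e1 by (simp add: algebra_simps)
  define \<alpha> where "\<alpha> = (a * ?A + b) / c"
  define t where "t = (c + a * b) / e"
  have ta: "th \<alpha> = t"
  proof -
    have "th \<alpha> * e = th (\<alpha> * c)" by (simp add: e_def)
    also have "\<dots> = a * a * ?A + ?B" using c by (simp add: \<alpha>_def power2_eq_square mult_ac)
    also have "\<dots> = c + a * b" unfolding c1 by (simp add: algebra_simps)
    finally show ?thesis using e by (simp add: t_def field_simps)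
  qed
  have tb: "th (b / c) = ?B / e" "th (a / c) = ?A / e"
  proof -
    have "th (x / c) * e = th x" for x using c by (simp only: e_def th_simps(3)[symmetric]) simp
    then show "th (b / c) = ?B / e" "th (a / c) = ?A / e" using e by (simp_all add: eq_divide_eq)
  qed
  have q1: "\<alpha> * t + a / c = b / e"
  proof -
    have "(a * ?A + b) * (c + a * b) + a * e = (c * (a * ?A + b) + a * e) + a * b * (a * ?A + b)" by (simp add: algebra_simps)
    also have "\<dots> = b * ?B + a * b * (a * ?A + b)" unfolding P2[symmetric] by (simp add: algebra_simps)
    also have "\<dots> = b * c" unfolding c1 by (simp add: algebra_simps)
    finally have k: "(a * ?A + b) * (c + a * b) + a * e = b * c" .
    have "\<alpha> * t + a / c = ((a * ?A + b) * (c + a * b) + a * e) / (c * e)"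
      using c e unfolding \<alpha>_def t_def times_divide_times_eq add_divide_distrib[of "_ * _" "a * e"] by simp
    then show ?thesis unfolding k using c e by simp
  qed
  have q2: "\<alpha> * (b / e) + ?A / e = 1 / c"
  proof -
    have "\<alpha> * (b / e) + ?A / e = ((a * ?A + b) * b + ?A * c) / (c * e)"
      using c e unfolding \<alpha>_def times_divide_times_eq add_divide_distrib[of "_ * b" "?A * c"] by simp
    also have "(a * ?A + b) * b + ?A * c = e" unfolding P1[symmetric] by (simp add: algebra_simps)
    finally show ?thesis using e by simp
  qed
  have q3: "b / c * (?B / e) + a / c = (c / e) * \<alpha>"
  proof -
    have "b / c * (?B / e) + a / c = (a * e + b * ?B) / (c * e)" using c e by (simp add: add_divide_distrib add.commute)
    then show ?thesis unfolding P2 using c by (simp add: \<alpha>_def)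
  qed
  have ac: "\<alpha> * c = a * ?A + b" using c by (simp add: \<alpha>_def)
  have q4: "?A + b * \<alpha> = e / c"
  proof -
    have "(?A + b * \<alpha>) * c = ?A * c + b * (\<alpha> * c)" by (simp add: algebra_simps)
    also have "\<dots> = e" unfolding ac P1[symmetric] by (simp add: algebra_simps)
    finally show ?thesis using c by (simp add: eq_divide_eq)
  qed
  have q5: "1 + a * \<alpha> = ?B / c"
  proof -
    have "(1 + a * \<alpha>) * c = c + a * (\<alpha> * c)" by (simp add: algebra_simps)
    also have "\<dots> = ?B" unfolding ac by (subst c1) (simp add: algebra_simps)
    finally show ?thesis using c by (simp add: eq_divide_eq)
  qed
  \<comment> \<open>Solves l * ph l = c: from ph (th c) = c one gets ph l = th c / c.\<close>
  define l where "l = c * c / e"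
  have l0: "l \<noteq> 0" using c e by (simp add: l_def)
  have "ph l * ph e = ph c * ph c" using e by (simp add: l_def ph_simps(1)[symmetric])
  moreover have "ph e = c" unfolding e_def by (rule ph_th)
  ultimately have pl: "ph l = e / c" using c by (simp add: e_def th_ph eq_divide_eq)
  then have lpl: "l * ph l = c" using c e by (simp add: l_def)
  define X where "X = uS (b / c) (a / c)"
  define Y where "Y = uS \<alpha> (a / c)"
  have X: "X = mat_of_rows_list 4 [[1,0,0,0],[b/c,1,0,0],[a/c,?B/e,1,0],[1/c, (c/e) * \<alpha>, b/c, 1]]"
  proof -
    have "(b / c)\<^sup>2 * (?B / e) + b / c * (a / c) + ?A / e = b / c * (b / c * (?B / e) + a / c) + ?A / e" by (simp add: algebra_simps power2_eq_square)
    also have "\<dots> = \<alpha> * (b / e) + ?A / e" unfolding q3 using c by simp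
    finally show ?thesis unfolding X_def uS_mat tb by (simp only: q2 q3)
  qed
  have Y: "Y = mat_of_rows_list 4 [[1,0,0,0],[\<alpha>,1,0,0],[a/c,t,1,0],[1/c, b/e, \<alpha>, 1]]"
  proof -
    have "\<alpha>\<^sup>2 * t + \<alpha> * (a / c) + ?A / e = \<alpha> * (\<alpha> * t + a / c) + ?A / e" by (simp add: algebra_simps power2_eq_square)
    then show ?thesis unfolding Y_def uS_mat tb ta by (simp only: q1 q2)
  qed
  have L: "wT * uS a b * wT = mat_of_rows_list 4 [[1,a,a*?A+b,c],[0,1,?A,b],[0,0,1,a],[0,0,0,1]]"
    unfolding uS_mat suzuki_T_def mat4_mult mat4_eq by (simp add: c_def)
  have R: "X * suzuki_M f l * wT = mat_of_rows_list 4 [[0,0,0,c],[0,0,e/c,b],[0,c/e,?B/c,a],[1/c,b/e,\<alpha>,1]]"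
    unfolding X hM_mat suzuki_T_def lpl unfolding mat4_mult mat4_eq pl using c e by (simp add: inverse_eq_divide)
  \<comment> \<open>The facts r1 to r6 evaluate those entries of w u w * Y that have to vanish or to
    match the monomial shape times X on the other side.\<close>
  have r1: "a + (a * ?A + b) * t + c * (b / e) = 0"
  proof -
    have "c * (\<alpha> * t + a / c) = (\<alpha> * c) * t + a" using c by (simp add: algebra_simps)
    then show ?thesis unfolding q1 ac by (simp add: add_ac)
  qed
  have r2: "1 + ?A * t + b * (b / e) = 0"
  proof -
    have te: "t * e = c + a * b" "b / e * e = b" using e by (simp_all add: t_def)
    have "(1 + ?A * t + b * (b / e)) * e = e + ?A * (t * e) + b * (b / e * e)" by (simp only: distrib_right mult_1 mult.assoc)
    also have "\<dots> = e + ?A * (c + a * b) + b * b" unfolding te ..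
    also have "\<dots> = 0" unfolding P1[symmetric] by (simp add: algebra_simps)
    finally show ?thesis using e by (simp only: mult_eq_0_iff) simp
  qed
  have r3: "t + a * (b / e) = c / e" by (simp add: t_def add_divide_distrib add.assoc)
  have r4: "\<alpha> + ?A * (a / c) + b * (1 / c) = 0"
    by (simp add: \<alpha>_def add_divide_distrib algebra_simps)
  have r5: "1 + a * \<alpha> + (a * ?A + b) * (a / c) + c * (1 / c) = 0"
  proof -
    have "(a * ?A + b) * (a / c) = a * \<alpha>" "c * (1 / c) = 1" unfolding ac[symmetric] using c by simp_all
    then show ?thesis by (simp only: add.assoc add_self_left add_self add_0_left)
  qed
  have r6: "a * ?A + b + c * \<alpha> = 0" "a / c + a * (1 / c) = 0" unfolding ac[symmetric] by (simp_all add: mult.commute)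
  have "wT * uS a b * wT * Y = X * suzuki_M f l * wT"
    unfolding L Y R mat4_mult mat4_eq
    by (simp only: mult_zero_left mult_zero_right mult_1_left mult_1_right add_0_left add_0_right r1 r2 r3 r4 r5[unfolded q5] q4 q5 r6 simp_thms)
  moreover have YY: "Y * uS \<alpha> (a / c + \<alpha> * t) = 1\<^sub>m 4"
    unfolding Y_def uS_mult ta uS_0[symmetric] by (simp add: mult.commute)
  moreover have "wT * uS a b * wT * Y * uS \<alpha> (a / c + \<alpha> * t) = wT * uS a b * wT * (Y * uS \<alpha> (a / c + \<alpha> * t))"
    by (rule assoc_mult_mat[of _ 4 4 _ 4 _ 4]) (simp_all only: L Y mat4_carrier, simp only: uS_mat mat4_carrier)
  ultimately have "wT * uS a b * wT = X * suzuki_M f l * wT * uS \<alpha> (a / c + \<alpha> * t)"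
    by (simp add: L right_mult_one_mat[OF mat4_carrier])
  then have "wT * uS a b * wT = uS (b / c) (a / c) * hM (inverse l) * wT * uS \<alpha> (a / c + \<alpha> * t)" by (simp add: X_def)
  then show ?thesis using l0 by (metis nonzero_imp_inverse_nonzero)
qed

lemma GL4: "uS a b \<in> carrier (GL 4)" "(k :: 'a) \<noteq> 0 \<Longrightarrow> suzuki_M f k \<in> carrier (GL 4)" "wT \<in> carrier (GL 4)"
proof -
  have c: "uS a b \<in> carrier_mat 4 4" "suzuki_M f k \<in> carrier_mat 4 4" "wT \<in> carrier_mat 4 4" for a b k :: 'a
    by (simp_all only: uS_mat hM_mat suzuki_T_def mat4_carrier)
  have "uS a (b + th a * a) * uS a b = 1\<^sub>m 4" "uS a b * uS a (b + th a * a) = 1\<^sub>m 4"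
    by (simp_all add: uS_mult uS_0 add_ac)
  then show "uS a b \<in> carrier (GL 4)" unfolding GL_carrier_iff using c by blast
  show "suzuki_M f k \<in> carrier (GL 4)" if k: "k \<noteq> 0"
  proof -
    have "suzuki_M f (inverse k) * suzuki_M f k = 1\<^sub>m 4" "suzuki_M f k * suzuki_M f (inverse k) = 1\<^sub>m 4"
      using k by (simp_all add: suzuki_M_mult suzuki_M_1)
    then show ?thesis unfolding GL_carrier_iff using c by blast
  qed
  show "wT \<in> carrier (GL 4)" unfolding GL_carrier_iff using c wT_wT by blast
qed

lemma suzuki_matrices: "suzuki (GL 4) f uS hM wT"
proof (intro suzuki.intro suzuki_field_axioms fin_group.intro GL_group fin_group_axioms.intro finite_GL suzuki_axioms.intro, goal_cases)
  case (10 k l a b c d)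
  have k: "inverse k \<noteq> 0" "inverse l \<noteq> 0" using 10 by auto
  have "ph (inverse k) = ph (inverse l)" "a * (inverse k * ph (inverse k)) = c * (inverse l * ph (inverse l))"
    "b * (inverse k * ph (inverse k)) = d * (inverse l * ph (inverse l))"
    using 10(3) unfolding GL_simps uS_mat hM_mat mat4_mult mat4_eq by auto
  then show ?case using k by (auto simp: ph_simps(4,5))
next
  case (11 k a b)
  have "inverse k * ph (inverse k) \<noteq> 0" using 11 by (simp add: ph_simps)
  then show ?case unfolding GL_simps uS_mat hM_mat suzuki_T_def mat4_mult mat4_eq by simp
next
  case (9 a b)
  then show ?case unfolding GL_simps by (rule wuw_relation)
qed (simp_all add: GL4 GL_simps(2,3) uS_mult suzuki_M_mult hM_uS wT_wT wT_hM)

lemma suzuki_frob_matrices: "suzuki_frob (GL 4) f uS hM wT (map_mat (\<lambda>x. x\<^sup>2))"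
proof -
  interpret Z: suzuki "GL 4" f "TYPE('a)" uS hM wT by (rule suzuki_matrices)
  interpret sq: semiring_hom "\<lambda>x::'a. x\<^sup>2"
    by unfold_locales (simp_all add: power_mult_distrib power2_eq_square algebra_simps)
  show ?thesis
  proof (unfold_locales, goal_cases)
    case (1 x y)
    then have "x \<in> carrier_mat 4 4" "y \<in> carrier_mat 4 4" using Z.Sz_carrier GL_carrier_iff by blast+
    then show ?case unfolding GL_simps by (rule sq.mat_hom_mult)
  next
    case (2 a b)
    show ?case unfolding uS_mat mat4_map mat4_eq
      by (simp add: power2_eq_square algebra_simps)
  next
    case (3 k)
    have "ph (l\<^sup>2) = (ph l)\<^sup>2" for l by (simp add: power2_eq_square ph_simps)
    then show ?case unfolding hM_mat mat4_map mat4_eq by (simp add: power_mult_distrib power_inverse[symmetric])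
  next
    case 4
    show ?case unfolding suzuki_T_def mat4_map by simp
  qed
qed

lemma suzuki_group_carrier: "suzuki_group f = (GL 4)\<lparr>carrier := suzuki.Sz (GL 4) uS hM wT\<rparr>"
proof -
  interpret Z: suzuki "GL 4" f "TYPE('a)" uS hM wT by (rule suzuki_matrices)
  let ?gens = "{uS a b | a b. True} \<union> {suzuki_M f l | l. l \<noteq> 0} \<union> {wT}"
  have M: "suzuki_M f l \<in> Z.Sz" if "l \<noteq> 0" for l using Z.h_Sz[of "inverse l"] that by simp
  have "generate (GL 4) ?gens \<subseteq> Z.Sz"
    by (rule Z.generate_subgroup_incl[OF _ Z.subgroup_Sz]) (use M in auto)
  moreover have "Z.Sz \<subseteq> generate (GL 4) ?gens"
  proof -
    have g: "uS a b \<in> generate (GL 4) ?gens" "k \<noteq> 0 \<Longrightarrow> hM k \<in> generate (GL 4) ?gens" "wT \<in> generate (GL 4) ?gens" for a b k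
      by (rule generate.incl, force)+
    show ?thesis
    proof
      fix x assume "x \<in> Z.Sz"
      then consider "x \<in> Z.B" | "x \<in> Z.C" by (auto simp: Z.Sz_def)
      then show "x \<in> generate (GL 4) ?gens"
      proof cases
        case 1
        then show ?thesis by (elim Z.BE) (use generate.eng[OF g(1) g(2)] in blast)
      next
        case 2
        then show ?thesis by (elim Z.CE) (use generate.eng[OF generate.eng[OF generate.eng[OF g(1) g(2)] g(3)] g(1)] in blast)
      qed
    qed
  qed
  ultimately show ?thesis unfolding suzuki_group_def by simp
qed

end

theorem corollaryB:
  fixes f d :: nat
    and S :: "'a::{field,finite} mat monoid"
    and G :: "('a mat \<Rightarrow> 'a mat) set"
  assumes "f > 1"
    and "card (UNIV :: 'a set) = 2 ^ (2 * f + 1)"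
    and "S = suzuki_group f"
    and "subgroup G (AutoGroup S)"
    and "Inn S \<subset> G"
    and "d = card (rcosets\<^bsub>AutoGroup S\<lparr>carrier := G\<rparr>\<^esub> (Inn S))"
  shows "card (cd (AutoGroup S\<lparr>carrier := G\<rparr>)) \<ge> 7 \<and>
    (\<not> prime d \<longrightarrow> card (cd (AutoGroup S\<lparr>carrier := G\<rparr>)) \<ge> 9)"
proof -
  interpret suzuki_field f "TYPE('a)" using assms(1,2) by unfold_locales
  interpret Z: suzuki_frob "GL 4" f "TYPE('a)" uS hM wT "map_mat (\<lambda>x. x\<^sup>2)" by (rule suzuki_frob_matrices)
  have S: "S = Z.SG" using assms(3) suzuki_group_carrier by simp
  interpret Z: suzuki_aut "GL 4" f "TYPE('a)" uS hM wT "map_mat (\<lambda>x. x\<^sup>2)" G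
    by (intro suzuki_aut.intro[OF suzuki_frob_matrices] suzuki_aut_axioms.intro) (use assms(4,5) S in simp_all)
  have "d = Z.d" using Z.index unfolding assms(6) S Z.K_def .
  then show ?thesis using Z.KE.card_cd unfolding S Z.K_def by simp
qed

end
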